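(* Let $\mathcal{K}$ be a $P$-minimal field, taken as a structure in Macintyre's language, with quantifier elimination and with definable Skolem functions. Let $\Phi$ be a finite set of formulas of the form $\varphi(x;y)$ (with $|x|\ge1$). Then $\Phi$ admits a distal cell decomposition with exponent $3|x|-2$.
   Context: Macintyre's language consists of the language of rings, a symbol defining the valuation $v$ (e.g. $x\mid y\iff v(x)\le v(y)$), and unary predicates $P_n$, $n\ge2$, with $P_n(x)\iff\exists y\,(y^n=x)$. A $P$-minimal field is a $p$-adically closed field such that, in every model of its theory, every definable subset of the field (in one variable) is quantifier-free definable with parameters in Macintyre's language. Let $\mathcal{M}$ be a first-order structure (here $\mathcal{M}=\mathcal{K}$) with universe $M$ in a language $\mathcal{L}$. Formulas are $\mathcal{L}$-formulas without parameters. In a partitioned formula $\varphi(x;y)$ the variables are split into finite tuples $x,y$ of lengths $|x|,|y|$; all formulas in a set $\Phi(x;y)$ share the same $x$ and $y$. For $b\in M^{|y|}$ put $\varphi(M^{|x|};b)=\{a\in M^{|x|}:\mathcal{M}\models\varphi(a,b)\}$. For $B\subseteq M^{|y|}$, a set $X\subseteq M^{|x|}$ is crossed by $\Phi(x;B)$ if for some $\varphi\in\Phi$, $b\in B$ both $X\cap\varphi(M^{|x|};b)$ and $X\setminus\varphi(M^{|x|};b)$ are nonempty. A distal cell decomposition $\mathcal{T}$ for a finite set $\Phi(x;y)$ is given by a finite set $\Psi(x;y_1,\dots,y_k)$ of formulas with $|y_1|=\dots=|y_k|=|y|$ and, for each $\psi\in\Psi$, a formula $\theta_\psi(y;y_1,\dots,y_k)$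 such that for each finite nonempty $B\subseteq M^{|y|}$ the following holds. Let $\mathcal{T}(B)$ be the set of all $\Delta=\psi(M^{|x|};b_1,\dots,b_k)$ with $\psi\in\Psi$, $b_1,\dots,b_k\in B$, such that no $b\in B$ satisfies $\theta_\psi(b;b_1,\dots,b_k)$. Then $\bigcup\mathcal{T}(B)=M^{|x|}$ and no element of $\mathcal{T}(B)$ is crossed by $\Phi(x;B)$. $\mathcal{T}$ has exponent $r$ if there is $C$ with $|\mathcal{T}(B)|\le C|B|^r$ for all finite nonempty $B\subseteq M^{|y|}$. *)

theory Defs
  imports "HOL-Algebra.Finite_Extensions" "HOL-Algebra.QuotRing" "HOL-Computational_Algebra.Primes"
begin

section \<open>First-order logic\<close>

datatype 'f tm = Var nat | Fun 'f "'f tm list"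

datatype ('f, 'r) fm =
    Eq "'f tm" "'f tm"
  | Rel 'r "'f tm list"
  | Neg "('f, 'r) fm"
  | Conj "('f, 'r) fm" "('f, 'r) fm"
  | Ex nat "('f, 'r) fm"

text \<open>A language is given by its function and relation symbols together with their arities.\<close>

record ('f, 'r) language =
  funs :: "('f \<times> nat) set"
  rels :: "('r \<times> nat) set"

text \<open>The universe of a structure is the whole type \<open>'a\<close>. Interpretations of symbols outside the
  language, or at lists whose length is not the arity, are irrelevant: formulas of the language
  never mention them.\<close>

record ('f, 'r, 'a) fo_struct =
  fun_of :: "'f \<Rightarrow> 'a list \<Rightarrow> 'a"
  rel_of :: "'r \<Rightarrow> 'a list \<Rightarrow> bool"

fun tm_vars :: "'f tm \<Rightarrow> nat set" where
  "tm_vars (Var i) = {i}"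
| "tm_vars (Fun f ts) = (\<Union>t\<in>set ts. tm_vars t)"

fun free_vars :: "('f, 'r) fm \<Rightarrow> nat set" where
  "free_vars (Eq s t) = tm_vars s \<union> tm_vars t"
| "free_vars (Rel r ts) = (\<Union>t\<in>set ts. tm_vars t)"
| "free_vars (Neg \<phi>) = free_vars \<phi>"
| "free_vars (Conj \<phi> \<psi>) = free_vars \<phi> \<union> free_vars \<psi>"
| "free_vars (Ex i \<phi>) = free_vars \<phi> - {i}"

fun is_term :: "('f, 'r) language \<Rightarrow> 'f tm \<Rightarrow> bool" where
  "is_term L (Var i) \<longleftrightarrow> True"
| "is_term L (Fun f ts) \<longleftrightarrow> (f, length ts) \<in> funs L \<and> (\<forall>t\<in>set ts. is_term L t)"

fun is_fm :: "('f, 'r) language \<Rightarrow> ('f, 'r) fm \<Rightarrow> bool" where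
  "is_fm L (Eq s t) \<longleftrightarrow> is_term L s \<and> is_term L t"
| "is_fm L (Rel r ts) \<longleftrightarrow> (r, length ts) \<in> rels L \<and> (\<forall>t\<in>set ts. is_term L t)"
| "is_fm L (Neg \<phi>) \<longleftrightarrow> is_fm L \<phi>"
| "is_fm L (Conj \<phi> \<psi>) \<longleftrightarrow> is_fm L \<phi> \<and> is_fm L \<psi>"
| "is_fm L (Ex i \<phi>) \<longleftrightarrow> is_fm L \<phi>"

fun quantifier_free :: "('f, 'r) fm \<Rightarrow> bool" where
  "quantifier_free (Eq s t) \<longleftrightarrow> True"
| "quantifier_free (Rel r ts) \<longleftrightarrow> True"
| "quantifier_free (Neg \<phi>) \<longleftrightarrow> quantifier_free \<phi>"
| "quantifier_free (Conj \<phi> \<psi>) \<longleftrightarrow> quantifier_free \<phi> \<and> quantifier_free \<psi>"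
| "quantifier_free (Ex i \<phi>) \<longleftrightarrow> False"

fun eval_tm :: "('f, 'r, 'a) fo_struct \<Rightarrow> (nat \<Rightarrow> 'a) \<Rightarrow> 'f tm \<Rightarrow> 'a" where
  "eval_tm M s (Var i) = s i"
| "eval_tm M s (Fun f ts) = fun_of M f (map (eval_tm M s) ts)"

fun sat :: "('f, 'r, 'a) fo_struct \<Rightarrow> (nat \<Rightarrow> 'a) \<Rightarrow> ('f, 'r) fm \<Rightarrow> bool" where
  "sat M s (Eq t u) \<longleftrightarrow> eval_tm M s t = eval_tm M s u"
| "sat M s (Rel r ts) \<longleftrightarrow> rel_of M r (map (eval_tm M s) ts)"
| "sat M s (Neg \<phi>) \<longleftrightarrow> \<not> sat M s \<phi>"
| "sat M s (Conj \<phi> \<psi>) \<longleftrightarrow> sat M s \<phi> \<and> sat M s \<psi>"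
| "sat M s (Ex i \<phi>) \<longleftrightarrow> (\<exists>a. sat M (s(i := a)) \<phi>)"

text \<open>\<open>fm_in L n\<close>: the \<open>L\<close>-formulas (without parameters) in the variables \<open>0, \<dots>, n - 1\<close>.
  A partitioned formula \<open>\<phi>(x; y)\<close> with \<open>|x| = m\<close> and \<open>|y| = n\<close> is an element of \<open>fm_in L (m + n)\<close>
  whose first \<open>m\<close> variables are \<open>x\<close> and whose last \<open>n\<close> variables are \<open>y\<close>; elements of \<open>M\<^sup>n\<close> are
  lists of length \<open>n\<close>, and \<open>\<phi>(a, b)\<close> is \<open>holds M (a @ b) \<phi>\<close>.\<close>

definition fm_in :: "('f, 'r) language \<Rightarrow> nat \<Rightarrow> ('f, 'r) fm set" where
  "fm_in L n = {\<phi>. is_fm L \<phi> \<and> free_vars \<phi> \<subseteq> {..<n}}"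

definition holds :: "('f, 'r, 'a) fo_struct \<Rightarrow> 'a list \<Rightarrow> ('f, 'r) fm \<Rightarrow> bool" where
  "holds M a \<phi> \<longleftrightarrow> sat M (\<lambda>i. a ! i) \<phi>"

definition tuples :: "nat \<Rightarrow> 'a list set" where
  "tuples n = {a. length a = n}"

text \<open>\<open>def_set M m \<phi> b\<close> is \<open>\<phi>(M\<^sup>m; b)\<close>.\<close>

definition def_set ::
  "('f, 'r, 'a) fo_struct \<Rightarrow> nat \<Rightarrow> ('f, 'r) fm \<Rightarrow> 'a list \<Rightarrow> 'a list set" where
  "def_set M m \<phi> b = {a \<in> tuples m. holds M (a @ b) \<phi>}"

text \<open>Definability with parameters.\<close>

definition definable ::
  "('f, 'r) language \<Rightarrow> ('f, 'r, 'a) fo_struct \<Rightarrow> nat \<Rightarrow> 'a list set \<Rightarrow> bool" where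
  "definable L M m D \<longleftrightarrow> (\<exists>\<phi> c. \<phi> \<in> fm_in L (m + length c) \<and> D = def_set M m \<phi> c)"

definition qf_definable ::
  "('f, 'r) language \<Rightarrow> ('f, 'r, 'a) fo_struct \<Rightarrow> nat \<Rightarrow> 'a list set \<Rightarrow> bool" where
  "qf_definable L M m D \<longleftrightarrow>
     (\<exists>\<phi> c. \<phi> \<in> fm_in L (m + length c) \<and> quantifier_free \<phi> \<and> D = def_set M m \<phi> c)"

definition models_theory_of ::
  "('f, 'r) language \<Rightarrow> ('f, 'r, 'b) fo_struct \<Rightarrow> ('f, 'r, 'a) fo_struct \<Rightarrow> bool" where
  "models_theory_of L N M \<longleftrightarrow> (\<forall>\<sigma>\<in>fm_in L 0. holds M [] \<sigma> \<longrightarrow> holds N [] \<sigma>)"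

text \<open>Equivalence in \<open>M\<close> is the same as equivalence modulo the complete theory of \<open>M\<close>.\<close>

definition quantifier_elimination ::
  "('f, 'r) language \<Rightarrow> ('f, 'r, 'a) fo_struct \<Rightarrow> bool" where
  "quantifier_elimination L M \<longleftrightarrow>
     (\<forall>n. \<forall>\<phi>\<in>fm_in L n. \<exists>\<psi>\<in>fm_in L n. quantifier_free \<psi> \<and>
        (\<forall>a\<in>tuples n. holds M a \<phi> \<longleftrightarrow> holds M a \<psi>))"

text \<open>Functions \<open>M\<^sup>n \<rightarrow> M\<^sup>m\<close> whose graph is definable without parameters.\<close>

definition zero_definable_fun ::
  "('f, 'r) language \<Rightarrow> ('f, 'r, 'a) fo_struct \<Rightarrow> nat \<Rightarrow> nat \<Rightarrow> ('a list \<Rightarrow> 'a list) \<Rightarrow> bool" where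
  "zero_definable_fun L M n m f \<longleftrightarrow> f \<in> tuples n \<rightarrow> tuples m \<and>
     (\<exists>\<gamma>\<in>fm_in L (m + n). \<forall>b\<in>tuples n. \<forall>a\<in>tuples m. holds M (a @ b) \<gamma> \<longleftrightarrow> a = f b)"

definition definable_Skolem_functions ::
  "('f, 'r) language \<Rightarrow> ('f, 'r, 'a) fo_struct \<Rightarrow> bool" where
  "definable_Skolem_functions L M \<longleftrightarrow>
     (\<forall>m n. \<forall>\<phi>\<in>fm_in L (m + n). \<exists>f. zero_definable_fun L M n m f \<and>
        (\<forall>b\<in>tuples n. (\<exists>a\<in>tuples m. holds M (a @ b) \<phi>) \<longrightarrow> holds M (f b @ b) \<phi>))"

section \<open>Distal cell decompositions\<close>

text \<open>The parameter set \<open>B\<close> consists of \<open>n\<close>-tuples, and \<open>D\<close> of \<open>m\<close>-tuples.\<close>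

definition crossed ::
  "('f, 'r, 'a) fo_struct \<Rightarrow> nat \<Rightarrow> ('f, 'r) fm set \<Rightarrow> 'a list set \<Rightarrow> 'a list set \<Rightarrow> bool" where
  "crossed M m \<Phi> B D \<longleftrightarrow>
     (\<exists>\<phi>\<in>\<Phi>. \<exists>b\<in>B. D \<inter> def_set M m \<phi> b \<noteq> {} \<and> D - def_set M m \<phi> b \<noteq> {})"

text \<open>\<open>\<T>(B)\<close>; the list \<open>bs = [b\<^sub>1, \<dots>, b\<^sub>k]\<close> collects the parameters of a cell.\<close>

definition cells ::
  "('f, 'r, 'a) fo_struct \<Rightarrow> nat \<Rightarrow> nat \<Rightarrow> ('f, 'r) fm set \<Rightarrow> (('f, 'r) fm \<Rightarrow> ('f, 'r) fm) \<Rightarrow>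
   'a list set \<Rightarrow> 'a list set set" where
  "cells M m k \<Psi> \<theta> B =
     {def_set M m \<psi> (concat bs) | \<psi> bs. \<psi> \<in> \<Psi> \<and> length bs = k \<and> set bs \<subseteq> B \<and>
        \<not> (\<exists>b\<in>B. holds M (b @ concat bs) (\<theta> \<psi>))}"

definition distal_cell_decomposition ::
  "('f, 'r) language \<Rightarrow> ('f, 'r, 'a) fo_struct \<Rightarrow> nat \<Rightarrow> nat \<Rightarrow> ('f, 'r) fm set \<Rightarrow>
   nat \<Rightarrow> ('f, 'r) fm set \<Rightarrow> (('f, 'r) fm \<Rightarrow> ('f, 'r) fm) \<Rightarrow> bool" where
  "distal_cell_decomposition L M m n \<Phi> k \<Psi> \<theta> \<longleftrightarrow>
     finite \<Psi> \<and> \<Psi> \<subseteq> fm_in L (m + k * n) \<and> (\<forall>\<psi>\<in>\<Psi>. \<theta> \<psi> \<in> fm_in L (n + k * n)) \<and>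
     (\<forall>B. finite B \<and> B \<noteq> {} \<and> B \<subseteq> tuples n \<longrightarrow>
        \<Union> (cells M m k \<Psi> \<theta> B) = tuples m \<and>
        (\<forall>\<Delta>\<in>cells M m k \<Psi> \<theta> B. \<not> crossed M m \<Phi> B \<Delta>))"

definition has_exponent ::
  "('f, 'r, 'a) fo_struct \<Rightarrow> nat \<Rightarrow> nat \<Rightarrow> nat \<Rightarrow> ('f, 'r) fm set \<Rightarrow>
   (('f, 'r) fm \<Rightarrow> ('f, 'r) fm) \<Rightarrow> real \<Rightarrow> bool" where
  "has_exponent M m n k \<Psi> \<theta> r \<longleftrightarrow>
     (\<exists>C :: real. \<forall>B. finite B \<and> B \<noteq> {} \<and> B \<subseteq> tuples n \<longrightarrow>
        real (card (cells M m k \<Psi> \<theta> B)) \<le> C * real (card B) powr r)"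

section \<open>\<open>p\<close>-adically closed fields\<close>

text \<open>A valuation \<open>v\<close> on a field \<open>R\<close> is given, up to equivalence, by its valuation ring \<open>A\<close>: the value
  group is \<open>R\<^sup>\<times> / A\<^sup>\<times>\<close>, and \<open>v(x) \<le> v(y)\<close> means that \<open>y \<in> A x\<close>.\<close>

definition valuation_ring :: "'a ring \<Rightarrow> 'a set \<Rightarrow> bool" where
  "valuation_ring R A \<longleftrightarrow> field R \<and> subring A R \<and>
     (\<forall>x\<in>carrier R. x \<noteq> \<zero>\<^bsub>R\<^esub> \<longrightarrow> x \<in> A \<or> inv\<^bsub>R\<^esub> x \<in> A)"

definition val_le :: "'a ring \<Rightarrow> 'a set \<Rightarrow> 'a \<Rightarrow> 'a \<Rightarrow> bool" where
  "val_le R A x y \<longleftrightarrow> (\<exists>c\<in>A. y = c \<otimes>\<^bsub>R\<^esub> x)"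

text \<open>\<open>p\<close>-valued fields of \<open>p\<close>-rank \<open>d\<close> in the sense of Prestel and Roquette: the characteristic is
  \<open>0\<close>, the residue characteristic is \<open>p\<close> (that is, \<open>p\<close> is not a unit of \<open>A\<close>), and \<open>A / pA\<close> has
  dimension \<open>d\<close> over the field with \<open>p\<close> elements (that is, it has \<open>p\<^sup>d\<close> elements).\<close>

definition p_valued :: "nat \<Rightarrow> nat \<Rightarrow> 'a ring \<Rightarrow> 'a set \<Rightarrow> bool" where
  "p_valued p d R A \<longleftrightarrow> Factorial_Ring.prime p \<and> valuation_ring R A \<and>
     (\<forall>n::nat. n > 0 \<longrightarrow> [n] \<cdot>\<^bsub>R\<^esub> \<one>\<^bsub>R\<^esub> \<noteq> \<zero>\<^bsub>R\<^esub>) \<and>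
     (let A' = R\<lparr>carrier := A\<rparr>; \<pi> = [p] \<cdot>\<^bsub>R\<^esub> \<one>\<^bsub>R\<^esub> in
        \<pi> \<notin> Units A' \<and> card (carrier (A' Quot (PIdl\<^bsub>A'\<^esub> \<pi>))) = p ^ d)"

text \<open>A \<open>p\<close>-valued field is \<open>p\<close>-adically closed if it has no proper algebraic \<open>p\<close>-valued extension of
  the same \<open>p\<close>-rank. An algebraic extension of the infinite field \<open>R\<close> has the cardinality of \<open>R\<close>, so up
  to isomorphism all of them have their carrier inside the type \<open>'a\<close>; the extension is therefore
  given by an embedding \<open>h\<close>, not by an inclusion.\<close>

definition p_adically_closed :: "'a ring \<Rightarrow> 'a set \<Rightarrow> bool" where
  "p_adically_closed R A \<longleftrightarrow>
     (\<exists>p d. p_valued p d R A \<and>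
        (\<forall>(S :: 'a ring) A' h.
           p_valued p d S A' \<and> h \<in> ring_hom R S \<and>
           (\<forall>x\<in>carrier R. x \<in> A \<longleftrightarrow> h x \<in> A') \<and>
           (\<forall>s\<in>carrier S. ring.algebraic S (h ` carrier R) s) \<longrightarrow>
           h ` carrier R = carrier S))"

section \<open>Macintyre's language and \<open>P\<close>-minimal fields\<close>

datatype mac_fun = Zero | One | Plus | Uminus | Times

datatype mac_rel = Div | Pow nat

definition macintyre :: "(mac_fun, mac_rel) language" where
  "macintyre = \<lparr>funs = {(Zero, 0), (One, 0), (Plus, 2), (Uminus, 1), (Times, 2)},
                rels = insert (Div, 2) {(Pow n, 1) | n. n \<ge> 2}\<rparr>"

type_synonym 'a mac_struct = "(mac_fun, mac_rel, 'a) fo_struct"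

definition ring_of :: "'a mac_struct \<Rightarrow> 'a ring" where
  "ring_of K = \<lparr>carrier = UNIV,
                mult = (\<lambda>x y. fun_of K Times [x, y]), one = fun_of K One [],
                zero = fun_of K Zero [], add = (\<lambda>x y. fun_of K Plus [x, y])\<rparr>"

definition integers_of :: "'a mac_struct \<Rightarrow> 'a set" where
  "integers_of K = {x. rel_of K Div [fun_of K One [], x]}"

text \<open>\<open>K\<close> is a \<open>p\<close>-adically closed field in which the symbols of Macintyre's language have their
  intended meaning.\<close>

definition p_adically_closed_struct :: "'a mac_struct \<Rightarrow> bool" where
  "p_adically_closed_struct K \<longleftrightarrow>
     p_adically_closed (ring_of K) (integers_of K) \<and>
     (\<forall>x. fun_of K Uminus [x] = \<ominus>\<^bsub>ring_of K\<^esub> x) \<and>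
     (\<forall>x y. rel_of K Div [x, y] \<longleftrightarrow> val_le (ring_of K) (integers_of K) x y) \<and>
     (\<forall>n\<ge>2. \<forall>x. rel_of K (Pow n) [x] \<longleftrightarrow> (\<exists>y. y [^]\<^bsub>ring_of K\<^esub> n = x))"

text \<open>The models \<open>N\<close> range over the structures on \<open>'a\<close>, the universe of \<open>K\<close>. This is no restriction:
  \<open>'a\<close> is infinite and the language is countable. If a definable subset of a model, with parameters
  \<open>c\<close>, is not quantifier-free definable, then this is expressed by a set of formulas satisfied by \<open>c\<close>,
  so by Loewenheim-Skolem it also happens in a model of the cardinality of \<open>'a\<close>.\<close>

definition P_minimal :: "'a mac_struct \<Rightarrow> bool" where
  "P_minimal K \<longleftrightarrow> p_adically_closed_struct K \<and>
     (\<forall>N :: 'a mac_struct. models_theory_of macintyre N K \<longrightarrow>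
        (\<forall>D. definable macintyre N 1 D \<longrightarrow> qf_definable macintyre N 1 D))"

end

theory Submission
  imports Defs "HOL-Algebra.Weak_Morphisms"
begin

text \<open>For \<open>|x| = 1\<close>, quantifier elimination shows that the truth of the given formulas at \<open>(x, b)\<close>
  depends only on the classes modulo powers, and on the comparison of the valuations, of finitely
  many polynomials in \<open>x\<close> with coefficients definable from \<open>b\<close>. The field is algebraically maximal:
  a nest of balls without common point on which some polynomial does not stabilize yields a proper
  algebraic \<open>p\<close>-valued extension of the same \<open>p\<close>-rank. Therefore boundedly many centers \<open>c\<^sub>j(b)\<close> meet
  all the balls in which these polynomials have a root, and definable Skolem functions make the
  centers definable in \<open>b\<close>. Truth at \<open>(x, b)\<close> is then determined by the classes of the differences
  \<open>x - c\<^sub>j(b)\<close> modulo a subgroup \<open>H\<close> of \<open>K\<^sup>\<times>\<close> and by the membership of \<open>x\<close> in finitely many balls around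
  the centers. \<open>H\<close> has finite index: a point whose valuation violates this could be chosen definable
  without parameters, hence algebraic over the rationals, where the valuation is commensurable with
  \<open>v(p)\<close>. A cell is given by a center \<open>c\<^sub>j(b\<^sub>1)\<close>, two consecutive balls around it with parameters \<open>b\<^sub>2\<close> and
  \<open>b\<^sub>3\<close>, and a class modulo \<open>H\<close>. Since balls do not depend on their center, there are only \<open>O(|B|)\<close> cells.

  For the step from \<open>d\<close> to \<open>d + 1\<close> one decomposes the fibres over \<open>x' \<in> K\<^sup>d\<close> into such cells. For each
  choice of \<open>b\<^sub>1, b\<^sub>2, b\<^sub>3\<close>, the set of \<open>x'\<close> is decomposed with respect to the conditions that \<open>b\<close> obstructs
  the cell in the fibre over \<open>x'\<close>, and that this cell meets \<open>\<phi>(\<cdot>, x'; b)\<close>. This adds \<open>3\<close> to the exponent.\<close>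

section \<open>Valued fields\<close>

text \<open>The value group is never formed: valuations are compared between field elements, through
  divisibility. Nor is an algebraic closure used. A polynomial need not have roots in the field, so
  a root near x is replaced by a ball read off from the Taylor coefficients at x, and the centers
  are points of minimal balls of this kind. Algebraic maximality is what makes minimal balls exist,
  and in the same form it replaces completeness in Hensel's lemma for roots of elements close to
  one. Working with Taylor coefficients also makes the condition on the centers first-order in the
  parameters, as Skolem functions require. The subgroup H has to meet two demands: its elements must
  be k-th powers for every exponent k in the formulas, and its units must be so close to one that
  class and valuation together determine an element up to a small relative error. Both hold for the
  q-th powers times 1 + \<pi>^M A, if M is large and q is a suitable multiple of the exponents. Only
  the last remaining coordinate profits from the linear count; every other one pays for three free
  parameters, whence 3(|x| - 1) + 1.\<close>

locale val_field = field R for R :: "'a ring" (structure) +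
  fixes A :: "'a set"
  assumes UNIV [simp]: "carrier R = UNIV"
    and subring_A: "subring A R"
    and A_or_inv: "x \<noteq> \<zero> \<Longrightarrow> x \<in> A \<or> inv x \<in> A"
begin

definition rdiv :: "'a \<Rightarrow> 'a \<Rightarrow> 'a" (infixl "\<oslash>" 70) where
  "x \<oslash> y = (if y = \<zero> then \<zero> else x \<otimes> inv y)"

definition rinv :: "'a \<Rightarrow> 'a" where
  "rinv x = \<one> \<oslash> x"

text \<open>With division totalised by the value zero, the record operations satisfy the axioms of
  the type class of fields. Its whole theory, in particular \<open>algebra_simps\<close> and
  \<open>field_simps\<close>, thus becomes available for the operations of R.\<close>

lemma class_field: "class.field (\<lambda>x y. x \<oslash> y) rinv (\<lambda>x y. x \<otimes> y) \<one> (\<lambda>x y. x \<oplus> y) \<zero>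
  (\<lambda>x y. x \<ominus> y) (\<lambda>x. \<ominus> x)"
proof (unfold_locales)
  show "a \<noteq> \<zero> \<Longrightarrow> rinv a \<otimes> a = \<one>" for a
    by (simp add: rinv_def rdiv_def field_Units)
  show "a \<otimes> b \<otimes> c = a \<otimes> (b \<otimes> c)" for a b c by (rule m_assoc) simp_all
  show "a \<oplus> b \<oplus> c = a \<oplus> (b \<oplus> c)" for a b c by (rule a_assoc) simp_all
  show "(a \<oplus> b) \<otimes> c = a \<otimes> c \<oplus> b \<otimes> c" for a b c by (rule l_distr) simp_all
  show "a \<otimes> b = b \<otimes> a" for a b by (rule m_comm) simp_all
  show "a \<oplus> b = b \<oplus> a" for a b by (rule a_comm) simp_all
qed (auto simp add: rdiv_def rinv_def a_minus_def l_neg)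

sublocale F: Fields.field "\<lambda>x y. x \<oslash> y" rinv "\<lambda>x y. x \<otimes> y" "\<one>" "\<lambda>x y. x \<oplus> y" \<zero>
  "\<lambda>x y. x \<ominus> y" "\<lambda>x. \<ominus> x"
  by (rule class_field)

lemma pow_0 [simp]: "x [^] (0::nat) = \<one>"
  and pow_Suc: "x [^] (Suc n) = x \<otimes> x [^] n"
  by (simp_all add: F.mult.commute)

declare nat_pow_Suc [simp del] pow_Suc [simp]

lemma pow_add: "x [^] (m + n) = x [^] m \<otimes> x [^] (n::nat)"
  by (simp add: nat_pow_mult)

lemma pow_mult: "x [^] (m * n) = (x [^] m) [^] (n::nat)"
  by (simp add: nat_pow_pow)

lemma pow_distrib: "(x \<otimes> y) [^] (n::nat) = x [^] n \<otimes> y [^] n"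
  by (simp add: nat_pow_distrib)

lemma pow_eq_0 [simp]: "x [^] (n::nat) = \<zero> \<longleftrightarrow> x = \<zero> \<and> n > 0"
  by (induction n) auto

lemma pow_one [simp]: "\<one> [^] (n::nat) = \<one>"
  by (induction n) auto

lemma pow_zero: "\<zero> [^] (n::nat) = (if n = 0 then \<one> else \<zero>)"
  by (cases n) auto

lemma pow_divide: "(x \<oslash> y) [^] (n::nat) = x [^] n \<oslash> y [^] n"
  by (induction n) auto

section \<open>The valuation ring and the comparison of valuations\<close>

lemma zero_A [simp]: "\<zero> \<in> A" and one_A [simp]: "\<one> \<in> A"
  using subringE(2,3)[OF subring_A] by auto

lemma add_A: "x \<in> A \<Longrightarrow> y \<in> A \<Longrightarrow> x \<oplus> y \<in> A"
  and mult_A: "x \<in> A \<Longrightarrow> y \<in> A \<Longrightarrow> x \<otimes> y \<in> A"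
  and neg_A: "x \<in> A \<Longrightarrow> \<ominus> x \<in> A"
  using subringE(5-7)[OF subring_A] by auto

lemma pow_A: "x \<in> A \<Longrightarrow> x [^] (n::nat) \<in> A"
  by (induction n) (auto simp: mult_A)

lemma A_or_rinv: "x \<in> A \<or> rinv x \<in> A"
  using A_or_inv[of x] by (auto simp: rinv_def rdiv_def)

text \<open>Read \<open>x \<preceq> y\<close> as v(x) \<le> v(y): larger means closer to zero, and
  zero is the greatest element. Hence a maximal difference always belongs to a nearest point, and
  \<open>\<approx>\<close> is equality of valuations.\<close>

definition le :: "'a \<Rightarrow> 'a \<Rightarrow> bool" (infix "\<preceq>" 50) where
  "x \<preceq> y \<longleftrightarrow> val_le R A x y"

definition lt :: "'a \<Rightarrow> 'a \<Rightarrow> bool" (infix "\<prec>" 50) where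
  "x \<prec> y \<longleftrightarrow> \<not> y \<preceq> x"

definition eqv :: "'a \<Rightarrow> 'a \<Rightarrow> bool" (infix "\<approx>" 50) where
  "x \<approx> y \<longleftrightarrow> x \<preceq> y \<and> y \<preceq> x"

lemma leI: "c \<in> A \<Longrightarrow> y = c \<otimes> x \<Longrightarrow> x \<preceq> y"
  by (auto simp: le_def val_le_def)

lemma leE: assumes "x \<preceq> y" obtains c where "c \<in> A" "y = c \<otimes> x"
  using assms by (auto simp: le_def val_le_def)

lemma le_refl [simp, intro]: "x \<preceq> x"
  by (rule leI[of \<one>]) auto

lemma le_trans [trans]: assumes "x \<preceq> y" "y \<preceq> z" shows "x \<preceq> z"
proof -
  obtain c d where "c \<in> A" "y = c \<otimes> x" "d \<in> A" "z = d \<otimes> y"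
    using assms by (auto elim!: leE)
  then show ?thesis by (intro leI[of "d \<otimes> c"]) (auto simp: mult_A F.mult.assoc)
qed

lemma le_zero [simp]: "x \<preceq> \<zero>"
  by (rule leI[of \<zero>]) auto

lemma zero_le_iff [simp]: "\<zero> \<preceq> x \<longleftrightarrow> x = \<zero>"
  by (auto elim: leE)

lemma one_le_iff: "\<one> \<preceq> x \<longleftrightarrow> x \<in> A"
  by (auto elim: leE intro: leI[of x])

lemma le_iff: "x \<noteq> \<zero> \<Longrightarrow> x \<preceq> y \<longleftrightarrow> y \<oslash> x \<in> A"
  by (auto elim!: leE intro!: leI[of "y \<oslash> x"])

lemma le_total: "x \<preceq> y \<or> y \<preceq> x"
proof (cases "x = \<zero> \<or> y = \<zero>")
  case False
  have "rinv (x \<oslash> y) = y \<oslash> x" using False by (simp add: rinv_def)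
  then show ?thesis using False A_or_rinv[of "x \<oslash> y"] by (auto simp: le_iff)
qed auto

lemma lt_iff: "x \<prec> y \<longleftrightarrow> x \<preceq> y \<and> \<not> y \<preceq> x"
  using le_total by (auto simp: lt_def)

lemma not_le: "\<not> x \<preceq> y \<longleftrightarrow> y \<prec> x" and not_lt: "\<not> x \<prec> y \<longleftrightarrow> y \<preceq> x"
  by (auto simp: lt_def)

lemma lt_imp_le: "x \<prec> y \<Longrightarrow> x \<preceq> y"
  by (simp add: lt_iff)

lemma le_lt_trans [trans]: "x \<preceq> y \<Longrightarrow> y \<prec> z \<Longrightarrow> x \<prec> z"
  and lt_le_trans [trans]: "x \<prec> y \<Longrightarrow> y \<preceq> z \<Longrightarrow> x \<prec> z"
  and lt_trans [trans]: "x \<prec> y \<Longrightarrow> y \<prec> z \<Longrightarrow> x \<prec> z"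
  unfolding lt_iff by (meson le_trans)+

lemma lt_irrefl [simp]: "\<not> x \<prec> x"
  by (simp add: lt_iff)

lemma lt_nonzero: "x \<prec> y \<Longrightarrow> x \<noteq> \<zero>"
  by (auto simp: lt_def)

lemma lt_zero_iff [simp]: "x \<prec> \<zero> \<longleftrightarrow> x \<noteq> \<zero>"
  by (auto simp: lt_def)

lemma le_mult: assumes "a \<preceq> b" "c \<preceq> d" shows "a \<otimes> c \<preceq> b \<otimes> d"
proof -
  obtain e f where "e \<in> A" "f \<in> A" "b = e \<otimes> a" "d = f \<otimes> c"
    using assms by (auto elim!: leE)
  then show ?thesis by (intro leI[of "e \<otimes> f"]) (auto simp: mult_A algebra_simps)
qed

lemma le_mult_cancel_left [simp]: "c \<otimes> a \<preceq> c \<otimes> b \<longleftrightarrow> c = \<zero> \<or> a \<preceq> b"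
proof
  assume "c \<otimes> a \<preceq> c \<otimes> b"
  then obtain d where d: "d \<in> A" "c \<otimes> b = d \<otimes> (c \<otimes> a)" by (rule leE)
  then have "c = \<zero> \<or> b = d \<otimes> a" using F.mult_cancel_left[of c b "d \<otimes> a"] by (simp add: F.mult.left_commute)
  then show "c = \<zero> \<or> a \<preceq> b" using d(1) by (auto intro: leI)
qed (auto intro: le_mult)

lemma le_mult_cancel_right [simp]: "a \<otimes> c \<preceq> b \<otimes> c \<longleftrightarrow> c = \<zero> \<or> a \<preceq> b"
  by (metis le_mult_cancel_left F.mult.commute)

lemma lt_mult_cancel_left [simp]: "c \<otimes> a \<prec> c \<otimes> b \<longleftrightarrow> c \<noteq> \<zero> \<and> a \<prec> b"
  by (auto simp: lt_def)

lemma lt_mult_cancel_right [simp]: "a \<otimes> c \<prec> b \<otimes> c \<longleftrightarrow> c \<noteq> \<zero> \<and> a \<prec> b"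
  by (auto simp: lt_def)

lemma lt_mult_le: assumes "a \<prec> b" "c \<preceq> d" "c \<noteq> \<zero>" shows "a \<otimes> c \<prec> b \<otimes> d"
proof -
  have "a \<otimes> c \<prec> b \<otimes> c" using assms by simp
  also have "b \<otimes> c \<preceq> b \<otimes> d" using assms by simp
  finally show ?thesis .
qed

lemma le_mult_lt: assumes "a \<preceq> b" "c \<prec> d" "a \<noteq> \<zero>" shows "a \<otimes> c \<prec> b \<otimes> d"
  using lt_mult_le[OF assms(2,1,3)] by (simp add: F.mult.commute)

lemma le_neg_iff [simp]: "x \<preceq> \<ominus> y \<longleftrightarrow> x \<preceq> y"
proof -
  have *: "x \<preceq> y \<Longrightarrow> x \<preceq> \<ominus> y" for y
    by (elim leE) (auto intro!: leI[OF neg_A])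
  then show ?thesis using *[of "\<ominus> y"] *[of y] by auto
qed

lemma neg_le_iff [simp]: "\<ominus> x \<preceq> y \<longleftrightarrow> x \<preceq> y"
proof -
  have "x \<preceq> \<ominus> x" "\<ominus> x \<preceq> x" using le_refl[of x] le_refl[of "\<ominus> x"] by (auto simp del: le_refl)
  then show ?thesis by (meson le_trans)
qed

lemma lt_neg_iff [simp]: "x \<prec> \<ominus> y \<longleftrightarrow> x \<prec> y" and neg_lt_iff [simp]: "\<ominus> x \<prec> y \<longleftrightarrow> x \<prec> y"
  by (auto simp: lt_def)

lemma le_add: assumes "x \<preceq> y" "x \<preceq> z" shows "x \<preceq> y \<oplus> z"
proof -
  obtain c d where "c \<in> A" "d \<in> A" "y = c \<otimes> x" "z = d \<otimes> x"
    using assms by (auto elim!: leE)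
  then show ?thesis by (intro leI[of "c \<oplus> d"]) (auto simp: add_A algebra_simps)
qed

lemma le_diff: "x \<preceq> y \<Longrightarrow> x \<preceq> z \<Longrightarrow> x \<preceq> y \<ominus> z"
  using le_add[of x y "\<ominus> z"] by simp

lemma le_diff_commute: "x \<preceq> y \<ominus> z \<longleftrightarrow> x \<preceq> z \<ominus> y" "y \<ominus> z \<preceq> x \<longleftrightarrow> z \<ominus> y \<preceq> x"
  by (metis le_neg_iff F.minus_diff_eq) (metis neg_le_iff F.minus_diff_eq)

lemma add_le_cases: "y \<oplus> z \<preceq> x \<Longrightarrow> y \<preceq> x \<or> z \<preceq> x"
proof (rule ccontr)
  assume *: "y \<oplus> z \<preceq> x" "\<not> (y \<preceq> x \<or> z \<preceq> x)"
  consider "y \<preceq> z" | "z \<preceq> y" using le_total by blast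
  then show False
  proof cases
    case 1
    then have "y \<preceq> y \<oplus> z" by (intro le_add) auto
    then show ?thesis using * by (meson le_trans)
  next
    case 2
    then have "z \<preceq> y \<oplus> z" by (intro le_add) auto
    then show ?thesis using * by (meson le_trans)
  qed
qed

lemma lt_add: "x \<prec> y \<Longrightarrow> x \<prec> z \<Longrightarrow> x \<prec> y \<oplus> z"
  using add_le_cases by (auto simp: lt_def)

lemma lt_diff: "x \<prec> y \<Longrightarrow> x \<prec> z \<Longrightarrow> x \<prec> y \<ominus> z"
  using lt_add[of x y "\<ominus> z"] by simp

lemma lt_diff_commute: "x \<prec> y \<ominus> z \<longleftrightarrow> x \<prec> z \<ominus> y" "y \<ominus> z \<prec> x \<longleftrightarrow> z \<ominus> y \<prec> x"
  by (simp_all add: lt_def le_diff_commute)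

lemma eqv_refl [simp, intro]: "x \<approx> x" by (simp add: eqv_def)
lemma eqv_sym: "x \<approx> y \<Longrightarrow> y \<approx> x" by (simp add: eqv_def)
lemma eqv_trans [trans]: "x \<approx> y \<Longrightarrow> y \<approx> z \<Longrightarrow> x \<approx> z"
  unfolding eqv_def by (meson le_trans)
lemma eqv_le_trans [trans]: "x \<approx> y \<Longrightarrow> y \<preceq> z \<Longrightarrow> x \<preceq> z"
  and le_eqv_trans [trans]: "x \<preceq> y \<Longrightarrow> y \<approx> z \<Longrightarrow> x \<preceq> z"
  and eqv_lt_trans [trans]: "x \<approx> y \<Longrightarrow> y \<prec> z \<Longrightarrow> x \<prec> z"
  and lt_eqv_trans [trans]: "x \<prec> y \<Longrightarrow> y \<approx> z \<Longrightarrow> x \<prec> z"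
  unfolding eqv_def by (meson le_trans lt_le_trans le_lt_trans)+

lemma eqv_zero_iff [simp]: "x \<approx> \<zero> \<longleftrightarrow> x = \<zero>" "\<zero> \<approx> x \<longleftrightarrow> x = \<zero>"
  by (auto simp: eqv_def)

lemma eqv_mult: "a \<approx> b \<Longrightarrow> c \<approx> d \<Longrightarrow> a \<otimes> c \<approx> b \<otimes> d"
  by (simp add: eqv_def le_mult)

lemma eqv_mult_cancel_left [simp]: "c \<otimes> a \<approx> c \<otimes> b \<longleftrightarrow> c = \<zero> \<or> a \<approx> b"
  by (auto simp: eqv_def)

lemma eqv_mult_cancel_right [simp]: "a \<otimes> c \<approx> b \<otimes> c \<longleftrightarrow> c = \<zero> \<or> a \<approx> b"
  by (auto simp: eqv_def)

lemma eqv_neg_iff [simp]: "\<ominus> x \<approx> y \<longleftrightarrow> x \<approx> y" "x \<approx> \<ominus> y \<longleftrightarrow> x \<approx> y"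
  by (auto simp: eqv_def)

text \<open>The ultrametric inequality is an equality when the valuations differ: writing
  \<open>x\<close> as the difference of \<open>x \<oplus> y\<close> and \<open>y\<close> bounds the
  valuation of the sum from above.\<close>

lemma eqv_add: assumes "x \<prec> y" shows "x \<oplus> y \<approx> x"
proof -
  have "x \<preceq> x \<oplus> y" using assms lt_imp_le by (intro le_add) auto
  moreover have "x \<oplus> y \<preceq> x"
  proof -
    have "(x \<oplus> y) \<oplus> \<ominus> y = x" by (simp add: F.add.assoc)
    then have "(x \<oplus> y) \<oplus> \<ominus> y \<preceq> x" by simp
    then have "x \<oplus> y \<preceq> x \<or> \<ominus> y \<preceq> x" by (rule add_le_cases)
    then show ?thesis using assms by (simp add: lt_def)
  qed
  ultimately show ?thesis by (simp add: eqv_def)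
qed

lemma eqv_diff: "x \<prec> y \<Longrightarrow> x \<ominus> y \<approx> x"
  using eqv_add[of x "\<ominus> y"] by simp

lemma eqv_diff': "x \<prec> y \<Longrightarrow> y \<ominus> x \<approx> x"
  using eqv_diff[of x y] by (metis eqv_neg_iff(1) F.minus_diff_eq)

lemma pow_le_mono: "x \<preceq> y \<Longrightarrow> x [^] (n::nat) \<preceq> y [^] n"
  by (induction n) (auto simp: le_mult)

lemma pow_lt_mono: assumes "x \<prec> y" "n > 0" shows "x [^] (n::nat) \<prec> y [^] n"
proof -
  have "x [^] Suc k \<prec> y [^] Suc k" for k
  proof (induction k)
    case 0 then show ?case using assms by (simp add: pow_Suc)
  next
    case (Suc k)
    have "x [^] Suc k \<noteq> \<zero>" using lt_nonzero[OF assms(1)] by simp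
    then show ?case using lt_mult_le[OF assms(1) lt_imp_le[OF Suc]]
      by (metis pow_Suc)
  qed
  then show ?thesis using assms(2) by (metis gr0_conv_Suc)
qed

lemma pow_le_iff: "n > 0 \<Longrightarrow> x [^] (n::nat) \<preceq> y [^] n \<longleftrightarrow> x \<preceq> y"
  using pow_le_mono pow_lt_mono by (metis not_le)

lemma pow_eqv_iff: "n > 0 \<Longrightarrow> x [^] (n::nat) \<approx> y [^] n \<longleftrightarrow> x \<approx> y"
  by (simp add: eqv_def pow_le_iff)

lemma pow_eqv_mono: "x \<approx> y \<Longrightarrow> x [^] (n::nat) \<approx> y [^] n"
  by (simp add: eqv_def pow_le_mono)

lemma finite_min:
  assumes "finite I" "I \<noteq> {}"
  obtains i where "i \<in> I" "\<And>j. j \<in> I \<Longrightarrow> f i \<preceq> f j"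
proof -
  have "\<exists>i\<in>I. \<forall>j\<in>I. f i \<preceq> f j" using assms
  proof (induction rule: finite_ne_induct)
    case (insert x F)
    then obtain i where "i \<in> F" "\<forall>j\<in>F. f i \<preceq> f j" by auto
    show ?case
    proof (cases "f i \<preceq> f x")
      case True
      then show ?thesis using \<open>i \<in> F\<close> \<open>\<forall>j\<in>F. f i \<preceq> f j\<close> by auto
    next
      case False
      then have "f x \<preceq> f i" using le_total by auto
      then have "\<forall>j\<in>insert x F. f x \<preceq> f j" using \<open>\<forall>j\<in>F. f i \<preceq> f j\<close> by (auto intro: le_trans)
      then show ?thesis by blast
    qed
  qed auto
  then show ?thesis using that by auto
qed

lemma finite_max:
  assumes "finite I" "I \<noteq> {}"
  obtains i where "i \<in> I" "\<And>j. j \<in> I \<Longrightarrow> f j \<preceq> f i"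
proof -
  have "\<exists>i\<in>I. \<forall>j\<in>I. f j \<preceq> f i" using assms
  proof (induction rule: finite_ne_induct)
    case (insert x F)
    then obtain i where "i \<in> F" "\<forall>j\<in>F. f j \<preceq> f i" by auto
    show ?case
    proof (cases "f x \<preceq> f i")
      case True
      then show ?thesis using \<open>i \<in> F\<close> \<open>\<forall>j\<in>F. f j \<preceq> f i\<close> by auto
    next
      case False
      then have "f i \<preceq> f x" using le_total by auto
      then have "\<forall>j\<in>insert x F. f j \<preceq> f x" using \<open>\<forall>j\<in>F. f j \<preceq> f i\<close> by (auto intro: le_trans)
      then show ?thesis by blast
    qed
  qed auto
  then show ?thesis using that by auto
qed

end

section \<open>Taylor coefficients and balls around roots\<close>

context val_field
begin

text \<open>The value at index \<open>i\<close> is the coefficient of t^i in p(x + t), that is, the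
  i-th Hasse derivative at x, so no division by factorials occurs. Coefficient lists start with the
  constant term, and the recursion is the Horner scheme for a + X q.\<close>

primrec taylor :: "'a list \<Rightarrow> 'a \<Rightarrow> nat \<Rightarrow> 'a" where
  "taylor [] x i = \<zero>"
| "taylor (a # p) x i = x \<otimes> taylor p x i \<oplus> (case i of 0 \<Rightarrow> a | Suc k \<Rightarrow> taylor p x k)"

abbreviation ev :: "'a list \<Rightarrow> 'a \<Rightarrow> 'a" where
  "ev p x \<equiv> taylor p x 0"

definition cf :: "'a list \<Rightarrow> nat \<Rightarrow> 'a" where
  "cf p i = (if i < length p then p ! i else \<zero>)"

lemma cf_simps [simp]: "cf [] i = \<zero>" "cf (a # p) 0 = a" "cf (a # p) (Suc i) = cf p i"
  by (auto simp: cf_def)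

lemma taylor_zero: "taylor p \<zero> i = cf p i"
  by (induction p arbitrary: i) (auto split: nat.splits)

lemma taylor_eq_0: "length p \<le> i \<Longrightarrow> taylor p x i = \<zero>"
  by (induction p arbitrary: i) (auto split: nat.splits)

lemma taylor_zero_poly: "\<forall>c\<in>set p. c = \<zero> \<Longrightarrow> taylor p x i = \<zero>"
  by (induction p arbitrary: i) (auto split: nat.splits)

fun ladd :: "'a list \<Rightarrow> 'a list \<Rightarrow> 'a list" where
  "ladd [] q = q"
| "ladd p [] = p"
| "ladd (a # p) (b # q) = (a \<oplus> b) # ladd p q"

primrec shift :: "'a \<Rightarrow> 'a list \<Rightarrow> 'a list" where
  "shift x [] = []"
| "shift x (a # p) = ladd (a # shift x p) (map (\<lambda>c. x \<otimes> c) (shift x p))"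

lemma taylor_ladd: "taylor (ladd p q) x i = taylor p x i \<oplus> taylor q x i"
  by (induction p q arbitrary: i rule: ladd.induct) (auto simp: algebra_simps split: nat.splits)

lemma taylor_smult: "taylor (map (\<lambda>c. a \<otimes> c) p) x i = a \<otimes> taylor p x i"
  by (induction p arbitrary: i) (auto simp: algebra_simps split: nat.splits)

lemma taylor_add: "taylor p (x \<oplus> t) i = taylor (shift x p) t i"
proof (induction p arbitrary: i)
  case (Cons a p)
  then show ?case
    by (cases i) (simp_all add: taylor_ladd taylor_smult Cons F.ring_distribs F.add_ac)
qed simp

lemma cf_shift: "cf (shift x p) i = taylor p x i"
  using taylor_add[of p x \<zero> i] by (simp add: taylor_zero)

text \<open>The minimum over j of the valuations of the terms at radius \<open>u\<close> is a Gauss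
  norm, which is invariant under translation by elements of the ball of that radius. In the
  induction one factor \<open>u\<close> is split off from \<open>w\<close>, because the tail of the
  list is multiplied by the variable.\<close>

lemma le_taylor:
  assumes "u \<noteq> \<zero>" "u \<preceq> t" "\<And>j. w \<preceq> cf p j \<otimes> u [^] j"
  shows "w \<preceq> taylor p t i \<otimes> u [^] i"
  using assms(3)
proof (induction p arbitrary: w i)
  case (Cons a p)
  have a: "w \<preceq> a" using Cons.prems[of 0] by simp
  define w' where "w' = w \<oslash> u"
  have w: "w = w' \<otimes> u" using assms(1) by (simp add: w'_def)
  have "w' \<preceq> cf p j \<otimes> u [^] j" for j
  proof -
    have "w' \<otimes> u \<preceq> (cf p j \<otimes> u [^] j) \<otimes> u"
      using Cons.prems[of "Suc j"] by (simp add: w algebra_simps)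
    then show ?thesis using assms(1) by simp
  qed
  from Cons.IH[OF this] have IH: "w' \<preceq> taylor p t i \<otimes> u [^] i" for i .
  have 1: "w \<preceq> (taylor p t i \<otimes> u [^] i) \<otimes> t" for i
    unfolding w using IH assms(2) by (intro le_mult) auto
  show ?case
  proof (cases i)
    case 0
    then show ?thesis using 1[of 0] a by (simp add: le_add algebra_simps)
  next
    case (Suc k)
    have "w \<preceq> (taylor p t k \<otimes> u [^] k) \<otimes> u" unfolding w using IH by (intro le_mult) auto
    then have "w \<preceq> (taylor p t i \<otimes> u [^] i) \<otimes> t \<oplus> (taylor p t k \<otimes> u [^] k) \<otimes> u" using 1 by (intro le_add)
    then show ?thesis using Suc by (simp add: algebra_simps)
  qed
qed simp

text \<open>A translation strictly smaller than the radius changes each Taylor term only by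
  something strictly smaller than the Gauss norm, so the coefficients at which the norm is attained
  keep their valuation.\<close>

lemma lt_taylor:
  assumes "u \<noteq> \<zero>" "u \<prec> t" "w \<noteq> \<zero>" "\<And>j. w \<preceq> cf p j \<otimes> u [^] j"
  shows "w \<prec> (taylor p t i \<ominus> cf p i) \<otimes> u [^] i"
  using assms(3,4)
proof (induction p arbitrary: w i)
  case (Cons a p)
  define w' where "w' = w \<oslash> u"
  have w: "w = w' \<otimes> u" and w': "w' \<noteq> \<zero>" using assms(1) Cons.prems(1) by (auto simp: w'_def)
  have *: "w' \<preceq> cf p j \<otimes> u [^] j" for j
  proof -
    have "w' \<otimes> u \<preceq> (cf p j \<otimes> u [^] j) \<otimes> u"
      using Cons.prems(2)[of "Suc j"] by (simp add: w algebra_simps)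
    then show ?thesis using assms(1) by simp
  qed
  have 1: "w \<prec> (taylor p t i \<otimes> u [^] i) \<otimes> t" for i
    unfolding w using le_taylor[OF assms(1) lt_imp_le[OF assms(2)] *] assms(2) w'
    by (intro le_mult_lt) auto
  show ?case
  proof (cases i)
    case 0
    then show ?thesis using 1[of 0] by (simp add: algebra_simps)
  next
    case (Suc k)
    have "w \<prec> ((taylor p t k \<ominus> cf p k) \<otimes> u [^] k) \<otimes> u"
      unfolding w using Cons.IH[OF w' *] assms(1) by (intro lt_mult_le) auto
    then have "w \<prec> (taylor p t i \<otimes> u [^] i) \<otimes> t \<oplus> ((taylor p t k \<ominus> cf p k) \<otimes> u [^] k) \<otimes> u"
      using 1 by (intro lt_add)
    then show ?thesis using Suc by (simp add: algebra_simps)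
  qed
qed (auto simp: lt_def)

lemma le_taylor_at:
  assumes "u \<noteq> \<zero>" "u \<preceq> t" "\<And>j. w \<preceq> taylor p x j \<otimes> u [^] j"
  shows "w \<preceq> taylor p (x \<oplus> t) i \<otimes> u [^] i"
  unfolding taylor_add by (rule le_taylor) (use assms in \<open>auto simp: cf_shift\<close>)

lemma lt_taylor_at:
  assumes "u \<noteq> \<zero>" "u \<prec> t" "w \<noteq> \<zero>" "\<And>j. w \<preceq> taylor p x j \<otimes> u [^] j"
  shows "w \<prec> (taylor p (x \<oplus> t) i \<ominus> taylor p x i) \<otimes> u [^] i"
  using lt_taylor[of u t w "shift x p" i] assms by (simp add: taylor_add cf_shift)

text \<open>For \<open>p\<close> not constant, this is the smallest ball around \<open>x\<close> that contains a root of \<open>p\<close> in an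
  algebraic closure.\<close>

definition root_ball :: "'a list \<Rightarrow> 'a \<Rightarrow> 'a set" where
  "root_ball p x = {y. \<forall>i>0. ev p x \<preceq> taylor p x i \<otimes> (y \<ominus> x) [^] i}"

section \<open>Root balls: inclusion and comparability\<close>

lemma root_ball_self [simp]: "x \<in> root_ball p x"
  by (auto simp: root_ball_def pow_zero)

lemma root_ball_nonempty [simp]: "root_ball p x \<noteq> {}"
  using root_ball_self by blast

lemma root_ball_le: "y \<in> root_ball p x \<Longrightarrow> ev p x \<preceq> taylor p x i \<otimes> (y \<ominus> x) [^] i"
  by (cases i) (auto simp: root_ball_def)

lemma root_ball_closer:
  assumes "y \<in> root_ball p x" "y \<ominus> x \<preceq> z \<ominus> x" shows "z \<in> root_ball p x"
proof -
  have "ev p x \<preceq> taylor p x i \<otimes> (z \<ominus> x) [^] i" for i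
  proof -
    have "ev p x \<preceq> taylor p x i \<otimes> (y \<ominus> x) [^] i" by (rule root_ball_le) fact
    also have "\<dots> \<preceq> taylor p x i \<otimes> (z \<ominus> x) [^] i" using assms(2) by (intro le_mult pow_le_mono) auto
    finally show ?thesis .
  qed
  then show ?thesis by (auto simp: root_ball_def)
qed

text \<open>If \<open>z\<close> were outside, its distance \<open>u\<close> from \<open>x\<close>
  would exceed that of \<open>y\<close>. At radius \<open>u\<close> some term of positive index
  \<open>i\<close> attains the minimum \<open>w\<close>, strictly below v(p(x)). Moving the center
  from \<open>x\<close> to \<open>y\<close> keeps the valuation of this term, while v(p(y)) is at
  least v(p(x)); so \<open>z\<close> would be outside the ball at \<open>y\<close> too.\<close>

lemma root_ball_trans:
  assumes "y \<in> root_ball p x" "z \<in> root_ball p y" shows "z \<in> root_ball p x"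
proof (rule ccontr)
  assume z: "z \<notin> root_ball p x"
  define u t where "u = z \<ominus> x" and "t = y \<ominus> x"
  have y: "y = x \<oplus> t" by (simp add: t_def algebra_simps)
  have ut: "u \<prec> t"
    using root_ball_closer[OF assms(1), of z] z by (auto simp: u_def t_def lt_def)
  then have u0: "u \<noteq> \<zero>" by (rule lt_nonzero)
  obtain k where k: "k > 0" "taylor p x k \<otimes> u [^] k \<prec> ev p x"
    using z by (auto simp: root_ball_def u_def not_le)
  \<comment> \<open>Beyond the length of \<open>p\<close> all Taylor coefficients vanish, and zero
    is the greatest element, so a minimum over these finitely many indices is a minimum over
    all.\<close>
  obtain i where i: "i \<in> {..max k (length p)}"
    "\<And>j. j \<in> {..max k (length p)} \<Longrightarrow> taylor p x i \<otimes> u [^] i \<preceq> taylor p x j \<otimes> u [^] j"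
    using finite_min[of "{..max k (length p)}" "\<lambda>j. taylor p x j \<otimes> u [^] j"] by auto
  define w where "w = taylor p x i \<otimes> u [^] i"
  have w: "w \<preceq> taylor p x j \<otimes> u [^] j" for j
  proof (cases "j \<le> max k (length p)")
    case False then show ?thesis by (simp add: taylor_eq_0)
  qed (use i w_def in auto)
  have wx: "w \<prec> ev p x" using le_lt_trans[OF w[of k] k(2)] .
  then have w0: "w \<noteq> \<zero>" by (rule lt_nonzero)
  have i0: "i > 0" using wx by (cases i) (auto simp: w_def)
  have "w \<prec> (taylor p y i \<ominus> taylor p x i) \<otimes> u [^] i"
    unfolding y by (rule lt_taylor_at[OF u0 ut w0 w])
  from eqv_add[OF this] have "taylor p y i \<otimes> u [^] i \<approx> w"
    by (simp add: w_def algebra_simps)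
  moreover have "z \<ominus> y \<approx> u" using eqv_diff[OF ut] by (simp add: u_def t_def algebra_simps)
  then have "taylor p y i \<otimes> (z \<ominus> y) [^] i \<approx> taylor p y i \<otimes> u [^] i"
    by (intro eqv_mult pow_eqv_mono) auto
  ultimately have 1: "taylor p y i \<otimes> (z \<ominus> y) [^] i \<approx> w" by (rule eqv_trans[rotated])
  have "ev p x \<preceq> ev p y"
  proof (cases "t = \<zero>")
    case False
    then show ?thesis
      using le_taylor_at[of t t "ev p x" p x 0] root_ball_le[OF assms(1)] by (simp add: y t_def[symmetric])
  qed (simp add: y)
  also have "ev p y \<preceq> taylor p y i \<otimes> (z \<ominus> y) [^] i" using assms(2) by (rule root_ball_le)
  also note 1
  finally show False using wx by (simp add: lt_def)
qed

lemma root_ball_mono: "y \<in> root_ball p x \<Longrightarrow> root_ball p y \<subseteq> root_ball p x"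
  using root_ball_trans by blast

text \<open>The term that excludes \<open>x\<close> from the ball at \<open>y\<close> lies strictly
  below p(y) in valuation, but at the radius y - x all terms at \<open>y\<close> are still bounded
  below by v(p(x)). So the valuation of the polynomial strictly increases on passing to a strictly
  smaller root ball.\<close>

lemma root_ball_lt:
  assumes "y \<in> root_ball p x" "x \<notin> root_ball p y" shows "ev p x \<prec> ev p y"
proof -
  define t where "t = y \<ominus> x"
  have y: "y = x \<oplus> t" by (simp add: t_def algebra_simps)
  have t0: "t \<noteq> \<zero>" using assms by (auto simp: y)
  obtain k where k: "k > 0" "taylor p y k \<otimes> (x \<ominus> y) [^] k \<prec> ev p y"
    using assms by (auto simp: root_ball_def not_le)
  have "ev p x \<preceq> taylor p (x \<oplus> t) k \<otimes> t [^] k"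
    using root_ball_le[OF assms(1)] t0 by (intro le_taylor_at) (auto simp: t_def)
  also have "\<dots> \<preceq> taylor p y k \<otimes> (x \<ominus> y) [^] k"
    unfolding y by (intro le_mult pow_le_mono) (auto simp: algebra_simps t_def le_diff_commute)
  also note k(2)
  finally show ?thesis .
qed

text \<open>Of the two centers, the one nearer to the common point \<open>z\<close> lies in the ball
  of the other, by the ultrametric inequality.\<close>

lemma root_ball_meet:
  assumes "z \<in> root_ball p x" "z \<in> root_ball p y" shows "x \<in> root_ball p y \<or> y \<in> root_ball p x"
proof -
  have *: "x \<in> root_ball p y" if "z \<in> root_ball p y" "z \<ominus> y \<preceq> z \<ominus> x" for x y
  proof -
    have "z \<ominus> y \<preceq> (z \<ominus> y) \<ominus> (z \<ominus> x)" using that(2) by (intro le_diff[of _ "z \<ominus> y"] le_refl)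
    then show ?thesis using that(1) by (auto intro: root_ball_closer simp: algebra_simps)
  qed
  show ?thesis using *[of y x] *[of x y] assms le_total by blast
qed

section \<open>Division by a linear factor and the number of incomparable root balls\<close>

primrec quot :: "'a \<Rightarrow> 'a list \<Rightarrow> 'a list" where
  "quot c [] = []"
| "quot c (b # q) = ev (b # q) c # quot c q"

lemma length_quot [simp]: "length (quot c q) = length q"
  by (induction q) auto

text \<open>Synthetic division: \<open>quot c q\<close> is the quotient by X - c of a + X q minus
  its value at \<open>c\<close>. It depends only on the tail \<open>q\<close>, as the constant
  coefficient enters the remainder alone. All Taylor coefficients at \<open>y\<close> are treated
  because root balls of the polynomial are compared with those of the quotient.\<close>

lemma taylor_quot:
  "taylor (a # q) y m = (y \<ominus> c) \<otimes> taylor (quot c q) y m \<oplus>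
    (case m of 0 \<Rightarrow> ev (a # q) c | Suc k \<Rightarrow> taylor (quot c q) y k)"
proof (induction q arbitrary: a m)
  case (Cons b q)
  define e T where "e = ev (b # q) c" and "T = taylor (quot c q) y"
  have U: "taylor (b # q) y m = (y \<ominus> c) \<otimes> T m \<oplus> (case m of 0 \<Rightarrow> e | Suc k \<Rightarrow> T k)" for m
    unfolding e_def T_def by (rule Cons)
  have p: "taylor (a # b # q) y m = y \<otimes> taylor (b # q) y m \<oplus> (case m of 0 \<Rightarrow> a | Suc k \<Rightarrow> taylor (b # q) y k)"
    by simp
  have g: "taylor (quot c (b # q)) y m = y \<otimes> T m \<oplus> (case m of 0 \<Rightarrow> e | Suc k \<Rightarrow> T k)" for m
    by (cases m) (simp_all add: T_def e_def)
  have e: "ev (a # b # q) c = c \<otimes> e \<oplus> a" by (simp add: e_def)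
  show ?case
    unfolding p U g e by (cases m; cases "m - 1") (simp_all add: algebra_simps)
qed (auto split: nat.splits)

text \<open>Over an algebraic closure, incomparable root balls would contain different roots.
  Instead one argues by induction on the degree: drop the point \<open>c\<close> at which p has the
  largest valuation and divide by X - c. For the quotient, the remaining points still lie outside
  each other's balls.\<close>

lemma card_root_balls:
  assumes "finite Xs" "\<And>x y. x \<in> Xs \<Longrightarrow> y \<in> Xs \<Longrightarrow> x \<noteq> y \<Longrightarrow> y \<notin> root_ball p x"
  shows "card Xs \<le> Suc (length p)"
  using assms
proof (induction "length p" arbitrary: p Xs)
  case 0
  then have "x = y" if "x \<in> Xs" "y \<in> Xs" for x y using that by (force simp: root_ball_def)
  then show ?case using 0 by (metis card_le_Suc0_iff_eq One_nat_def le_Suc_eq le_zero_eq)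
next
  case (Suc n)
  then obtain a q where p: "p = a # q" and q: "length q = n" by (cases p) auto
  show ?case
  proof (cases "Xs = {}")
    case False
    obtain c where c: "c \<in> Xs" "\<And>x. x \<in> Xs \<Longrightarrow> ev p x \<preceq> ev p c"
      using finite_max[OF Suc.prems(1) False, of "ev p"] by blast
    define g where "g = quot c q"
    have "y \<notin> root_ball g x" if xy: "x \<in> Xs - {c}" "y \<in> Xs - {c}" "x \<noteq> y" for x y
    proof -
      \<comment> \<open>The test point \<open>t\<close> is the other point of \<open>Xs\<close>
        nearest to \<open>x\<close>; a root ball around \<open>x\<close> that contains any other
        point also contains \<open>t\<close>.\<close>
      have "finite (Xs - {x})" "Xs - {x} \<noteq> {}" using Suc.prems(1) c(1) xy by auto
      from finite_max[OF this, of "\<lambda>y. y \<ominus> x"]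
      obtain t where t: "t \<in> Xs - {x}" "\<And>y. y \<in> Xs - {x} \<Longrightarrow> y \<ominus> x \<preceq> t \<ominus> x" by blast
      obtain m where m: "m > 0" "taylor p x m \<otimes> (t \<ominus> x) [^] m \<prec> ev p x"
        using Suc.prems(2)[of x t] t(1) xy(1) by (auto simp: root_ball_def not_le)
      then obtain k where k: "m = Suc k" by (cases m) auto
      have h0: "ev p x = (x \<ominus> c) \<otimes> ev g x \<oplus> ev p c"
        and hm: "taylor p x m = (x \<ominus> c) \<otimes> taylor g x m \<oplus> taylor g x k"
        using taylor_quot[of a q x _ c] by (simp_all add: p g_def k del: taylor.simps)
      have xc: "x \<ominus> c \<noteq> \<zero>" using xy(1) by auto
      \<comment> \<open>Subtracting p(c), whose valuation is largest, does not lower the valuation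
        of p(x), and the difference is (x - c) g(x). Hence one of the two summands of the m-th
        coefficient violates the bound, and either violation excludes \<open>t\<close>.\<close>
      have "taylor p x m \<otimes> (t \<ominus> x) [^] m \<prec> ev p x \<ominus> ev p c"
        using m(2) c(2)[of x] xy(1) by (intro lt_diff) (auto intro: lt_le_trans)
      then have "taylor p x m \<otimes> (t \<ominus> x) [^] m \<prec> (x \<ominus> c) \<otimes> ev g x" by (simp add: h0)
      then have "\<not> (x \<ominus> c) \<otimes> ev g x \<preceq> (x \<ominus> c) \<otimes> (taylor g x m \<otimes> (t \<ominus> x) [^] m) \<or>
        \<not> (x \<ominus> c) \<otimes> ev g x \<preceq> taylor g x k \<otimes> (t \<ominus> x) [^] m"
        using le_add[of "(x \<ominus> c) \<otimes> ev g x" "(x \<ominus> c) \<otimes> (taylor g x m \<otimes> (t \<ominus> x) [^] m)" "taylor g x k \<otimes> (t \<ominus> x) [^] m"]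
        by (auto simp: hm lt_def algebra_simps)
      then have "t \<notin> root_ball g x"
      proof
        assume "\<not> (x \<ominus> c) \<otimes> ev g x \<preceq> (x \<ominus> c) \<otimes> (taylor g x m \<otimes> (t \<ominus> x) [^] m)"
        then show ?thesis using xc m(1) by (auto simp: root_ball_def)
      next
        assume *: "\<not> (x \<ominus> c) \<otimes> ev g x \<preceq> taylor g x k \<otimes> (t \<ominus> x) [^] m"
        have "x \<ominus> c \<preceq> t \<ominus> x" using t(2)[of c] c(1) xy(1) by (auto simp: le_diff_commute)
        then have "(x \<ominus> c) \<otimes> (taylor g x k \<otimes> (t \<ominus> x) [^] k) \<preceq> (t \<ominus> x) \<otimes> (taylor g x k \<otimes> (t \<ominus> x) [^] k)"
          by (intro le_mult) auto
        then have "\<not> (x \<ominus> c) \<otimes> ev g x \<preceq> (x \<ominus> c) \<otimes> (taylor g x k \<otimes> (t \<ominus> x) [^] k)"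
          using * le_trans by (auto simp: k algebra_simps)
        then have "\<not> ev g x \<preceq> taylor g x k \<otimes> (t \<ominus> x) [^] k" by simp
        then show ?thesis using root_ball_le by blast
      qed
      then show ?thesis using root_ball_closer[of y g x t] t(2)[of y] xy by auto
    qed
    then have "card (Xs - {c}) \<le> Suc (length g)"
      using Suc.hyps(1)[of g "Xs - {c}"] Suc.prems(1) by (auto simp: g_def q)
    then show ?thesis using c(1) Suc.prems(1) by (simp add: p q g_def)
  qed simp
qed

text \<open>The radius is a cut in the value set rather than an element: a ball is any nonempty set
  closed under moving closer to its points. Singletons and the whole field are included.\<close>

definition ball :: "'a set \<Rightarrow> bool" where
  "ball C \<longleftrightarrow> C \<noteq> {} \<and> (\<forall>x\<in>C. \<forall>y\<in>C. \<forall>z. y \<ominus> x \<preceq> z \<ominus> x \<longrightarrow> z \<in> C)"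

definition nest :: "'a set set \<Rightarrow> bool" where
  "nest \<N> \<longleftrightarrow> \<N> \<noteq> {} \<and> (\<forall>C\<in>\<N>. ball C) \<and> (\<forall>C\<in>\<N>. \<forall>D\<in>\<N>. C \<subseteq> D \<or> D \<subseteq> C) \<and> \<Inter>\<N> = {}"

text \<open>The leading part of \<open>f\<close> is constant on \<open>C\<close>: all values agree
  up to a relative error of positive valuation. The case \<open>y = x\<close> forces
  \<open>f\<close> to have no zero on \<open>C\<close>.\<close>

definition stable_on :: "'a set \<Rightarrow> ('a \<Rightarrow> 'a) \<Rightarrow> bool" where
  "stable_on C f \<longleftrightarrow> (\<forall>x\<in>C. \<forall>y\<in>C. f x \<prec> f y \<ominus> f x)"

text \<open>Every pseudo-convergent sequence without pseudo-limit is of transcendental type.\<close>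

definition alg_maximal :: bool where
  "alg_maximal \<longleftrightarrow> (\<forall>\<N> p. nest \<N> \<and> (\<exists>c\<in>set p. c \<noteq> \<zero>) \<longrightarrow> (\<exists>C\<in>\<N>. stable_on C (ev p)))"

lemma ball_root_ball: "ball (root_ball p x)"
  unfolding ball_def
proof (intro conjI ballI allI impI)
  fix a b z assume *: "a \<in> root_ball p x" "b \<in> root_ball p x" "b \<ominus> a \<preceq> z \<ominus> a"
  consider "a \<ominus> x \<preceq> b \<ominus> x" | "b \<ominus> x \<preceq> a \<ominus> x" using le_total by blast
  then show "z \<in> root_ball p x"
  proof cases
    case 1
    have "a \<ominus> x \<preceq> (b \<ominus> x) \<ominus> (a \<ominus> x)" using 1 by (intro le_diff[of _ "b \<ominus> x"] le_refl)
    then have "a \<ominus> x \<preceq> b \<ominus> a" by (simp add: algebra_simps)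
    also note *(3)
    finally have "a \<ominus> x \<preceq> (z \<ominus> a) \<oplus> (a \<ominus> x)" by (intro le_add) auto
    then show ?thesis using *(1) by (auto intro: root_ball_closer simp: algebra_simps)
  next
    case 2
    have "b \<ominus> x \<preceq> (b \<ominus> x) \<ominus> (a \<ominus> x)" using 2 by (intro le_diff[of _ "b \<ominus> x"] le_refl)
    then have "b \<ominus> x \<preceq> b \<ominus> a" by (simp add: algebra_simps)
    also note *(3)
    finally have "b \<ominus> x \<preceq> (z \<ominus> a) \<oplus> (a \<ominus> x)" using 2 by (intro le_add) auto
    then show ?thesis using *(2) by (auto intro: root_ball_closer simp: algebra_simps)
  qed
qed (use root_ball_self in blast)

section \<open>Minimal root balls and centers\<close>

definition antichain :: "'a list \<Rightarrow> 'a set \<Rightarrow> bool" where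
  "antichain p Y \<longleftrightarrow> (\<forall>x\<in>Y. \<forall>y\<in>Y. x \<noteq> y \<longrightarrow> y \<notin> root_ball p x)"

lemma max_antichain:
  assumes "s \<in> S"
  shows "\<exists>Y. Y \<subseteq> S \<and> finite Y \<and> Y \<noteq> {} \<and> card Y \<le> Suc (length p) \<and> antichain p Y \<and>
    (\<forall>Z. Z \<subseteq> S \<and> finite Z \<and> antichain p Z \<longrightarrow> card Z \<le> card Y)"
proof -
  define P where "P Y \<longleftrightarrow> Y \<subseteq> S \<and> finite Y \<and> antichain p Y" for Y
  have "P {s}" using assms by (auto simp: P_def antichain_def)
  moreover have bd: "\<forall>Y. P Y \<longrightarrow> card Y \<le> Suc (length p)"
    using card_root_balls by (auto simp: P_def antichain_def)
  ultimately obtain Y where Y: "P Y" "\<forall>Z. P Z \<longrightarrow> card Z \<le> card Y"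
    using ex_has_greatest_nat[of P "{s}" card "Suc (Suc (length p))"] by (auto simp: less_Suc_eq_le)
  have "card Y \<ge> 1" using Y(2) \<open>P {s}\<close> by force
  then have "Y \<noteq> {}" by auto
  then show ?thesis using Y bd by (auto simp: P_def)
qed

text \<open>A largest antichain in the ball exists because the size of antichains is bounded. Below
  a member \<open>c\<close> of it any two root balls are comparable, for otherwise \<open>c\<close>
  could be replaced by two points. Without a minimal ball they form a nest, on one of whose balls
  the polynomial would have to stabilize, whereas its valuation strictly increases along ever
  smaller balls.\<close>

lemma minimal_root_ball:
  assumes alg_maximal
  shows "\<exists>c\<in>root_ball p x. \<forall>y\<in>root_ball p c. c \<in> root_ball p y"
proof (rule ccontr)
  assume "\<not> ?thesis"
  then have no_min: "\<exists>y\<in>root_ball p c. c \<notin> root_ball p y" if "c \<in> root_ball p x" for c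
    using that by blast
  obtain Xs where Xs: "Xs \<subseteq> root_ball p x" "finite Xs" "Xs \<noteq> {}" and anti: "antichain p Xs"
    and Xmax: "\<forall>Z. Z \<subseteq> root_ball p x \<and> finite Z \<and> antichain p Z \<longrightarrow> card Z \<le> card Xs"
    using max_antichain[OF root_ball_self[of x p], of p] by auto
  have anti': "y \<notin> root_ball p x" if "x \<in> Xs" "y \<in> Xs" "x \<noteq> y" for x y
    using anti that by (auto simp: antichain_def)
  obtain c where c: "c \<in> Xs" using Xs(3) by auto
  have comp: "y' \<in> root_ball p y \<or> y \<in> root_ball p y'" if y: "y \<in> root_ball p c" "y' \<in> root_ball p c" for y y'
  proof (rule ccontr)
    assume n: "\<not> ?thesis"
    define Y where "Y = insert y (insert y' (Xs - {c}))"
    have apart: "z \<notin> root_ball p w \<and> w \<notin> root_ball p z" if "z \<in> Xs - {c}" "w \<in> root_ball p c" for z w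
    proof (intro conjI notI)
      assume "w \<in> root_ball p z"
      then have "z \<in> root_ball p c \<or> c \<in> root_ball p z" by (rule root_ball_meet) fact
      then show False using anti'[of z c] anti'[of c z] that(1) c by auto
    next
      assume "z \<in> root_ball p w"
      then have "z \<in> root_ball p c" using root_ball_mono[OF that(2)] by blast
      then show False using anti'[of c z] that(1) c by auto
    qed
    have ne: "y \<noteq> y'" using n by auto
    have "y \<notin> Xs - {c}" "y' \<notin> Xs - {c}" using apart y by (metis root_ball_self)+
    then have "card Y = Suc (Suc (card (Xs - {c})))" using Xs(2) ne by (simp add: Y_def)
    also have "\<dots> = Suc (card Xs)" using c Xs(2) by (metis card_Suc_Diff1)
    finally have "card Y > card Xs" by simp
    moreover have "card Y \<le> card Xs"
    proof -
      have "Y \<subseteq> root_ball p x" using Xs(1) c y root_ball_mono[of c p x] by (auto simp: Y_def)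
      moreover have "finite Y" using Xs(2) by (simp add: Y_def)
      moreover have "v \<notin> root_ball p u" if "u \<in> Y" "v \<in> Y" "u \<noteq> v" for u v
        using that apart[of u] apart[of v] anti'[of u v] y n by (auto simp: Y_def)
      then have "antichain p Y" by (auto simp: antichain_def)
      ultimately show ?thesis using Xmax by blast
    qed
    ultimately show False by simp
  qed
  have cx: "c \<in> root_ball p x" using c Xs(1) by blast
  define \<N> where "\<N> = root_ball p ` root_ball p c"
  have "nest \<N>"
    unfolding nest_def
  proof (intro conjI)
    show "\<forall>C\<in>\<N>. \<forall>D\<in>\<N>. C \<subseteq> D \<or> D \<subseteq> C"
    proof (intro ballI)
      fix C D assume "C \<in> \<N>" "D \<in> \<N>"
      then obtain y y' where "y \<in> root_ball p c" "y' \<in> root_ball p c" "C = root_ball p y" "D = root_ball p y'"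
        by (auto simp: \<N>_def)
      then show "C \<subseteq> D \<or> D \<subseteq> C" using comp[of y y'] root_ball_mono by auto
    qed
    show "\<Inter>\<N> = {}"
    proof (rule ccontr)
      assume "\<Inter>\<N> \<noteq> {}"
      then obtain z where z: "\<And>y. y \<in> root_ball p c \<Longrightarrow> z \<in> root_ball p y" by (auto simp: \<N>_def)
      then have zc: "z \<in> root_ball p c" by auto
      then have "z \<in> root_ball p x" using root_ball_mono[OF cx] by blast
      then obtain y where y: "y \<in> root_ball p z" "z \<notin> root_ball p y" using no_min by blast
      then have "y \<in> root_ball p c" using root_ball_mono[OF zc] by blast
      then show False using z y(2) by blast
    qed
  qed (use ball_root_ball in \<open>auto simp: \<N>_def\<close>)
  \<comment> \<open>For the zero polynomial every root ball is the whole field, hence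
    minimal.\<close>
  moreover have "\<exists>a\<in>set p. a \<noteq> \<zero>"
  proof (rule ccontr)
    assume "\<not> ?thesis"
    then have "root_ball p y = UNIV" for y by (auto simp: root_ball_def taylor_zero_poly)
    then show False using no_min[OF cx] by blast
  qed
  ultimately obtain C where C: "C \<in> \<N>" "stable_on C (ev p)" using assms by (auto simp: alg_maximal_def)
  then obtain y where y: "y \<in> root_ball p c" "C = root_ball p y" by (auto simp: \<N>_def)
  then have "y \<in> root_ball p x" using root_ball_mono[OF cx] by blast
  then obtain z where z: "z \<in> root_ball p y" "y \<notin> root_ball p z" using no_min by blast
  then have "ev p y \<prec> ev p z" by (rule root_ball_lt)
  then have "ev p z \<ominus> ev p y \<approx> ev p y" by (rule eqv_diff')
  moreover have "ev p y \<prec> ev p z \<ominus> ev p y" using C(2) z(1) by (auto simp: stable_on_def y)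
  ultimately show False by (auto simp: eqv_def lt_def)
qed

text \<open>The points of \<open>S\<close> have minimal root balls, and every root ball contains
  such a point. A largest antichain in \<open>S\<close> has a member in every minimal ball, since
  between points of \<open>S\<close> lying in each other's root balls is a symmetric relation; hence
  it has a member in every root ball.\<close>

lemma centers:
  assumes alg_maximal
  obtains C where "finite C" "C \<noteq> {}" "card C \<le> Suc (length p)" "\<And>x. \<exists>c\<in>C. c \<in> root_ball p x"
proof -
  define S where "S = {c. \<forall>y\<in>root_ball p c. c \<in> root_ball p y}"
  obtain s where "s \<in> S" using minimal_root_ball[OF assms, of p \<zero>] by (auto simp: S_def)
  from max_antichain[OF this, of p]
  obtain Xs where Xs: "Xs \<subseteq> S" "finite Xs" "Xs \<noteq> {}" "card Xs \<le> Suc (length p)" and anti: "antichain p Xs"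
    and Xmax: "\<forall>Z. Z \<subseteq> S \<and> finite Z \<and> antichain p Z \<longrightarrow> card Z \<le> card Xs"
    by auto
  have "\<exists>c\<in>Xs. c \<in> root_ball p x" for x
  proof -
    obtain c where c: "c \<in> root_ball p x" "c \<in> S"
      using minimal_root_ball[OF assms, of p x] by (auto simp: S_def)
    have "\<exists>d\<in>Xs. d \<in> root_ball p c"
    proof (rule ccontr)
      assume n: "\<not> ?thesis"
      then have "c \<notin> Xs" using root_ball_self by blast
      then have "card (insert c Xs) = Suc (card Xs)" using Xs(2) by simp
      moreover have "v \<notin> root_ball p u" if "u \<in> insert c Xs" "v \<in> insert c Xs" "u \<noteq> v" for u v
        using that anti n Xs(1) c(2) unfolding S_def antichain_def by blast
      then have "antichain p (insert c Xs)" by (auto simp: antichain_def)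
      then have "card (insert c Xs) \<le> card Xs" using Xmax Xs c by auto
      ultimately show False by simp
    qed
    then show ?thesis using root_ball_mono[OF c(1)] by blast
  qed
  then show ?thesis using that[of Xs] Xs(2-4) by auto
qed

end

section \<open>Extensions of p-valued fields\<close>

lemma carrier_Quot_PIdl:
  "carrier ((R\<lparr>carrier := A\<rparr>) Quot (PIdl\<^bsub>R\<lparr>carrier := A\<rparr>\<^esub> \<pi>)) = (\<lambda>a. {t \<otimes>\<^bsub>R\<^esub> \<pi> \<oplus>\<^bsub>R\<^esub> a | t. t \<in> A}) ` A"
  for R :: "'a ring"
  by (auto simp: FactRing_def A_RCOSETS_def' a_r_coset_def' cgenideal_def)

lemma card_image_cong:
  assumes "\<And>a b. a \<in> A \<Longrightarrow> b \<in> A \<Longrightarrow> F a = F b \<longleftrightarrow> G a = G b"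
  shows "card (F ` A) = card (G ` A)"
proof -
  define h where "h y = G (SOME a. a \<in> A \<and> F a = y)" for y
  have h: "h (F a) = G a" if "a \<in> A" for a
  proof -
    have "(SOME b. b \<in> A \<and> F b = F a) \<in> A \<and> F (SOME b. b \<in> A \<and> F b = F a) = F a"
      by (rule someI_ex) (use that in auto)
    then show ?thesis using assms that by (auto simp: h_def)
  qed
  then have "bij_betw h (F ` A) (G ` A)"
    by (auto simp: bij_betw_def inj_on_def image_image assms)
  then show ?thesis by (rule bij_betw_same_card)
qed

text \<open>An extension of \<open>p\<close>-valued fields has the same \<open>p\<close>-rank if every integral element is congruent
  modulo \<open>p\<close> to an element of the smaller field.\<close>

lemma p_valued_extension:
  fixes R S :: "'a ring"
  assumes pv: "p_valued p d R A" and vS: "valuation_ring S A'"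
    and h: "h \<in> ring_hom R S" and hA: "\<And>x. x \<in> carrier R \<Longrightarrow> x \<in> A \<longleftrightarrow> h x \<in> A'"
    and red: "\<And>s. s \<in> A' \<Longrightarrow> \<exists>a\<in>A. \<exists>t\<in>A'. s = t \<otimes>\<^bsub>S\<^esub> h ([p] \<cdot>\<^bsub>R\<^esub> \<one>\<^bsub>R\<^esub>) \<oplus>\<^bsub>S\<^esub> h a"
  shows "p_valued p d S A'"
proof -
  define \<pi> where "\<pi> = [p] \<cdot>\<^bsub>R\<^esub> \<one>\<^bsub>R\<^esub>"
  have fR: "field R" and sA: "subring A R" and char: "\<And>n::nat. n > 0 \<Longrightarrow> [n] \<cdot>\<^bsub>R\<^esub> \<one>\<^bsub>R\<^esub> \<noteq> \<zero>\<^bsub>R\<^esub>"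
    and pr: "Factorial_Ring.prime p"
    and nu: "\<pi> \<notin> Units (R\<lparr>carrier := A\<rparr>)"
    and card: "card (carrier (R\<lparr>carrier := A\<rparr> Quot (PIdl\<^bsub>R\<lparr>carrier := A\<rparr>\<^esub> \<pi>))) = p ^ d"
    using pv by (auto simp: p_valued_def valuation_ring_def Let_def \<pi>_def)
  have fS: "field S" and sA': "subring A' S" using vS by (auto simp: valuation_ring_def)
  interpret R: field R by (rule fR)
  interpret S: field S by (rule fS)
  interpret H: ring_hom_ring R S h
    by (rule ring_hom_ringI2) (use h R.ring_axioms S.ring_axioms in auto)
  have inj: "inj_on h (carrier R)"
  proof (rule H.non_trivial_field_hom_imp_inj[OF fR])
    have "\<one>\<^bsub>S\<^esub> \<in> h ` carrier R" using H.hom_one R.one_closed by (metis imageI)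
    then show "h ` carrier R \<noteq> {\<zero>\<^bsub>S\<^esub>}" by (metis S.one_not_zero singletonD)
  qed
  have hnat: "h ([n] \<cdot>\<^bsub>R\<^esub> \<one>\<^bsub>R\<^esub>) = [n] \<cdot>\<^bsub>S\<^esub> \<one>\<^bsub>S\<^esub>" for n :: nat
    by (induction n) (auto simp: R.add.nat_pow_Suc S.add.nat_pow_Suc)
  have AR: "A \<subseteq> carrier R" and A'S: "A' \<subseteq> carrier S" using sA sA' by (auto dest: subringE(1))
  have \<pi>R: "\<pi> \<in> carrier R" by (simp add: \<pi>_def)
  have \<pi>0: "\<pi> \<noteq> \<zero>\<^bsub>R\<^esub>" using char[of p] pr by (auto simp: \<pi>_def prime_gt_0_nat)
  have h0: "h x = \<zero>\<^bsub>S\<^esub> \<longleftrightarrow> x = \<zero>\<^bsub>R\<^esub>" if "x \<in> carrier R" for x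
    using inj that by (metis H.hom_zero R.zero_closed inj_onD)
  have hinv: "h (inv\<^bsub>R\<^esub> x) = inv\<^bsub>S\<^esub> (h x)" if "x \<in> carrier R" "x \<noteq> \<zero>\<^bsub>R\<^esub>" for x
  proof -
    have "x \<in> Units R" using that by (simp add: R.field_Units)
    then have "h x \<otimes>\<^bsub>S\<^esub> h (inv\<^bsub>R\<^esub> x) = \<one>\<^bsub>S\<^esub>" "h (inv\<^bsub>R\<^esub> x) \<in> carrier S" "h x \<in> carrier S"
      using that by (auto simp flip: H.hom_mult)
    then show ?thesis using S.comm_inv_char by metis
  qed
  have "h \<pi> \<notin> Units (S\<lparr>carrier := A'\<rparr>)"
  proof
    assume "h \<pi> \<in> Units (S\<lparr>carrier := A'\<rparr>)"
    then obtain t where t: "t \<in> A'" "h \<pi> \<otimes>\<^bsub>S\<^esub> t = \<one>\<^bsub>S\<^esub>" "h \<pi> \<in> A'" by (auto simp: Units_def)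
    then have "inv\<^bsub>S\<^esub> (h \<pi>) = t" using A'S \<pi>R by (intro S.comm_inv_char) auto
    then have "h (inv\<^bsub>R\<^esub> \<pi>) \<in> A'" using hinv[OF \<pi>R \<pi>0] t by simp
    moreover have inv: "inv\<^bsub>R\<^esub> \<pi> \<in> carrier R" using \<pi>R \<pi>0 by (simp add: R.field_Units)
    ultimately have "inv\<^bsub>R\<^esub> \<pi> \<in> A" "\<pi> \<in> A" using hA \<pi>R t by auto
    moreover have "inv\<^bsub>R\<^esub> \<pi> \<otimes>\<^bsub>R\<^esub> \<pi> = \<one>\<^bsub>R\<^esub>" "\<pi> \<otimes>\<^bsub>R\<^esub> inv\<^bsub>R\<^esub> \<pi> = \<one>\<^bsub>R\<^esub>"
      using \<pi>R \<pi>0 R.Units_l_inv R.Units_r_inv by (auto simp: R.field_Units)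
    ultimately have "\<pi> \<in> Units (R\<lparr>carrier := A\<rparr>)"
      by (simp add: Units_def) (rule bexI[of _ "inv\<^bsub>R\<^esub> \<pi>"], simp_all)
    then show False using nu by simp
  qed
  moreover have "card (carrier (S\<lparr>carrier := A'\<rparr> Quot (PIdl\<^bsub>S\<lparr>carrier := A'\<rparr>\<^esub> h \<pi>))) = p ^ d"
  proof -
    define F where "F a = {t \<otimes>\<^bsub>R\<^esub> \<pi> \<oplus>\<^bsub>R\<^esub> a | t. t \<in> A}" for a
    define G where "G s = {t \<otimes>\<^bsub>S\<^esub> h \<pi> \<oplus>\<^bsub>S\<^esub> s | t. t \<in> A'}" for s
    have G_eq: "G s = G r \<longleftrightarrow> (\<exists>t\<in>A'. s = t \<otimes>\<^bsub>S\<^esub> h \<pi> \<oplus>\<^bsub>S\<^esub> r)" if sr: "s \<in> A'" "r \<in> A'" for s r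
    proof
      assume "G s = G r"
      moreover have "s \<in> G s"
        using sr A'S \<pi>R subringE(2)[OF sA'] by (auto simp: G_def intro!: exI[of _ "\<zero>\<^bsub>S\<^esub>"])
      ultimately show "\<exists>t\<in>A'. s = t \<otimes>\<^bsub>S\<^esub> h \<pi> \<oplus>\<^bsub>S\<^esub> r" by (auto simp: G_def)
    next
      assume "\<exists>t\<in>A'. s = t \<otimes>\<^bsub>S\<^esub> h \<pi> \<oplus>\<^bsub>S\<^esub> r"
      then obtain u where u: "u \<in> A'" "s = u \<otimes>\<^bsub>S\<^esub> h \<pi> \<oplus>\<^bsub>S\<^esub> r" by blast
      have c: "u \<in> carrier S" "r \<in> carrier S" "h \<pi> \<in> carrier S" using u sr A'S \<pi>R by auto
      have "t \<otimes>\<^bsub>S\<^esub> h \<pi> \<oplus>\<^bsub>S\<^esub> s = (t \<oplus>\<^bsub>S\<^esub> u) \<otimes>\<^bsub>S\<^esub> h \<pi> \<oplus>\<^bsub>S\<^esub> r" if "t \<in> A'" for t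
        using that A'S c unfolding u(2) by (auto simp: S.l_distr S.a_assoc)
      moreover have "t \<otimes>\<^bsub>S\<^esub> h \<pi> \<oplus>\<^bsub>S\<^esub> r = (t \<ominus>\<^bsub>S\<^esub> u) \<otimes>\<^bsub>S\<^esub> h \<pi> \<oplus>\<^bsub>S\<^esub> s" if "t \<in> A'" for t
      proof -
        have "t \<in> carrier S" using that A'S by auto
        then show ?thesis using c unfolding u(2) by algebra
      qed
      moreover have "t \<oplus>\<^bsub>S\<^esub> u \<in> A'" "t \<ominus>\<^bsub>S\<^esub> u \<in> A'" if "t \<in> A'" for t
        using that u(1) subringE(5,7)[OF sA'] unfolding a_minus_def by blast+
      ultimately have "x \<in> G s \<longleftrightarrow> x \<in> G r" for x unfolding G_def mem_Collect_eq by metis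
      then show "G s = G r" by blast
    qed
    have F_eq: "F a = F b \<longleftrightarrow> (\<exists>t\<in>A. a = t \<otimes>\<^bsub>R\<^esub> \<pi> \<oplus>\<^bsub>R\<^esub> b)" if sr: "a \<in> A" "b \<in> A" for a b
    proof
      assume "F a = F b"
      moreover have "a \<in> F a"
        using sr AR \<pi>R subringE(2)[OF sA] by (auto simp: F_def intro!: exI[of _ "\<zero>\<^bsub>R\<^esub>"])
      ultimately show "\<exists>t\<in>A. a = t \<otimes>\<^bsub>R\<^esub> \<pi> \<oplus>\<^bsub>R\<^esub> b" by (auto simp: F_def)
    next
      assume "\<exists>t\<in>A. a = t \<otimes>\<^bsub>R\<^esub> \<pi> \<oplus>\<^bsub>R\<^esub> b"
      then obtain u where u: "u \<in> A" "a = u \<otimes>\<^bsub>R\<^esub> \<pi> \<oplus>\<^bsub>R\<^esub> b" by blast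
      have c: "u \<in> carrier R" "b \<in> carrier R" using u sr AR by auto
      have "t \<otimes>\<^bsub>R\<^esub> \<pi> \<oplus>\<^bsub>R\<^esub> a = (t \<oplus>\<^bsub>R\<^esub> u) \<otimes>\<^bsub>R\<^esub> \<pi> \<oplus>\<^bsub>R\<^esub> b" if "t \<in> A" for t
        using that AR c \<pi>R unfolding u(2) by (auto simp: R.l_distr R.a_assoc)
      moreover have "t \<otimes>\<^bsub>R\<^esub> \<pi> \<oplus>\<^bsub>R\<^esub> b = (t \<ominus>\<^bsub>R\<^esub> u) \<otimes>\<^bsub>R\<^esub> \<pi> \<oplus>\<^bsub>R\<^esub> a" if "t \<in> A" for t
      proof -
        have "t \<in> carrier R" using that AR by auto
        then show ?thesis using c \<pi>R unfolding u(2) by algebra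
      qed
      moreover have "t \<oplus>\<^bsub>R\<^esub> u \<in> A" "t \<ominus>\<^bsub>R\<^esub> u \<in> A" if "t \<in> A" for t
        using that u(1) subringE(5,7)[OF sA] unfolding a_minus_def by blast+
      ultimately have "x \<in> F a \<longleftrightarrow> x \<in> F b" for x unfolding F_def mem_Collect_eq by metis
      then show "F a = F b" by blast
    qed
    have hA': "h a \<in> A'" if "a \<in> A" for a using hA that AR by auto
    have "carrier (S\<lparr>carrier := A'\<rparr> Quot (PIdl\<^bsub>S\<lparr>carrier := A'\<rparr>\<^esub> h \<pi>)) = G ` A'"
      unfolding carrier_Quot_PIdl G_def ..
    also have "\<dots> = (\<lambda>a. G (h a)) ` A"
    proof
      show "G ` A' \<subseteq> (\<lambda>a. G (h a)) ` A"
      proof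
        fix C assume "C \<in> G ` A'"
        then obtain s where s: "s \<in> A'" "C = G s" by auto
        obtain a t where "a \<in> A" "t \<in> A'" "s = t \<otimes>\<^bsub>S\<^esub> h \<pi> \<oplus>\<^bsub>S\<^esub> h a"
          using red[OF s(1)] by (auto simp: \<pi>_def)
        then show "C \<in> (\<lambda>a. G (h a)) ` A" using s G_eq[of s "h a"] hA' by auto
      qed
    qed (use hA' in auto)
    finally have "card (carrier (S\<lparr>carrier := A'\<rparr> Quot (PIdl\<^bsub>S\<lparr>carrier := A'\<rparr>\<^esub> h \<pi>))) = card ((\<lambda>a. G (h a)) ` A)" by simp
    also have "\<dots> = card (F ` A)"
    proof (rule card_image_cong)
      fix a b assume ab: "a \<in> A" "b \<in> A"
      then have c: "a \<in> carrier R" "b \<in> carrier R" using AR by auto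
      show "G (h a) = G (h b) \<longleftrightarrow> F a = F b"
        unfolding F_eq[OF ab] G_eq[OF hA'[OF ab(1)] hA'[OF ab(2)]]
      proof
        assume "\<exists>t\<in>A. a = t \<otimes>\<^bsub>R\<^esub> \<pi> \<oplus>\<^bsub>R\<^esub> b"
        then show "\<exists>t\<in>A'. h a = t \<otimes>\<^bsub>S\<^esub> h \<pi> \<oplus>\<^bsub>S\<^esub> h b"
          using hA' AR c \<pi>R by (auto intro!: bexI[of _ "h _"])
      next
        assume "\<exists>t\<in>A'. h a = t \<otimes>\<^bsub>S\<^esub> h \<pi> \<oplus>\<^bsub>S\<^esub> h b"
        then obtain t where t: "t \<in> A'" "h a = t \<otimes>\<^bsub>S\<^esub> h \<pi> \<oplus>\<^bsub>S\<^esub> h b" by blast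
        \<comment> \<open>Congruence modulo p descends to the smaller field: \<open>t\<close> is the
          image of (a - b)/p, and \<open>h\<close> reflects integrality.\<close>
        define u where "u = (a \<ominus>\<^bsub>R\<^esub> b) \<otimes>\<^bsub>R\<^esub> inv\<^bsub>R\<^esub> \<pi>"
        have inv: "inv\<^bsub>R\<^esub> \<pi> \<in> carrier R" "\<pi> \<otimes>\<^bsub>R\<^esub> inv\<^bsub>R\<^esub> \<pi> = \<one>\<^bsub>R\<^esub>" "inv\<^bsub>R\<^esub> \<pi> \<otimes>\<^bsub>R\<^esub> \<pi> = \<one>\<^bsub>R\<^esub>"
          using \<pi>R \<pi>0 by (auto simp: R.field_Units)
        have uR: "u \<in> carrier R" using c inv by (simp add: u_def)
        have "a = u \<otimes>\<^bsub>R\<^esub> \<pi> \<oplus>\<^bsub>R\<^esub> b" using c inv \<pi>R unfolding u_def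
          by (simp add: R.m_assoc) (simp add: R.minus_eq R.a_assoc R.l_neg)
        moreover have "h u = t"
        proof -
          have tS: "t \<in> carrier S" using t A'S by auto
          have "h u = (h a \<ominus>\<^bsub>S\<^esub> h b) \<otimes>\<^bsub>S\<^esub> h (inv\<^bsub>R\<^esub> \<pi>)"
            using c inv(1) by (simp add: u_def R.minus_eq S.minus_eq)
          also have "h a \<ominus>\<^bsub>S\<^esub> h b = t \<otimes>\<^bsub>S\<^esub> h \<pi>"
            unfolding t(2) using tS c \<pi>R by (simp add: S.minus_eq S.a_assoc S.r_neg)
          also have "t \<otimes>\<^bsub>S\<^esub> h \<pi> \<otimes>\<^bsub>S\<^esub> h (inv\<^bsub>R\<^esub> \<pi>) = t \<otimes>\<^bsub>S\<^esub> h (\<pi> \<otimes>\<^bsub>R\<^esub> inv\<^bsub>R\<^esub> \<pi>)"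
            using tS \<pi>R inv(1) by (simp add: S.m_assoc)
          finally show ?thesis using inv(2) tS by simp
        qed
        then have "u \<in> A" using t(1) uR hA by auto
        ultimately show "\<exists>t\<in>A. a = t \<otimes>\<^bsub>R\<^esub> \<pi> \<oplus>\<^bsub>R\<^esub> b" by blast
      qed
    qed
    also have "\<dots> = p ^ d" using card unfolding carrier_Quot_PIdl F_def .
    finally show ?thesis .
  qed
  moreover have "[n] \<cdot>\<^bsub>S\<^esub> \<one>\<^bsub>S\<^esub> \<noteq> \<zero>\<^bsub>S\<^esub>" if "n > 0" for n :: nat
    using char[OF that] h0[of "[n] \<cdot>\<^bsub>R\<^esub> \<one>\<^bsub>R\<^esub>"] by (simp add: hnat)
  ultimately show ?thesis
    using pr vS hnat[of p] unfolding p_valued_def Let_def \<pi>_def by auto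
qed

context val_field
begin

definition residue_finite :: "'a \<Rightarrow> bool" where
  "residue_finite q \<longleftrightarrow> (\<exists>F. finite F \<and> F \<subseteq> A \<and> (\<forall>a\<in>A. \<exists>f\<in>F. q \<preceq> a \<ominus> f))"

definition uniformizer :: "'a \<Rightarrow> bool" where
  "uniformizer \<pi> \<longleftrightarrow> \<one> \<prec> \<pi> \<and> \<pi> \<noteq> \<zero> \<and> (\<forall>z. \<one> \<prec> z \<longrightarrow> \<pi> \<preceq> z)"

text \<open>An element not divisible by \<open>q\<close> has the same valuation as its
  representative modulo \<open>q\<close>, so a least positive valuation occurs among the finitely
  many representatives and \<open>q\<close>. The valuation of \<open>q\<close> is a multiple of it:
  if all powers of \<pi> stayed below \<open>q\<close>, two of them would fall into the same
  class.\<close>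

lemma uniformizer_exists:
  assumes "residue_finite q" "\<one> \<prec> q" "q \<noteq> \<zero>"
  obtains \<pi> e where "uniformizer \<pi>" "q \<approx> \<pi> [^] (e::nat)"
proof -
  obtain F where F: "finite F" "F \<subseteq> A" "\<And>a. a \<in> A \<Longrightarrow> \<exists>f\<in>F. q \<preceq> a \<ominus> f"
    using assms(1) by (auto simp: residue_finite_def)
  define F' where "F' = {f\<in>insert q F. \<one> \<prec> f}"
  have "finite F'" "F' \<noteq> {}" using F(1) assms(2) by (auto simp: F'_def)
  then obtain \<pi> where \<pi>: "\<pi> \<in> F'" "\<And>f. f \<in> F' \<Longrightarrow> \<pi> \<preceq> f"
    using finite_min[of F' "\<lambda>x. x"] by blast
  have min: "\<pi> \<preceq> z" if z: "\<one> \<prec> z" for z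
  proof (cases "q \<preceq> z")
    case True
    moreover have "\<pi> \<preceq> q" using \<pi>(2)[of q] assms(2) by (simp add: F'_def)
    ultimately show ?thesis using le_trans by blast
  next
    case False
    have "z \<in> A" using z lt_imp_le one_le_iff by blast
    then obtain f where f: "f \<in> F" "q \<preceq> z \<ominus> f" using F(3) by blast
    have "z \<prec> z \<ominus> f" using False f(2) lt_le_trans not_le by blast
    then have "z \<ominus> (z \<ominus> f) \<approx> z" by (rule eqv_diff)
    then have fz: "f \<approx> z" by (simp add: algebra_simps)
    then have "\<one> \<prec> f" using z by (meson eqv_sym lt_eqv_trans)
    then have "\<pi> \<preceq> f" using \<pi>(2) f(1) by (simp add: F'_def)
    then show ?thesis using fz le_eqv_trans by blast
  qed
  have \<pi>0: "\<pi> \<noteq> \<zero>" using min[OF assms(2)] assms(3) by auto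
  have \<pi>1: "\<one> \<prec> \<pi>" using \<pi>(1) by (simp add: F'_def)
  have ex: "\<exists>i. q \<preceq> \<pi> [^] (i::nat)"
  proof (rule ccontr)
    assume "\<not> ?thesis"
    then have n: "\<pi> [^] i \<prec> q" for i :: nat by (auto simp: not_le)
    have "\<pi> [^] i \<in> A" for i :: nat using pow_A[of \<pi> i] \<pi>1 lt_imp_le one_le_iff by blast
    then have "\<exists>f\<in>F. q \<preceq> \<pi> [^] i \<ominus> f" for i :: nat using F(3) by blast
    then obtain g where g: "\<And>i::nat. g i \<in> F" "\<And>i. q \<preceq> \<pi> [^] i \<ominus> g i" by metis
    have "\<not> inj g"
    proof
      assume "inj g"
      then have "infinite (range g)" by (simp add: finite_image_iff)
      moreover have "range g \<subseteq> F" using g(1) by auto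
      ultimately show False using F(1) finite_subset by blast
    qed
    then obtain i j where ij: "g i = g j" "i < j" by (metis injI linorder_neqE_nat)
    have lt: "\<pi> [^] i \<prec> \<pi> [^] j"
    proof -
      obtain k where k: "j = i + Suc k" using ij(2) less_iff_Suc_add by auto
      have "\<one> [^] (Suc k) \<prec> \<pi> [^] (Suc k)" using \<pi>1 by (intro pow_lt_mono) auto
      then have "\<pi> [^] i \<otimes> \<one> \<prec> \<pi> [^] i \<otimes> \<pi> [^] (Suc k)"
        unfolding lt_mult_cancel_left using \<pi>0 by simp
      then show ?thesis unfolding k pow_add by simp
    qed
    have "q \<preceq> (\<pi> [^] j \<ominus> g j) \<ominus> (\<pi> [^] i \<ominus> g i)" by (rule le_diff[OF g(2) g(2)])
    then have "q \<preceq> \<pi> [^] j \<ominus> \<pi> [^] i" using ij(1) by (simp add: algebra_simps)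
    also have "\<dots> \<approx> \<pi> [^] i" by (rule eqv_diff') (rule lt)
    finally show False using n lt_def by blast
  qed
  define e where "e = (LEAST i::nat. q \<preceq> \<pi> [^] i)"
  have e: "q \<preceq> \<pi> [^] e" "\<And>i. i < e \<Longrightarrow> \<not> q \<preceq> \<pi> [^] i"
    unfolding e_def using LeastI_ex[OF ex] not_less_Least by blast+
  have "e \<noteq> 0" using e(1) assms(2) by (cases "e = 0") (auto simp: lt_def)
  then obtain k where k: "e = Suc k" by (cases e) auto
  have "\<pi> [^] k \<prec> q" using e(2)[of k] k by (auto simp: not_le)
  then have "\<pi> [^] k \<otimes> \<one> \<prec> \<pi> [^] k \<otimes> (q \<oslash> \<pi> [^] k)" using \<pi>0 by simp
  then have "\<one> \<prec> q \<oslash> \<pi> [^] k" by (simp only: lt_mult_cancel_left)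
  then have "\<pi> \<preceq> q \<oslash> \<pi> [^] k" by (rule min)
  then have "\<pi> \<otimes> \<pi> [^] k \<preceq> (q \<oslash> \<pi> [^] k) \<otimes> \<pi> [^] k" by (intro le_mult) auto
  then have "\<pi> [^] e \<preceq> q" using \<pi>0 by (simp add: k F.mult.commute)
  then show ?thesis using that[of \<pi> e] e(1) \<pi>0 \<pi>1 min by (auto simp: uniformizer_def eqv_def)
qed

end

lemma p_valued_val_field:
  fixes R :: "'a ring" (structure)
  assumes "p_valued p d R A" "carrier R = UNIV"
  defines "\<pi> \<equiv> [p] \<cdot>\<^bsub>R\<^esub> \<one>\<^bsub>R\<^esub>"
  shows "val_field R A" "val_field.residue_finite R A \<pi>" "val_field.lt R A \<one>\<^bsub>R\<^esub> \<pi>"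
    "\<And>n::nat. n > 0 \<Longrightarrow> [n] \<cdot>\<^bsub>R\<^esub> \<one>\<^bsub>R\<^esub> \<noteq> \<zero>\<^bsub>R\<^esub>" "Factorial_Ring.prime p"
proof -
  have v: "valuation_ring R A" using assms by (auto simp: p_valued_def)
  then have f: "field R" by (simp add: valuation_ring_def)
  interpret val_field R A
    by (intro val_field.intro f val_field_axioms.intro) (use v assms in \<open>auto simp: valuation_ring_def\<close>)
  show "val_field R A" by (rule val_field_axioms)
  show char: "[n] \<cdot>\<^bsub>R\<^esub> \<one>\<^bsub>R\<^esub> \<noteq> \<zero>\<^bsub>R\<^esub>" if "n > 0" for n :: nat
    using assms that by (auto simp: p_valued_def)
  show pr: "Factorial_Ring.prime p" using assms by (auto simp: p_valued_def)
  have \<pi>A: "[n] \<cdot>\<^bsub>R\<^esub> \<one>\<^bsub>R\<^esub> \<in> A" for n :: nat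
    by (induction n) (auto simp: add_A)
  have \<pi>0: "\<pi> \<noteq> \<zero>" using char[of p] pr by (auto simp: \<pi>_def prime_gt_0_nat)
  have nu: "\<pi> \<notin> Units (R\<lparr>carrier := A\<rparr>)"
    and card: "card (carrier (R\<lparr>carrier := A\<rparr> Quot (PIdl\<^bsub>R\<lparr>carrier := A\<rparr>\<^esub> \<pi>))) = p ^ d"
    using assms by (auto simp: p_valued_def Let_def)
  show "\<one> \<prec> \<pi>"
  proof (rule ccontr)
    assume "\<not> \<one> \<prec> \<pi>"
    then have "\<pi> \<preceq> \<one>" by (simp add: lt_def)
    then obtain c where "c \<in> A" "\<one> = c \<otimes> \<pi>" by (rule leE)
    then have "\<pi> \<in> Units (R\<lparr>carrier := A\<rparr>)"
      using \<pi>A[of p] by (auto simp: Units_def \<pi>_def F.mult.commute intro!: bexI[of _ c])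
    then show False using nu by blast
  qed
  define F where "F a = {t \<otimes> \<pi> \<oplus> a | t. t \<in> A}" for a
  have "card (F ` A) = p ^ d" using card unfolding carrier_Quot_PIdl F_def .
  moreover have "p ^ d > 0" using pr by (simp add: prime_gt_0_nat)
  ultimately have "finite (F ` A)" by (metis card.infinite less_numeral_extra(3))
  then obtain F0 where F0: "finite F0" "F0 \<subseteq> A" "F ` A = F ` F0" using finite_subset_image[of "F ` A" F A] by auto
  have "\<exists>f\<in>F0. \<pi> \<preceq> a \<ominus> f" if "a \<in> A" for a
  proof -
    have "F a \<in> F ` F0" using that unfolding F0(3)[symmetric] by (rule imageI)
    then obtain f where f: "f \<in> F0" "F a = F f" by (rule imageE)
    have "a \<in> F a" by (auto simp: F_def intro!: exI[of _ \<zero>])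
    then have "a \<in> F f" by (simp only: f(2))
    then obtain t where "t \<in> A" "a = t \<otimes> \<pi> \<oplus> f" by (auto simp: F_def)
    then show ?thesis using f(1) by (intro bexI[of _ f]) (auto intro!: leI[of t])
  qed
  then show "residue_finite \<pi>" using F0 by (auto simp: residue_finite_def)
qed

section \<open>Nests of balls with empty intersection\<close>

text \<open>The definition of p-adically closed tests extension fields carried by the type
  \<open>'a\<close>. The field built below consists of classes of polynomials of bounded degree, so
  it is enough to code lists of bounded length by elements of \<open>'a\<close>.\<close>

lemma inj_on_lists:
  assumes "infinite (UNIV :: 'a set)"
  shows "\<exists>f :: 'a list \<Rightarrow> 'a. inj_on f {xs. length xs \<le> n}"
proof -
  obtain p :: "'a \<times> 'a \<Rightarrow> 'a" where "bij_betw p (UNIV \<times> UNIV) UNIV"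
    using card_of_Times_same_infinite[OF assms, folded card_of_ordIso] by blast
  then have p: "inj p" by (simp add: bij_betw_def)
  obtain a b :: 'a where ab: "a \<noteq> b"
    using assms by (metis (full_types) UNIV_I finite.emptyI finite.insertI finite_subset insertI1 singletonI subsetI)
  show ?thesis
  proof (induction n)
    case (Suc n)
    then obtain f :: "'a list \<Rightarrow> 'a" where f: "inj_on f {xs. length xs \<le> n}" by blast
    define g where "g xs = (case xs of [] \<Rightarrow> p (a, a) | x # ys \<Rightarrow> p (b, p (x, f ys)))" for xs
    have "inj_on g {xs. length xs \<le> Suc n}"
      using ab f by (auto simp: inj_on_def g_def inj_eq[OF p] split: list.splits)
    then show ?case by blast
  qed auto
qed

context val_field
begin

section \<open>Functions with constant leading part on a ball\<close>

lemma stable_on_subset: "stable_on C f \<Longrightarrow> D \<subseteq> C \<Longrightarrow> stable_on D f"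
  by (auto simp: stable_on_def)

lemma stable_on_eqv: assumes "stable_on C f" "x \<in> C" "y \<in> C" shows "f x \<approx> f y"
proof -
  have "f x \<prec> f y \<ominus> f x" using assms by (auto simp: stable_on_def)
  from eqv_add[OF this] have "f y \<approx> f x" by (simp add: algebra_simps)
  then show ?thesis by (rule eqv_sym)
qed

lemma diff_add_diff: "(a \<ominus> b) \<oplus> (b \<ominus> c) = a \<ominus> c"
  by (simp add: algebra_simps)

lemma stable_on_mult: assumes "stable_on C f" "stable_on C g" shows "stable_on C (\<lambda>x. f x \<otimes> g x)"
  unfolding stable_on_def
proof (intro ballI)
  fix x y assume xy: "x \<in> C" "y \<in> C"
  have f: "f x \<prec> f y \<ominus> f x" and g: "g x \<prec> g y \<ominus> g x" using assms xy by (auto simp: stable_on_def)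
  have gy: "g x \<preceq> g y" using stable_on_eqv[OF assms(2)] xy by (simp add: eqv_def)
  have "f x \<otimes> g x \<prec> (f y \<ominus> f x) \<otimes> g y \<oplus> f x \<otimes> (g y \<ominus> g x)"
    using f g gy lt_nonzero[OF f] lt_nonzero[OF g] by (intro lt_add lt_mult_le le_mult_lt) auto
  then show "f x \<otimes> g x \<prec> f y \<otimes> g y \<ominus> f x \<otimes> g x"
    by (simp add: F.left_diff_distrib F.right_diff_distrib diff_add_diff)
qed

lemma stable_on_cancel: assumes "stable_on C (\<lambda>x. f x \<otimes> g x)" "stable_on C g" shows "stable_on C f"
  unfolding stable_on_def
proof (intro ballI)
  fix x y assume xy: "x \<in> C" "y \<in> C"
  have fg: "f x \<otimes> g x \<prec> f y \<otimes> g y \<ominus> f x \<otimes> g x" and g: "g x \<prec> g y \<ominus> g x"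
    using assms xy by (auto simp: stable_on_def)
  have gy: "g y \<preceq> g x" using stable_on_eqv[OF assms(2)] xy by (simp add: eqv_def)
  have f0: "f x \<noteq> \<zero>" using lt_nonzero[OF fg] by auto
  have "f x \<otimes> g x \<prec> (f y \<otimes> g y \<ominus> f x \<otimes> g x) \<ominus> f x \<otimes> (g y \<ominus> g x)"
    using fg by (rule lt_diff) (use g f0 in simp)
  also have "(f y \<otimes> g y \<ominus> f x \<otimes> g x) \<ominus> f x \<otimes> (g y \<ominus> g x) = (f y \<ominus> f x) \<otimes> g y"
    by (simp add: algebra_simps)
  also have "\<dots> \<preceq> (f y \<ominus> f x) \<otimes> g x" using gy by (intro le_mult) auto
  finally show "f x \<prec> f y \<ominus> f x" by simp
qed

text \<open>If nothing cancelled at the point \<open>x\<close>, then on all of \<open>C\<close> the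
  difference would vary by less than its own size at \<open>x\<close>, and would be stable. So there
  is cancellation, which needs equal valuations.\<close>

lemma stable_on_diff:
  assumes "stable_on C f" "stable_on C g" "\<not> stable_on C (\<lambda>x. f x \<ominus> g x)" "x \<in> C"
  shows "f x \<approx> g x"
proof -
  have "\<not> (f x \<ominus> g x \<preceq> f x \<and> f x \<ominus> g x \<preceq> g x)"
  proof
    assume d: "f x \<ominus> g x \<preceq> f x \<and> f x \<ominus> g x \<preceq> g x"
    define e where "e = f x \<ominus> g x"
    have *: "e \<prec> (f y \<ominus> g y) \<ominus> e" if "y \<in> C" for y
    proof -
      have "f x \<prec> f y \<ominus> f x" "g x \<prec> g y \<ominus> g x" using assms that by (auto simp: stable_on_def)
      then have "e \<prec> f y \<ominus> f x" "e \<prec> g y \<ominus> g x" using d le_lt_trans unfolding e_def by blast+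
      then have "e \<prec> (f y \<ominus> f x) \<ominus> (g y \<ominus> g x)" by (rule lt_diff)
      then show ?thesis by (simp add: e_def algebra_simps)
    qed
    have eq: "f y \<ominus> g y \<approx> e" if "y \<in> C" for y
      using eqv_add[OF *[OF that]] by (simp add: algebra_simps)
    have "stable_on C (\<lambda>x. f x \<ominus> g x)"
      unfolding stable_on_def
    proof (intro ballI)
      fix y z assume yz: "y \<in> C" "z \<in> C"
      have "f y \<ominus> g y \<approx> e" by (rule eq) fact
      also have "e \<prec> ((f z \<ominus> g z) \<ominus> e) \<ominus> ((f y \<ominus> g y) \<ominus> e)" by (intro lt_diff[OF * *] yz)
      finally show "f y \<ominus> g y \<prec> f z \<ominus> g z \<ominus> (f y \<ominus> g y)" by (simp add: algebra_simps)
    qed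
    then show False using assms(3) by blast
  qed
  then have "f x \<prec> f x \<ominus> g x \<or> g x \<prec> f x \<ominus> g x" by (auto simp: lt_def)
  then show ?thesis
  proof
    assume "f x \<prec> f x \<ominus> g x"
    from eqv_diff[OF this] show ?thesis by (simp add: eqv_sym algebra_simps)
  next
    assume "g x \<prec> f x \<ominus> g x"
    from eqv_add[OF this] show ?thesis by (simp add: algebra_simps)
  qed
qed

lemma stable_on_const: "c \<noteq> \<zero> \<Longrightarrow> stable_on C (\<lambda>x. c)"
  by (auto simp: stable_on_def)

lemma nest_Int: assumes "nest \<N>" "C \<in> \<N>" "D \<in> \<N>" obtains E where "E \<in> \<N>" "E \<subseteq> C" "E \<subseteq> D"
proof -
  have "C \<subseteq> D \<or> D \<subseteq> C" using assms unfolding nest_def by auto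
  then show ?thesis
  proof
    assume "C \<subseteq> D" then show ?thesis using that[OF assms(2)] by simp
  next
    assume "D \<subseteq> C" then show ?thesis using that[OF assms(3)] by simp
  qed
qed

lemma nest_nonempty: "nest \<N> \<Longrightarrow> C \<in> \<N> \<Longrightarrow> C \<noteq> {}"
  by (auto simp: nest_def ball_def)

text \<open>The zero of the linear polynomial lies outside some ball of the nest, since the
  intersection is empty; seen from the zero, the points of this ball differ little.\<close>

lemma nest_linear_stable:
  assumes "nest \<N>" "a \<noteq> \<zero>" shows "\<exists>C\<in>\<N>. stable_on C (\<lambda>x. a \<otimes> x \<oplus> b)"
proof -
  obtain z where "z = \<ominus> (b \<oslash> a)" by blast
  then have az: "a \<otimes> z = \<ominus> b" using assms(2) by simp
  have z: "a \<otimes> x \<oplus> b = a \<otimes> (x \<ominus> z)" for x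
    unfolding F.right_diff_distrib az by simp
  have "z \<notin> \<Inter>\<N>" using assms(1) by (simp add: nest_def)
  then obtain C where C: "C \<in> \<N>" "z \<notin> C" by blast
  have "ball C" using assms(1) C(1) by (simp add: nest_def)
  then have ballC: "\<And>x y. x \<in> C \<Longrightarrow> y \<in> C \<Longrightarrow> y \<ominus> x \<preceq> z \<ominus> x \<Longrightarrow> z \<in> C" unfolding ball_def by meson
  have "x \<ominus> z \<prec> (y \<ominus> z) \<ominus> (x \<ominus> z)" if xy: "x \<in> C" "y \<in> C" for x y
  proof -
    have "z \<ominus> x \<prec> y \<ominus> x" using ballC[OF xy] C(2) unfolding lt_def by blast
    then have "x \<ominus> z \<prec> y \<ominus> x" by (simp only: lt_diff_commute(2))
    moreover have "(y \<ominus> z) \<ominus> (x \<ominus> z) = y \<ominus> x" by (simp add: algebra_simps)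
    ultimately show ?thesis by simp
  qed
  then have "stable_on C (\<lambda>x. x \<ominus> z)" by (simp add: stable_on_def)
  from stable_on_mult[OF stable_on_const[OF assms(2)] this]
  have "stable_on C (\<lambda>x. a \<otimes> x \<oplus> b)" unfolding z .
  then show ?thesis using C(1) by blast
qed

lemma eval_rev: "eval (rev p) x = ev p x"
  by (induction p) (auto simp: eval_append_aux F.mult.commute)

end

text \<open>A counterexample to algebraic maximality, with \<open>q\<close> of least degree among
  the polynomials that do not stabilize. Those of smaller degree do, and so have an eventual
  valuation along the nest. This is the setting of Kaplansky's construction of an immediate
  algebraic extension.\<close>

locale bad_nest = val_field +
  fixes \<N> q
  assumes nest: "nest \<N>" and q: "q \<in> carrier (poly_ring R)" "q \<noteq> []"
    and unstable: "\<And>C. C \<in> \<N> \<Longrightarrow> \<not> stable_on C (eval q)"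
    and minimal: "\<And>g. g \<in> carrier (poly_ring R) \<Longrightarrow> g \<noteq> [] \<Longrightarrow> length g < length q \<Longrightarrow>
      \<exists>C\<in>\<N>. stable_on C (eval g)"
begin

declare UNIV [simp del]

lemma in_carrier [simp]: "x \<in> carrier R" "B \<subseteq> carrier R"
  by (auto simp: UNIV)

abbreviation "PR \<equiv> poly_ring R"

sublocale UP: domain PR
  by (rule univ_poly_is_domain[OF carrier_is_subring])

lemma sf: "subfield (carrier R) R" by (rule carrier_is_subfield)
lemma sr: "subring (carrier R) R" by (rule carrier_is_subring)

lemma poly_in: "p \<in> carrier PR \<longleftrightarrow> p = [] \<or> hd p \<noteq> \<zero>"
  by (auto simp: polynomial_def simp flip: univ_poly_carrier)

lemma eval_mult: "g \<in> carrier PR \<Longrightarrow> h \<in> carrier PR \<Longrightarrow> eval (g \<otimes>\<^bsub>PR\<^esub> h) x = eval g x \<otimes> eval h x"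
  and eval_add: "g \<in> carrier PR \<Longrightarrow> h \<in> carrier PR \<Longrightarrow> eval (g \<oplus>\<^bsub>PR\<^esub> h) x = eval g x \<oplus> eval h x"
  using eval_is_hom[OF sr, of x] by (auto simp: ring_hom_def)

lemma eval_neg: "g \<in> carrier PR \<Longrightarrow> eval (\<ominus>\<^bsub>PR\<^esub> g) x = \<ominus> eval g x"
  using ring_hom_cring.hom_a_inv[OF eval_cring_hom[OF sr, of x], of g] by simp

lemma PR_zero: "\<zero>\<^bsub>PR\<^esub> = []" by (simp add: univ_poly_zero)

lemma mult_nonzero: "g \<in> carrier PR \<Longrightarrow> h \<in> carrier PR \<Longrightarrow> g \<noteq> [] \<Longrightarrow> h \<noteq> [] \<Longrightarrow> g \<otimes>\<^bsub>PR\<^esub> h \<noteq> []"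
  using UP.integral_iff PR_zero by simp

lemma degree_mult: "g \<in> carrier PR \<Longrightarrow> h \<in> carrier PR \<Longrightarrow> g \<noteq> [] \<Longrightarrow> h \<noteq> [] \<Longrightarrow>
    degree (g \<otimes>\<^bsub>PR\<^esub> h) = degree g + degree h"
  using poly_mult_degree_eq[OF sr] by (simp add: univ_poly_mult univ_poly_carrier)

lemma const_stable: "c \<noteq> \<zero> \<Longrightarrow> stable_on C (eval [c])"
  by (auto simp: stable_on_def)

lemma degree_q: "degree q \<ge> 2"
proof (rule ccontr)
  assume "\<not> ?thesis"
  then have "length q \<le> 2" by simp
  then consider a where "q = [a]" | a b where "q = [a, b]" using q(2)
    by (auto simp: numeral_2_eq_2 le_Suc_eq length_Suc_conv)
  then show False
  proof cases
    case 1
    then have "a \<noteq> \<zero>" using q by (simp add: poly_in)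
    moreover obtain C where "C \<in> \<N>" using nest by (auto simp: nest_def)
    ultimately show ?thesis using unstable const_stable 1 by blast
  next
    case 2
    then have "a \<noteq> \<zero>" using q by (simp add: poly_in)
    moreover have "eval q = (\<lambda>x. a \<otimes> x \<oplus> b)" using 2 by auto
    ultimately show ?thesis using nest_linear_stable[OF nest, of a b] unstable by auto
  qed
qed

definition G where "G = {g \<in> carrier PR. length g \<le> degree q}"

lemma G_carrier: "g \<in> G \<Longrightarrow> g \<in> carrier PR" by (simp add: G_def)

lemma G_stable: "g \<in> G \<Longrightarrow> g \<noteq> [] \<Longrightarrow> \<exists>C\<in>\<N>. stable_on C (eval g)"
  using minimal degree_q by (auto simp: G_def)

lemma nest_eventually2:
  assumes "\<exists>C\<in>\<N>. stable_on C f" "\<exists>C\<in>\<N>. stable_on C g"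
  obtains C where "C \<in> \<N>" "stable_on C f" "stable_on C g"
proof -
  obtain C D where C: "C \<in> \<N>" "stable_on C f" and D: "D \<in> \<N>" "stable_on D g" using assms by auto
  obtain E where E: "E \<in> \<N>" "E \<subseteq> C" "E \<subseteq> D" using nest_Int[OF nest C(1) D(1)] .
  show ?thesis by (rule that[OF E(1) stable_on_subset[OF C(2) E(2)] stable_on_subset[OF D(2) E(3)]])
qed

lemma stable_mult: assumes "\<exists>C\<in>\<N>. stable_on C (eval g)" "\<exists>C\<in>\<N>. stable_on C (eval h)"
    "g \<in> carrier PR" "h \<in> carrier PR"
  shows "\<exists>C\<in>\<N>. stable_on C (eval (g \<otimes>\<^bsub>PR\<^esub> h))"
proof -
  obtain C where "C \<in> \<N>" "stable_on C (eval g)" "stable_on C (eval h)"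
    using assms(1,2) by (rule nest_eventually2)
  then have "stable_on C (\<lambda>x. eval g x \<otimes> eval h x)" using stable_on_mult by blast
  moreover have "eval (g \<otimes>\<^bsub>PR\<^esub> h) = (\<lambda>x. eval g x \<otimes> eval h x)" using assms by (auto simp: eval_mult)
  ultimately show ?thesis using \<open>C \<in> \<N>\<close> by auto
qed

text \<open>Write g h = q s + r. If \<open>s\<close> is nonzero, it has small degree and stabilizes,
  so q s cannot, as otherwise \<open>q\<close> would. Since g h and \<open>r\<close> stabilize while
  their difference q s does not, both have the same eventual valuation. This is the multiplicativity
  of the valuation of the extension.\<close>

lemma pmod_mult:
  assumes g: "g \<in> G" "g \<noteq> []" and h: "h \<in> G" "h \<noteq> []"
  defines "r \<equiv> (g \<otimes>\<^bsub>PR\<^esub> h) pmod q"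
  shows "r \<in> G" "r \<noteq> []"
    "\<exists>C\<in>\<N>. stable_on C (eval g) \<and> stable_on C (eval h) \<and> stable_on C (eval r) \<and>
      (\<forall>x\<in>C. eval r x \<approx> eval g x \<otimes> eval h x)"
proof -
  note c = G_carrier[OF g(1)] G_carrier[OF h(1)]
  define s where "s = (g \<otimes>\<^bsub>PR\<^esub> h) pdiv q"
  have ghc: "g \<otimes>\<^bsub>PR\<^esub> h \<in> carrier PR" using c by simp
  have sc: "s \<in> carrier PR" and rc: "r \<in> carrier PR"
    unfolding s_def r_def using long_division_closed[OF sf ghc q(1)] by auto
  have eq: "g \<otimes>\<^bsub>PR\<^esub> h = (q \<otimes>\<^bsub>PR\<^esub> s) \<oplus>\<^bsub>PR\<^esub> r"
    unfolding s_def r_def by (rule pdiv_pmod[OF sf ghc q(1)])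
  have "r = [] \<or> degree r < degree q" unfolding r_def by (rule pmod_degree[OF sf ghc q(1) q(2)])
  then have "length r \<le> degree q" by auto
  then show rG: "r \<in> G" using rc by (simp add: G_def)
  have ghx: "eval g x \<otimes> eval h x = eval q x \<otimes> eval s x \<oplus> eval r x" for x
    using arg_cong[OF eq, of "\<lambda>p. eval p x"] c sc rc q by (simp add: eval_mult eval_add)
  obtain C0 where C0: "C0 \<in> \<N>" "stable_on C0 (eval g)" "stable_on C0 (eval h)"
    using G_stable[OF g] G_stable[OF h] by (rule nest_eventually2)
  have st: "stable_on C (\<lambda>x. eval g x \<otimes> eval h x)" if "C \<subseteq> C0" for C
    using stable_on_subset[OF stable_on_mult[OF C0(2,3)] that] .
  show "r \<noteq> []" "\<exists>C\<in>\<N>. stable_on C (eval g) \<and> stable_on C (eval h) \<and> stable_on C (eval r) \<and>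
      (\<forall>x\<in>C. eval r x \<approx> eval g x \<otimes> eval h x)"
  proof (atomize (full), cases "s = []")
    case True
    then have "eval r = (\<lambda>x. eval g x \<otimes> eval h x)" using ghx by auto
    moreover have "r \<noteq> []"
    proof
      assume "r = []"
      then have "g \<otimes>\<^bsub>PR\<^esub> h = \<zero>\<^bsub>PR\<^esub>"
        unfolding eq True PR_zero[symmetric] using q(1) by (simp add: UP.r_null)
      then have "g \<otimes>\<^bsub>PR\<^esub> h = []" by (simp add: PR_zero)
      then show False using mult_nonzero c g h by blast
    qed
    ultimately show "r \<noteq> [] \<and> (\<exists>C\<in>\<N>. stable_on C (eval g) \<and> stable_on C (eval h) \<and> stable_on C (eval r) \<and>
      (\<forall>x\<in>C. eval r x \<approx> eval g x \<otimes> eval h x))" using C0 st[of C0] by auto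
  next
    case False
    \<comment> \<open>Degree count: the degree of q s is at most 2 deg q - 2, hence deg s < deg q
      and \<open>s\<close> is again a reduced polynomial.\<close>
    have qs: "q \<otimes>\<^bsub>PR\<^esub> s = g \<otimes>\<^bsub>PR\<^esub> h \<oplus>\<^bsub>PR\<^esub> (\<ominus>\<^bsub>PR\<^esub> r)"
      unfolding eq using q sc rc by (simp add: UP.a_assoc UP.r_neg)
    have "degree (q \<otimes>\<^bsub>PR\<^esub> s) \<le> max (degree (g \<otimes>\<^bsub>PR\<^esub> h)) (degree (\<ominus>\<^bsub>PR\<^esub> r))"
      unfolding qs univ_poly_add by (rule poly_add_degree)
    also have "degree (\<ominus>\<^bsub>PR\<^esub> r) = degree r" by (rule univ_poly_a_inv_degree[OF sr rc])
    finally have "degree q + degree s \<le> max (degree g + degree h) (degree r)"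
      using degree_mult[OF q(1) sc q(2) False] degree_mult[OF c g(2) h(2)] by simp
    moreover have "length g \<le> degree q" "length h \<le> degree q" "length r \<le> degree q" "length g > 0" "length h > 0"
      using g h rG by (auto simp: G_def)
    ultimately have "degree s + 1 \<le> degree q - 1" using degree_q by linarith
    then have "s \<in> G" using sc by (simp add: G_def)
    then obtain C1 where C1: "C1 \<in> \<N>" "stable_on C1 (eval s)" using G_stable False by blast
    obtain C2 where C2: "C2 \<in> \<N>" "C2 \<subseteq> C0" "C2 \<subseteq> C1" using nest_Int[OF nest C0(1) C1(1)] .
    have nqs: "\<not> stable_on C (\<lambda>x. eval q x \<otimes> eval s x)" if "C \<in> \<N>" "C \<subseteq> C1" for C
      using stable_on_cancel[of C "eval q" "eval s"] stable_on_subset[OF C1(2)] that unstable by blast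
    have r0: "r \<noteq> []"
    proof
      assume "r = []"
      then have "(\<lambda>x. eval q x \<otimes> eval s x) = (\<lambda>x. eval g x \<otimes> eval h x)" using ghx by auto
      then show False using nqs[OF C2(1,3)] st[OF C2(2)] by simp
    qed
    obtain C3 where C3: "C3 \<in> \<N>" "stable_on C3 (eval r)" using G_stable[OF rG r0] by blast
    obtain C where C: "C \<in> \<N>" "C \<subseteq> C2" "C \<subseteq> C3" using nest_Int[OF nest C2(1) C3(1)] .
    have "eval g x \<otimes> eval h x \<approx> eval r x" if "x \<in> C" for x
    proof (rule stable_on_diff[of C "\<lambda>x. eval g x \<otimes> eval h x" "eval r" x])
      show "\<not> stable_on C (\<lambda>x. eval g x \<otimes> eval h x \<ominus> eval r x)"
        using nqs[OF C(1)] C C2 by (auto simp: ghx)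
    qed (use st C C2 that stable_on_subset[OF C3(2)] in auto)
    then have "\<forall>x\<in>C. eval r x \<approx> eval g x \<otimes> eval h x" by (auto intro: eqv_sym)
    moreover have "stable_on C (eval g)" "stable_on C (eval h)" "stable_on C (eval r)"
      using C C2 by (auto intro: stable_on_subset[OF C0(2)] stable_on_subset[OF C0(3)] stable_on_subset[OF C3(2)])
    ultimately show "r \<noteq> [] \<and> (\<exists>C\<in>\<N>. stable_on C (eval g) \<and> stable_on C (eval h) \<and> stable_on C (eval r) \<and>
      (\<forall>x\<in>C. eval r x \<approx> eval g x \<otimes> eval h x))"
      using r0 C(1) by auto
  qed
qed

text \<open>A proper factorization would have stabilizing factors and hence a stabilizing product.
  Irreducibility makes the residue ring modulo \<open>q\<close> a field.\<close>

lemma q_irreducible: "pirreducible (carrier R) q"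
proof (rule pirreducibleI[OF sr q])
  have units: "Units PR = {[k] | k. k \<noteq> \<zero>}" using univ_poly_carrier_units by auto
  show "q \<notin> Units PR" using degree_q by (auto simp: units)
  fix g h assume gh: "g \<in> carrier PR" "h \<in> carrier PR" "q = g \<otimes>\<^bsub>PR\<^esub> h"
  show "g \<in> Units PR \<or> h \<in> Units PR"
  proof (rule ccontr)
    assume n: "\<not> ?thesis"
    have 0: "g \<noteq> []" "h \<noteq> []"
      using gh(3) q(2) UP.l_null[OF gh(2)] UP.r_null[OF gh(1)] by (auto simp: PR_zero)
    have "degree g \<noteq> 0"
    proof
      assume "degree g = 0"
      then obtain k where "g = [k]" using 0(1) by (cases g) auto
      then show False using n gh(1) by (auto simp: units poly_in)
    qed
    moreover have "degree h \<noteq> 0"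
    proof
      assume "degree h = 0"
      then obtain k where "h = [k]" using 0(2) by (cases h) auto
      then show False using n gh(2) by (auto simp: units poly_in)
    qed
    moreover have "degree q = degree g + degree h" using degree_mult gh 0 by simp
    ultimately have "length g < length q" "length h < length q" using 0 by auto
    then have "\<exists>C\<in>\<N>. stable_on C (eval (g \<otimes>\<^bsub>PR\<^esub> h))" using stable_mult minimal gh 0 by blast
    then show False using unstable gh(3) by blast
  qed
qed

end

section \<open>p-adically closed fields are algebraically maximal\<close>

locale bad_nest_emb = bad_nest +
  fixes \<iota> :: "'a list set \<Rightarrow> 'a"
  assumes inj_\<iota>: "inj_on \<iota> (carrier (Rupt (carrier R) q))"
begin

declare UNIV [simp del]

definition E :: "'a list \<Rightarrow> 'a" where
  "E g = \<iota> (rupture_surj (carrier R) q g)"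

definition S :: "'a ring" where
  "S = image_ring \<iota> (Rupt (carrier R) q)"

definition h :: "'a \<Rightarrow> 'a" where
  "h a = E (poly_of_const a)"

text \<open>The valuation of the class of g is the eventual valuation of g(x) along the nest, and
  \<open>A'\<close> collects the classes for which it is nonnegative. Representatives are reduced,
  because polynomials of degree less than that of \<open>q\<close> are the ones known to
  stabilize.\<close>

definition A' :: "'a set" where
  "A' = {E g | g. g \<in> G \<and> (\<exists>C\<in>\<N>. \<forall>x\<in>C. eval g x \<in> A)}"

lemma field_Rupt: "field (Rupt (carrier R) q)"
  using rupture_is_field_iff_pirreducible[OF sf q(1)] q_irreducible by simp

lemma field_S: "field S"
  unfolding S_def by (rule field.inj_imp_image_ring_is_field[OF field_Rupt inj_\<iota>])

sublocale S: field S by (rule field_S)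

lemma E_hom: "E \<in> ring_hom PR S"
proof -
  have "\<iota> \<in> ring_hom (Rupt (carrier R) q) S"
    using inj_imp_image_ring_iso[OF inj_\<iota>] unfolding S_def ring_iso_def by blast
  from ring_hom_trans[OF rupture_surj_hom(1)[OF sr q(1)] this]
  show ?thesis by (simp add: E_def[abs_def] comp_def)
qed

sublocale E: ring_hom_ring PR S E
  by (rule ring_hom_ringI2[OF UP.ring_axioms S.ring_axioms E_hom])

lemma carrier_S: "carrier S = E ` G"
proof -
  have "carrier S = \<iota> ` rupture_surj (carrier R) q ` (\<lambda>p. p pmod q) ` carrier PR"
    unfolding S_def image_ring_carrier rupture_carrier_as_pmod_image[OF sf q(1)] ..
  then show ?thesis
    unfolding pmod_image_characterization[OF sf q] by (auto simp: G_def E_def)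
qed

lemma inj_E: "inj_on E G"
proof -
  have 1: "inj_on (rupture_surj (carrier R) q) G"
    using rupture_surj_inj_on[OF sf q(1)] unfolding pmod_image_characterization[OF sf q] G_def .
  moreover have "rupture_surj (carrier R) q ` G \<subseteq> carrier (Rupt (carrier R) q)"
    using rupture_carrier_as_pmod_image[OF sf q(1)] unfolding pmod_image_characterization[OF sf q] G_def by simp
  ultimately have "inj_on (\<iota> \<circ> rupture_surj (carrier R) q) G"
    using inj_\<iota> by (meson comp_inj_on inj_on_subset)
  then show ?thesis by (simp add: E_def[abs_def] comp_def)
qed

lemma E_eq_iff: "g \<in> G \<Longrightarrow> g' \<in> G \<Longrightarrow> E g = E g' \<longleftrightarrow> g = g'"
  using inj_E by (auto simp: inj_on_def)

lemma E_pmod: "g \<in> carrier PR \<Longrightarrow> E (g pmod q) = E g"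
  using rupture_surj_composed_with_pmod[OF sf q(1)] by (simp add: E_def)

lemma nil_G [simp]: "[] \<in> G" by (simp add: G_def poly_in)

lemma E_nil [simp]: "E [] = \<zero>\<^bsub>S\<^esub>"
  using E.hom_zero by (simp add: PR_zero)

lemma const_G: "poly_of_const a \<in> G"
  using degree_q by (auto simp: G_def poly_in poly_of_const_def)

lemma eval_const: "eval (poly_of_const a) x = a"
  by (auto simp: poly_of_const_def)

lemma h_hom: "h \<in> ring_hom R S"
proof -
  have "poly_of_const \<in> ring_hom R PR" using canonical_embedding_is_hom[OF sr] by simp
  from ring_hom_trans[OF this E_hom] show ?thesis by (simp add: h_def[abs_def] comp_def)
qed

sublocale H: ring_hom_ring R S h
  by (rule ring_hom_ringI2[OF ring_axioms S.ring_axioms h_hom])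

section \<open>The valuation ring of the extension\<close>

lemma add_G: assumes "g \<in> G" "g' \<in> G" shows "g \<oplus>\<^bsub>PR\<^esub> g' \<in> G"
proof -
  have "length (g \<oplus>\<^bsub>PR\<^esub> g') \<le> max (length g) (length g')"
    unfolding univ_poly_add by (rule poly_add_length_le)
  then show ?thesis using assms by (auto simp: G_def)
qed

lemma neg_G: "g \<in> G \<Longrightarrow> \<ominus>\<^bsub>PR\<^esub> g \<in> G"
  using univ_poly_a_inv_length[OF sr, of g] by (simp add: G_def)

lemma A'I: "g \<in> G \<Longrightarrow> C \<in> \<N> \<Longrightarrow> (\<And>x. x \<in> C \<Longrightarrow> eval g x \<in> A) \<Longrightarrow> E g \<in> A'"
  by (auto simp: A'_def)

lemma A'E: assumes "s \<in> A'" obtains g C where "g \<in> G" "s = E g" "C \<in> \<N>" "\<forall>x\<in>C. eval g x \<in> A"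
  using assms by (auto simp: A'_def)

lemma nest_ex: "\<exists>C. C \<in> \<N>" using nest by (auto simp: nest_def)

lemma A'_mult: assumes "s \<in> A'" "t \<in> A'" shows "s \<otimes>\<^bsub>S\<^esub> t \<in> A'"
proof -
  obtain g C where g: "g \<in> G" "s = E g" "C \<in> \<N>" "\<forall>x\<in>C. eval g x \<in> A" using A'E[OF assms(1)] .
  obtain g' C' where g': "g' \<in> G" "t = E g'" "C' \<in> \<N>" "\<forall>x\<in>C'. eval g' x \<in> A" using A'E[OF assms(2)] .
  note c = G_carrier[OF g(1)] G_carrier[OF g'(1)]
  have E: "s \<otimes>\<^bsub>S\<^esub> t = E ((g \<otimes>\<^bsub>PR\<^esub> g') pmod q)" using c by (simp add: g g' E_pmod)
  show ?thesis
  proof (cases "g = [] \<or> g' = []")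
    case True
    then have "s = \<zero>\<^bsub>S\<^esub> \<or> t = \<zero>\<^bsub>S\<^esub>" using g g' by auto
    moreover have "s \<in> carrier S" "t \<in> carrier S" using g g' by (auto simp: carrier_S)
    ultimately have "s \<otimes>\<^bsub>S\<^esub> t = E []" by auto
    then show ?thesis using A'I[of "[]" C] g(3) by simp
  next
    case False
    obtain D where D: "D \<in> \<N>" "\<forall>x\<in>D. eval ((g \<otimes>\<^bsub>PR\<^esub> g') pmod q) x \<approx> eval g x \<otimes> eval g' x"
      and r: "(g \<otimes>\<^bsub>PR\<^esub> g') pmod q \<in> G"
      using pmod_mult[of g g'] g(1) g'(1) False by auto
    obtain D' where D': "D' \<in> \<N>" "D' \<subseteq> C" "D' \<subseteq> C'" using nest_Int[OF nest g(3) g'(3)] .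
    obtain D'' where D'': "D'' \<in> \<N>" "D'' \<subseteq> D" "D'' \<subseteq> D'" using nest_Int[OF nest D(1) D'(1)] .
    have "eval ((g \<otimes>\<^bsub>PR\<^esub> g') pmod q) x \<in> A" if x: "x \<in> D''" for x
    proof -
      have "eval g x \<otimes> eval g' x \<in> A" using g(4) g'(4) x D' D'' by (intro mult_A) auto
      moreover have "eval ((g \<otimes>\<^bsub>PR\<^esub> g') pmod q) x \<approx> eval g x \<otimes> eval g' x" using D(2) D''(2) x by auto
      ultimately show ?thesis unfolding one_le_iff[symmetric] eqv_def by (meson le_trans)
    qed
    then show ?thesis unfolding E by (rule A'I[OF r D''(1)])
  qed
qed

lemma A'_add: assumes "s \<in> A'" "t \<in> A'" shows "s \<oplus>\<^bsub>S\<^esub> t \<in> A'"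
proof -
  obtain g C where g: "g \<in> G" "s = E g" "C \<in> \<N>" "\<forall>x\<in>C. eval g x \<in> A" using A'E[OF assms(1)] .
  obtain g' C' where g': "g' \<in> G" "t = E g'" "C' \<in> \<N>" "\<forall>x\<in>C'. eval g' x \<in> A" using A'E[OF assms(2)] .
  note c = G_carrier[OF g(1)] G_carrier[OF g'(1)]
  obtain D where D: "D \<in> \<N>" "D \<subseteq> C" "D \<subseteq> C'" using nest_Int[OF nest g(3) g'(3)] .
  have "eval (g \<oplus>\<^bsub>PR\<^esub> g') x \<in> A" if "x \<in> D" for x
    unfolding eval_add[OF c] using g(4) g'(4) that D by (intro add_A) auto
  from A'I[OF add_G[OF g(1) g'(1)] D(1) this] show ?thesis using c by (simp add: g g')
qed

lemma A'_neg: assumes "s \<in> A'" shows "\<ominus>\<^bsub>S\<^esub> s \<in> A'"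
proof -
  obtain g C where g: "g \<in> G" "s = E g" "C \<in> \<N>" "\<forall>x\<in>C. eval g x \<in> A" using A'E[OF assms(1)] .
  note c = G_carrier[OF g(1)]
  have "eval (\<ominus>\<^bsub>PR\<^esub> g) x \<in> A" if "x \<in> C" for x
    unfolding eval_neg[OF c] using g(4) that by (intro neg_A) auto
  from A'I[OF neg_G[OF g(1)] g(3) this] show ?thesis using c by (simp add: g)
qed

lemma h_A: "a \<in> A \<longleftrightarrow> h a \<in> A'"
proof
  assume "a \<in> A"
  then show "h a \<in> A'" using nest_ex A'I[OF const_G] by (auto simp: eval_const h_def)
next
  assume "h a \<in> A'"
  then obtain g C where g: "g \<in> G" "h a = E g" "C \<in> \<N>" "\<forall>x\<in>C. eval g x \<in> A" by (rule A'E)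
  then have "g = poly_of_const a" using const_G by (simp add: h_def E_eq_iff)
  moreover obtain x where "x \<in> C" using nest_nonempty[OF nest g(3)] by blast
  then have "eval g x \<in> A" using g(4) by blast
  ultimately show "a \<in> A" by (simp add: eval_const)
qed

lemma subring_A': "subring A' S"
proof (rule S.subringI)
  show "A' \<subseteq> carrier S" by (auto simp: A'_def carrier_S)
  show "\<one>\<^bsub>S\<^esub> \<in> A'" using h_A[of \<one>] H.hom_one by simp
qed (use A'_mult A'_add A'_neg in auto)

text \<open>Representatives of \<open>s\<close> and of its inverse have product congruent to one, so
  their eventual valuations are opposite. One of the two is integral at a chosen point and, being
  stable, on the whole ball.\<close>

lemma valuation_ring_A': "valuation_ring S A'"
  unfolding valuation_ring_def
proof (intro conjI ballI impI field_S subring_A')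
  fix s assume s: "s \<in> carrier S" "s \<noteq> \<zero>\<^bsub>S\<^esub>"
  define t where "t = inv\<^bsub>S\<^esub> s"
  have t: "t \<in> carrier S" "s \<otimes>\<^bsub>S\<^esub> t = \<one>\<^bsub>S\<^esub>" using s by (auto simp: t_def S.field_Units)
  obtain g where g: "g \<in> G" "s = E g" using s(1) by (auto simp: carrier_S)
  obtain g' where g': "g' \<in> G" "t = E g'" using t(1) by (auto simp: carrier_S)
  note c = G_carrier[OF g(1)] G_carrier[OF g'(1)]
  have g0: "g \<noteq> []" using s(2) g by auto
  have "t \<noteq> \<zero>\<^bsub>S\<^esub>" using t s(1) S.one_not_zero S.r_null by metis
  then have g'0: "g' \<noteq> []" using g' by auto
  define r where "r = (g \<otimes>\<^bsub>PR\<^esub> g') pmod q"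
  obtain C where C: "C \<in> \<N>" "stable_on C (eval g)" "\<forall>x\<in>C. eval r x \<approx> eval g x \<otimes> eval g' x"
    "stable_on C (eval g')" and r: "r \<in> G"
    using pmod_mult[OF g(1) g0 g'(1) g'0] unfolding r_def by auto
  have "E r = \<one>\<^bsub>S\<^esub>" using c t(2) by (simp add: r_def E_pmod g g')
  also have "\<one>\<^bsub>S\<^esub> = E (poly_of_const \<one>)" using H.hom_one by (simp add: h_def)
  finally have "r = poly_of_const \<one>" using r const_G by (simp add: E_eq_iff)
  then have 1: "\<one> \<approx> eval g x \<otimes> eval g' x" if "x \<in> C" for x using C(3) that by (simp add: eval_const)
  obtain x0 where x0: "x0 \<in> C" using nest_nonempty[OF nest C(1)] by blast
  show "s \<in> A' \<or> inv\<^bsub>S\<^esub> s \<in> A'"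
  proof (cases "eval g x0 \<in> A")
    case True
    have "eval g x \<in> A" if "x \<in> C" for x
      using True le_eqv_trans[OF _ stable_on_eqv[OF C(2) x0 that]] by (simp flip: one_le_iff)
    then show ?thesis using A'I[OF g(1) C(1)] g(2) by blast
  next
    case False
    then have "eval g x0 \<prec> \<one>" by (simp add: lt_def one_le_iff)
    have "\<one> \<preceq> eval g' x0"
    proof (rule ccontr)
      assume "\<not> ?thesis"
      then have *: "eval g' x0 \<prec> \<one>" by (simp add: lt_def)
      have "eval g x0 \<otimes> eval g' x0 \<prec> \<one> \<otimes> \<one>"
        using \<open>eval g x0 \<prec> \<one>\<close> * by (intro lt_mult_le lt_imp_le[OF *]) (auto dest: lt_nonzero)
      then show False using 1[OF x0] by (simp add: eqv_def lt_def)
    qed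
    then have *: "eval g' x \<in> A" if "x \<in> C" for x
      using le_eqv_trans[OF _ stable_on_eqv[OF C(4) x0 that]] by (simp flip: one_le_iff)
    have "E g' \<in> A'" by (rule A'I[OF g'(1) C(1) *])
    then show ?thesis using g'(2) t_def by simp
  qed
qed

text \<open>The extension is immediate: deep in the nest g(x) differs from the constant g(x0) by an
  element of valuation greater than v(g(x0)), hence positive, and so divisible by \<pi>.\<close>

lemma residue_step:
  assumes \<pi>: "uniformizer \<pi>" and s: "s \<in> A'"
  shows "\<exists>a\<in>A. \<exists>t\<in>A'. s = h a \<oplus>\<^bsub>S\<^esub> h \<pi> \<otimes>\<^bsub>S\<^esub> t"
proof -
  obtain g C where g: "g \<in> G" "s = E g" "C \<in> \<N>" "\<forall>x\<in>C. eval g x \<in> A" using A'E[OF s] .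
  note c = G_carrier[OF g(1)]
  have zA: "\<zero>\<^bsub>S\<^esub> \<in> A'" using h_A[of \<zero>] H.hom_zero by simp
  show ?thesis
  proof (cases "g = []")
    case True
    then show ?thesis using g(2) zA by (intro bexI[of _ \<zero>] bexI[of _ "\<zero>\<^bsub>S\<^esub>"]) auto
  next
    case False
    obtain D where D: "D \<in> \<N>" "stable_on D (eval g)" using G_stable[OF g(1) False] by blast
    obtain D' where D': "D' \<in> \<N>" "D' \<subseteq> C" "D' \<subseteq> D" using nest_Int[OF nest g(3) D(1)] .
    obtain x0 where x0: "x0 \<in> D'" using nest_nonempty[OF nest D'(1)] by blast
    define a where "a = eval g x0"
    have aA: "a \<in> A" using g(4) x0 D' by (auto simp: a_def)
    have \<pi>0: "\<pi> \<noteq> \<zero>" using \<pi> by (simp add: uniformizer_def)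
    define g1 where "g1 = g \<oplus>\<^bsub>PR\<^esub> \<ominus>\<^bsub>PR\<^esub> (poly_of_const a)"
    have g1: "g1 \<in> G" unfolding g1_def by (intro add_G neg_G const_G g)
    define t where "t = h (rinv \<pi>) \<otimes>\<^bsub>S\<^esub> E g1"
    have cc: "poly_of_const a \<in> carrier PR" "poly_of_const (rinv \<pi>) \<in> carrier PR" using const_G G_carrier by auto
    have "t \<in> A'"
    proof -
      define r where "r = (poly_of_const (rinv \<pi>) \<otimes>\<^bsub>PR\<^esub> g1) pmod q"
      have tr: "t = E r" using G_carrier[OF g1] cc by (simp add: t_def h_def r_def E_pmod)
      show ?thesis
      proof (cases "g1 = []")
        case True
        then have "t = \<zero>\<^bsub>S\<^esub>" by (simp add: t_def)
        then show ?thesis using zA by simp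
      next
        case g10: False
        have r0: "poly_of_const (rinv \<pi>) \<noteq> []" using \<pi>0 by (auto simp: poly_of_const_def rinv_def)
        obtain B where B: "B \<in> \<N>" "\<forall>x\<in>B. eval r x \<approx> eval (poly_of_const (rinv \<pi>)) x \<otimes> eval g1 x"
          and r: "r \<in> G"
          using pmod_mult[OF const_G r0 g1 g10] unfolding r_def by auto
        obtain B' where B': "B' \<in> \<N>" "B' \<subseteq> B" "B' \<subseteq> D'" using nest_Int[OF nest B(1) D'(1)] .
        have "eval r x \<in> A" if x: "x \<in> B'" for x
        proof -
          have "x \<in> D" "x0 \<in> D" using x B' D' x0 by auto
          then have "eval g x0 \<prec> eval g x \<ominus> eval g x0"
            using D(2) unfolding stable_on_def by blast
          moreover have "\<one> \<preceq> eval g x0" using aA by (simp add: a_def one_le_iff)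
          ultimately have "\<one> \<prec> eval g x \<ominus> a" unfolding a_def by (rule le_lt_trans[rotated])
          then have "\<pi> \<preceq> eval g x \<ominus> a" using \<pi> by (simp add: uniformizer_def)
          moreover have "eval g1 x = eval g x \<ominus> a"
            using c cc by (simp add: g1_def eval_add eval_neg eval_const)
          ultimately have "rinv \<pi> \<otimes> \<pi> \<preceq> rinv \<pi> \<otimes> eval g1 x" by simp
          moreover have "rinv \<pi> \<otimes> \<pi> = \<one>" using \<pi>0 by (simp add: rinv_def)
          ultimately have "\<one> \<preceq> rinv \<pi> \<otimes> eval g1 x" by simp
          moreover have "rinv \<pi> \<otimes> eval g1 x \<approx> eval r x"
            using B(2) B'(2) x by (auto simp: eval_const intro: eqv_sym)
          ultimately show ?thesis unfolding one_le_iff[symmetric] by (rule le_eqv_trans)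
        qed
        then show ?thesis unfolding tr by (rule A'I[OF r B'(1)])
      qed
    qed
    moreover have "s = h a \<oplus>\<^bsub>S\<^esub> h \<pi> \<otimes>\<^bsub>S\<^esub> t"
    proof -
      have "\<pi> \<otimes> rinv \<pi> = \<one>" using \<pi>0 by (simp add: rinv_def)
      then have "h \<pi> \<otimes>\<^bsub>S\<^esub> h (rinv \<pi>) = \<one>\<^bsub>S\<^esub>" by (simp flip: H.hom_mult)
      then have "h \<pi> \<otimes>\<^bsub>S\<^esub> t = E g1" using G_carrier[OF g1]
        by (simp add: t_def S.m_assoc[symmetric])
      also have "\<dots> = s \<ominus>\<^bsub>S\<^esub> h a" using c cc by (simp add: g1_def g(2) h_def S.minus_eq)
      finally have "h a \<oplus>\<^bsub>S\<^esub> h \<pi> \<otimes>\<^bsub>S\<^esub> t = h a \<oplus>\<^bsub>S\<^esub> (s \<ominus>\<^bsub>S\<^esub> h a)" by simp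
      also have "\<dots> = s" using c g(2) by (simp add: S.minus_eq S.a_lcomm S.r_neg)
      finally show ?thesis by simp
    qed
    ultimately show ?thesis using aA by blast
  qed
qed

text \<open>Iterating the expansion in powers of \<pi> reaches the modulus p, which is such a power
  up to a unit; the p-rank is defined modulo p.\<close>

lemma residue_pow:
  assumes \<pi>: "uniformizer \<pi>" and s: "s \<in> A'"
  shows "\<exists>a\<in>A. \<exists>t\<in>A'. s = h a \<oplus>\<^bsub>S\<^esub> h (\<pi> [^] (k::nat)) \<otimes>\<^bsub>S\<^esub> t"
proof (induction k)
  case 0
  have "s \<in> carrier S" using s by (auto simp: A'_def carrier_S)
  then show ?case using s by (intro bexI[of _ \<zero>] bexI[of _ s]) auto
next
  case (Suc k)
  then obtain a t where at: "a \<in> A" "t \<in> A'" "s = h a \<oplus>\<^bsub>S\<^esub> h (\<pi> [^] k) \<otimes>\<^bsub>S\<^esub> t" by blast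
  obtain b u where bu: "b \<in> A" "u \<in> A'" "t = h b \<oplus>\<^bsub>S\<^esub> h \<pi> \<otimes>\<^bsub>S\<^esub> u" using residue_step[OF \<pi> at(2)] by blast
  have u: "u \<in> carrier S" using bu by (auto simp: A'_def carrier_S)
  have "s = h (a \<oplus> \<pi> [^] k \<otimes> b) \<oplus>\<^bsub>S\<^esub> h (\<pi> [^] k \<otimes> \<pi>) \<otimes>\<^bsub>S\<^esub> u"
    using u unfolding at(3) bu(3) by (simp add: S.r_distr S.a_assoc S.m_assoc)
  moreover have "\<one> \<prec> \<pi>" using \<pi> by (simp add: uniformizer_def)
  then have "a \<oplus> \<pi> [^] k \<otimes> b \<in> A" using at bu lt_imp_le one_le_iff by (intro add_A mult_A pow_A) blast+
  moreover have "\<pi> [^] Suc k = \<pi> [^] k \<otimes> \<pi>" by (rule nat_pow_Suc)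
  ultimately show ?case using bu(2) by metis
qed

lemma algebraic_S: assumes "s \<in> carrier S" shows "ring.algebraic S (h ` carrier R) s"
proof -
  have csub: "subfield (poly_of_const ` carrier R) PR" by (rule univ_poly_subfield_of_consts[OF sf])
  have eq: "h ` carrier R = E ` poly_of_const ` carrier R" by (simp add: h_def[abs_def] image_image)
  have dim: "UP.dimension (degree q) (poly_of_const ` carrier R) G"
    unfolding G_def by (rule bounded_degree_dimension[OF sf])
  have "S.dimension (degree q) (h ` carrier R) (E ` G)"
    unfolding eq by (rule E.inj_hom_dimension[OF csub S.one_not_zero inj_E dim])
  then have "S.finite_dimension (h ` carrier R) (carrier S)" unfolding carrier_S by (rule S.finite_dimensionI)
  moreover have "subfield (h ` carrier R) S"
    unfolding eq by (rule E.img_is_subfield(2)[OF csub S.one_not_zero])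
  ultimately have "(S.algebraic over (h ` carrier R)) s"
    using S.finite_dimension_imp_algebraic S.carrier_is_subring assms by blast
  then show ?thesis by (simp add: over_def)
qed

text \<open>The class of X is not the class of a constant, because \<open>q\<close> has degree at
  least 2. So the extension is proper, although it is algebraic, p-valued and of the same
  p-rank.\<close>

lemma contradiction:
  assumes "p_adically_closed (R :: 'a ring) A" shows False
proof -
  obtain p d where pv: "p_valued p d R A" and max: "\<forall>(S :: 'a ring) A' h.
           p_valued p d S A' \<and> h \<in> ring_hom R S \<and>
           (\<forall>x\<in>carrier R. x \<in> A \<longleftrightarrow> h x \<in> A') \<and>
           (\<forall>s\<in>carrier S. ring.algebraic S (h ` carrier R) s) \<longrightarrow>
           h ` carrier R = carrier S"
    using assms unfolding p_adically_closed_def by auto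
  define P where "P = [p] \<cdot> \<one>"
  have pvf: "residue_finite P" "\<one> \<prec> P" using p_valued_val_field(2,3)[OF pv UNIV] by (simp_all add: P_def)
  have P0: "P \<noteq> \<zero>" using p_valued_val_field(4,5)[OF pv UNIV] by (simp add: P_def prime_gt_0_nat)
  obtain \<pi> e where \<pi>: "uniformizer \<pi>" "P \<approx> \<pi> [^] (e::nat)"
    using uniformizer_exists[OF pvf P0] .
  have "p_valued p d S A'"
  proof (rule p_valued_extension[OF pv valuation_ring_A' h_hom])
    fix s assume "s \<in> A'"
    then obtain a t where at: "a \<in> A" "t \<in> A'" "s = h a \<oplus>\<^bsub>S\<^esub> h (\<pi> [^] e) \<otimes>\<^bsub>S\<^esub> t"
      using residue_pow[OF \<pi>(1)] by blast
    have t: "t \<in> carrier S" using at(2) by (auto simp: A'_def carrier_S)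
    have "P \<preceq> \<pi> [^] e" using \<pi>(2) by (simp add: eqv_def)
    then obtain c where c: "c \<in> A" "\<pi> [^] e = c \<otimes> P" by (rule leE)
    have "h c \<otimes>\<^bsub>S\<^esub> t \<in> A'" using A'_mult c(1) at(2) h_A by blast
    moreover have "s = (h c \<otimes>\<^bsub>S\<^esub> t) \<otimes>\<^bsub>S\<^esub> h P \<oplus>\<^bsub>S\<^esub> h a"
      using t unfolding at(3) c(2) by (simp add: S.m_ac S.a_comm)
    ultimately show "\<exists>a\<in>A. \<exists>t\<in>A'. s = t \<otimes>\<^bsub>S\<^esub> h ([p] \<cdot> \<one>) \<oplus>\<^bsub>S\<^esub> h a"
      unfolding P_def using at(1) by blast
  qed (use h_A in auto)
  then have "h ` carrier R = carrier S"
    using max[rule_format, of S A' h] h_hom h_A algebraic_S by simp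
  moreover have XG: "[\<one>, \<zero>] \<in> G" using degree_q by (auto simp: G_def poly_in)
  ultimately obtain a where "E [\<one>, \<zero>] = h a" unfolding carrier_S by (metis imageE imageI)
  then have "[\<one>, \<zero>] = poly_of_const a" using XG const_G by (simp add: h_def E_eq_iff)
  then show False by (auto simp: poly_of_const_def split: if_splits)
qed

end

context val_field
begin

lemma alg_maximal:
  assumes "p_adically_closed (R :: 'a ring) A" shows alg_maximal
  unfolding alg_maximal_def
proof (intro allI impI, rule ccontr)
  fix \<N> p assume *: "nest \<N> \<and> (\<exists>c\<in>set p. c \<noteq> \<zero>)" "\<not> (\<exists>C\<in>\<N>. stable_on C (ev p))"
  define q0 where "q0 = normalize (rev p)"
  have q0c: "q0 \<in> carrier (poly_ring R)"
    unfolding q0_def using normalize_gives_polynomial[of "rev p" "carrier R"] by (simp add: univ_poly_carrier)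
  have eval_q0: "eval q0 = ev p"
    unfolding q0_def using eval_normalize[of "rev p"] by (auto simp: eval_rev)
  have "q0 \<noteq> []"
  proof
    assume "q0 = []"
    then have "set (rev p) \<subseteq> {\<zero>}" unfolding q0_def using normalize_trick[of "rev p"] by (metis append_Nil2 set_replicate_conv_if empty_subsetI order_refl)
    then show False using * by auto
  qed
  define bad where "bad g \<longleftrightarrow> g \<in> carrier (poly_ring R) \<and> g \<noteq> [] \<and> \<not> (\<exists>C\<in>\<N>. stable_on C (eval g))" for g
  have "bad q0" using q0c eval_q0 \<open>q0 \<noteq> []\<close> * by (simp add: bad_def)
  then obtain q where q: "bad q" "\<And>g. bad g \<Longrightarrow> length q \<le> length g"
    using ex_has_least_nat[of bad q0 length] by auto
  interpret bad_nest R A \<N> q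
    by unfold_locales (use q * in \<open>force simp: bad_def\<close>)+
  have "infinite (UNIV :: 'a set)"
  proof
    assume fin: "finite (UNIV :: 'a set)"
    obtain p d where pv: "p_valued p d R A" using assms unfolding p_adically_closed_def by auto
    have "\<not> inj (\<lambda>n::nat. [n] \<cdot> \<one>)" using fin by (metis finite_imageD finite_subset infinite_UNIV_nat subset_UNIV)
    then obtain i j :: nat where ij: "i < j" "[i] \<cdot> \<one> = [j] \<cdot> \<one>" by (metis injI linorder_neqE_nat)
    have "[j] \<cdot> \<one> = ([i] \<cdot> \<one>) \<oplus> ([(j - i)] \<cdot> \<one>)" using ij(1) add.nat_pow_mult[of \<one> i "j - i"] by simp
    then have "[(j - i)] \<cdot> \<one> = \<zero>" using ij(2) by simp
    then show False using p_valued_val_field(4)[OF pv UNIV, of "j - i"] ij(1) by simp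
  qed
  \<comment> \<open>The classes modulo \<open>q\<close> correspond to their reduced representatives,
    lists of length at most \<open>degree q\<close>; coding these lists places the new field inside
    the type \<open>'a\<close>.\<close>
  from inj_on_lists[OF this, of "degree q"] obtain f :: "'a list \<Rightarrow> 'a" where f: "inj_on f {xs. length xs \<le> degree q}" by blast
  define rep where "rep c = (SOME g. g \<in> G \<and> rupture_surj (carrier R) q g = c)" for c
  have rep: "rep c \<in> G \<and> rupture_surj (carrier R) q (rep c) = c" if "c \<in> carrier (Rupt (carrier R) q)" for c
    unfolding rep_def
  proof (rule someI_ex)
    show "\<exists>g. g \<in> G \<and> rupture_surj (carrier R) q g = c"
    proof -
      have "carrier (Rupt (carrier R) q) = rupture_surj (carrier R) q ` G"
        using rupture_carrier_as_pmod_image[OF sf bad_nest.q(1)[OF bad_nest_axioms]]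
        unfolding pmod_image_characterization[OF sf bad_nest.q[OF bad_nest_axioms]] G_def by simp
      then have "c \<in> rupture_surj (carrier R) q ` G" using that by simp
      then show ?thesis by blast
    qed
  qed
  have "inj_on (\<lambda>c. f (rep c)) (carrier (Rupt (carrier R) q))"
  proof (rule inj_onI)
    fix c c' assume c: "c \<in> carrier (Rupt (carrier R) q)" "c' \<in> carrier (Rupt (carrier R) q)" "f (rep c) = f (rep c')"
    have "rep c \<in> {xs. length xs \<le> degree q}" "rep c' \<in> {xs. length xs \<le> degree q}" using rep[OF c(1)] rep[OF c(2)] by (auto simp: G_def)
    then have "rep c = rep c'" using f c(3) by (meson inj_onD)
    then show "c = c'" using rep[OF c(1)] rep[OF c(2)] by metis
  qed
  then interpret bad_nest_emb R A \<N> q "\<lambda>c. f (rep c)" by unfold_locales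
  show False using contradiction assms by blast
qed

end

section \<open>Uniformizers and powers\<close>

context val_field
begin

lemma root_ball_ev_le: assumes "y \<in> root_ball p x" shows "ev p x \<preceq> ev p y"
proof (cases "y = x")
  case False
  have t: "y = x \<oplus> (y \<ominus> x)" by (simp add: algebra_simps)
  have "ev p x \<preceq> ev p (x \<oplus> (y \<ominus> x)) \<otimes> (y \<ominus> x) [^] (0::nat)"
    by (rule le_taylor_at) (use False root_ball_le[OF assms] in auto)
  then show ?thesis unfolding t[symmetric] by simp
qed simp

lemma taylor_A: assumes "set p \<subseteq> A" "x \<in> A" shows "taylor p x i \<in> A"
proof -
  have "cf p j \<in> A" for j using assms(1) by (auto simp: cf_def)
  then have "\<one> \<preceq> taylor p x i \<otimes> \<one> [^] i"
    using assms(2) by (intro le_taylor) (auto simp: one_le_iff)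
  then show ?thesis by (simp add: one_le_iff)
qed

section \<open>Hensel's lemma for roots of elements close to one\<close>

primrec mon :: "nat \<Rightarrow> 'a list" where
  "mon 0 = [\<one>]"
| "mon (Suc k) = \<zero> # mon k"

lemma ev_mon: "ev (mon k) y = y [^] k"
  by (induction k) (auto simp: F.mult.commute)

lemma y_taylor_mon: "y \<otimes> taylor (mon k) y 1 = ([k] \<cdot> \<one>) \<otimes> y [^] k"
proof (induction k)
  case (Suc k)
  have "taylor (mon (Suc k)) y 1 = y \<otimes> taylor (mon k) y 1 \<oplus> y [^] k" by (simp add: ev_mon)
  also have "\<dots> = ([Suc k] \<cdot> \<one>) \<otimes> y [^] k" unfolding Suc by (simp add: add.nat_pow_Suc algebra_simps)
  finally show ?case by (simp add: algebra_simps)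
qed simp

lemma taylor_mon: "taylor (mon (Suc k)) y 1 = ([Suc k] \<cdot> \<one>) \<otimes> y [^] k"
  using y_taylor_mon[of y k] by (simp add: ev_mon add.nat_pow_Suc algebra_simps)

lemma nat_A: "[n] \<cdot> \<one> \<in> A" for n :: nat
  by (induction n) (auto simp: add_A add.nat_pow_Suc)

text \<open>Hensel's lemma without completeness. Put N = k + 1 and take a minimal root ball of X^N -
  u inside the one at 1. If its center \<open>c\<close> were not a root, a Newton step would lead to
  a point of that ball where the polynomial has larger valuation, contrary to minimality. The
  hypothesis on \<open>u\<close> is the usual v(u - 1) > 2 v(N).\<close>

lemma nth_root:
  assumes max: alg_maximal and N0: "[Suc k] \<cdot> \<one> \<noteq> \<zero>"
    and u: "([Suc k] \<cdot> \<one>) \<otimes> ([Suc k] \<cdot> \<one>) \<prec> u \<ominus> \<one>"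
  shows "\<exists>y. y [^] Suc k = u"
proof -
  define N where "N = [Suc k] \<cdot> \<one>"
  have N: "N \<in> A" "N \<noteq> \<zero>" "\<one> \<preceq> N" "N \<otimes> N \<prec> u \<ominus> \<one>"
    using nat_A[of "Suc k"] N0 u by (auto simp: N_def one_le_iff)
  have NN: "\<one> \<preceq> N \<otimes> N" using N(1) by (simp add: one_le_iff mult_A)
  have u1: "\<one> \<prec> u \<ominus> \<one>" by (rule le_lt_trans[OF NN N(4)])
  have "u = \<one> \<oplus> (u \<ominus> \<one>)" by (simp add: algebra_simps)
  moreover have "u \<ominus> \<one> \<in> A" using lt_imp_le[OF u1] by (simp add: one_le_iff)
  ultimately have uA: "u \<in> A" using add_A[OF one_A, of "u \<ominus> \<one>"] by simp
  define p where "p = (\<ominus> u) # mon k"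
  have monA: "set (mon j) \<subseteq> A" for j by (induction j) auto
  then have pA: "set p \<subseteq> A" using uA by (auto simp: p_def neg_A)
  have evp: "ev p y = y [^] Suc k \<ominus> u" for y by (simp add: p_def ev_mon F.mult.commute)
  have t1: "taylor p y 1 = N \<otimes> y [^] k" for y
    using taylor_mon[of k y] by (simp add: p_def N_def)
  obtain c where c: "c \<in> root_ball p \<one>" "\<forall>y\<in>root_ball p c. c \<in> root_ball p y"
    using minimal_root_ball[OF max] by blast
  show ?thesis
  proof (cases "ev p c = \<zero>")
    case True
    then show ?thesis by (auto simp: evp)
  next
    case f0: False
    have "N \<otimes> N \<prec> ev p \<one>" using N(4) by (simp add: evp lt_diff_commute)
    also have "ev p \<one> \<preceq> N \<otimes> (c \<ominus> \<one>)" using root_ball_le[OF c(1), of 1] t1[of \<one>] by simp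
    finally have "N \<prec> c \<ominus> \<one>" using N(2) by simp
    then have c1: "\<one> \<prec> c \<ominus> \<one>" by (rule le_lt_trans[OF N(3)])
    from eqv_add[OF this] have c_eqv: "c \<approx> \<one>" by (simp add: algebra_simps)
    then have cA: "c \<in> A" by (simp add: eqv_def one_le_iff)
    have c0: "c \<noteq> \<zero>" using c_eqv by auto
    define D where "D = N \<otimes> c [^] k"
    have D0: "D \<noteq> \<zero>" using N(2) c0 by (simp add: D_def)
    have "c [^] k \<approx> \<one>" using pow_eqv_mono[OF c_eqv, of k] by simp
    then have "N \<otimes> c [^] k \<approx> N \<otimes> \<one>" by (intro eqv_mult) auto
    then have DN: "D \<approx> N" by (simp add: D_def)
    define f where "f = ev p c"
    have "D \<otimes> D \<approx> N \<otimes> N" using DN by (intro eqv_mult)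
    also have "N \<otimes> N \<prec> ev p \<one>" by fact
    also have "ev p \<one> \<preceq> f" unfolding f_def by (rule root_ball_ev_le[OF c(1)])
    finally have DDf: "D \<otimes> D \<prec> f" .
    \<comment> \<open>\<open>D\<close> is the derivative at \<open>c\<close>, and \<delta> will be
      the Newton correction -f / D; the valuation of \<open>z\<close> measures by how much v(f)
      exceeds 2 v(D).\<close>
    define z where "z = f \<oslash> (D \<otimes> D)"
    have fz: "f = z \<otimes> (D \<otimes> D)" using D0 by (simp add: z_def)
    have z1: "\<one> \<prec> z"
    proof -
      have "\<one> \<otimes> (D \<otimes> D) \<prec> z \<otimes> (D \<otimes> D)" using DDf fz by simp
      then show ?thesis by (simp only: lt_mult_cancel_right)
    qed
    define \<delta> where "\<delta> = \<ominus> (z \<otimes> D)"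
    have D\<delta>: "D \<otimes> \<delta> = \<ominus> f" by (simp add: \<delta>_def fz algebra_simps)
    have \<delta>2: "\<delta> \<otimes> \<delta> = f \<otimes> z" by (simp add: \<delta>_def fz algebra_simps)
    have zA: "z \<in> A" using lt_imp_le[OF z1] by (simp add: one_le_iff)
    have DA: "D \<in> A" using N(1) cA by (simp add: D_def mult_A pow_A)
    have \<delta>A: "\<delta> \<in> A" using zA DA by (simp add: \<delta>_def mult_A neg_A)
    have f\<delta>: "f \<prec> \<delta> \<otimes> \<delta>"
    proof -
      have "f \<otimes> \<one> \<prec> f \<otimes> z" using z1 f0 unfolding lt_mult_cancel_left f_def by simp
      then show ?thesis by (simp add: \<delta>2)
    qed
    define y where "y = c \<oplus> \<delta>"
    have "f \<preceq> taylor p c i \<otimes> \<delta> [^] i" for i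
    proof -
      consider "i = 0" | "i = 1" | j where "i = Suc (Suc j)" by (cases i rule: nat.exhaust; cases "i - 1") auto
      then show ?thesis
      proof cases
        case 1 then show ?thesis by (simp add: f_def)
      next
        case 2
        then have "taylor p c i \<otimes> \<delta> [^] i = \<ominus> f" using t1[of c] D\<delta> by (simp add: D_def)
        then show ?thesis by simp
      next
        case 3
        have "f \<otimes> \<one> \<preceq> (\<delta> \<otimes> \<delta>) \<otimes> (taylor p c i \<otimes> \<delta> [^] j)"
          using f\<delta> taylor_A[OF pA cA] \<delta>A
          by (intro le_mult) (auto simp: lt_imp_le one_le_iff mult_A pow_A)
        then show ?thesis by (simp add: 3 algebra_simps)
      qed
    qed
    then have "y \<in> root_ball p c" by (simp add: root_ball_def y_def f_def)
    then have "c \<in> root_ball p y" using c(2) by blast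
    then have "ev p y \<preceq> f" unfolding f_def by (rule root_ball_ev_le)
    moreover have "f \<prec> ev p y"
    proof -
      obtain s where s: "shift c p = s" by blast
      have cfs: "cf s 0 = f" "cf s 1 = D" using cf_shift[of c p] t1[of c] by (simp_all add: s f_def D_def)
      have "cf s i \<in> A" for i using cf_shift[of c p i] taylor_A[OF pA cA] by (simp add: s)
      moreover have "set s \<subseteq> range (cf s)" by (auto simp: in_set_conv_nth cf_def image_iff)
      ultimately have sA: "set s \<subseteq> A" by blast
      have evy: "ev p y = ev s \<delta>" unfolding y_def taylor_add s ..
      have "cf s 1 \<noteq> \<zero>" using cfs D0 by simp
      then obtain s0 s1 r where sr: "s = s0 # s1 # r"
        by (cases s; cases "tl s") (auto simp: cf_def)
      have "s0 = f" "s1 = D" using cfs by (simp_all add: sr)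
      \<comment> \<open>By the choice of \<delta> the constant and the linear term cancel; what
        remains is divisible by the square of \<delta>, whose valuation exceeds that of
        \<open>f\<close>.\<close>
      then have "ev s \<delta> = (\<delta> \<otimes> \<delta>) \<otimes> ev r \<delta> \<oplus> (\<delta> \<otimes> D \<oplus> f)" by (simp add: sr algebra_simps)
      also have "\<delta> \<otimes> D \<oplus> f = \<zero>" using D\<delta> by (simp add: F.mult.commute)
      finally have "ev p y = (\<delta> \<otimes> \<delta>) \<otimes> ev r \<delta>" by (simp add: evy)
      moreover have "\<one> \<preceq> ev r \<delta>" using taylor_A[of r \<delta> 0] sA \<delta>A by (simp add: sr one_le_iff)
      then have "f \<otimes> \<one> \<prec> (\<delta> \<otimes> \<delta>) \<otimes> ev r \<delta>" using f\<delta> by (intro lt_mult_le) auto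
      ultimately show ?thesis by simp
    qed
    ultimately show ?thesis by (simp add: lt_def)
  qed
qed

end

text \<open>From here on a p-adically closed field enters through algebraic maximality,
  characteristic zero and the finiteness of the valuation ring modulo p.\<close>

locale p_field = val_field +
  fixes p :: nat
  assumes alg_max: alg_maximal and prime_p: "Factorial_Ring.prime p"
    and char_0: "\<And>n::nat. n > 0 \<Longrightarrow> [n] \<cdot> \<one> \<noteq> \<zero>"
    and p_nonunit: "\<one> \<prec> [p] \<cdot> \<one>" and residue_p: "residue_finite ([p] \<cdot> \<one>)"
begin

lemma unif_ex: "\<exists>\<pi> e. uniformizer \<pi> \<and> [p] \<cdot> \<one> \<approx> \<pi> [^] (e::nat)"
proof -
  have "[p] \<cdot> \<one> \<noteq> \<zero>" using char_0[of p] prime_p by (simp add: prime_gt_0_nat)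
  then obtain \<pi> e where "uniformizer \<pi>" "[p] \<cdot> \<one> \<approx> \<pi> [^] (e::nat)"
    by (rule uniformizer_exists[OF residue_p p_nonunit])
  then show ?thesis by auto
qed

lemma uniformizer_eqv: "uniformizer \<pi> \<Longrightarrow> uniformizer \<rho> \<Longrightarrow> \<pi> \<approx> \<rho>"
  by (simp add: uniformizer_def eqv_def)

lemma uniformizer_p: "uniformizer \<pi> \<Longrightarrow> \<exists>e. [p] \<cdot> \<one> \<approx> \<pi> [^] (e::nat)"
proof -
  assume \<pi>: "uniformizer \<pi>"
  obtain \<rho> e where \<rho>: "uniformizer \<rho>" "[p] \<cdot> \<one> \<approx> \<rho> [^] (e::nat)" using unif_ex by blast
  note \<rho>(2)
  also have "\<rho> [^] e \<approx> \<pi> [^] e" by (rule pow_eqv_mono[OF uniformizer_eqv[OF \<rho>(1) \<pi>]])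
  finally show ?thesis by blast
qed

section \<open>Valuations of integers\<close>

lemma nat_mult: "[(m * n)] \<cdot> \<one> = ([m] \<cdot> \<one>) \<otimes> ([n] \<cdot> \<one>)" for m n :: nat
  by (induction m) (auto simp: add.nat_pow_mult[symmetric] F.distrib_right F.add.commute)

lemma nat_add: "[(m + n)] \<cdot> \<one> = ([m] \<cdot> \<one>) \<oplus> ([n] \<cdot> \<one>)" for m n :: nat
  by (simp add: add.nat_pow_mult)

lemma nat_pow: "[(m ^ k)] \<cdot> \<one> = ([m] \<cdot> \<one>) [^] k" for m k :: nat
  by (induction k) (auto simp: nat_mult F.mult.commute)

text \<open>In a Bezout relation m x - p y = 1 the left side would have positive valuation if
  \<open>m\<close> had.\<close>

lemma coprime_unit: assumes "\<not> p dvd m" shows "[m] \<cdot> \<one> \<approx> \<one>"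
proof -
  have "coprime m p" using prime_imp_coprime[OF prime_p assms] by (simp add: coprime_commute)
  moreover have "m \<noteq> 0"
  proof
    assume "m = 0" then show False using assms by simp
  qed
  ultimately obtain x y where xy: "m * x = p * y + 1"
    using bezout_nat[of m p] by (auto simp: coprime_iff_gcd_eq_1)
  have "\<not> \<one> \<prec> [m] \<cdot> \<one>"
  proof
    assume m: "\<one> \<prec> [m] \<cdot> \<one>"
    have "\<one> \<prec> ([m] \<cdot> \<one>) \<otimes> ([x] \<cdot> \<one>)"
      using lt_mult_le[OF m, of \<one> "[x] \<cdot> \<one>"] nat_A[of x] by (simp add: one_le_iff)
    moreover have "\<one> \<prec> ([p] \<cdot> \<one>) \<otimes> ([y] \<cdot> \<one>)"
      using lt_mult_le[OF p_nonunit, of \<one> "[y] \<cdot> \<one>"] nat_A[of y] by (simp add: one_le_iff)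
    ultimately have "\<one> \<prec> ([m] \<cdot> \<one>) \<otimes> ([x] \<cdot> \<one>) \<ominus> ([p] \<cdot> \<one>) \<otimes> ([y] \<cdot> \<one>)" by (rule lt_diff)
    then have "\<one> \<prec> [(m * x)] \<cdot> \<one> \<ominus> [(p * y)] \<cdot> \<one>" unfolding nat_mult .
    moreover have "[(m * x)] \<cdot> \<one> \<ominus> [(p * y)] \<cdot> \<one> = \<one>" unfolding xy nat_add by (simp add: algebra_simps)
    ultimately show False by simp
  qed
  then show ?thesis using nat_A[of m] by (simp add: eqv_def lt_def one_le_iff)
qed

lemma nat_val: fixes n :: nat assumes "uniformizer \<pi>" "n > 0" shows "\<exists>j. [n] \<cdot> \<one> \<approx> \<pi> [^] (j::nat)"
proof -
  obtain e where e: "[p] \<cdot> \<one> \<approx> \<pi> [^] (e::nat)" using uniformizer_p assms by blast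
  have "n \<noteq> 0" using assms(2) by simp
  moreover have "\<not> is_unit p" using prime_p not_prime_unit by auto
  ultimately obtain m where m: "n = p ^ multiplicity p n * m" "\<not> p dvd m" by (rule multiplicity_decompose')
  have "([p] \<cdot> \<one>) [^] multiplicity p n \<otimes> ([m] \<cdot> \<one>) \<approx> (\<pi> [^] e) [^] multiplicity p n \<otimes> \<one>"
    by (intro eqv_mult pow_eqv_mono e coprime_unit m)
  then have "[n] \<cdot> \<one> \<approx> \<pi> [^] (e * multiplicity p n)"
    by (subst m(1)) (simp only: nat_mult nat_pow pow_mult F.mult_1_right)
  then show ?thesis ..
qed

end

locale p_field_unif = p_field +
  fixes \<pi> :: 'a
  assumes uniformizer_\<pi>: "uniformizer \<pi>"
begin

section \<open>Discreteness, residues modulo powers of the uniformizer, and powers of units\<close>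

lemma \<pi>0 [simp]: "\<pi> \<noteq> \<zero>" and \<pi>1: "\<one> \<prec> \<pi>" and \<pi>_min: "\<one> \<prec> z \<Longrightarrow> \<pi> \<preceq> z"
  using uniformizer_\<pi> by (auto simp: uniformizer_def)

lemma \<pi>A: "\<pi> \<in> A" using lt_imp_le[OF \<pi>1] by (simp add: one_le_iff)

lemma \<pi>_pow_A: "\<one> \<preceq> \<pi> [^] (k::nat)"
  using \<pi>A by (simp add: one_le_iff pow_A)

lemma lt_iff_\<pi>: "x \<prec> y \<longleftrightarrow> x \<noteq> \<zero> \<and> x \<otimes> \<pi> \<preceq> y"
proof
  assume xy: "x \<prec> y"
  then have x0: "x \<noteq> \<zero>" by (rule lt_nonzero)
  have "x \<otimes> \<one> \<prec> x \<otimes> (y \<oslash> x)" using xy x0 by simp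
  then have "\<one> \<prec> y \<oslash> x" unfolding lt_mult_cancel_left by simp
  then have "\<pi> \<preceq> y \<oslash> x" by (rule \<pi>_min)
  then have "x \<otimes> \<pi> \<preceq> x \<otimes> (y \<oslash> x)" by (intro le_mult le_refl)
  then show "x \<noteq> \<zero> \<and> x \<otimes> \<pi> \<preceq> y" using x0 by simp
next
  assume *: "x \<noteq> \<zero> \<and> x \<otimes> \<pi> \<preceq> y"
  then have "x \<otimes> \<one> \<prec> x \<otimes> \<pi>" using \<pi>1 unfolding lt_mult_cancel_left by simp
  then show "x \<prec> y" using * lt_le_trans by auto
qed

lemma \<pi>_pow_lt: "i < j \<Longrightarrow> \<pi> [^] i \<prec> \<pi> [^] (j::nat)"
proof -
  assume "i < j"
  then obtain k where k: "j = i + Suc k" using less_iff_Suc_add by auto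
  have "\<one> [^] Suc k \<prec> \<pi> [^] Suc k" by (rule pow_lt_mono[OF \<pi>1]) simp
  then have "\<pi> [^] i \<otimes> \<one> \<prec> \<pi> [^] i \<otimes> \<pi> [^] Suc k" unfolding lt_mult_cancel_left by simp
  then show ?thesis unfolding k pow_add by simp
qed

lemma \<pi>_pow_le_iff: "\<pi> [^] i \<preceq> \<pi> [^] j \<longleftrightarrow> i \<le> (j::nat)"
proof (cases "i \<le> j")
  case True
  then have "i = j \<or> i < j" by auto
  then show ?thesis using True lt_imp_le[OF \<pi>_pow_lt[of i j]] by auto
next
  case False
  then show ?thesis using \<pi>_pow_lt[of j i] by (simp add: lt_def)
qed

lemma discrete: assumes "x \<preceq> y" "y \<prec> x \<otimes> \<pi> [^] (k::nat)"
  shows "\<exists>j<k. y \<approx> x \<otimes> \<pi> [^] j"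
  using assms(2)
proof (induction k)
  case 0
  then show ?case using assms(1) by (simp add: lt_def)
next
  case (Suc k)
  show ?case
  proof (cases "y \<prec> x \<otimes> \<pi> [^] k")
    case True
    then show ?thesis using Suc.IH less_SucI by blast
  next
    case False
    then have 1: "x \<otimes> \<pi> [^] k \<preceq> y" by (simp add: lt_def)
    have "y \<preceq> x \<otimes> \<pi> [^] k"
    proof (rule ccontr)
      assume "\<not> ?thesis"
      then have "x \<otimes> \<pi> [^] k \<prec> y" by (simp add: lt_def)
      then have "x \<otimes> \<pi> [^] k \<otimes> \<pi> \<preceq> y" by (simp add: lt_iff_\<pi>)
      then show False using Suc.prems by (simp add: lt_def algebra_simps)
    qed
    then show ?thesis using 1 by (auto simp: eqv_def)
  qed
qed

text \<open>Expansion by digits: a representative modulo \<pi>^k is corrected by \<pi>^k times a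
  representative modulo p, which fixes the next digit because \<pi> divides p.\<close>

lemma residue_finite_\<pi>: "residue_finite (\<pi> [^] (k::nat))"
proof (induction k)
  case 0
  show ?case unfolding residue_finite_def by (rule exI[of _ "{\<zero>}"]) (auto simp: one_le_iff)
next
  case (Suc k)
  then obtain F where F: "finite F" "F \<subseteq> A" "\<forall>a\<in>A. \<exists>f\<in>F. \<pi> [^] k \<preceq> a \<ominus> f" by (auto simp: residue_finite_def)
  obtain F1 where F1: "finite F1" "F1 \<subseteq> A" "\<forall>a\<in>A. \<exists>f\<in>F1. [p] \<cdot> \<one> \<preceq> a \<ominus> f"
    using residue_p by (auto simp: residue_finite_def)
  have "\<exists>f\<in>(\<lambda>(f, g). f \<oplus> \<pi> [^] k \<otimes> g) ` (F \<times> F1). \<pi> [^] Suc k \<preceq> a \<ominus> f" if a: "a \<in> A" for a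
  proof -
    obtain f where f: "f \<in> F" "\<pi> [^] k \<preceq> a \<ominus> f" using F(3) a by blast
    then obtain t where t: "t \<in> A" "a \<ominus> f = t \<otimes> \<pi> [^] k" by (auto elim: leE)
    obtain g where g: "g \<in> F1" "[p] \<cdot> \<one> \<preceq> t \<ominus> g" using F1(3) t(1) by blast
    have "\<pi> \<preceq> t \<ominus> g" using \<pi>_min[OF p_nonunit] g(2) by (rule le_trans)
    then have "\<pi> \<otimes> \<pi> [^] k \<preceq> (t \<ominus> g) \<otimes> \<pi> [^] k" by simp
    also have "(t \<ominus> g) \<otimes> \<pi> [^] k = (a \<ominus> f) \<ominus> \<pi> [^] k \<otimes> g" unfolding t(2) by (simp add: algebra_simps)
    also have "\<dots> = a \<ominus> (f \<oplus> \<pi> [^] k \<otimes> g)" by (simp add: algebra_simps)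
    finally have "\<pi> [^] Suc k \<preceq> a \<ominus> (f \<oplus> \<pi> [^] k \<otimes> g)" by (simp add: F.mult.commute)
    then show ?thesis using f(1) g(1) by (intro bexI[of _ "f \<oplus> \<pi> [^] k \<otimes> g"]) auto
  qed
  then show ?case unfolding residue_finite_def
    using F F1 \<pi>A by (intro exI[of _ "(\<lambda>(f, g). f \<oplus> \<pi> [^] k \<otimes> g) ` (F \<times> F1)"]) (auto intro!: add_A mult_A pow_A)
qed

lemma nth_roots:
  assumes "n > 0" shows "\<exists>M>0. \<forall>u. \<pi> [^] (M::nat) \<preceq> u \<ominus> \<one> \<longrightarrow> (\<exists>y. y [^] (n::nat) = u)"
proof -
  obtain k where k: "n = Suc k" using assms by (cases n) auto
  obtain j where j: "[n] \<cdot> \<one> \<approx> \<pi> [^] (j::nat)" using nat_val[OF uniformizer_\<pi> assms] by blast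
  show ?thesis
  \<comment> \<open>One more than twice the valuation of \<open>n\<close>, as Hensel's lemma asks
    for a strict inequality.\<close>
  proof (intro exI[of _ "Suc (j + j)"] conjI allI impI)
    fix u assume u: "\<pi> [^] Suc (j + j) \<preceq> u \<ominus> \<one>"
    have "([n] \<cdot> \<one>) \<otimes> ([n] \<cdot> \<one>) \<approx> \<pi> [^] (j + j)" unfolding pow_add by (intro eqv_mult j)
    also have "\<pi> [^] (j + j) \<prec> \<pi> [^] Suc (j + j)" by (rule \<pi>_pow_lt) simp
    also note u
    finally show "\<exists>y. y [^] n = u" using nth_root[OF alg_max, of k u] char_0[OF assms] by (simp add: k)
  qed simp
qed

text \<open>Among the powers of \<open>y\<close> with exponent up to \<open>card F\<close> two are
  congruent modulo \<pi>^M, so y^d is congruent to one for some positive d \<le> card F. The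
  factorial is a multiple of every such d, and so an exponent that does not depend on
  \<open>y\<close>.\<close>

lemma unit_power:
  fixes M :: nat
  shows "\<exists>e>0. \<forall>y. y \<approx> \<one> \<longrightarrow> \<pi> [^] M \<preceq> y [^] (e::nat) \<ominus> \<one>"
proof -
  obtain F where F: "finite F" "F \<subseteq> A" "\<forall>a\<in>A. \<exists>f\<in>F. \<pi> [^] M \<preceq> a \<ominus> f"
    using residue_finite_\<pi>[of M] by (auto simp: residue_finite_def)
  have "\<pi> [^] M \<preceq> y [^] (fact (card F) :: nat) \<ominus> \<one>" if y: "y \<approx> \<one>" for y
  proof -
    have yk: "y [^] i \<approx> \<one>" for i :: nat using pow_eqv_mono[OF y, of i] by simp
    then have "y [^] i \<in> A" for i :: nat by (simp add: eqv_def one_le_iff)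
    then have "\<forall>i::nat. \<exists>f\<in>F. \<pi> [^] M \<preceq> y [^] i \<ominus> f" using F(3) by blast
    then obtain g where g: "\<And>i::nat. g i \<in> F" "\<And>i. \<pi> [^] M \<preceq> y [^] i \<ominus> g i" by metis
    have "\<not> inj_on g {..card F}"
    proof
      assume "inj_on g {..card F}"
      then have "card {..card F} \<le> card F" using F(1) g(1) by (intro card_inj_on_le[of g]) auto
      then show False by simp
    qed
    then obtain i j where ij: "i < j" "j \<le> card F" "g i = g j"
      unfolding inj_on_def by (metis atMost_iff linorder_neqE_nat)
    obtain d where d: "j = i + d" "d > 0" using ij(1) less_imp_add_positive by blast
    have "\<pi> [^] M \<preceq> (y [^] j \<ominus> g j) \<ominus> (y [^] i \<ominus> g i)" by (rule le_diff[OF g(2) g(2)])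
    also have "(y [^] j \<ominus> g j) \<ominus> (y [^] i \<ominus> g i) = y [^] i \<otimes> (y [^] d \<ominus> \<one>)"
      unfolding ij(3) d(1) pow_add by (simp add: algebra_simps)
    also have "\<dots> \<approx> \<one> \<otimes> (y [^] d \<ominus> \<one>)" by (intro eqv_mult yk) auto
    finally have yd: "\<pi> [^] M \<preceq> y [^] d \<ominus> \<one>" by simp
    have "\<pi> [^] M \<preceq> (y [^] d) [^] l \<ominus> \<one>" for l :: nat
    proof (induction l)
      case (Suc l)
      have "\<pi> [^] M \<otimes> \<one> \<preceq> (y [^] d \<ominus> \<one>) \<otimes> (y [^] d) [^] l"
        using yd yk[of d] pow_eqv_mono[OF yk[of d], of l] by (intro le_mult) (auto simp: eqv_def)
      then have "\<pi> [^] M \<preceq> (y [^] d \<ominus> \<one>) \<otimes> (y [^] d) [^] l \<oplus> ((y [^] d) [^] l \<ominus> \<one>)"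
        using Suc by (intro le_add) auto
      moreover have "(y [^] d \<ominus> \<one>) \<otimes> (y [^] d) [^] l \<oplus> ((y [^] d) [^] l \<ominus> \<one>) = y [^] d \<otimes> (y [^] d) [^] l \<ominus> \<one>"
        by (simp add: F.left_diff_distrib diff_add_diff)
      ultimately show ?case unfolding pow_Suc by simp
    qed simp
    moreover have "d dvd fact (card F)" using d ij by (intro dvd_fact) auto
    then obtain l where "fact (card F) = d * l" by (rule dvdE)
    ultimately show ?thesis by (simp add: pow_mult)
  qed
  then show ?thesis by (intro exI[of _ "fact (card F)"]) auto
qed

end

section \<open>Polynomials near their centers\<close>

context val_field
begin

lemma ev_dominated:
  assumes "e \<noteq> \<zero>" "\<And>i. i \<noteq> k \<Longrightarrow> w \<preceq> cf s i \<otimes> e [^] i"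
  shows "w \<preceq> ev s e \<ominus> cf s k \<otimes> e [^] k"
  using assms(2)
proof (induction s arbitrary: k w)
  case (Cons a s)
  define w' where "w' = w \<oslash> e"
  have w: "w = e \<otimes> w'" using assms(1) by (simp add: w'_def)
  have cancel: "w' \<preceq> z" if "w \<preceq> e \<otimes> z" for z using that assms(1) by (simp add: w)
  have tail: "w' \<preceq> cf s i \<otimes> e [^] i" if "Suc i \<noteq> k" for i
    using Cons.prems[OF that] by (intro cancel) (simp add: algebra_simps)
  show ?case
  proof (cases k)
    case 0
    have "w' \<preceq> ev s e \<otimes> e [^] (0::nat)" using tail 0 by (intro le_taylor[OF assms(1)]) auto
    then have "e \<otimes> w' \<preceq> e \<otimes> ev s e" by simp
    then show ?thesis by (simp add: 0 w)
  next
    case (Suc k')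
    have "w' \<preceq> ev s e \<ominus> cf s k' \<otimes> e [^] k'" using tail Suc by (intro Cons.IH) auto
    then have "e \<otimes> w' \<preceq> e \<otimes> (ev s e \<ominus> cf s k' \<otimes> e [^] k')" by simp
    moreover have "w \<preceq> a" using Cons.prems[of 0] Suc by simp
    ultimately have "w \<preceq> e \<otimes> (ev s e \<ominus> cf s k' \<otimes> e [^] k') \<oplus> a" unfolding w by (intro le_add)
    then show ?thesis by (simp add: Suc algebra_simps)
  qed
qed simp

end

text \<open>The exponent \<open>n\<close> turns every unit into an element congruent to one modulo
  \<pi>^M. This couples the two parameters: a unit that is close to an \<open>n\<close>-th power is
  then close to one.\<close>

locale h_field = p_field_unif +
  fixes M n :: nat
  assumes M_pos: "M > 0" and n_pos: "n > 0"
    and unit_pow: "\<And>y. y \<approx> \<one> \<Longrightarrow> \<pi> [^] M \<preceq> y [^] n \<ominus> \<one>"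
begin

definition Q :: 'a where "Q = \<pi> [^] M"

definition near :: "'a \<Rightarrow> 'a \<Rightarrow> bool" where
  "near x y \<longleftrightarrow> Q \<otimes> x \<preceq> y \<ominus> x"

text \<open>The elements \<open>h\<close> with \<open>H h\<close> form a subgroup of finite index of the multiplicative group, and
  those of valuation \<open>0\<close> among them are exactly the elements of \<open>1 + Q A\<close>.\<close>

definition H :: "'a \<Rightarrow> bool" where
  "H x \<longleftrightarrow> (\<exists>y. y \<noteq> \<zero> \<and> near (y [^] n) x)"

definition sim :: "'a \<Rightarrow> 'a \<Rightarrow> bool" where
  "sim x y \<longleftrightarrow> (\<exists>h. H h \<and> y = h \<otimes> x)"

section \<open>Closeness up to a factor in 1 + Q A, and classes modulo the subgroup\<close>

lemma Q0 [simp]: "Q \<noteq> \<zero>" by (simp add: Q_def)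

lemma Q1: "\<one> \<prec> Q"
  using \<pi>_pow_lt[OF M_pos] by (simp add: Q_def)

lemma near_refl [simp]: "near x x" by (simp add: near_def)

lemma near_zero_iff [simp]: "near \<zero> y \<longleftrightarrow> y = \<zero>" by (simp add: near_def)

lemma lt_Q: "x \<noteq> \<zero> \<Longrightarrow> x \<prec> Q \<otimes> x"
  using lt_mult_cancel_right[of \<one> x Q] Q1 by simp

lemma near_eqv: assumes "near x y" shows "x \<approx> y"
proof (cases "x = \<zero>")
  case False
  have "x \<prec> y \<ominus> x" using lt_Q[OF False] assms lt_le_trans unfolding near_def by blast
  from eqv_add[OF this] have "y \<approx> x" by (simp add: algebra_simps)
  then show ?thesis by (rule eqv_sym)
qed (use assms in auto)

lemma near_sym: assumes "near x y" shows "near y x"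
proof -
  have "Q \<otimes> y \<approx> Q \<otimes> x" using near_eqv[OF assms] by (intro eqv_mult) (auto intro: eqv_sym)
  also have "Q \<otimes> x \<preceq> y \<ominus> x" using assms by (simp add: near_def)
  finally show ?thesis unfolding near_def by (simp only: le_diff_commute)
qed

lemma near_trans: assumes "near x y" "near y z" shows "near x z"
proof -
  have "Q \<otimes> x \<approx> Q \<otimes> y" using near_eqv[OF assms(1)] by (intro eqv_mult) auto
  also have "Q \<otimes> y \<preceq> z \<ominus> y" using assms by (simp add: near_def)
  finally have "Q \<otimes> x \<preceq> (z \<ominus> y) \<oplus> (y \<ominus> x)" using assms(1) by (intro le_add) (auto simp: near_def)
  then show ?thesis by (simp add: near_def diff_add_diff)
qed

lemma near_mult: assumes "near a b" "near c d" shows "near (a \<otimes> c) (b \<otimes> d)"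
proof -
  have "Q \<otimes> a \<otimes> c \<preceq> (b \<ominus> a) \<otimes> d"
    using assms(1) near_eqv[OF assms(2)] by (intro le_mult) (auto simp: near_def eqv_def)
  moreover have "a \<otimes> (Q \<otimes> c) \<preceq> a \<otimes> (d \<ominus> c)"
    using assms(2) by (intro le_mult) (auto simp: near_def)
  ultimately have "Q \<otimes> (a \<otimes> c) \<preceq> (b \<ominus> a) \<otimes> d \<oplus> a \<otimes> (d \<ominus> c)" by (intro le_add) (simp_all add: algebra_simps)
  also have "(b \<ominus> a) \<otimes> d \<oplus> a \<otimes> (d \<ominus> c) = b \<otimes> d \<ominus> a \<otimes> c"
    by (simp add: F.left_diff_distrib F.right_diff_distrib diff_add_diff)
  finally show ?thesis by (simp add: near_def)
qed

lemma near_cancel: "z \<noteq> \<zero> \<Longrightarrow> near (z \<otimes> x) (z \<otimes> y) \<longleftrightarrow> near x y"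
proof -
  assume z: "z \<noteq> \<zero>"
  have "near (z \<otimes> x) (z \<otimes> y) \<longleftrightarrow> z \<otimes> (Q \<otimes> x) \<preceq> z \<otimes> (y \<ominus> x)"
    by (simp only: near_def F.right_diff_distrib F.mult.left_commute)
  then show ?thesis using z by (simp add: near_def)
qed

lemma H_nonzero: "H x \<Longrightarrow> x \<noteq> \<zero>"
proof
  assume "H x" "x = \<zero>"
  then obtain y where "y \<noteq> \<zero>" "near (y [^] n) \<zero>" by (auto simp: H_def)
  then show False using near_eqv by fastforce
qed

lemma H_near_one: "near \<one> x \<Longrightarrow> H x"
  unfolding H_def by (rule exI[of _ \<one>]) simp

lemma H_one [simp]: "H \<one>" by (rule H_near_one) simp

lemma H_mult: assumes "H x" "H y" shows "H (x \<otimes> y)"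
proof -
  obtain a b where "a \<noteq> \<zero>" "near (a [^] n) x" "b \<noteq> \<zero>" "near (b [^] n) y" using assms by (auto simp: H_def)
  then have "a \<otimes> b \<noteq> \<zero>" "near ((a \<otimes> b) [^] n) (x \<otimes> y)" by (auto simp: pow_distrib intro: near_mult)
  then show ?thesis unfolding H_def by blast
qed

lemma H_inv: assumes "H x" shows "H (\<one> \<oslash> x)"
proof -
  obtain a where a: "a \<noteq> \<zero>" "near (a [^] n) x" using assms by (auto simp: H_def)
  have x: "x \<noteq> \<zero>" using H_nonzero assms by blast
  define b where "b = a [^] n"
  have b: "b \<noteq> \<zero>" using a n_pos by (simp add: b_def)
  have "near x b" using a(2) near_sym by (simp add: b_def)
  moreover have "(x \<otimes> b) \<otimes> (\<one> \<oslash> b) = x" "(x \<otimes> b) \<otimes> (\<one> \<oslash> x) = b" using x b by (simp_all add: field_simps)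
  ultimately have "near ((x \<otimes> b) \<otimes> (\<one> \<oslash> b)) ((x \<otimes> b) \<otimes> (\<one> \<oslash> x))" by simp
  moreover have "x \<otimes> b \<noteq> \<zero>" using x b by simp
  ultimately have "near (\<one> \<oslash> b) (\<one> \<oslash> x)" by (metis near_cancel)
  then have "near ((\<one> \<oslash> a) [^] n) (\<one> \<oslash> x)" by (simp add: pow_divide b_def)
  then show ?thesis using a(1) unfolding H_def by (intro exI[of _ "\<one> \<oslash> a"]) auto
qed

text \<open>If y^n has valuation zero, so has \<open>y\<close>, and then the choice of
  \<open>n\<close> puts y^n close to one.\<close>

lemma H_unit: assumes "H h" "h \<approx> \<one>" shows "near \<one> h"
proof -
  obtain y where y: "y \<noteq> \<zero>" "near (y [^] n) h" using assms by (auto simp: H_def)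
  have "y [^] n \<approx> \<one>" using near_eqv[OF y(2)] assms(2) by (rule eqv_trans)
  then have "y [^] n \<approx> \<one> [^] n" by simp
  then have "y \<approx> \<one>" using pow_eqv_iff[OF n_pos] by blast
  then have "near \<one> (y [^] n)" using unit_pow by (simp add: near_def Q_def)
  then show ?thesis using y(2) near_trans by blast
qed

lemma sim_refl [simp]: "sim x x" unfolding sim_def by (rule exI[of _ \<one>]) simp

lemma sim_sym: assumes "sim x y" shows "sim y x"
proof -
  obtain h where h: "H h" "y = h \<otimes> x" using assms by (auto simp: sim_def)
  have "x = (\<one> \<oslash> h) \<otimes> y" using H_nonzero[OF h(1)] by (simp add: h(2))
  then show ?thesis using H_inv[OF h(1)] unfolding sim_def by blast
qed

lemma sim_trans: assumes "sim x y" "sim y z" shows "sim x z"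
proof -
  obtain h k where "H h" "y = h \<otimes> x" "H k" "z = k \<otimes> y" using assms by (auto simp: sim_def)
  then have "H (k \<otimes> h)" "z = (k \<otimes> h) \<otimes> x" by (auto simp: H_mult F.mult.assoc)
  then show ?thesis unfolding sim_def by blast
qed

lemma sim_mult: assumes "sim a b" "sim c d" shows "sim (a \<otimes> c) (b \<otimes> d)"
proof -
  obtain h k where "H h" "b = h \<otimes> a" "H k" "d = k \<otimes> c" using assms by (auto simp: sim_def)
  then have "H (h \<otimes> k)" "b \<otimes> d = (h \<otimes> k) \<otimes> (a \<otimes> c)" by (auto simp: H_mult algebra_simps)
  then show ?thesis unfolding sim_def by blast
qed

lemma sim_pow: "sim x y \<Longrightarrow> sim (x [^] (k::nat)) (y [^] k)"
  by (induction k) (auto intro: sim_mult)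

lemma sim_zero_iff: "sim x y \<Longrightarrow> x = \<zero> \<longleftrightarrow> y = \<zero>"
  using H_nonzero by (auto simp: sim_def)

lemma near_sim: assumes "near x y" shows "sim x y"
proof (cases "x = \<zero>")
  case False
  have "near (x \<otimes> \<one>) (x \<otimes> (y \<oslash> x))" using assms False by simp
  then have "H (y \<oslash> x)" using near_cancel[OF False] H_near_one by blast
  moreover have "y = (y \<oslash> x) \<otimes> x" using False by simp
  ultimately show ?thesis unfolding sim_def by blast
qed (use assms in auto)

text \<open>The purpose of the choice of the subgroup: class and valuation together determine an
  element up to a factor in 1 + Q A.\<close>

lemma sim_near: assumes "sim x y" "x \<approx> y" shows "near x y"
proof (cases "x = \<zero>")
  case False
  obtain h where h: "H h" "y = h \<otimes> x" using assms by (auto simp: sim_def)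
  have "h \<otimes> x \<approx> \<one> \<otimes> x" using assms(2) h(2) by (simp add: eqv_sym)
  then have "h \<approx> \<one>" using False by (simp only: eqv_mult_cancel_right) simp
  from H_unit[OF h(1) this] have "near (x \<otimes> \<one>) (x \<otimes> h)" by (intro near_mult) auto
  then show ?thesis by (simp add: h(2) F.mult.commute)
qed (use assms in auto)

lemma near_le: "near x x' \<Longrightarrow> near y y' \<Longrightarrow> x \<preceq> y \<longleftrightarrow> x' \<preceq> y'"
  using near_eqv unfolding eqv_def by (meson le_trans)

text \<open>Around a nearest center \<open>c\<close>, each polynomial is either dominated by one of its Taylor terms, or
  the comparisons of the Taylor terms determine the valuation of \<open>x - c\<close>, so that \<open>x'\<close> is close to
  \<open>x\<close>.\<close>

lemma prep:
  assumes len: "\<And>p. p \<in> ps \<Longrightarrow> length p \<le> Suc D" and C: "finite C" "C \<noteq> {}"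
    and cent: "\<And>p x. p \<in> ps \<Longrightarrow> \<exists>c\<in>C. c \<in> root_ball p x"
    and sim: "\<And>c. c \<in> C \<Longrightarrow> sim (x \<ominus> c) (x' \<ominus> c)"
    and cuts: "\<And>c p q i j d m1 m2. c \<in> C \<Longrightarrow> p \<in> ps \<Longrightarrow> q \<in> ps \<Longrightarrow> i \<le> D \<Longrightarrow> j \<le> D \<Longrightarrow> 0 < d \<Longrightarrow> d \<le> D \<Longrightarrow>
      m1 \<le> Suc M \<Longrightarrow> m2 \<le> Suc M \<Longrightarrow>
      taylor p c i \<otimes> \<pi> [^] (m1::nat) \<preceq> taylor q c j \<otimes> \<pi> [^] (m2::nat) \<otimes> (x \<ominus> c) [^] (d::nat) \<longleftrightarrow>
      taylor p c i \<otimes> \<pi> [^] m1 \<preceq> taylor q c j \<otimes> \<pi> [^] m2 \<otimes> (x' \<ominus> c) [^] d"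
  shows "(\<forall>p\<in>ps. sim (ev p x) (ev p x')) \<and> (\<forall>p\<in>ps. \<forall>q\<in>ps. ev p x \<preceq> ev q x \<longleftrightarrow> ev p x' \<preceq> ev q x')"
proof -
  obtain c where c: "c \<in> C" "\<And>c'. c' \<in> C \<Longrightarrow> x \<ominus> c' \<preceq> x \<ominus> c"
    using finite_max[OF C, of "\<lambda>c. x \<ominus> c"] by blast
  define e e' where "e = x \<ominus> c" and "e' = x' \<ominus> c"
  have se: "sim e e'" using sim[OF c(1)] by (simp add: e_def e'_def)
  have x: "x = c \<oplus> e" and x': "x' = c \<oplus> e'" by (simp_all add: e_def e'_def algebra_simps)
  show ?thesis
  proof (cases "e = \<zero>")
    case True
    then have "e' = \<zero>" using sim_zero_iff[OF se] by simp
    then have "x' = x" using True by (simp add: x x')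
    then show ?thesis by simp
  next
    case e0: False
    then have e'0: "e' \<noteq> \<zero>" using sim_zero_iff[OF se] by simp
    define T where "T p i = taylor p c i" for p i
    \<comment> \<open>After cancelling the smaller power of the difference, a comparison of two
      Taylor terms becomes one of the cuts. If the remaining power stands on the left, the
      comparison is negated, and the strict inequality costs one more factor \<pi>; this is why the
      cuts go up to \<open>Suc M\<close>.\<close>
    have cmp: "T p i \<otimes> \<pi> [^] m1 \<otimes> e [^] i \<preceq> T q j \<otimes> \<pi> [^] m2 \<otimes> e [^] j \<longleftrightarrow>
      T p i \<otimes> \<pi> [^] m1 \<otimes> e' [^] i \<preceq> T q j \<otimes> \<pi> [^] m2 \<otimes> e' [^] j"
      if "p \<in> ps" "q \<in> ps" "i \<le> D" "j \<le> D" "m1 \<le> M" "m2 \<le> M" for p q i j m1 m2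
    proof -
      have *: "T p i \<otimes> \<pi> [^] m1 \<otimes> u [^] i \<preceq> T q j \<otimes> \<pi> [^] m2 \<otimes> u [^] j \<longleftrightarrow>
        (if i < j then T p i \<otimes> \<pi> [^] m1 \<preceq> T q j \<otimes> \<pi> [^] m2 \<otimes> u [^] (j - i)
         else if i = j then T p i \<otimes> \<pi> [^] m1 \<preceq> T q j \<otimes> \<pi> [^] m2
         else \<not> (T q j \<noteq> \<zero> \<and> T q j \<otimes> \<pi> [^] Suc m2 \<preceq> T p i \<otimes> \<pi> [^] m1 \<otimes> u [^] (i - j)))" if u: "u \<noteq> \<zero>" for u
      proof -
        consider "i < j" | "i = j" | "j < i" by linarith
        then show ?thesis
        proof cases
          case 1
          then have "u [^] j = u [^] (j - i) \<otimes> u [^] i" by (simp flip: pow_add)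
          then have "T p i \<otimes> \<pi> [^] m1 \<otimes> u [^] i \<preceq> T q j \<otimes> \<pi> [^] m2 \<otimes> u [^] j \<longleftrightarrow>
            T p i \<otimes> \<pi> [^] m1 \<otimes> u [^] i \<preceq> (T q j \<otimes> \<pi> [^] m2 \<otimes> u [^] (j - i)) \<otimes> u [^] i"
            by (simp add: F.mult.assoc)
          then show ?thesis using 1 u by simp
        next
          case 2
          then show ?thesis using u by simp
        next
          case 3
          then have "u [^] i = u [^] (i - j) \<otimes> u [^] j" by (simp flip: pow_add)
          then have "T p i \<otimes> \<pi> [^] m1 \<otimes> u [^] i \<preceq> T q j \<otimes> \<pi> [^] m2 \<otimes> u [^] j \<longleftrightarrow>
            (T p i \<otimes> \<pi> [^] m1 \<otimes> u [^] (i - j)) \<otimes> u [^] j \<preceq> (T q j \<otimes> \<pi> [^] m2) \<otimes> u [^] j"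
            by (simp add: F.mult.assoc)
          also have "\<dots> \<longleftrightarrow> T p i \<otimes> \<pi> [^] m1 \<otimes> u [^] (i - j) \<preceq> T q j \<otimes> \<pi> [^] m2" using u by simp
          also have "\<dots> \<longleftrightarrow> \<not> (T q j \<otimes> \<pi> [^] m2 \<prec> T p i \<otimes> \<pi> [^] m1 \<otimes> u [^] (i - j))" by (simp add: lt_def)
          finally show ?thesis using 3 by (simp add: lt_iff_\<pi> F.mult_ac)
        qed
      qed
      show ?thesis
        unfolding *[OF e0] *[OF e'0] unfolding T_def e_def e'_def
        using cuts[OF c(1) that(1,2,3,4), of "j - i" m1 m2] cuts[OF c(1) that(2,1,4,3), of "i - j" "Suc m2" m1] that
        by auto
    qed
    have cmp0: "T p i \<otimes> e [^] i \<preceq> T q j \<otimes> e [^] j \<longleftrightarrow> T p i \<otimes> e' [^] i \<preceq> T q j \<otimes> e' [^] j"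
      if "p \<in> ps" "q \<in> ps" "i \<le> D" "j \<le> D" for p q i j
      using cmp[OF that, of 0 0] by simp
    have evx: "ev p (c \<oplus> u) = ev (shift c p) u" for p u by (simp add: taylor_add)
    have big: "T p i = \<zero>" if "p \<in> ps" "\<not> i \<le> D" for p i
      unfolding T_def using len[OF that(1)] that(2) by (intro taylor_eq_0) simp
    \<comment> \<open>Term \<open>k\<close> dominates if every other term exceeds its valuation by
      at least that of \<pi>^M; then it alone determines the value of the polynomial up to
      closeness.\<close>
    define dom where "dom p k u \<longleftrightarrow> (\<forall>i\<le>D. i \<noteq> k \<longrightarrow> T p k \<otimes> \<pi> [^] M \<otimes> u [^] k \<preceq> T p i \<otimes> u [^] i)" for p k u
    have dom_near: "near (T p k \<otimes> u [^] k) (ev p (c \<oplus> u))" if "p \<in> ps" "dom p k u" "u \<noteq> \<zero>" for p k u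
    proof -
      have "Q \<otimes> (T p k \<otimes> u [^] k) \<preceq> ev (shift c p) u \<ominus> cf (shift c p) k \<otimes> u [^] k"
      proof (rule ev_dominated[OF that(3)])
        fix i assume "i \<noteq> k"
        then show "Q \<otimes> (T p k \<otimes> u [^] k) \<preceq> cf (shift c p) i \<otimes> u [^] i"
          using that(2) big[OF that(1), of i] unfolding dom_def cf_shift T_def[symmetric] Q_def
          by (cases "i \<le> D") (auto simp: algebra_simps)
      qed
      then show ?thesis by (simp add: near_def evx cf_shift T_def)
    qed
    show ?thesis
    proof (cases "\<forall>p\<in>ps. \<exists>k\<le>D. dom p k e")
      case True
      then obtain k where k: "\<And>p. p \<in> ps \<Longrightarrow> k p \<le> D" "\<And>p. p \<in> ps \<Longrightarrow> dom p (k p) e" by metis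
      have k': "dom p (k p) e'" if "p \<in> ps" for p
        unfolding dom_def
      proof (intro allI impI)
        fix i assume i: "i \<le> D" "i \<noteq> k p"
        have "T p (k p) \<otimes> \<pi> [^] M \<otimes> e [^] k p \<preceq> T p i \<otimes> e [^] i" using k(2)[OF that] i by (simp add: dom_def)
        then show "T p (k p) \<otimes> \<pi> [^] M \<otimes> e' [^] k p \<preceq> T p i \<otimes> e' [^] i"
          using cmp[OF that that k(1)[OF that] i(1), of M 0] by simp
      qed
      have 1: "near (T p (k p) \<otimes> e [^] k p) (ev p x)" "near (T p (k p) \<otimes> e' [^] k p) (ev p x')" if "p \<in> ps" for p
        unfolding x x' using dom_near that k(2) k' e0 e'0 by blast+
      have "sim (ev p x) (ev p x')" if "p \<in> ps" for p
      proof -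
        have "sim (ev p x) (T p (k p) \<otimes> e [^] k p)" using near_sim near_sym 1 that by blast
        moreover have "sim (T p (k p) \<otimes> e [^] k p) (T p (k p) \<otimes> e' [^] k p)" by (intro sim_mult sim_pow se sim_refl)
        moreover have "sim (T p (k p) \<otimes> e' [^] k p) (ev p x')" using near_sim 1 that by blast
        ultimately show ?thesis using sim_trans by blast
      qed
      moreover have "ev p x \<preceq> ev q x \<longleftrightarrow> ev p x' \<preceq> ev q x'" if "p \<in> ps" "q \<in> ps" for p q
        using near_le[OF 1(1)[OF that(1)] 1(1)[OF that(2)]] near_le[OF 1(2)[OF that(1)] 1(2)[OF that(2)]]
          cmp0[OF that k(1)[OF that(1)] k(1)[OF that(2)]] by simp
      ultimately show ?thesis by blast
    next
      case False
      \<comment> \<open>Now some polynomial has two terms of nearly equal valuation. The cuts record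
        the difference of these valuations, so it is the same for x and x'; as the two exponents
        differ, this fixes the valuation of x - c.\<close>
      then obtain p where p: "p \<in> ps" "\<And>k. k \<le> D \<Longrightarrow> \<not> dom p k e" by blast
      obtain k where k: "k \<in> {..D}" "\<And>i. i \<in> {..D} \<Longrightarrow> T p k \<otimes> e [^] k \<preceq> T p i \<otimes> e [^] i"
        using finite_min[of "{..D}" "\<lambda>i. T p i \<otimes> e [^] i"] by auto
      obtain i where i: "i \<le> D" "i \<noteq> k" "\<not> T p k \<otimes> \<pi> [^] M \<otimes> e [^] k \<preceq> T p i \<otimes> e [^] i"
        using p(2)[of k] k(1) by (auto simp: dom_def)
      have kD: "k \<le> D" using k(1) by simp
      have "T p i \<otimes> e [^] i \<prec> T p k \<otimes> e [^] k \<otimes> \<pi> [^] M" using i(3) by (simp add: lt_def algebra_simps)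
      then obtain m where m: "m < M" "T p i \<otimes> e [^] i \<approx> T p k \<otimes> e [^] k \<otimes> \<pi> [^] m"
        using discrete[OF k(2)[of i]] i(1) by auto
      then have me: "T p i \<otimes> e [^] i \<approx> T p k \<otimes> \<pi> [^] m \<otimes> e [^] k" by (simp add: algebra_simps)
      then have me': "T p i \<otimes> e' [^] i \<approx> T p k \<otimes> \<pi> [^] m \<otimes> e' [^] k"
        using cmp[OF p(1) p(1) i(1) kD, of 0 m] cmp[OF p(1) p(1) kD i(1), of m 0] m(1) by (simp add: eqv_def)
      have nz: "T p i \<otimes> e [^] i \<noteq> \<zero>" by (rule lt_nonzero) fact
      then have Ti: "T p i \<noteq> \<zero>" by auto
      have Tk: "T p k \<noteq> \<zero>" using me nz by auto
      have "(T p i \<otimes> e [^] i) \<otimes> (T p k \<otimes> \<pi> [^] m \<otimes> e' [^] k) \<approx> (T p k \<otimes> \<pi> [^] m \<otimes> e [^] k) \<otimes> (T p i \<otimes> e' [^] i)"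
        using me eqv_sym[OF me'] by (rule eqv_mult)
      then have "(T p i \<otimes> T p k \<otimes> \<pi> [^] m) \<otimes> (e [^] i \<otimes> e' [^] k) \<approx> (T p i \<otimes> T p k \<otimes> \<pi> [^] m) \<otimes> (e [^] k \<otimes> e' [^] i)"
        by (simp only: F.mult_ac)
      then have ek: "e [^] i \<otimes> e' [^] k \<approx> e [^] k \<otimes> e' [^] i" using Ti Tk by simp
      have ee: "e \<approx> e'"
      proof -
        have *: "a \<approx> b" if "a \<noteq> \<zero>" "b \<noteq> \<zero>" "k < i" "a [^] i \<otimes> b [^] k \<approx> a [^] k \<otimes> b [^] i" for a b and k i :: nat
        proof -
          obtain d where d: "i = k + d" "d > 0" using \<open>k < i\<close> less_imp_add_positive by blast
          have "(a [^] k \<otimes> b [^] k) \<otimes> a [^] d \<approx> (a [^] k \<otimes> b [^] k) \<otimes> b [^] d"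
            using that(4) unfolding d(1) pow_add by (simp only: F.mult_ac)
          then have "a [^] d \<approx> b [^] d" using that(1,2) by simp
          then show ?thesis using d(2) pow_eqv_iff by blast
        qed
        consider "k < i" | "i < k" using i(2) by linarith
        then show ?thesis
        proof cases
          case 1 then show ?thesis using *[OF e0 e'0] ek by blast
        next
          case 2
          have "e [^] k \<otimes> e' [^] i \<approx> e [^] i \<otimes> e' [^] k" using ek by (rule eqv_sym)
          then show ?thesis using *[OF e0 e'0 2] by blast
        qed
      qed
      have ne: "near e e'" using se ee by (rule sim_near)
      define t where "t = x' \<ominus> x"
      have t: "Q \<otimes> e \<preceq> t" "x' = x \<oplus> t" using ne by (simp_all add: near_def t_def x x' algebra_simps)
      have nq: "near (ev q x) (ev q x')" if q: "q \<in> ps" for q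
      proof -
        obtain c' where c': "c' \<in> C" "c' \<in> root_ball q x" using cent[OF q] by blast
        \<comment> \<open>The center \<open>c\<close> is at least as near to \<open>x\<close> as the
          center known to lie in the root ball, so it lies there too. Hence at radius x - c all
          Taylor terms of q at \<open>x\<close> have valuation at least v(q(x)), and a step smaller
          by the factor Q changes q(x) only up to closeness.\<close>
        have "c' \<ominus> x \<preceq> c \<ominus> x" using c(2)[OF c'(1)] by (simp only: le_diff_commute)
        then have "c \<in> root_ball q x" using c'(2) root_ball_closer by blast
        then have rb: "ev q x \<preceq> taylor q x i \<otimes> (c \<ominus> x) [^] i" for i by (rule root_ball_le)
        have ce: "c \<ominus> x \<approx> e" by (simp add: e_def eqv_def le_diff_commute)
        have rbe: "ev q x \<preceq> taylor q x i \<otimes> e [^] i" for i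
        proof -
          note rb[of i]
          also have "taylor q x i \<otimes> (c \<ominus> x) [^] i \<approx> taylor q x i \<otimes> e [^] i" by (intro eqv_mult pow_eqv_mono ce eqv_refl)
          finally show ?thesis .
        qed
        obtain s where s: "shift x q = s" by blast
        have evs: "ev q x' = ev s t" unfolding t(2) taylor_add s ..
        show ?thesis
        proof (cases s)
          case Nil
          then have "ev q x = \<zero>" using cf_shift[of x q 0] by (simp add: s)
          then show ?thesis using evs Nil by simp
        next
          case (Cons s0 r)
          have s0: "s0 = ev q x" using cf_shift[of x q 0] by (simp add: s Cons)
          define w where "w = ev q x \<oslash> e"
          have w: "ev q x = e \<otimes> w" using e0 by (simp add: w_def)
          have "w \<preceq> cf r j \<otimes> e [^] j" for j
          proof -
            have "cf r j = taylor q x (Suc j)" using cf_shift[of x q "Suc j"] by (simp add: s Cons)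
            then have "e \<otimes> w \<preceq> e \<otimes> (cf r j \<otimes> e [^] j)" using rbe[of "Suc j"] by (simp add: w algebra_simps)
            then show ?thesis using e0 by simp
          qed
          moreover have "e \<preceq> t" using lt_imp_le[OF lt_Q[OF e0]] t(1) by (rule le_trans)
          ultimately have "w \<preceq> ev r t \<otimes> e [^] (0::nat)" by (intro le_taylor[OF e0])
          then have "(Q \<otimes> e) \<otimes> w \<preceq> t \<otimes> ev r t" using t(1) by (intro le_mult) auto
          then show ?thesis unfolding near_def evs by (simp add: Cons s0 w algebra_simps)
        qed
      qed
      then have "sim (ev q x) (ev q x')" if "q \<in> ps" for q using that near_sim by blast
      moreover have "ev p x \<preceq> ev q x \<longleftrightarrow> ev p x' \<preceq> ev q x'" if "p \<in> ps" "q \<in> ps" for p q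
        using near_le[OF nq nq] that by blast
      ultimately show ?thesis by blast
    qed
  qed
qed

end

section \<open>Balls and classes modulo powers\<close>

context val_field
begin

lemma eqv_le_cong: "x \<approx> y \<Longrightarrow> x \<preceq> z \<longleftrightarrow> y \<preceq> z" "x \<approx> y \<Longrightarrow> z \<preceq> x \<longleftrightarrow> z \<preceq> y"
  unfolding eqv_def by (meson le_trans)+

lemma ball_comparable:
  assumes "ball B" "ball C" "z \<in> B" "z \<in> C" shows "B \<subseteq> C \<or> C \<subseteq> B"
proof (rule ccontr)
  assume "\<not> ?thesis"
  then obtain b c where bc: "b \<in> B" "b \<notin> C" "c \<in> C" "c \<notin> B" by auto
  have B: "\<And>x y z. x \<in> B \<Longrightarrow> y \<in> B \<Longrightarrow> y \<ominus> x \<preceq> z \<ominus> x \<Longrightarrow> z \<in> B"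
    and C: "\<And>x y z. x \<in> C \<Longrightarrow> y \<in> C \<Longrightarrow> y \<ominus> x \<preceq> z \<ominus> x \<Longrightarrow> z \<in> C"
    using assms(1,2) unfolding ball_def by meson+
  show False using le_total[of "b \<ominus> z" "c \<ominus> z"] B[OF assms(3) bc(1)] C[OF assms(4) bc(3)] bc by auto
qed

lemma ballD: "ball B \<Longrightarrow> x \<in> B \<Longrightarrow> y \<in> B \<Longrightarrow> y \<ominus> x \<preceq> z \<ominus> x \<Longrightarrow> z \<in> B"
  unfolding ball_def by meson

lemma ball_outside: assumes "ball B" "x \<in> B" "y \<in> B" "z \<notin> B" shows "z \<ominus> x \<prec> y \<ominus> x" "z \<ominus> y \<approx> z \<ominus> x"
proof -
  show 1: "z \<ominus> x \<prec> y \<ominus> x" using ballD[OF assms(1,2,3)] assms(4) unfolding lt_def by blast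
  have "(z \<ominus> x) \<ominus> (y \<ominus> x) \<approx> z \<ominus> x" using 1 by (rule eqv_diff)
  moreover have "(z \<ominus> x) \<ominus> (y \<ominus> x) = z \<ominus> y" by (simp add: algebra_simps)
  ultimately show "z \<ominus> y \<approx> z \<ominus> x" by simp
qed

lemma ball_disc: "ball {x. r \<preceq> (x \<ominus> c) \<otimes> q}"
  unfolding ball_def
proof (intro conjI ballI allI impI)
  show "{x. r \<preceq> (x \<ominus> c) \<otimes> q} \<noteq> {}" by (auto intro!: exI[of _ c])
  fix x y z assume *: "x \<in> {x. r \<preceq> (x \<ominus> c) \<otimes> q}" "y \<in> {x. r \<preceq> (x \<ominus> c) \<otimes> q}" "y \<ominus> x \<preceq> z \<ominus> x"
  have "r \<preceq> (y \<ominus> c) \<otimes> q \<ominus> (x \<ominus> c) \<otimes> q" using * by (intro le_diff) auto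
  also have "(y \<ominus> c) \<otimes> q \<ominus> (x \<ominus> c) \<otimes> q = (y \<ominus> x) \<otimes> q" by (simp add: algebra_simps)
  also have "(y \<ominus> x) \<otimes> q \<preceq> (z \<ominus> x) \<otimes> q" using *(3) by (intro le_mult) auto
  finally have "r \<preceq> (z \<ominus> x) \<otimes> q \<oplus> (x \<ominus> c) \<otimes> q" using * by (intro le_add) auto
  also have "(z \<ominus> x) \<otimes> q \<oplus> (x \<ominus> c) \<otimes> q = (z \<ominus> c) \<otimes> q" by (simp add: F.left_diff_distrib diff_add_diff)
  finally show "z \<in> {x. r \<preceq> (x \<ominus> c) \<otimes> q}" by simp
qed

text \<open>The smallest ball containing both points.\<close>

definition join :: "'a \<Rightarrow> 'a \<Rightarrow> 'a set" where
  "join c d = {x. c \<ominus> d \<preceq> x \<ominus> c}"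

lemma join_eq: assumes "c \<ominus> d \<approx> a \<ominus> b" "c \<ominus> d \<preceq> a \<ominus> c" shows "join c d = join a b"
proof -
  have "c \<ominus> d \<preceq> x \<ominus> c \<longleftrightarrow> a \<ominus> b \<preceq> x \<ominus> a" for x
  proof
    assume "c \<ominus> d \<preceq> x \<ominus> c"
    then have "c \<ominus> d \<preceq> (x \<ominus> c) \<ominus> (a \<ominus> c)" using assms(2) by (rule le_diff)
    also have "(x \<ominus> c) \<ominus> (a \<ominus> c) = x \<ominus> a" by (simp add: algebra_simps)
    finally show "a \<ominus> b \<preceq> x \<ominus> a" using eqv_le_cong(1)[OF assms(1)] by simp
  next
    assume "a \<ominus> b \<preceq> x \<ominus> a"
    then have "c \<ominus> d \<preceq> x \<ominus> a" using eqv_le_cong(1)[OF assms(1)] by simp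
    then have "c \<ominus> d \<preceq> (x \<ominus> a) \<oplus> (a \<ominus> c)" using assms(2) by (rule le_add)
    then show "c \<ominus> d \<preceq> x \<ominus> c" by (simp add: diff_add_diff)
  qed
  then show ?thesis by (simp add: join_def)
qed

lemma diff_eqv_commute: "x \<ominus> y \<approx> y \<ominus> x" by (simp add: eqv_def le_diff_commute)

lemma join_commute: "join c d = join d c"
  by (rule join_eq[OF diff_eqv_commute]) (simp add: le_diff_commute)

text \<open>The joins are the branching points and the leaves of a finite tree. A new point
  \<open>c\<close> with nearest old point \<open>d\<close> creates only the ball at \<open>c\<close>
  itself and its join with \<open>d\<close>: a point farther away than \<open>d\<close> has the same
  join with \<open>c\<close> as with \<open>d\<close>.\<close>

lemma card_joins:
  assumes "finite C" shows "finite {join c d | c d. c \<in> C \<and> d \<in> C} \<and> card {join c d | c d. c \<in> C \<and> d \<in> C} \<le> 2 * card C"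
  using assms
proof (induction C)
  case (insert c C)
  define S where "S = {join c d | c d. c \<in> C \<and> d \<in> C}"
  define T where "T = {join a b | a b. a \<in> insert c C \<and> b \<in> insert c C}"
  have "\<exists>d. T \<subseteq> insert (join c c) (insert (join c d) S)"
  proof (cases "C = {}")
    case True
    then show ?thesis by (auto simp: T_def)
  next
    case False
    obtain d where d: "d \<in> C" "\<And>b. b \<in> C \<Longrightarrow> c \<ominus> b \<preceq> c \<ominus> d"
      using finite_max[OF insert.hyps(1) False, of "\<lambda>b. c \<ominus> b"] by blast
    have 1: "join c b \<in> insert (join c d) S" if b: "b \<in> C" for b
    proof (cases "c \<ominus> d \<preceq> c \<ominus> b")
      case True
      then have "c \<ominus> b \<approx> c \<ominus> d" using d(2)[OF b] by (simp add: eqv_def)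
      then have "join c b = join c d" by (rule join_eq) simp
      then show ?thesis by simp
    next
      case False
      then have lt: "c \<ominus> b \<prec> c \<ominus> d" by (simp add: lt_def)
      have "(c \<ominus> b) \<ominus> (c \<ominus> d) \<approx> c \<ominus> b" by (rule eqv_diff[OF lt])
      moreover have "(c \<ominus> b) \<ominus> (c \<ominus> d) = d \<ominus> b" by (simp add: algebra_simps)
      ultimately have "c \<ominus> b \<approx> d \<ominus> b" by (simp add: eqv_sym)
      then have "join c b = join d b" using lt_imp_le[OF lt] by (rule join_eq[OF _ le_diff_commute(1)[THEN iffD1]])
      then show ?thesis using b d(1) by (auto simp: S_def)
    qed
    have "join a b \<in> insert (join c c) (insert (join c d) S)" if "a \<in> insert c C" "b \<in> insert c C" for a b
    proof -
      consider "a = c" "b = c" | "a = c" "b \<in> C" | "b = c" "a \<in> C" | "a \<in> C" "b \<in> C" using \<open>a \<in> _\<close> \<open>b \<in> _\<close> by auto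
      then show ?thesis
      proof cases
        case 2 then show ?thesis using 1[of b] by simp
      next
        case 3 then show ?thesis using 1[of a] join_commute[of a b] by simp
      qed (auto simp: S_def)
    qed
    then show ?thesis by (auto simp: T_def)
  qed
  then obtain d where sub: "T \<subseteq> insert (join c c) (insert (join c d) S)" by blast
  have fS: "finite S" "card S \<le> 2 * card C" using insert.IH by (simp_all add: S_def)
  then have "finite T" using sub finite_subset by blast
  have "card T \<le> card (insert (join c c) (insert (join c d) S))" using sub fS(1) by (intro card_mono) auto
  also have "\<dots> \<le> Suc (Suc (card S))" using fS(1) by (simp add: card_insert_if)
  also have "\<dots> \<le> 2 * card (insert c C)" using fS(2) insert.hyps by simp
  finally show ?case using \<open>finite T\<close> by (simp add: T_def)
qed simp

end

context h_field
begin

text \<open>The ball around \<open>c\<close> whose radius has valuation v(c - d) + m - M. For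
  \<open>m\<close> from 0 to 2 M these are the radii within M of the distance of the two points, the
  range in which neither x - c nor c - d alone determines the class of x - d.\<close>

definition J :: "nat \<Rightarrow> 'a \<Rightarrow> 'a \<Rightarrow> 'a set" where
  "J m c d = {x. (c \<ominus> d) \<otimes> \<pi> [^] m \<preceq> (x \<ominus> c) \<otimes> Q}"

section \<open>Balls with radius close to the distance of two centers\<close>

lemma ball_J: "ball (J m c d)" unfolding J_def by (rule ball_disc)

lemma J_self [simp]: "c \<in> J m c d" by (simp add: J_def)

lemma J_eq: assumes "(c \<ominus> d) \<otimes> \<pi> [^] m \<approx> (a \<ominus> b) \<otimes> \<pi> [^] k" "(c \<ominus> d) \<otimes> \<pi> [^] m \<preceq> (a \<ominus> c) \<otimes> Q"
  shows "J m c d = J k a b"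
proof -
  have "(c \<ominus> d) \<otimes> \<pi> [^] m \<preceq> (x \<ominus> c) \<otimes> Q \<longleftrightarrow> (a \<ominus> b) \<otimes> \<pi> [^] k \<preceq> (x \<ominus> a) \<otimes> Q" for x
  proof
    assume "(c \<ominus> d) \<otimes> \<pi> [^] m \<preceq> (x \<ominus> c) \<otimes> Q"
    then have "(c \<ominus> d) \<otimes> \<pi> [^] m \<preceq> (x \<ominus> c) \<otimes> Q \<ominus> (a \<ominus> c) \<otimes> Q" using assms(2) by (rule le_diff)
    also have "(x \<ominus> c) \<otimes> Q \<ominus> (a \<ominus> c) \<otimes> Q = (x \<ominus> a) \<otimes> Q" by (simp add: algebra_simps)
    finally show "(a \<ominus> b) \<otimes> \<pi> [^] k \<preceq> (x \<ominus> a) \<otimes> Q" using eqv_le_cong(1)[OF assms(1)] by simp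
  next
    assume "(a \<ominus> b) \<otimes> \<pi> [^] k \<preceq> (x \<ominus> a) \<otimes> Q"
    then have "(c \<ominus> d) \<otimes> \<pi> [^] m \<preceq> (x \<ominus> a) \<otimes> Q" using eqv_le_cong(1)[OF assms(1)] by simp
    then have "(c \<ominus> d) \<otimes> \<pi> [^] m \<preceq> (x \<ominus> a) \<otimes> Q \<oplus> (a \<ominus> c) \<otimes> Q" using assms(2) by (rule le_add)
    then show "(c \<ominus> d) \<otimes> \<pi> [^] m \<preceq> (x \<ominus> c) \<otimes> Q" by (simp add: F.left_diff_distrib diff_add_diff)
  qed
  then show ?thesis by (simp add: J_def)
qed

lemma between_J:
  assumes "u \<noteq> \<zero>" "x \<in> J m c d" "x \<notin> J (Suc m) c d" shows "(x \<ominus> c) \<otimes> Q \<approx> (c \<ominus> d) \<otimes> \<pi> [^] m"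
proof -
  have 1: "(c \<ominus> d) \<otimes> \<pi> [^] m \<preceq> (x \<ominus> c) \<otimes> Q" and 2: "(x \<ominus> c) \<otimes> Q \<prec> ((c \<ominus> d) \<otimes> \<pi> [^] m) \<otimes> \<pi>"
    using assms by (auto simp: J_def lt_def F.mult_ac)
  have "\<not> (c \<ominus> d) \<otimes> \<pi> [^] m \<prec> (x \<ominus> c) \<otimes> Q" using 2 unfolding lt_iff_\<pi>[of "(c \<ominus> d) \<otimes> \<pi> [^] m"] by (simp add: lt_def)
  then show ?thesis using 1 by (simp add: eqv_def lt_def)
qed

text \<open>Between two consecutive balls the valuation of x - c is constant, so equality of classes
  improves to closeness.\<close>

lemma same_shell:
  assumes J: "\<And>m. m \<le> 2 * M \<Longrightarrow> x \<in> J m c d \<longleftrightarrow> x' \<in> J m c d"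
    and m: "m < 2 * M" "x \<in> J m c d" "x \<notin> J (Suc m) c d" and sim: "sim (x \<ominus> c) (x' \<ominus> c)"
  shows "x \<ominus> c \<approx> x' \<ominus> c" "Q \<otimes> (x \<ominus> c) \<preceq> x' \<ominus> x"
proof -
  have "x' \<in> J m c d" "x' \<notin> J (Suc m) c d" using J[of m] J[of "Suc m"] m by auto
  then have "(x' \<ominus> c) \<otimes> Q \<approx> (c \<ominus> d) \<otimes> \<pi> [^] m" by (rule between_J[OF Q0])
  from eqv_trans[OF between_J[OF Q0 m(2,3)] eqv_sym[OF this]]
  have "(x \<ominus> c) \<otimes> Q \<approx> (x' \<ominus> c) \<otimes> Q" .
  then show 1: "x \<ominus> c \<approx> x' \<ominus> c" by simp
  have "Q \<otimes> (x \<ominus> c) \<preceq> (x' \<ominus> c) \<ominus> (x \<ominus> c)" using sim_near[OF sim 1] by (simp add: near_def)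
  then show "Q \<otimes> (x \<ominus> c) \<preceq> x' \<ominus> x" by (simp add: algebra_simps)
qed

text \<open>Outside the largest ball \<open>J 0 c d\<close> the difference x - d is close to x - c;
  inside the smallest it is close to c - d. In the shells between them v(x - c) is fixed, and x' is
  so near to \<open>x\<close> that the class of x - d is kept as well; here it matters that
  \<open>d\<close> is not nearer to \<open>x\<close> than \<open>c\<close>.\<close>

lemma sim_transfer:
  assumes J: "\<And>m. m \<le> 2 * M \<Longrightarrow> x \<in> J m c d \<longleftrightarrow> x' \<in> J m c d"
    and sim: "sim (x \<ominus> c) (x' \<ominus> c)" and le: "x \<ominus> d \<preceq> x \<ominus> c"
  shows "sim (x \<ominus> d) (x' \<ominus> d)"
proof -
  have xd: "x \<ominus> d = (x \<ominus> c) \<oplus> (c \<ominus> d)" "x' \<ominus> d = (x' \<ominus> c) \<oplus> (c \<ominus> d)" by (simp_all add: diff_add_diff)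
  consider "x \<notin> J 0 c d" | "x \<in> J (2 * M) c d" | m where "m < 2 * M" "x \<in> J m c d" "x \<notin> J (Suc m) c d"
  proof (cases "x \<in> J 0 c d \<and> x \<notin> J (2 * M) c d")
    case True
    then have "\<exists>k. x \<notin> J k c d" by blast
    define k where "k = (LEAST k. x \<notin> J k c d)"
    have "x \<notin> J k c d" unfolding k_def by (rule LeastI_ex) fact
    moreover have "k \<le> 2 * M" unfolding k_def by (rule Least_le) (use True in blast)
    ultimately have k: "x \<notin> J k c d" "k \<le> 2 * M" by auto
    have "k \<noteq> 0" using k(1) True by (cases "k = 0") auto
    then obtain m where m: "k = Suc m" by (cases k) auto
    then have "m < k" by simp
    then have "x \<in> J m c d" unfolding k_def using not_less_Least by blast
    then show ?thesis using that(3)[of m] k m by simp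
  qed (use that in blast)
  then show ?thesis
  proof cases
    case 1
    then have "x' \<notin> J 0 c d" using J[of 0] by simp
    then have "near (x \<ominus> c) (x \<ominus> d)" "near (x' \<ominus> c) (x' \<ominus> d)"
      using 1 unfolding near_def xd by (auto simp: J_def lt_imp_le not_le F.mult.commute)
    then show ?thesis using sim_trans[OF sim_trans[OF sim_sym[OF near_sim] sim] near_sim] by simp
  next
    case 2
    then have 2: "x \<in> J (2 * M) c d" "x' \<in> J (2 * M) c d" using J[of "2 * M"] by auto
    have "near (c \<ominus> d) (z \<ominus> d)" if "z \<in> J (2 * M) c d" for z
    proof -
      have "((c \<ominus> d) \<otimes> Q) \<otimes> Q \<preceq> (z \<ominus> c) \<otimes> Q" using that by (simp add: J_def mult_2 pow_add Q_def F.mult.assoc)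
      then have "(c \<ominus> d) \<otimes> Q \<preceq> z \<ominus> c" by simp
      moreover have "z \<ominus> c = (z \<ominus> d) \<ominus> (c \<ominus> d)" by (simp add: algebra_simps)
      ultimately show ?thesis by (simp add: near_def F.mult.commute)
    qed
    from sim_trans[OF sim_sym[OF near_sim[OF this[OF 2(1)]]] near_sim[OF this[OF 2(2)]]] show ?thesis .
  next
    case 3
    have "Q \<otimes> (x \<ominus> d) \<preceq> Q \<otimes> (x \<ominus> c)" using le by simp
    also have "Q \<otimes> (x \<ominus> c) \<preceq> x' \<ominus> x" by (rule same_shell(2)[OF J 3 sim])
    also have "x' \<ominus> x = (x' \<ominus> d) \<ominus> (x \<ominus> d)" by (simp add: algebra_simps)
    finally have "near (x \<ominus> d) (x' \<ominus> d)" by (simp add: near_def)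
    then show ?thesis by (rule near_sim)
  qed
qed

text \<open>A point x' of \<open>G\<close> would be as far from \<open>c\<close> as \<open>d\<close>
  is, hence lie in the shell between \<open>J M c d\<close> and \<open>J (Suc M) c d\<close>, and so
  would \<open>x\<close>. Then x' - x is too small to alter the distance from \<open>d\<close>; but
  x' is nearer to \<open>d\<close> than \<open>c\<close> is, whereas \<open>x\<close> is
  not.\<close>

lemma outside_transfer:
  assumes J: "\<And>m. m \<le> 2 * M \<Longrightarrow> x \<in> J m c d \<longleftrightarrow> x' \<in> J m c d"
    and sim: "sim (x \<ominus> c) (x' \<ominus> c)" and le: "x \<ominus> d \<preceq> x \<ominus> c"
    and G: "ball G" "d \<in> G" "c \<notin> G"
  shows "x' \<notin> G"
proof
  assume x': "x' \<in> G"
  have lt: "c \<ominus> d \<prec> x' \<ominus> d" and eq: "c \<ominus> x' \<approx> c \<ominus> d" using ball_outside[OF G(1,2) x' G(3)] by auto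
  have e': "x' \<ominus> c \<approx> c \<ominus> d" using eqv_trans[OF diff_eqv_commute eq] .
  have cd: "c \<ominus> d \<noteq> \<zero>" using lt by (rule lt_nonzero)
  have "(c \<ominus> d) \<otimes> \<pi> [^] M \<preceq> (x' \<ominus> c) \<otimes> Q" unfolding Q_def using e' by (intro le_mult) (auto simp: eqv_def)
  moreover have "\<not> (c \<ominus> d) \<otimes> \<pi> [^] Suc M \<preceq> (x' \<ominus> c) \<otimes> Q"
  proof
    assume "(c \<ominus> d) \<otimes> \<pi> [^] Suc M \<preceq> (x' \<ominus> c) \<otimes> Q"
    also have "(x' \<ominus> c) \<otimes> Q \<approx> (c \<ominus> d) \<otimes> Q" using e' by (intro eqv_mult) auto
    finally show False using cd \<pi>_pow_le_iff[of "Suc M" M] by (simp add: Q_def del: pow_Suc nat_pow_Suc)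
  qed
  ultimately have "x \<in> J M c d" "x \<notin> J (Suc M) c d"
    using J[of M] J[of "Suc M"] M_pos by (auto simp: J_def)
  moreover have "M < 2 * M" using M_pos by simp
  ultimately have sh: "x \<ominus> c \<approx> x' \<ominus> c" "Q \<otimes> (x \<ominus> c) \<preceq> x' \<ominus> x"
    using same_shell[of x c d x' M] J sim by blast+
  have ec: "x \<ominus> c \<approx> c \<ominus> d" using sh(1) e' by (rule eqv_trans)
  have "x \<ominus> d \<preceq> c \<ominus> d" using le ec by (rule le_eqv_trans)
  also have "c \<ominus> d \<prec> Q \<otimes> (c \<ominus> d)" by (rule lt_Q[OF cd])
  also have "Q \<otimes> (c \<ominus> d) \<approx> Q \<otimes> (x \<ominus> c)" using eqv_sym[OF ec] by (intro eqv_mult) auto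
  also have "Q \<otimes> (x \<ominus> c) \<preceq> x' \<ominus> x" by (rule sh(2))
  finally have "(x \<ominus> d) \<oplus> (x' \<ominus> x) \<approx> x \<ominus> d" by (rule eqv_add)
  moreover have "(x \<ominus> d) \<oplus> (x' \<ominus> x) = x' \<ominus> d" by (simp add: algebra_simps)
  ultimately have "x' \<ominus> d \<approx> x \<ominus> d" by simp
  also note \<open>x \<ominus> d \<preceq> c \<ominus> d\<close>
  finally show False using lt by (simp add: lt_def)
qed

text \<open>If \<open>c\<close> is not farther from \<open>d1\<close> than \<open>d2\<close> is, one
  of its distances from the two points equals their mutual distance, and the index is kept.
  Otherwise membership of \<open>c\<close> in the ball forces m \<le> M, and its distance from
  \<open>d1\<close> exceeds that of \<open>d2\<close> by at most M - m steps, so the shifted index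
  stays in range.\<close>

lemma J_recenter:
  assumes "c \<in> J m d1 d2" "m \<le> 2 * M" shows "\<exists>d\<in>{d1, d2}. \<exists>k\<le>2 * M. J m d1 d2 = J k c d"
proof -
  have c: "(d1 \<ominus> d2) \<otimes> \<pi> [^] m \<preceq> (c \<ominus> d1) \<otimes> Q" using assms(1) by (simp add: J_def)
  have same: "J m d1 d2 = J m c d" if "d1 \<ominus> d2 \<approx> c \<ominus> d" for d
    by (rule J_eq) (use that c in \<open>auto intro: eqv_mult\<close>)
  consider "d1 \<ominus> d2 \<approx> c \<ominus> d1" | "d1 \<ominus> d2 \<prec> c \<ominus> d1" | "c \<ominus> d1 \<prec> d1 \<ominus> d2"
    by (auto simp: eqv_def lt_def)
  then show ?thesis
  proof cases
    case 1
    then show ?thesis using same[of d1] assms(2) by blast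
  next
    case 2
    have "(d1 \<ominus> d2) \<oplus> (c \<ominus> d1) \<approx> d1 \<ominus> d2" by (rule eqv_add[OF 2])
    moreover have "(d1 \<ominus> d2) \<oplus> (c \<ominus> d1) = c \<ominus> d2" by (simp add: algebra_simps)
    ultimately have "d1 \<ominus> d2 \<approx> c \<ominus> d2" by (simp add: eqv_sym)
    then show ?thesis using same[of d2] assms(2) by blast
  next
    case 3
    have m: "m \<le> M"
    proof (rule ccontr)
      assume "\<not> m \<le> M"
      then have "\<pi> [^] M \<preceq> \<pi> [^] m" by (simp add: \<pi>_pow_le_iff)
      then have "(d1 \<ominus> d2) \<otimes> Q \<preceq> (d1 \<ominus> d2) \<otimes> \<pi> [^] m" by (simp add: Q_def)
      also note c
      finally have "d1 \<ominus> d2 \<preceq> c \<ominus> d1" by simp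
      then show False using 3 by (simp add: lt_def)
    qed
    have "\<pi> [^] (M - m) \<otimes> \<pi> [^] m = Q" using m by (simp add: Q_def flip: pow_add)
    then have "(d1 \<ominus> d2) \<otimes> \<pi> [^] m \<preceq> ((c \<ominus> d1) \<otimes> \<pi> [^] (M - m)) \<otimes> \<pi> [^] m" using c by (simp add: F.mult.assoc)
    then have "d1 \<ominus> d2 \<preceq> (c \<ominus> d1) \<otimes> \<pi> [^] (M - m)" by simp
    also have "(c \<ominus> d1) \<otimes> \<pi> [^] (M - m) \<prec> (c \<ominus> d1) \<otimes> \<pi> [^] Suc (M - m)"
      using \<pi>_pow_lt[of "M - m" "Suc (M - m)"] lt_nonzero[OF 3] unfolding lt_mult_cancel_left by blast
    finally have "\<exists>j<Suc (M - m). d1 \<ominus> d2 \<approx> (c \<ominus> d1) \<otimes> \<pi> [^] j"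
      by (rule discrete[OF lt_imp_le[OF 3]])
    then obtain j where j: "j \<le> M - m" "d1 \<ominus> d2 \<approx> (c \<ominus> d1) \<otimes> \<pi> [^] j" by (auto simp: less_Suc_eq_le)
    have "(d1 \<ominus> d2) \<otimes> \<pi> [^] m \<approx> (c \<ominus> d1) \<otimes> \<pi> [^] j \<otimes> \<pi> [^] m" by (intro eqv_mult j) auto
    then have "(d1 \<ominus> d2) \<otimes> \<pi> [^] m \<approx> (c \<ominus> d1) \<otimes> \<pi> [^] (j + m)" by (simp only: pow_add F.mult.assoc)
    then have "J m d1 d2 = J (j + m) c d1" by (rule J_eq) (rule c)
    moreover have "j + m \<le> 2 * M" using j(1) m by simp
    ultimately show ?thesis by blast
  qed
qed

text \<open>Such a ball is determined by \<open>m\<close>, by the join of the two points and by the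
  position of \<open>c\<close> in this join modulo Q, measured in units of its radius. The number of
  joins is linear, and the rest takes boundedly many values.\<close>

lemma card_J:
  shows "\<exists>K. \<forall>C. finite C \<longrightarrow> finite {J m c d | m c d. m \<le> 2 * M \<and> c \<in> C \<and> d \<in> C} \<and>
    card {J m c d | m c d. m \<le> 2 * M \<and> c \<in> C \<and> d \<in> C} \<le> K * card C"
proof -
  obtain F where F: "finite F" "\<forall>a\<in>A. \<exists>f\<in>F. Q \<preceq> a \<ominus> f"
    using residue_finite_\<pi>[of M] by (auto simp: residue_finite_def Q_def)
  define K where "K = Suc (2 * M) * (2 * card F)"
  have "finite {J m c d | m c d. m \<le> 2 * M \<and> c \<in> C \<and> d \<in> C} \<and>
    card {J m c d | m c d. m \<le> 2 * M \<and> c \<in> C \<and> d \<in> C} \<le> K * card C" if C: "finite C" for C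
  proof -
    define S where "S = {join c d | c d. c \<in> C \<and> d \<in> C}"
    \<comment> \<open>A reference pair for each join: its first point serves as origin, the
      difference of both as unit of length.\<close>
    define cd where "cd Z = (SOME (c, d). c \<in> C \<and> d \<in> C \<and> join c d = Z)" for Z
    define JJ where "JJ = (\<lambda>(m, Z, f). {x. (fst (cd Z) \<ominus> snd (cd Z)) \<otimes> \<pi> [^] (m::nat) \<preceq>
      (x \<ominus> (fst (cd Z) \<oplus> (fst (cd Z) \<ominus> snd (cd Z)) \<otimes> f)) \<otimes> Q})"
    have S: "finite S" "card S \<le> 2 * card C" using card_joins[OF C] by (simp_all add: S_def)
    have "J m c d \<in> JJ ` ({..2 * M} \<times> S \<times> F)" if mcd: "m \<le> 2 * M" "c \<in> C" "d \<in> C" for m c d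
    proof -
      define Z where "Z = join c d"
      have "case cd Z of (c, d) \<Rightarrow> c \<in> C \<and> d \<in> C \<and> join c d = Z"
        unfolding cd_def by (rule someI[of _ "(c, d)"]) (use mcd in \<open>simp add: Z_def\<close>)
      then obtain z w where zw: "cd Z = (z, w)" "join z w = Z" by (auto split: prod.splits)
      define \<delta> where "\<delta> = z \<ominus> w"
      have "c \<in> join z w" "d \<in> join z w" unfolding zw(2) Z_def by (auto simp: join_def le_diff_commute)
      then have 1: "\<delta> \<preceq> c \<ominus> z" "\<delta> \<preceq> d \<ominus> z" by (auto simp: join_def \<delta>_def)
      have "z \<in> join c d" "w \<in> join c d" using zw(2) Z_def by (auto simp: join_def le_diff_commute)
      then have 2: "c \<ominus> d \<preceq> z \<ominus> c" "c \<ominus> d \<preceq> w \<ominus> c" by (auto simp: join_def)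
      have "\<delta> \<preceq> (c \<ominus> z) \<ominus> (d \<ominus> z)" using 1 by (rule le_diff)
      moreover have "c \<ominus> d \<preceq> (z \<ominus> c) \<ominus> (w \<ominus> c)" using 2 by (rule le_diff)
      ultimately have cd\<delta>: "c \<ominus> d \<approx> \<delta>" by (simp add: eqv_def \<delta>_def algebra_simps)
      obtain t where t: "t \<in> A" "c \<ominus> z = t \<otimes> \<delta>" using 1(1) by (rule leE)
      obtain f where f: "f \<in> F" "Q \<preceq> t \<ominus> f" using F(2) t(1) by blast
      define y where "y = z \<oplus> \<delta> \<otimes> f"
      have cy: "c \<ominus> y = \<delta> \<otimes> (t \<ominus> f)"
      proof -
        have "c \<ominus> y = (c \<ominus> z) \<ominus> \<delta> \<otimes> f" by (simp add: y_def algebra_simps)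
        then show ?thesis unfolding t(2) by (simp add: algebra_simps)
      qed
      have m: "\<pi> [^] m \<preceq> Q \<otimes> Q" unfolding Q_def pow_add[symmetric] using mcd(1) by (simp add: \<pi>_pow_le_iff)
      have "\<delta> \<otimes> \<pi> [^] m \<preceq> \<delta> \<otimes> ((t \<ominus> f) \<otimes> Q)"
        by (rule le_mult[OF le_refl le_trans[OF m le_mult[OF f(2) le_refl]]])
      then have y1: "\<delta> \<otimes> \<pi> [^] m \<preceq> (c \<ominus> y) \<otimes> Q" by (simp add: cy F.mult.assoc)
      have dm: "(c \<ominus> d) \<otimes> \<pi> [^] m \<approx> \<delta> \<otimes> \<pi> [^] m" using cd\<delta> by (intro eqv_mult) auto
      have "(c \<ominus> d) \<otimes> \<pi> [^] m \<preceq> (x \<ominus> c) \<otimes> Q \<longleftrightarrow> \<delta> \<otimes> \<pi> [^] m \<preceq> (x \<ominus> y) \<otimes> Q" for x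
      proof -
        have "(x \<ominus> c) \<otimes> Q \<oplus> (c \<ominus> y) \<otimes> Q = (x \<ominus> y) \<otimes> Q" "(x \<ominus> y) \<otimes> Q \<ominus> (c \<ominus> y) \<otimes> Q = (x \<ominus> c) \<otimes> Q"
          by (simp_all add: algebra_simps)
        then have "\<delta> \<otimes> \<pi> [^] m \<preceq> (x \<ominus> c) \<otimes> Q \<longleftrightarrow> \<delta> \<otimes> \<pi> [^] m \<preceq> (x \<ominus> y) \<otimes> Q"
          using le_add[OF _ y1, of "(x \<ominus> c) \<otimes> Q"] le_diff[OF _ y1, of "(x \<ominus> y) \<otimes> Q"] by auto
        then show ?thesis using eqv_le_cong(1)[OF dm] by simp
      qed
      then have "J m c d = JJ (m, Z, f)" by (simp add: J_def JJ_def zw(1) \<delta>_def y_def)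
      moreover have "Z \<in> S" using mcd by (auto simp: Z_def S_def)
      ultimately show ?thesis using mcd(1) f(1) by (intro image_eqI[of _ _ "(m, Z, f)"]) auto
    qed
    then have sub: "{J m c d | m c d. m \<le> 2 * M \<and> c \<in> C \<and> d \<in> C} \<subseteq> JJ ` ({..2 * M} \<times> S \<times> F)" by blast
    have fin: "finite (JJ ` ({..2 * M} \<times> S \<times> F))" using S(1) F(1) by simp
    have "card {J m c d | m c d. m \<le> 2 * M \<and> c \<in> C \<and> d \<in> C} \<le> card (JJ ` ({..2 * M} \<times> S \<times> F))"
      by (rule card_mono[OF fin sub])
    also have "\<dots> \<le> card ({..2 * M} \<times> S \<times> F)" using S(1) F(1) by (intro card_image_le) simp
    also have "\<dots> = Suc (2 * M) * (card S * card F)" by (simp add: card_cartesian_product)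
    also have "\<dots> \<le> Suc (2 * M) * ((2 * card C) * card F)" using S(2) by (intro mult_le_mono) auto
    also have "\<dots> = K * card C" by (simp add: K_def algebra_simps)
    finally show ?thesis using finite_subset[OF sub fin] by blast
  qed
  then show ?thesis by blast
qed

text \<open>The hypothesis leaves finitely many valuations modulo \<open>n\<close>-th powers, and
  units are classified by their residues modulo Q. The products of the two kinds of representatives
  cover all classes.\<close>

lemma finite_index:
  assumes "\<And>x. x \<noteq> \<zero> \<Longrightarrow> \<exists>y i. y \<noteq> \<zero> \<and> i < n \<and> x \<approx> y [^] n \<otimes> \<pi> [^] (i::nat)"
  shows "\<exists>\<Lambda>. finite \<Lambda> \<and> \<zero> \<notin> \<Lambda> \<and> (\<forall>x. x \<noteq> \<zero> \<longrightarrow> (\<exists>l\<in>\<Lambda>. sim l x))"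
proof -
  obtain F where F: "finite F" "\<forall>a\<in>A. \<exists>f\<in>F. Q \<preceq> a \<ominus> f"
    using residue_finite_\<pi>[of M] by (auto simp: residue_finite_def Q_def)
  define \<Lambda> where "\<Lambda> = (\<lambda>(i, f). \<pi> [^] (i::nat) \<otimes> f) ` ({..<n} \<times> F) - {\<zero>}"
  have "\<exists>l\<in>\<Lambda>. sim l x" if x: "x \<noteq> \<zero>" for x
  proof -
    obtain y i where yi: "y \<noteq> \<zero>" "i < n" "x \<approx> y [^] n \<otimes> \<pi> [^] i" using assms[OF x] by blast
    define z where "z = y [^] n \<otimes> \<pi> [^] i"
    have z0: "z \<noteq> \<zero>" using yi(1) by (simp add: z_def)
    define u where "u = x \<oslash> z"
    have xu: "x = u \<otimes> z" using z0 by (simp add: u_def)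
    then have "u \<otimes> z \<approx> \<one> \<otimes> z" using yi(3) by (simp add: z_def)
    then have u1: "u \<approx> \<one>" using z0 eqv_mult_cancel_right[of u z \<one>] by blast
    then have "u \<in> A" by (simp add: eqv_def one_le_iff)
    then obtain f where f: "f \<in> F" "Q \<preceq> u \<ominus> f" using F(2) by blast
    have "Q \<otimes> u \<approx> Q \<otimes> \<one>" using u1 by (intro eqv_mult) auto
    then have "Q \<otimes> u \<approx> Q" by simp
    then have "Q \<otimes> u \<preceq> u \<ominus> f" using f(2) by (rule eqv_le_trans)
    then have "Q \<otimes> u \<preceq> f \<ominus> u" by (simp only: le_diff_commute)
    then have nuf: "near u f" by (simp add: near_def)
    have "u \<noteq> \<zero>" using u1 by auto
    then have f0: "f \<noteq> \<zero>" using near_eqv[OF nuf] by auto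
    have "sim (\<pi> [^] i \<otimes> f) (y [^] n \<otimes> (\<pi> [^] i \<otimes> f))"
    proof -
      have "H (y [^] n)" unfolding H_def using yi(1) near_refl by blast
      then show ?thesis unfolding sim_def by blast
    qed
    moreover have "sim (y [^] n \<otimes> (\<pi> [^] i \<otimes> f)) x"
    proof -
      have "near (z \<otimes> f) (z \<otimes> u)" using near_sym[OF nuf] by (intro near_mult) auto
      then show ?thesis by (intro near_sim) (simp add: z_def xu F.mult_ac)
    qed
    ultimately have "sim (\<pi> [^] i \<otimes> f) x" by (rule sim_trans)
    moreover have "(\<lambda>(i, f). \<pi> [^] i \<otimes> f) (i, f) \<in> (\<lambda>(i, f). \<pi> [^] (i::nat) \<otimes> f) ` ({..<n} \<times> F)"
      by (rule imageI) (simp add: yi(2) f(1))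
    then have "\<pi> [^] i \<otimes> f \<in> \<Lambda>" unfolding \<Lambda>_def using f0 by simp
    ultimately show ?thesis by blast
  qed
  moreover have "finite \<Lambda>" unfolding \<Lambda>_def using F(1) by (intro finite_Diff finite_imageI finite_SigmaI) simp_all
  moreover have "\<zero> \<notin> \<Lambda>" by (simp add: \<Lambda>_def)
  ultimately show ?thesis by blast
qed

end

section \<open>Cells on the line\<close>

text \<open>The data for the line: centers \<open>cen j b\<close>, balls \<open>g l b\<close>, and
  representatives of the classes. The whole line and the singletons of the centers are among the
  balls, so that around a center there is always a ball containing a given point and, unless the
  point is that center, one omitting it.\<close>

locale cell_family = h_field +
  fixes cen :: "nat \<Rightarrow> 'b \<Rightarrow> 'a" and N :: nat and g :: "nat \<Rightarrow> 'b \<Rightarrow> 'a set" and L :: nat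
    and rep :: "nat \<Rightarrow> 'a" and r :: nat
  assumes ball_g: "l < L \<Longrightarrow> ball (g l b)"
    and center_in_g: "l < L \<Longrightarrow> \<exists>j<N. cen j b \<in> g l b"
    and singleton_g: "j < N \<Longrightarrow> \<exists>l<L. \<forall>b. g l b = {cen j b}"
    and UNIV_g: "\<exists>l<L. \<forall>b. g l b = UNIV"
    and reps: "x \<noteq> \<zero> \<Longrightarrow> \<exists>i<r. sim (rep i) x"
begin

definition Idx :: "(nat + nat \<times> nat) set" where
  "Idx = Inl ` {..<L} \<union> Inr ` ({..2 * M} \<times> {..<N})"

text \<open>The balls relevant to a cell with center \<open>c\<close>: besides the balls
  \<open>g l b\<close>, those around \<open>c\<close> with radius comparable to the distance from a
  center of \<open>b\<close>.\<close>

fun U :: "'a \<Rightarrow> nat + nat \<times> nat \<Rightarrow> 'b \<Rightarrow> 'a set" where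
  "U c (Inl l) b = g l b"
| "U c (Inr (m, j)) b = J m c (cen j b)"

text \<open>The condition concerns one \<open>b\<close> at a time, because a distal cell
  decomposition excludes cells by single elements of the parameter set. Its conjunction over all
  these elements says that no relevant ball lies strictly between \<open>W\<close> and
  \<open>V\<close>.\<close>

definition consecutive :: "'a \<Rightarrow> 'a set \<Rightarrow> 'a set \<Rightarrow> 'b \<Rightarrow> bool" where
  "consecutive c V W b \<longleftrightarrow> c \<in> V \<and> c \<in> W \<and> W \<subset> V \<and> (\<forall>i\<in>Idx. \<not> (c \<in> U c i b \<and> W \<subset> U c i b \<and> U c i b \<subset> V))"

definition cell :: "'a \<Rightarrow> 'a set \<Rightarrow> 'a set \<Rightarrow> nat \<Rightarrow> 'a set" where
  "cell c V W s = {x. x \<in> V \<and> x \<notin> W \<and> sim (rep s) (x \<ominus> c)}"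

definition same :: "'b \<Rightarrow> 'a \<Rightarrow> 'a \<Rightarrow> bool" where
  "same b x y \<longleftrightarrow> (\<forall>l<L. x \<in> g l b \<longleftrightarrow> y \<in> g l b) \<and> (\<forall>j<N. sim (x \<ominus> cen j b) (y \<ominus> cen j b))"

definition cells1 :: "'b set \<Rightarrow> 'a set set" where
  "cells1 B = {cell (cen j b1) (U (cen j b1) u b2) (U (cen j b1) w b3) s | j u w s b1 b2 b3.
     j < N \<and> u \<in> Idx \<and> w \<in> Idx \<and> s < r \<and> b1 \<in> B \<and> b2 \<in> B \<and> b3 \<in> B \<and>
     (\<forall>b\<in>B. consecutive (cen j b1) (U (cen j b1) u b2) (U (cen j b1) w b3) b)}"

lemma finite_Idx: "finite Idx" by (simp add: Idx_def)

lemma ball_U: "i \<in> Idx \<Longrightarrow> ball (U c i b)"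
  by (auto simp: Idx_def ball_g ball_J)

section \<open>The chain of balls around a center\<close>

definition centers_of :: "'b set \<Rightarrow> 'a set" where
  "centers_of B = {cen j b | j b. j < N \<and> b \<in> B}"

definition balls_at :: "'b set \<Rightarrow> 'a \<Rightarrow> 'a set set" where
  "balls_at B c = {U c i b | i b. i \<in> Idx \<and> b \<in> B \<and> c \<in> U c i b}"

lemma balls_atE: assumes "V \<in> balls_at B c" obtains i b where "i \<in> Idx" "b \<in> B" "c \<in> U c i b" "V = U c i b"
  using assms unfolding balls_at_def by blast

lemma balls_at_ball: "V \<in> balls_at B c \<Longrightarrow> ball V \<and> c \<in> V"
  using ball_U by (auto simp: balls_at_def)

lemma balls_at_chain: assumes "V \<in> balls_at B c" "W \<in> balls_at B c" shows "V \<subseteq> W \<or> W \<subseteq> V"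
  using ball_comparable[of V W c] balls_at_ball assms by blast

lemma J_balls_at: assumes "m \<le> 2 * M" "d \<in> centers_of B" shows "J m c d \<in> balls_at B c"
proof -
  obtain j b where "j < N" "b \<in> B" "d = cen j b" using assms(2) by (auto simp: centers_of_def)
  then have "Inr (m, j) \<in> Idx" "J m c d = U c (Inr (m, j)) b" "c \<in> U c (Inr (m, j)) b"
    using assms(1) by (auto simp: Idx_def)
  then show ?thesis using \<open>b \<in> B\<close> unfolding balls_at_def by blast
qed

lemma g_balls_at: assumes "l < L" "b \<in> B" "c \<in> g l b" shows "g l b \<in> balls_at B c"
proof -
  have "Inl l \<in> Idx" "g l b = U c (Inl l) b" using assms by (auto simp: Idx_def)
  then show ?thesis using assms(2,3) unfolding balls_at_def by fastforce
qed

lemma balls_at_cases: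
  assumes "V \<in> balls_at B c"
  obtains l b where "l < L" "b \<in> B" "V = g l b" "c \<in> V" | m d where "m \<le> 2 * M" "d \<in> centers_of B" "V = J m c d"
proof -
  obtain i b where i: "i \<in> Idx" "b \<in> B" "c \<in> U c i b" "V = U c i b" using assms by (rule balls_atE)
  from i(1) consider l where "i = Inl l" "l < L" | m j where "i = Inr (m, j)" "m \<le> 2 * M" "j < N"
    by (auto simp: Idx_def)
  then show ?thesis
  proof cases
    case 1 then show ?thesis using that(1)[of l b] i by simp
  next
    case 2
    then have "cen j b \<in> centers_of B" using i(2) unfolding centers_of_def by blast
    then show ?thesis using that(2)[of m "cen j b"] 2 i(4) by simp
  qed
qed

lemma finite_centers_of: "finite B \<Longrightarrow> finite (centers_of B) \<and> card (centers_of B) \<le> N * card B"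
proof -
  assume B: "finite B"
  have eq: "centers_of B = (\<lambda>(j, b). cen j b) ` ({..<N} \<times> B)" by (auto simp: centers_of_def)
  have "card ((\<lambda>(j, b). cen j b) ` ({..<N} \<times> B)) \<le> card ({..<N} \<times> B)" using B by (intro card_image_le) simp
  then show ?thesis using B unfolding eq by (simp add: card_cartesian_product)
qed

lemma finite_balls_at: assumes "finite B" shows "finite (balls_at B c)"
proof -
  have "balls_at B c \<subseteq> (\<lambda>(i, b). U c i b) ` (Idx \<times> B)" unfolding balls_at_def by auto
  then show ?thesis using finite_Idx assms by (meson finite_SigmaI finite_imageI finite_subset)
qed

text \<open>The balls around a center do not depend on the choice of the center in them. This is what makes
  the number of cells linear in the number of parameters.\<close>

lemma balls_at_recenter:
  assumes "V \<in> balls_at B c" "d \<in> centers_of B" "c \<in> centers_of B" "d \<in> V" shows "V \<in> balls_at B d"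
  using assms(1)
proof (cases rule: balls_at_cases)
  case (1 l b)
  then show ?thesis using g_balls_at assms(4) by blast
next
  case (2 m a)
  have "d \<in> J m c a" using 2 assms(4) by simp
  from J_recenter[OF this 2(1)] obtain d' k where "d' \<in> {c, a}" "k \<le> 2 * M" "J m c a = J k d d'" by blast
  moreover have "d' \<in> centers_of B" using \<open>d' \<in> {c, a}\<close> assms(3) 2(2) by auto
  ultimately show ?thesis using J_balls_at[of k d' B d] 2(3) by simp
qed

definition succ :: "'b set \<Rightarrow> 'a \<Rightarrow> 'a set \<Rightarrow> 'a set \<Rightarrow> bool" where
  "succ B c V W \<longleftrightarrow> V \<in> balls_at B c \<and> W \<in> balls_at B c \<and> W \<subset> V \<and>
     (\<forall>T\<in>balls_at B c. \<not> (W \<subset> T \<and> T \<subset> V))"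

lemma U_balls_at_iff: assumes "i \<in> Idx" "b \<in> B" shows "U c i b \<in> balls_at B c \<longleftrightarrow> c \<in> U c i b"
proof
  show "U c i b \<in> balls_at B c" if "c \<in> U c i b" using that assms unfolding balls_at_def by blast
qed (simp add: balls_at_ball)

lemma consecutive_iff_succ:
  assumes "B \<noteq> {}" "u \<in> Idx" "w \<in> Idx" "b2 \<in> B" "b3 \<in> B"
  shows "(\<forall>b\<in>B. consecutive c (U c u b2) (U c w b3) b) \<longleftrightarrow> succ B c (U c u b2) (U c w b3)"
proof -
  have "U c u b2 \<in> balls_at B c \<longleftrightarrow> c \<in> U c u b2" "U c w b3 \<in> balls_at B c \<longleftrightarrow> c \<in> U c w b3"
    using assms by (simp_all add: U_balls_at_iff)
  moreover have "(\<forall>T\<in>balls_at B c. \<not> (W \<subset> T \<and> T \<subset> V)) \<longleftrightarrow>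
    (\<forall>b\<in>B. \<forall>i\<in>Idx. \<not> (c \<in> U c i b \<and> W \<subset> U c i b \<and> U c i b \<subset> V))" for V W
    unfolding balls_at_def by blast
  moreover have "(\<forall>b\<in>B. P1 \<and> P2 \<and> P3 \<and> P4 b) \<longleftrightarrow> P1 \<and> P2 \<and> P3 \<and> (\<forall>b\<in>B. P4 b)" for P1 P2 P3 P4
    using assms(1) by blast
  ultimately show ?thesis unfolding consecutive_def succ_def by simp
qed

lemma succ_separate:
  assumes "succ B c V W" "x \<in> V - W" "y \<in> V - W" "T \<in> balls_at B c" shows "x \<in> T \<longleftrightarrow> y \<in> T"
proof -
  have "T \<subseteq> W \<or> W \<subset> T" "T \<subset> V \<or> V \<subseteq> T" using balls_at_chain[of T B c W] balls_at_chain[of T B c V] assms(1,4)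
    unfolding succ_def by auto
  then show ?thesis using assms unfolding succ_def by auto
qed

lemma succ_sim:
  assumes s: "succ B c V W" and d: "d \<in> centers_of B" and xy: "x \<in> V - W" "y \<in> V - W"
    and "sim (x \<ominus> c) (y \<ominus> c)" "x \<ominus> d \<preceq> x \<ominus> c"
  shows "sim (x \<ominus> d) (y \<ominus> d)"
  using sim_transfer[OF _ assms(5,6)] succ_separate[OF s xy J_balls_at[OF _ d]] by blast

text \<open>Only for \<open>x\<close> is \<open>c\<close> assumed to be a nearest center. A ball
  \<open>g l b\<close> around \<open>c\<close> cannot separate points of V - W. One that misses
  \<open>c\<close> contains another center, so it cannot contain \<open>x\<close>, to which
  \<open>c\<close> is at least as near; the shells transfer this to \<open>y\<close>.\<close>

lemma cell_same:
  assumes s: "succ B c V W" and xy: "x \<in> V - W" "y \<in> V - W" and sim: "sim (x \<ominus> c) (y \<ominus> c)"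
    and near: "\<And>d. d \<in> centers_of B \<Longrightarrow> x \<ominus> d \<preceq> x \<ominus> c" and b: "b \<in> B"
  shows "same b x y"
  unfolding same_def
proof (intro conjI allI impI)
  fix j assume "j < N"
  then have "cen j b \<in> centers_of B" using b by (auto simp: centers_of_def)
  then show "sim (x \<ominus> cen j b) (y \<ominus> cen j b)" using succ_sim[OF s _ xy sim] near by blast
next
  fix l assume l: "l < L"
  show "x \<in> g l b \<longleftrightarrow> y \<in> g l b"
  proof (cases "c \<in> g l b")
    case True
    then show ?thesis using succ_separate[OF s xy g_balls_at[OF l b]] by blast
  next
    case False
    obtain j where j: "j < N" "cen j b \<in> g l b" using center_in_g[OF l] by blast
    define d where "d = cen j b"
    have d: "d \<in> centers_of B" "d \<in> g l b" using j b by (auto simp: centers_of_def d_def)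
    have "x \<notin> g l b"
    proof
      assume x: "x \<in> g l b"
      have "d \<ominus> x \<preceq> c \<ominus> x" using near[OF d(1)] by (simp only: le_diff_commute)
      then show False using ballD[OF ball_g[OF l] x d(2)] False by blast
    qed
    moreover have "y \<notin> g l b"
    proof (rule outside_transfer[OF _ sim near[OF d(1)] ball_g[OF l] d(2) False])
      show "m \<le> 2 * M \<Longrightarrow> x \<in> J m c d \<longleftrightarrow> y \<in> J m c d" for m
        using succ_separate[OF s xy J_balls_at[OF _ d(1)]] by blast
    qed
    ultimately show ?thesis by blast
  qed
qed

text \<open>Take a nearest center, the smallest of its balls that contains \<open>x\<close> and the
  largest that omits it. As the balls around a center form a chain, these two are
  consecutive.\<close>

lemma cover:
  assumes B: "finite B" "B \<noteq> {}" and x: "x \<notin> centers_of B"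
  obtains j u w s b1 b2 b3 where "j < N" "u \<in> Idx" "w \<in> Idx" "s < r" "b1 \<in> B" "b2 \<in> B" "b3 \<in> B"
    "x \<in> cell (cen j b1) (U (cen j b1) u b2) (U (cen j b1) w b3) s"
    "\<forall>b\<in>B. consecutive (cen j b1) (U (cen j b1) u b2) (U (cen j b1) w b3) b"
    "\<forall>y\<in>cell (cen j b1) (U (cen j b1) u b2) (U (cen j b1) w b3) s. \<forall>b\<in>B. same b x y"
proof -
  obtain b0 where b0: "b0 \<in> B" using B(2) by blast
  obtain l0 where l0: "l0 < L" "\<And>b. g l0 b = UNIV" using UNIV_g by blast
  obtain j0 where "j0 < N" using center_in_g[OF l0(1)] by blast
  then have ne: "centers_of B \<noteq> {}" using b0 unfolding centers_of_def by blast
  have finC: "finite (centers_of B)" using finite_centers_of[OF B(1)] by simp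
  obtain c where c: "c \<in> centers_of B" "\<And>d. d \<in> centers_of B \<Longrightarrow> x \<ominus> d \<preceq> x \<ominus> c"
    using finite_max[OF finC ne, of "\<lambda>d. x \<ominus> d"] by blast
  obtain j b1 where j: "j < N" "b1 \<in> B" "c = cen j b1" using c(1) by (auto simp: centers_of_def)
  have xc: "x \<ominus> c \<noteq> \<zero>" using x c(1) by auto
  define P where "P = {V \<in> balls_at B c. x \<in> V}"
  define R' where "R' = {V \<in> balls_at B c. x \<notin> V}"
  have fin: "finite P" "finite R'" using finite_balls_at[OF B(1)] by (auto simp: P_def R'_def)
  have "g l0 b0 \<in> P" using g_balls_at[OF l0(1) b0, of c] l0(2) by (simp add: P_def)
  then have "P \<noteq> {}" by blast
  then obtain V where V: "V \<in> P" "\<forall>T\<in>P. T \<subseteq> V \<longrightarrow> V = T" using finite_has_minimal[OF fin(1)] by blast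
  obtain l1 where l1: "l1 < L" "\<And>b. g l1 b = {cen j b}" using singleton_g[OF j(1)] by blast
  have "g l1 b1 \<in> R'" using g_balls_at[OF l1(1) j(2), of c] l1(2) xc by (auto simp: R'_def j(3))
  then have "R' \<noteq> {}" by blast
  then obtain W where W: "W \<in> R'" "\<forall>T\<in>R'. W \<subseteq> T \<longrightarrow> W = T" using finite_has_maximal[OF fin(2)] by blast
  have VW: "V \<in> balls_at B c" "x \<in> V" "W \<in> balls_at B c" "x \<notin> W" using V(1) W(1) by (auto simp: P_def R'_def)
  have succ: "succ B c V W"
    unfolding succ_def
  proof (intro conjI ballI notI)
    show "W \<subset> V" using balls_at_chain[OF VW(1,3)] VW by blast
    fix T assume T: "T \<in> balls_at B c" "W \<subset> T \<and> T \<subset> V"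
    then show False using V(2) W(2) unfolding P_def R'_def by (cases "x \<in> T") auto
  qed (use VW in auto)
  obtain u b2 where u: "u \<in> Idx" "b2 \<in> B" "V = U c u b2" using VW(1) by (rule balls_atE)
  obtain w b3 where w: "w \<in> Idx" "b3 \<in> B" "W = U c w b3" using VW(3) by (rule balls_atE)
  obtain s where s: "s < r" "sim (rep s) (x \<ominus> c)" using reps[OF xc] by blast
  have "same b x y" if y: "y \<in> cell c V W s" "b \<in> B" for y b
  proof (rule cell_same[OF succ _ _ _ c(2) y(2)])
    show "sim (x \<ominus> c) (y \<ominus> c)" using sim_trans[OF sim_sym[OF s(2)]] y(1) by (simp add: cell_def)
  qed (use VW y in \<open>auto simp: cell_def\<close>)
  moreover have "x \<in> cell c V W s" using VW s(2) by (simp add: cell_def)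
  moreover have "\<forall>b\<in>B. consecutive c V W b"
    using succ consecutive_iff_succ[OF B(2) u(1) w(1) u(2) w(2)] by (simp add: u w)
  ultimately show ?thesis using that[of j u w s b1 b2 b3] j u w s(1) by blast
qed

lemma card_all_balls:
  "\<exists>K. \<forall>B. finite B \<longrightarrow> finite (\<Union>c\<in>centers_of B. balls_at B c) \<and> card (\<Union>c\<in>centers_of B. balls_at B c) \<le> K * card B"
proof -
  obtain K where K: "\<And>C. finite C \<Longrightarrow> finite {J m c d | m c d. m \<le> 2 * M \<and> c \<in> C \<and> d \<in> C} \<and>
    card {J m c d | m c d. m \<le> 2 * M \<and> c \<in> C \<and> d \<in> C} \<le> K * card C" using card_J by blast
  have "finite (\<Union>c\<in>centers_of B. balls_at B c) \<and> card (\<Union>c\<in>centers_of B. balls_at B c) \<le> (L + K * N) * card B"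
    if B: "finite B" for B
  proof -
    define C where "C = centers_of B"
    have C: "finite C" "card C \<le> N * card B" using finite_centers_of[OF B] by (auto simp: C_def)
    define S1 where "S1 = (\<lambda>(l, b). g l b) ` ({..<L} \<times> B)"
    define S2 where "S2 = {J m c d | m c d. m \<le> 2 * M \<and> c \<in> C \<and> d \<in> C}"
    have sub: "(\<Union>c\<in>C. balls_at B c) \<subseteq> S1 \<union> S2"
    proof
      fix V assume "V \<in> (\<Union>c\<in>C. balls_at B c)"
      then obtain c where c: "c \<in> C" "V \<in> balls_at B c" by blast
      from c(2) show "V \<in> S1 \<union> S2"
      proof (cases rule: balls_at_cases)
        case (1 l b)
        then have "V = (\<lambda>(l, b). g l b) (l, b)" "(l, b) \<in> {..<L} \<times> B" by auto
        then show ?thesis unfolding S1_def by blast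
      next
        case (2 m d)
        then show ?thesis using c(1) unfolding S2_def C_def by blast
      qed
    qed
    have S1: "finite S1" "card S1 \<le> L * card B"
    proof -
      show "finite S1" using B by (simp add: S1_def)
      have "card S1 \<le> card ({..<L} \<times> B)" unfolding S1_def using B by (intro card_image_le) simp
      then show "card S1 \<le> L * card B" by (simp add: card_cartesian_product)
    qed
    have S2: "finite S2" "card S2 \<le> K * card C" using K[OF C(1)] by (simp_all add: S2_def)
    have "card (\<Union>c\<in>C. balls_at B c) \<le> card (S1 \<union> S2)" using S1 S2 by (intro card_mono sub) simp
    also have "\<dots> \<le> card S1 + card S2" by (rule card_Un_le)
    also have "\<dots> \<le> L * card B + K * (N * card B)" using S1(2) S2(2) mult_le_mono2[OF C(2), of K] by linarith
    also have "\<dots> = (L + K * N) * card B" by (simp add: distrib_right)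
    finally show ?thesis using finite_subset[OF sub] S1(1) S2(1) by (simp add: C_def)
  qed
  then show ?thesis by blast
qed

text \<open>On the face of it a cell depends on three parameters. But recentring within
  \<open>W\<close> changes nothing, so \<open>W\<close> determines its successor and may be given a
  fixed center \<open>cn W\<close>. The class seen from the original center is recovered from the
  set of classes that the cell meets as seen from the fixed one. This leaves one ball and one subset
  of \<open>{..<r}\<close>, whence the factor 2^r.\<close>

lemma card_cells1:
  "\<exists>K. \<forall>B. finite B \<and> B \<noteq> {} \<longrightarrow> finite (cells1 B) \<and> card (cells1 B) \<le> K * card B"
proof -
  obtain K where K: "\<And>B. finite B \<Longrightarrow> finite (\<Union>c\<in>centers_of B. balls_at B c) \<and> card (\<Union>c\<in>centers_of B. balls_at B c) \<le> K * card B"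
    using card_all_balls by blast
  have "finite (cells1 B) \<and> card (cells1 B) \<le> (K * 2 ^ r) * card B" if B: "finite B" "B \<noteq> {}" for B
  proof -
    define S where "S = (\<Union>c\<in>centers_of B. balls_at B c)"
    define cn where "cn W = (SOME c. c \<in> centers_of B \<and> c \<in> W)" for W
    define nx where "nx W = (SOME V. succ B (cn W) V W)" for W
    define f where "f = (\<lambda>(W, T). {x. x \<in> nx W \<and> x \<notin> W \<and> (\<exists>s\<in>T. sim (rep s) (x \<ominus> cn W))})"
    have "D \<in> f ` (S \<times> Set.Pow {..<r})" if "D \<in> cells1 B" for D
    proof -
      have "\<exists>j u w s b1 b2 b3. D = cell (cen j b1) (U (cen j b1) u b2) (U (cen j b1) w b3) s \<and>
        j < N \<and> u \<in> Idx \<and> w \<in> Idx \<and> s < r \<and> b1 \<in> B \<and> b2 \<in> B \<and> b3 \<in> B \<and>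
        (\<forall>b\<in>B. consecutive (cen j b1) (U (cen j b1) u b2) (U (cen j b1) w b3) b)"
        using that unfolding cells1_def mem_Collect_eq .
      then obtain j u w s b1 b2 b3 where D: "D = cell (cen j b1) (U (cen j b1) u b2) (U (cen j b1) w b3) s"
        "j < N" "u \<in> Idx" "w \<in> Idx" "s < r" "b1 \<in> B" "b2 \<in> B" "b3 \<in> B"
        "\<forall>b\<in>B. consecutive (cen j b1) (U (cen j b1) u b2) (U (cen j b1) w b3) b"
        by (elim exE conjE)
      define c V W where "c = cen j b1" and "V = U c u b2" and "W = U c w b3"
      have succ: "succ B c V W" using D(9) consecutive_iff_succ[OF B(2) D(3,4,7,8)] by (simp add: c_def V_def W_def)
      have cC: "c \<in> centers_of B" using D(2,6) by (auto simp: centers_of_def c_def)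
      have WS: "V \<in> balls_at B c" "W \<in> balls_at B c" using succ by (auto simp: succ_def)
      have bW: "ball W" "c \<in> W" "ball V" "c \<in> V" using balls_at_ball WS by auto
      define d where "d = cn W"
      have d: "d \<in> centers_of B" "d \<in> W" unfolding d_def cn_def using someI_ex[of "\<lambda>c. c \<in> centers_of B \<and> c \<in> W"] cC bW(2) by blast+
      \<comment> \<open>All balls in question contain \<open>W\<close> and therefore both centers,
        so recentring keeps them in the family.\<close>
      have move: "succ B a V' W" if "succ B a' V' W" "a \<in> centers_of B" "a' \<in> centers_of B" "a \<in> W" for a a' V'
        unfolding succ_def
      proof (intro conjI ballI)
        have V': "W \<subset> V'" using that(1) by (simp add: succ_def)
        show "V' \<in> balls_at B a" "W \<in> balls_at B a"
          using balls_at_recenter[OF _ that(2,3)] that(1,4) V' unfolding succ_def by auto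
        show "W \<subset> V'" by fact
        fix T assume T: "T \<in> balls_at B a"
        show "\<not> (W \<subset> T \<and> T \<subset> V')"
        proof
          assume "W \<subset> T \<and> T \<subset> V'"
          moreover have "a' \<in> W" using that(1) balls_at_ball by (auto simp: succ_def)
          ultimately have "T \<in> balls_at B a'" using balls_at_recenter[OF T that(3,2)] by auto
          then show False using that(1) \<open>W \<subset> T \<and> T \<subset> V'\<close> by (auto simp: succ_def)
        qed
      qed
      have succd: "succ B d V W" by (rule move[OF succ d(1) cC d(2)])
      have "nx W = V"
      proof -
        have "succ B d (nx W) W" unfolding nx_def d_def[symmetric] by (rule someI[of _ V]) (rule succd)
        then have 1: "nx W \<in> balls_at B d" "W \<subset> nx W" "\<not> (W \<subset> V \<and> V \<subset> nx W)" using succd by (auto simp: succ_def)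
        have 2: "V \<in> balls_at B d" "W \<subset> V" "\<not> (W \<subset> nx W \<and> nx W \<subset> V)" using succd 1(1) by (auto simp: succ_def)
        show ?thesis using balls_at_chain[OF 1(1) 2(1)] 1(2,3) 2(2,3) by blast
      qed
      have le: "x \<ominus> c \<preceq> x \<ominus> d" if "x \<notin> W" for x
        using ball_outside(2)[OF bW(1) d(2) bW(2) that] by (simp add: eqv_def)
      \<comment> \<open>Points outside \<open>W\<close> are equally far from \<open>c\<close> and
        \<open>d\<close>; on V - W, equality of classes with respect to one center thus gives
        equality with respect to the other.\<close>
      define T where "T = {t. t < r \<and> (\<exists>x\<in>D. sim (rep t) (x \<ominus> d))}"
      have "D = f (W, T)"
      proof
        show "D \<subseteq> f (W, T)"
        proof
          fix x assume x: "x \<in> D"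
          then have "x \<in> V" "x \<notin> W" using D(1) by (auto simp: cell_def c_def V_def W_def)
          then have "x \<ominus> d \<noteq> \<zero>" using d(2) by auto
          then obtain t where "t < r" "sim (rep t) (x \<ominus> d)" using reps by blast
          then have "t \<in> T" using x by (auto simp: T_def)
          then show "x \<in> f (W, T)" using \<open>x \<in> V\<close> \<open>x \<notin> W\<close> \<open>sim (rep t) (x \<ominus> d)\<close> \<open>nx W = V\<close> by (auto simp: f_def d_def)
        qed
        show "f (W, T) \<subseteq> D"
        proof
          fix x assume "x \<in> f (W, T)"
          then obtain t where x: "x \<in> V" "x \<notin> W" "t \<in> T" "sim (rep t) (x \<ominus> d)"
            using \<open>nx W = V\<close> by (auto simp: f_def d_def)
          then obtain y where y: "y \<in> D" "sim (rep t) (y \<ominus> d)" by (auto simp: T_def)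
          then have y': "y \<in> V" "y \<notin> W" "sim (rep s) (y \<ominus> c)" using D(1) by (auto simp: cell_def c_def V_def W_def)
          have "sim (y \<ominus> d) (x \<ominus> d)" using sim_trans[OF sim_sym[OF y(2)] x(4)] .
          then have "sim (y \<ominus> c) (x \<ominus> c)" using succ_sim[OF succd cC, of y x] x y' le[OF y'(2)] by blast
          then have "sim (rep s) (x \<ominus> c)" using sim_trans[OF y'(3)] by blast
          then show "x \<in> D" using x D(1) by (simp add: cell_def c_def V_def W_def)
        qed
      qed
      moreover have "W \<in> S" using WS(2) cC by (auto simp: S_def)
      moreover have "T \<in> Set.Pow {..<r}" by (auto simp: T_def)
      ultimately show ?thesis by blast
    qed
    then have sub: "cells1 B \<subseteq> f ` (S \<times> Set.Pow {..<r})" by blast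
    have S: "finite S" "card S \<le> K * card B" using K[OF B(1)] by (simp_all add: S_def)
    have fin: "finite (f ` (S \<times> Set.Pow {..<r}))" using S(1) by simp
    have "card (cells1 B) \<le> card (f ` (S \<times> Set.Pow {..<r}))" by (rule card_mono[OF fin sub])
    also have "\<dots> \<le> card (S \<times> Set.Pow {..<r})" using S(1) by (intro card_image_le) simp
    also have "\<dots> = card S * 2 ^ r" by (simp add: card_cartesian_product card_Pow)
    also have "\<dots> \<le> (K * card B) * 2 ^ r" using S(2) by simp
    also have "\<dots> = (K * 2 ^ r) * card B" by simp
    finally show ?thesis using finite_subset[OF sub fin] by blast
  qed
  then show ?thesis by blast
qed

end

section \<open>Definable predicates and functions\<close>

fun rename_tm :: "(nat \<Rightarrow> nat) \<Rightarrow> 'f tm \<Rightarrow> 'f tm" where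
  "rename_tm f (Var i) = Var (f i)"
| "rename_tm f (Fun g ts) = Fun g (map (rename_tm f) ts)"

lemma tm_vars_rename: "tm_vars (rename_tm f t) = f ` tm_vars t"
  by (induction t) auto

lemma is_term_rename: "is_term L (rename_tm f t) = is_term L t"
  by (induction t) auto

lemma eval_tm_rename: "eval_tm M s (rename_tm f t) = eval_tm M (s \<circ> f) t"
proof (induction t)
  case (Fun g ts)
  have "map (eval_tm M s) (map (rename_tm f) ts) = map (eval_tm M (s \<circ> f)) ts"
    unfolding map_map by (rule map_cong[OF refl]) (subst o_apply, rule Fun.IH)
  then show ?case by (simp only: eval_tm.simps rename_tm.simps)
qed simp

lemmas rename_tm = tm_vars_rename is_term_rename eval_tm_rename

lemma eval_tm_cong: "\<forall>i\<in>tm_vars t. s i = s' i \<Longrightarrow> eval_tm M s t = eval_tm M s' t"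
proof (induction t)
  case (Fun f ts)
  have "map (eval_tm M s) ts = map (eval_tm M s') ts"
    by (rule map_cong[OF refl], rule Fun.IH) (use Fun.prems in auto)
  then show ?case by (simp only: eval_tm.simps)
qed simp

lemma sat_cong_aux: "\<forall>i\<in>free_vars \<phi>. s i = s' i \<Longrightarrow> sat M s \<phi> = sat M s' \<phi>"
proof (induction \<phi> arbitrary: s s')
  case (Eq t u)
  then show ?case using eval_tm_cong[of t s s' M] eval_tm_cong[of u s s' M] by simp
next
  case (Rel r ts)
  have "map (eval_tm M s) ts = map (eval_tm M s') ts"
    by (rule map_cong[OF refl], rule eval_tm_cong) (use Rel in auto)
  then show ?case by (simp only: sat.simps)
next
  case (Conj \<phi> \<psi>)
  have "sat M s \<phi> = sat M s' \<phi>" by (rule Conj.IH(1)) (use Conj.prems in simp)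
  moreover have "sat M s \<psi> = sat M s' \<psi>" by (rule Conj.IH(2)) (use Conj.prems in simp)
  ultimately show ?case by simp
next
  case (Ex i \<phi>)
  have "sat M (s(i := a)) \<phi> = sat M (s'(i := a)) \<phi>" for a
    by (rule Ex.IH) (use Ex.prems in auto)
  then show ?case by simp
next
  case (Neg \<phi>)
  have "sat M s \<phi> = sat M s' \<phi>" by (rule Neg.IH) (use Neg.prems in simp)
  then show ?case by simp
qed

lemma sat_cong: "(\<And>i. i \<in> free_vars \<phi> \<Longrightarrow> s i = s' i) \<Longrightarrow> sat M s \<phi> = sat M s' \<phi>"
  by (rule sat_cong_aux) blast

lemma finite_tm_vars: "finite (tm_vars t)" by (induction t) auto

lemma finite_free_vars: "finite (free_vars \<phi>)" by (induction \<phi>) (auto simp: finite_tm_vars)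

text \<open>The renaming need not be injective. Below a quantifier the bound variable is sent to a
  fresh one, so that nothing is captured.\<close>

lemma rename_fm:
  fixes \<phi> :: "('f, 'r) fm"
  assumes "is_fm L \<phi>"
  shows "\<exists>\<phi>'. is_fm L \<phi>' \<and> free_vars \<phi>' \<subseteq> f ` free_vars \<phi> \<and> (\<forall>s. sat M s \<phi>' \<longleftrightarrow> sat M (s \<circ> f) \<phi>)"
  using assms
proof (induction \<phi> arbitrary: f)
  case (Eq t u)
  show ?case by (rule exI[of _ "Eq (rename_tm f t) (rename_tm f u)"]) (use Eq in \<open>auto simp: rename_tm comp_def\<close>)
next
  case (Rel r ts)
  show ?case by (rule exI[of _ "Rel r (map (rename_tm f) ts)"]) (use Rel in \<open>auto simp: rename_tm comp_def\<close>)
next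
  case (Neg \<phi>)
  have "is_fm L \<phi>" using Neg.prems by simp
  from Neg.IH[OF this, of f] obtain \<phi>' where "is_fm L \<phi>'" "free_vars \<phi>' \<subseteq> f ` free_vars \<phi>" "\<forall>s. sat M s \<phi>' \<longleftrightarrow> sat M (s \<circ> f) \<phi>"
    by blast
  then show ?case by (intro exI[of _ "Neg \<phi>'"]) (simp add: comp_def)
next
  case (Conj \<phi> \<psi>)
  have fm: "is_fm L \<phi>" "is_fm L \<psi>" using Conj.prems by auto
  from Conj.IH(1)[OF fm(1), of f] obtain \<phi>' where \<phi>': "is_fm L \<phi>'" "free_vars \<phi>' \<subseteq> f ` free_vars \<phi>" "\<forall>s. sat M s \<phi>' \<longleftrightarrow> sat M (s \<circ> f) \<phi>"
    by blast
  from Conj.IH(2)[OF fm(2), of f] obtain \<psi>' where \<psi>': "is_fm L \<psi>'" "free_vars \<psi>' \<subseteq> f ` free_vars \<psi>" "\<forall>s. sat M s \<psi>' \<longleftrightarrow> sat M (s \<circ> f) \<psi>"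
    by blast
  have "free_vars (Conj \<phi>' \<psi>') \<subseteq> f ` free_vars (Conj \<phi> \<psi>)" using \<phi>'(2) \<psi>'(2) by auto
  then show ?case using \<phi>'(1,3) \<psi>'(1,3) by (intro exI[of _ "Conj \<phi>' \<psi>'"]) (simp add: comp_def)
next
  case (Ex i \<phi>)
  obtain j where j: "j \<notin> f ` free_vars \<phi>" using ex_new_if_finite[OF infinite_UNIV_nat, of "f ` free_vars \<phi>"] finite_free_vars[of \<phi>] by auto
  have "is_fm L \<phi>" using Ex.prems by simp
  from Ex.IH[OF this, of "f(i := j)"] obtain \<phi>' where \<phi>': "is_fm L \<phi>'" "free_vars \<phi>' \<subseteq> (f(i := j)) ` free_vars \<phi>"
    "\<forall>s. sat M s \<phi>' \<longleftrightarrow> sat M (s \<circ> f(i := j)) \<phi>" by blast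
  have "sat M s (Ex j \<phi>') \<longleftrightarrow> sat M (s \<circ> f) (Ex i \<phi>)" for s
  proof -
    have "sat M (s(j := a)) \<phi>' \<longleftrightarrow> sat M ((s \<circ> f)(i := a)) \<phi>" for a
      unfolding \<phi>'(3)[rule_format] by (rule sat_cong) (use j in auto)
    then show ?thesis by simp
  qed
  moreover have "free_vars (Ex j \<phi>') \<subseteq> f ` free_vars (Ex i \<phi>)" using \<phi>'(2) by auto
  moreover have "is_fm L (Ex j \<phi>')" using \<phi>'(1) by simp
  ultimately show ?case by (intro exI[of _ "Ex j \<phi>'"] conjI allI)
qed

locale fo =
  fixes L :: "('f, 'r) language" and K :: "('f, 'r, 'a) fo_struct"
begin

text \<open>Definability without parameters as a property of predicates on lists. Compound formulas
  are not written out; their existence follows from closure properties.\<close>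

definition dfn :: "nat \<Rightarrow> ('a list \<Rightarrow> bool) \<Rightarrow> bool" where
  "dfn n P \<longleftrightarrow> (\<exists>\<phi>\<in>fm_in L n. \<forall>a\<in>tuples n. holds K a \<phi> \<longleftrightarrow> P a)"

definition sel :: "nat \<Rightarrow> nat \<Rightarrow> ('a list \<Rightarrow> 'a list) \<Rightarrow> bool" where
  "sel n m f \<longleftrightarrow> (\<exists>is. length is = m \<and> set is \<subseteq> {..<n} \<and> (\<forall>a\<in>tuples n. f a = map (\<lambda>i. a ! i) is))"

text \<open>The value of the function stands at the head of the list, so substituting a function
  amounts to quantifying over the head.\<close>

definition dfun :: "nat \<Rightarrow> ('a list \<Rightarrow> 'a) \<Rightarrow> bool" where
  "dfun n f \<longleftrightarrow> dfn (Suc n) (\<lambda>u. hd u = f (tl u))"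

section \<open>Closure properties of definable predicates\<close>

lemma dfnI: "is_fm L \<phi> \<Longrightarrow> free_vars \<phi> \<subseteq> {..<n} \<Longrightarrow> (\<And>a. length a = n \<Longrightarrow> sat K (\<lambda>i. a ! i) \<phi> \<longleftrightarrow> P a) \<Longrightarrow> dfn n P"
  unfolding dfn_def by (rule bexI[of _ \<phi>]) (auto simp: fm_in_def tuples_def holds_def)

lemma dfnE: assumes "dfn n P"
  obtains \<phi> where "is_fm L \<phi>" "free_vars \<phi> \<subseteq> {..<n}" "\<forall>a. length a = n \<longrightarrow> (sat K (\<lambda>i. a ! i) \<phi> \<longleftrightarrow> P a)"
proof -
  obtain \<phi> where "\<phi> \<in> fm_in L n" "\<forall>a\<in>tuples n. holds K a \<phi> \<longleftrightarrow> P a" using assms unfolding dfn_def by (rule bexE)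
  then show thesis by (intro that[of \<phi>]) (simp_all add: fm_in_def tuples_def holds_def)
qed

lemma dfn_cong: "(\<And>a. length a = n \<Longrightarrow> P a = Q a) \<Longrightarrow> dfn n P \<longleftrightarrow> dfn n Q"
  unfolding dfn_def by (auto simp: tuples_def)

lemma dfn_holds: "\<phi> \<in> fm_in L n \<Longrightarrow> dfn n (\<lambda>a. holds K a \<phi>)"
  unfolding dfn_def by blast

lemma dfn_True: "dfn n (\<lambda>a. True)"
  \<comment> \<open>A closed formula, so that it also serves for \<open>n = 0\<close>.\<close>
  by (rule dfnI[of "Ex 0 (Eq (Var 0) (Var 0))"]) auto

lemma dfn_not: assumes "dfn n P" shows "dfn n (\<lambda>a. \<not> P a)"
proof -
  obtain \<phi> where \<phi>: "is_fm L \<phi>" "free_vars \<phi> \<subseteq> {..<n}" "\<forall>a. length a = n \<longrightarrow> (sat K (\<lambda>i. a ! i) \<phi> \<longleftrightarrow> P a)"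
    using assms by (rule dfnE)
  show ?thesis by (rule dfnI[of "Neg \<phi>"]) (use \<phi> in simp_all)
qed

lemma dfn_conj: assumes "dfn n P" "dfn n Q" shows "dfn n (\<lambda>a. P a \<and> Q a)"
proof -
  obtain \<phi> where \<phi>: "is_fm L \<phi>" "free_vars \<phi> \<subseteq> {..<n}" "\<forall>a. length a = n \<longrightarrow> (sat K (\<lambda>i. a ! i) \<phi> \<longleftrightarrow> P a)"
    using assms(1) by (rule dfnE)
  obtain \<psi> where \<psi>: "is_fm L \<psi>" "free_vars \<psi> \<subseteq> {..<n}" "\<forall>a. length a = n \<longrightarrow> (sat K (\<lambda>i. a ! i) \<psi> \<longleftrightarrow> Q a)"
    using assms(2) by (rule dfnE)
  show ?thesis by (rule dfnI[of "Conj \<phi> \<psi>"]) (use \<phi> \<psi> in simp_all)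
qed

lemma dfn_disj: assumes "dfn n P" "dfn n Q" shows "dfn n (\<lambda>a. P a \<or> Q a)"
proof -
  have "dfn n (\<lambda>a. \<not> (\<not> P a \<and> \<not> Q a))" by (intro dfn_not dfn_conj assms)
  then show ?thesis by (simp only: de_Morgan_conj not_not)
qed

lemma dfn_imp: assumes "dfn n P" "dfn n Q" shows "dfn n (\<lambda>a. P a \<longrightarrow> Q a)"
  unfolding imp_conv_disj by (intro dfn_disj dfn_not assms)

lemma dfn_const: "dfn n (\<lambda>a. p)"
proof (cases p)
  case True
  then show ?thesis using dfn_True by simp
next
  case False
  then show ?thesis using dfn_not[OF dfn_True] by simp
qed

lemma selE: assumes "sel n m f"
  obtains js where "length js = m" "set js \<subseteq> {..<n}" "\<forall>a. length a = n \<longrightarrow> f a = map (\<lambda>i. a ! i) js"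
proof -
  obtain js where "length js = m \<and> set js \<subseteq> {..<n} \<and> (\<forall>a\<in>tuples n. f a = map (\<lambda>i. a ! i) js)"
    using assms unfolding sel_def by (rule exE)
  then show thesis by (intro that[of js]) (simp_all add: tuples_def)
qed

lemma selI: "length js = m \<Longrightarrow> set js \<subseteq> {..<n} \<Longrightarrow> (\<And>a. length a = n \<Longrightarrow> f a = map (\<lambda>i. a ! i) js) \<Longrightarrow> sel n m f"
  unfolding sel_def by (rule exI[of _ js]) (simp add: tuples_def)

lemma dfn_sel: assumes "dfn m P" "sel n m f" shows "dfn n (\<lambda>a. P (f a))"
proof -
  obtain \<phi> where \<phi>: "is_fm L \<phi>" "free_vars \<phi> \<subseteq> {..<m}" "\<forall>a. length a = m \<longrightarrow> (sat K (\<lambda>i. a ! i) \<phi> \<longleftrightarrow> P a)"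
    using assms(1) by (rule dfnE)
  obtain js where js: "length js = m" "set js \<subseteq> {..<n}" "\<forall>a. length a = n \<longrightarrow> f a = map (\<lambda>i. a ! i) js"
    using assms(2) by (rule selE)
  obtain \<phi>' where \<phi>': "is_fm L \<phi>'" "free_vars \<phi>' \<subseteq> (\<lambda>i. js ! i) ` free_vars \<phi>"
    "\<forall>s. sat K s \<phi>' \<longleftrightarrow> sat K (s \<circ> (\<lambda>i. js ! i)) \<phi>" using rename_fm[OF \<phi>(1)] by blast
  show ?thesis
  proof (rule dfnI[OF \<phi>'(1)])
    show "free_vars \<phi>' \<subseteq> {..<n}"
    proof
      fix i assume "i \<in> free_vars \<phi>'"
      then obtain j where "j < m" "i = js ! j" using \<phi>'(2) \<phi>(2) by blast
      then show "i \<in> {..<n}" using js(1,2) nth_mem[of j js] by blast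
    qed
    fix a :: "'a list" assume a: "length a = n"
    have "sat K ((\<lambda>i. a ! i) \<circ> (\<lambda>i. js ! i)) \<phi> \<longleftrightarrow> sat K (\<lambda>i. map (\<lambda>i. a ! i) js ! i) \<phi>"
      by (rule sat_cong) (use \<phi>(2) js(1) in auto)
    then show "sat K (\<lambda>i. a ! i) \<phi>' \<longleftrightarrow> P (f a)"
      using \<phi>'(3) \<phi>(3) js a by (simp add: tuples_def)
  qed
qed

lemma dfn_ex: assumes "dfn (Suc n) (\<lambda>u. P (hd u) (tl u))" shows "dfn n (\<lambda>a. \<exists>x. P x a)"
proof -
  obtain \<phi> where \<phi>: "is_fm L \<phi>" "free_vars \<phi> \<subseteq> {..<Suc n}"
    "\<forall>a. length a = Suc n \<longrightarrow> (sat K (\<lambda>i. a ! i) \<phi> \<longleftrightarrow> P (hd a) (tl a))"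
    using assms by (rule dfnE)
  \<comment> \<open>The predicate has the quantified value at the head, the formula has it at the
    last place \<open>n\<close>; the renaming rotates the variables accordingly.\<close>
  define f where "f i = (case i of 0 \<Rightarrow> n | Suc j \<Rightarrow> j)" for i
  obtain \<phi>' where \<phi>': "is_fm L \<phi>'" "free_vars \<phi>' \<subseteq> f ` free_vars \<phi>" "\<forall>s. sat K s \<phi>' \<longleftrightarrow> sat K (s \<circ> f) \<phi>"
    using rename_fm[OF \<phi>(1)] by blast
  show ?thesis
  proof (rule dfnI[of "Ex n \<phi>'"])
    show "is_fm L (Ex n \<phi>')" using \<phi>'(1) by simp
    have *: "f i = n \<or> f i < n" if "i < Suc n" for i using that by (cases i) (auto simp: f_def)
    show "free_vars (Ex n \<phi>') \<subseteq> {..<n}"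
    proof (intro subsetI)
      fix i assume "i \<in> free_vars (Ex n \<phi>')"
      then obtain j where "j < Suc n" "i = f j" "i \<noteq> n" using \<phi>'(2) \<phi>(2) by auto
      then show "i \<in> {..<n}" using * by blast
    qed
    fix a :: "'a list" assume a: "length a = n"
    have "sat K ((\<lambda>i. a ! i)(n := x)) \<phi>' \<longleftrightarrow> P x a" for x
    proof -
      have "sat K (((\<lambda>i. a ! i)(n := x)) \<circ> f) \<phi> \<longleftrightarrow> sat K (\<lambda>i. (x # a) ! i) \<phi>"
        by (rule sat_cong) (use \<phi>(2) in \<open>auto simp: f_def split: nat.splits\<close>)
      then show ?thesis using \<phi>(3)[rule_format, of "x # a"] \<phi>'(3) a by simp
    qed
    then show "sat K (\<lambda>i. a ! i) (Ex n \<phi>') \<longleftrightarrow> (\<exists>x. P x a)" by simp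
  qed
qed

lemma dfn_all: assumes "dfn (Suc n) (\<lambda>u. P (hd u) (tl u))" shows "dfn n (\<lambda>a. \<forall>x. P x a)"
proof -
  have "dfn n (\<lambda>a. \<not> (\<exists>x. \<not> P x a))" by (intro dfn_not dfn_ex assms)
  then show ?thesis by (simp only: not_ex not_not)
qed

lemma dfn_bex_finite: assumes "finite I" "\<And>i. i \<in> I \<Longrightarrow> dfn n (P i)" shows "dfn n (\<lambda>a. \<exists>i\<in>I. P i a)"
  using assms
proof (induction I rule: finite_induct)
  case empty
  show ?case using dfn_const[of n False] by simp
next
  case (insert i I)
  have "dfn n (\<lambda>a. P i a \<or> (\<exists>i\<in>I. P i a))" by (intro dfn_disj insert.IH insert.prems) simp_all
  then show ?case by simp
qed

lemma dfn_ball_finite: assumes "finite I" "\<And>i. i \<in> I \<Longrightarrow> dfn n (P i)" shows "dfn n (\<lambda>a. \<forall>i\<in>I. P i a)"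
proof -
  have "dfn n (\<lambda>a. \<not> (\<exists>i\<in>I. \<not> P i a))" by (intro dfn_not dfn_bex_finite assms)
  then show ?thesis by (simp only: bex_simps not_not)
qed

section \<open>Rearrangement of coordinates\<close>

lemma sel_id: "sel n n (\<lambda>a. a)"
  unfolding sel_def by (rule exI[of _ "[0..<n]"]) (auto simp: tuples_def intro: nth_equalityI)

lemma sel_append: assumes "sel n m f" "sel n k g" shows "sel n (m + k) (\<lambda>a. f a @ g a)"
proof -
  obtain js where js: "length js = m" "set js \<subseteq> {..<n}" "\<forall>a. length a = n \<longrightarrow> f a = map (\<lambda>i. a ! i) js"
    using assms(1) by (rule selE)
  obtain ks where ks: "length ks = k" "set ks \<subseteq> {..<n}" "\<forall>a. length a = n \<longrightarrow> g a = map (\<lambda>i. a ! i) ks"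
    using assms(2) by (rule selE)
  show ?thesis by (rule selI[of "js @ ks"]) (use js ks in simp_all)
qed

lemma sel_take: assumes "sel n m f" "k \<le> m" shows "sel n k (\<lambda>a. take k (f a))"
proof -
  obtain js where js: "length js = m" "set js \<subseteq> {..<n}" "\<forall>a. length a = n \<longrightarrow> f a = map (\<lambda>i. a ! i) js"
    using assms(1) by (rule selE)
  have "set (take k js) \<subseteq> {..<n}" using js(2) set_take_subset by (rule order_trans[rotated])
  then show ?thesis by (intro selI[of "take k js"]) (use js assms(2) in \<open>simp_all add: take_map\<close>)
qed

lemma sel_drop: assumes "sel n m f" "k + l = m" shows "sel n l (\<lambda>a. drop k (f a))"
proof -
  obtain js where js: "length js = m" "set js \<subseteq> {..<n}" "\<forall>a. length a = n \<longrightarrow> f a = map (\<lambda>i. a ! i) js"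
    using assms(1) by (rule selE)
  have "set (drop k js) \<subseteq> {..<n}" using js(2) set_drop_subset by (rule order_trans[rotated])
  then show ?thesis by (intro selI[of "drop k js"]) (use js assms(2) in \<open>auto simp add: drop_map\<close>)
qed

lemma sel_comp: assumes "sel n m f" "sel m k g" shows "sel n k (\<lambda>a. g (f a))"
proof -
  obtain js where js: "length js = m" "set js \<subseteq> {..<n}" "\<forall>a. length a = n \<longrightarrow> f a = map (\<lambda>i. a ! i) js"
    using assms(1) by (rule selE)
  obtain ks where ks: "length ks = k" "set ks \<subseteq> {..<m}" "\<forall>a. length a = m \<longrightarrow> g a = map (\<lambda>i. a ! i) ks"
    using assms(2) by (rule selE)
  show ?thesis
  proof (rule selI[of "map (\<lambda>i. js ! i) ks"])
    show "set (map (\<lambda>i. js ! i) ks) \<subseteq> {..<n}"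
    proof
      fix x assume "x \<in> set (map (\<lambda>i. js ! i) ks)"
      then obtain i where "i < m" "x = js ! i" using ks(2) by auto
      then show "x \<in> {..<n}" using js(1,2) nth_mem[of i js] by blast
    qed
    fix a :: "'a list" assume a: "length a = n"
    have "g (f a) = map (\<lambda>i. map (\<lambda>i. a ! i) js ! i) ks" using js a by (simp add: ks(3))
    also have "\<dots> = map (\<lambda>i. a ! i) (map (\<lambda>i. js ! i) ks)"
      unfolding map_map o_def by (rule map_cong[OF refl]) (use ks js in auto)
    finally show "g (f a) = map (\<lambda>i. a ! i) (map (\<lambda>i. js ! i) ks)" .
  qed (use ks in simp)
qed

lemma sel_Nil: "sel n 0 (\<lambda>a. [])"
  unfolding sel_def by (rule exI[of _ "[]"]) auto

lemma sel_concat: "(\<And>i. i < k \<Longrightarrow> sel n m (f i)) \<Longrightarrow> sel n (k * m) (\<lambda>a. concat (map (\<lambda>i. f i a) [0..<k]))"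
proof (induction k)
  case (Suc k)
  then have "sel n (k * m + m) (\<lambda>a. concat (map (\<lambda>i. f i a) [0..<k]) @ f k a)" by (intro sel_append) auto
  then show ?case by (simp add: add.commute)
qed (simp add: sel_Nil)

lemma dfn_ex_tuple:
  assumes "dfn (k + n) (\<lambda>u. P (take k u) (drop k u))" shows "dfn n (\<lambda>a. \<exists>x\<in>tuples k. P x a)"
  using assms
proof (induction k arbitrary: P)
  case 0
  have "(\<exists>x\<in>tuples 0. P x a) \<longleftrightarrow> P [] a" for a by (auto simp: tuples_def)
  then show ?case using 0 by simp
next
  case (Suc k)
  define Q where "Q y a \<longleftrightarrow> (\<exists>x. P (x # y) a)" for y a
  have "dfn (Suc (k + n)) (\<lambda>u. P (hd u # take k (tl u)) (drop k (tl u)))"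
    by (rule iffD1[OF dfn_cong, OF _ Suc.prems[simplified]]) (auto simp: length_Suc_conv)
  then have "dfn (k + n) (\<lambda>u. Q (take k u) (drop k u))"
    unfolding Q_def by (rule dfn_ex)
  then have "dfn n (\<lambda>a. \<exists>y\<in>tuples k. Q y a)" by (rule Suc.IH)
  moreover have "(\<exists>x\<in>tuples (Suc k). P x a) \<longleftrightarrow> (\<exists>y\<in>tuples k. Q y a)" for a
    by (auto simp: tuples_def Q_def length_Suc_conv)
  ultimately show ?case by simp
qed

lemma dfn_subst: assumes "dfn (Suc n) (\<lambda>u. P (hd u) (tl u))" "dfun n f" shows "dfn n (\<lambda>a. P (f a) a)"
proof -
  have "dfn n (\<lambda>a. \<exists>x. x = f a \<and> P x a)"
    using assms unfolding dfun_def by (intro dfn_ex dfn_conj)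
  then show ?thesis by simp
qed

lemma sel_tl: "sel (Suc n) n tl"
  using sel_drop[OF sel_id[of "Suc n"], of 1 n] by (simp add: drop_Suc)

lemma sel_nth: "i < n \<Longrightarrow> sel n 1 (\<lambda>a. [a ! i])"
  unfolding sel_def by (rule exI[of _ "[i]"]) auto

section \<open>Definable functions and Skolem functions\<close>

lemma dfn_eq_nth: assumes "i < n" "j < n" shows "dfn n (\<lambda>a. a ! i = a ! j)"
  by (rule dfnI[of "Eq (Var i) (Var j)"]) (use assms in auto)

lemma dfun_nth: assumes "i < n" shows "dfun n (\<lambda>a. a ! i)"
proof -
  have "dfn (Suc n) (\<lambda>a. a ! 0 = a ! Suc i)" by (rule dfn_eq_nth) (use assms in auto)
  then show ?thesis unfolding dfun_def
    by (rule iffD1[OF dfn_cong, rotated]) (use assms in \<open>auto simp: length_Suc_conv\<close>)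
qed

lemma dfun_hd: "dfun (Suc n) hd"
proof -
  have "dfun (Suc n) (\<lambda>a. a ! 0)" by (rule dfun_nth) simp
  then show ?thesis unfolding dfun_def
    by (rule iffD1[OF dfn_cong, rotated]) (auto simp: length_Suc_conv)
qed

lemma dfun_cong: "(\<And>a. length a = n \<Longrightarrow> f a = g a) \<Longrightarrow> dfun n f \<longleftrightarrow> dfun n g"
  unfolding dfun_def by (rule dfn_cong) (auto simp: length_Suc_conv)

lemma dfun_sel: assumes "dfun m f" "sel n m s" shows "dfun n (\<lambda>a. f (s a))"
proof -
  have "sel (Suc n) (1 + m) (\<lambda>u. [u ! 0] @ s (tl u))"
    by (intro sel_append sel_nth sel_comp[OF sel_tl assms(2)]) simp
  from dfn_sel[OF assms(1)[unfolded dfun_def], of "Suc n", simplified, OF this[simplified]]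
  show ?thesis unfolding dfun_def
    by (rule iffD1[OF dfn_cong, rotated]) (auto simp: length_Suc_conv)
qed

lemma dfun_lift: "dfun n f \<Longrightarrow> dfun (Suc n) (\<lambda>u. f (tl u))"
  by (rule dfun_sel[OF _ sel_tl])

lemma dfn_eq: assumes "dfun n f" "dfun n g" shows "dfn n (\<lambda>a. f a = g a)"
  by (rule dfn_subst[OF _ assms(1), of "\<lambda>x a. x = g a"]) (use assms(2) in \<open>simp add: dfun_def\<close>)

lemma dfn_rel2: assumes "dfn 2 (\<lambda>u. P (u ! 0) (u ! 1))" "dfun n f" "dfun n g" shows "dfn n (\<lambda>a. P (f a) (g a))"
proof (rule dfn_subst[OF _ assms(2), of "\<lambda>x a. P x (g a)"], rule dfn_subst[OF _ dfun_lift[OF assms(3)], of "\<lambda>y u. P (hd u) y"])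
  have "sel (Suc (Suc n)) (1 + 1) (\<lambda>u. [u ! 1] @ [u ! 0])" by (intro sel_append sel_nth) simp_all
  then have "sel (Suc (Suc n)) 2 (\<lambda>u. [u ! 1] @ [u ! 0])" by (simp add: numeral_2_eq_2)
  from dfn_sel[OF assms(1) this] show "dfn (Suc (Suc n)) (\<lambda>u. P (hd (tl u)) (hd u))"
    by (rule iffD1[OF dfn_cong, rotated]) (auto simp: length_Suc_conv)
qed

lemma dfun_op1: assumes "dfun 1 (\<lambda>u. F (u ! 0))" "dfun n f" shows "dfun n (\<lambda>a. F (f a))"
  unfolding dfun_def
proof (rule dfn_rel2[OF _ dfun_hd dfun_lift[OF assms(2)], of "\<lambda>x y. x = F y"])
  show "dfn 2 (\<lambda>u. u ! 0 = F (u ! 1))" using assms(1) unfolding dfun_def numeral_2_eq_2 One_nat_def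
    by (rule iffD1[OF dfn_cong, rotated]) (auto simp: length_Suc_conv)
qed

lemma dfun_op2: assumes "dfun 2 (\<lambda>u. F (u ! 0) (u ! 1))" "dfun n f" "dfun n g" shows "dfun n (\<lambda>a. F (f a) (g a))"
proof -
  have "dfn (Suc n) (\<lambda>u. hd u = F (f (tl u)) (g (tl u)))"
  proof (rule dfn_subst[OF _ dfun_lift[OF assms(3)], of "\<lambda>y u. hd u = F (f (tl u)) y"],
      rule dfn_subst[OF _ dfun_lift[OF dfun_lift[OF assms(2)]], of "\<lambda>x u. hd (tl u) = F x (hd u)"])
    have "sel (Suc (Suc (Suc n))) (1 + 1 + 1) (\<lambda>u. ([u ! 2] @ [u ! 0]) @ [u ! 1])" by (intro sel_append sel_nth) simp_all
    then have "sel (Suc (Suc (Suc n))) (Suc 2) (\<lambda>u. ([u ! 2] @ [u ! 0]) @ [u ! 1])" by (simp add: numeral_3_eq_3 numeral_2_eq_2)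
    from dfn_sel[OF assms(1)[unfolded dfun_def] this]
    show "dfn (Suc (Suc (Suc n))) (\<lambda>u. hd (tl (tl u)) = F (hd u) (hd (tl u)))"
      by (rule iffD1[OF dfn_cong, rotated]) (auto simp: length_Suc_conv numeral_2_eq_2)
  qed
  then show ?thesis by (simp add: dfun_def)
qed

lemma dfun_const: "dfun 0 (\<lambda>a. c) \<Longrightarrow> dfun n (\<lambda>a. c)"
  by (rule dfun_sel[OF _ sel_Nil, of "\<lambda>_. c"])

lemma dfun_tuple:
  assumes "dfn (m + n) P" "\<And>b. length b = n \<Longrightarrow> f b \<in> tuples m"
    "\<And>a b. length a = m \<Longrightarrow> length b = n \<Longrightarrow> P (a @ b) \<longleftrightarrow> a = f b" "j < m"
  shows "dfun n (\<lambda>b. f b ! j)"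
proof -
  have "sel (m + Suc n) (m + n) (\<lambda>u. take m u @ drop (Suc m) u)"
    by (intro sel_append sel_take[OF sel_id] sel_drop[OF sel_id]) simp_all
  from dfn_conj[OF dfn_sel[OF assms(1) this] dfn_eq_nth[of m "m + Suc n" j]]
  have "dfn (m + Suc n) (\<lambda>u. P (take m u @ drop (Suc m) u) \<and> u ! m = u ! j)" using assms(4) by simp
  then have "dfn (m + Suc n) (\<lambda>u. P (take m u @ tl (drop m u)) \<and> hd (drop m u) = take m u ! j)"
    by (rule iffD1[OF dfn_cong, rotated]) (use assms(4) in \<open>auto simp: hd_drop_conv_nth drop_Suc tl_drop\<close>)
  then have "dfn (Suc n) (\<lambda>v. \<exists>a\<in>tuples m. P (a @ tl v) \<and> hd v = a ! j)" by (rule dfn_ex_tuple)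
  then show ?thesis unfolding dfun_def
    by (rule iffD1[OF dfn_cong, rotated]) (use assms(2,3) in \<open>auto simp: tuples_def\<close>)
qed

lemma skolem:
  assumes "definable_Skolem_functions L K" "dfn (m + n) P"
  shows "\<exists>f. (\<forall>b\<in>tuples n. f b \<in> tuples m) \<and> (\<forall>j<m. dfun n (\<lambda>b. f b ! j)) \<and>
    (\<forall>b\<in>tuples n. (\<exists>a\<in>tuples m. P (a @ b)) \<longrightarrow> P (f b @ b))"
proof -
  obtain \<phi> where \<phi>: "\<phi> \<in> fm_in L (m + n)" "\<forall>a\<in>tuples (m + n). holds K a \<phi> \<longleftrightarrow> P a"
    using assms(2) unfolding dfn_def by blast
  obtain f where f: "zero_definable_fun L K n m f"
    "\<forall>b\<in>tuples n. (\<exists>a\<in>tuples m. holds K (a @ b) \<phi>) \<longrightarrow> holds K (f b @ b) \<phi>"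
    using assms(1) \<phi>(1) unfolding definable_Skolem_functions_def by blast
  obtain \<gamma> where \<gamma>: "\<gamma> \<in> fm_in L (m + n)" "\<forall>b\<in>tuples n. \<forall>a\<in>tuples m. holds K (a @ b) \<gamma> \<longleftrightarrow> a = f b"
    and ft: "f \<in> tuples n \<rightarrow> tuples m"
    using f(1) unfolding zero_definable_fun_def by blast
  have "dfun n (\<lambda>b. f b ! j)" if "j < m" for j
    by (rule dfun_tuple[OF dfn_holds[OF \<gamma>(1)]]) (use ft \<gamma>(2) that in \<open>auto simp: tuples_def\<close>)
  moreover have "P (f b @ b)" if b: "b \<in> tuples n" "a \<in> tuples m" "P (a @ b)" for a b
  proof -
    have "a @ b \<in> tuples (m + n)" "f b @ b \<in> tuples (m + n)" using b ft by (auto simp: tuples_def)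
    then have "holds K (a @ b) \<phi>" "holds K (f b @ b) \<phi> \<longleftrightarrow> P (f b @ b)" using \<phi>(2) b(3) by auto
    then show ?thesis using f(2) b by auto
  qed
  moreover have "\<forall>b\<in>tuples n. f b \<in> tuples m" using ft by auto
  ultimately show ?thesis by (intro exI[of _ f] conjI ballI impI allI) (erule (1) bspec | erule bexE | assumption)+
qed

end

section \<open>Induction on the dimension\<close>

lemma length_concat_blocks: "\<forall>b\<in>set bs. length b = n \<Longrightarrow> length (concat bs) = length bs * n"
  by (induction bs) auto

lemma block_concat: "\<forall>b\<in>set bs. length b = n \<Longrightarrow> i < length bs \<Longrightarrow> take n (drop (i * n) (concat bs)) = bs ! i"
proof (induction bs arbitrary: i)
  case (Cons b bs)
  then show ?case by (cases i) simp_all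
qed simp

lemma map_image_list: assumes "set ys \<subseteq> f ` B" shows "\<exists>xs. set xs \<subseteq> B \<and> ys = map f xs"
  using assms
proof (induction ys)
  case (Cons y ys)
  then obtain xs where "set xs \<subseteq> B" "ys = map f xs" by auto
  moreover obtain x where "x \<in> B" "y = f x" using Cons.prems by auto
  ultimately show ?case by (intro exI[of _ "x # xs"]) simp
qed simp

definition block :: "nat \<Rightarrow> nat \<Rightarrow> nat \<Rightarrow> 'a list \<Rightarrow> 'a list" where
  "block n k i u = take n (drop (k + i * n) u)"

lemma block_append:
  assumes "length a = k" "\<forall>b\<in>set bs. length b = n" "i < length bs" shows "block n k i (a @ concat bs) = bs ! i"
  using block_concat[OF assms(2,3)] assms(1) by (simp add: block_def)

text \<open>A supply of distinct true sentences. In a distal cell decomposition \<theta> is a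
  function of \<psi>; conjoining such sentences keeps apart cell types that share the formula of the
  cell but not the condition.\<close>

primrec tower :: "nat \<Rightarrow> ('f, 'r) fm" where
  "tower 0 = Ex 0 (Eq (Var 0) (Var 0))"
| "tower (Suc i) = Neg (Neg (tower i))"

lemma tower_inj: "tower i = tower j \<Longrightarrow> i = j"
proof (induction i arbitrary: j)
  case 0
  then show ?case by (cases j) simp_all
next
  case (Suc i)
  then show ?case by (cases j) simp_all
qed

lemma tower: "is_fm L (tower i)" "free_vars (tower i) = {}" "sat K s (tower i)"
  by (induction i) simp_all

context fo
begin

lemma sel_block: assumes "k + Suc i * n \<le> l" shows "sel l n (block n k i)"
proof -
  have "sel l (l - (k + i * n)) (\<lambda>u. drop (k + i * n) u)"
    by (rule sel_drop[OF sel_id]) (use assms in simp)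
  from sel_take[OF this, of n] show ?thesis using assms unfolding block_def by simp
qed

text \<open>The semantic counterpart of \<open>cells\<close>. Cell types are pairs of predicates, so
  the same \<open>F\<close> may occur with several conditions \<open>E\<close>.\<close>

definition scells :: "nat \<Rightarrow> nat \<Rightarrow> (('a list \<Rightarrow> bool) \<times> ('a list \<Rightarrow> bool)) set \<Rightarrow> 'a list set \<Rightarrow> 'a list set set" where
  "scells m k T B = {{x \<in> tuples m. F (x @ concat bs)} | F E bs. (F, E) \<in> T \<and> length bs = k \<and> set bs \<subseteq> B \<and>
     (\<forall>b\<in>B. \<not> E (b @ concat bs))}"

lemma scellsI: "(F, E) \<in> T \<Longrightarrow> length bs = k \<Longrightarrow> set bs \<subseteq> B \<Longrightarrow> (\<And>b. b \<in> B \<Longrightarrow> \<not> E (b @ concat bs)) \<Longrightarrow>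
    {x \<in> tuples m. F (x @ concat bs)} \<in> scells m k T B"
  unfolding scells_def by (intro CollectI exI[of _ F] exI[of _ E] exI[of _ bs] conjI refl ballI) simp_all

lemma scellsE: assumes "D \<in> scells m k T B"
  obtains F E bs where "(F, E) \<in> T" "length bs = k" "set bs \<subseteq> B" "\<forall>b\<in>B. \<not> E (b @ concat bs)"
    "D = {x \<in> tuples m. F (x @ concat bs)}"
  using assms unfolding scells_def by auto

lemma finite_scells: assumes "finite T" "finite B" shows "finite (scells m k T B)"
proof (rule finite_subset)
  show "scells m k T B \<subseteq> (\<lambda>((F, E), bs). {x \<in> tuples m. F (x @ concat bs)}) ` (T \<times> {bs. set bs \<subseteq> B \<and> length bs = k})"
    unfolding scells_def by force
  show "finite ((\<lambda>((F, E), bs). {x \<in> tuples m. F (x @ concat bs)}) ` (T \<times> {bs. set bs \<subseteq> B \<and> length bs = k}))"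
    by (intro finite_imageI finite_cartesian_product assms finite_lists_length_eq)
qed

definition params :: "nat \<Rightarrow> 'a list set \<Rightarrow> bool" where
  "params n B \<longleftrightarrow> finite B \<and> B \<noteq> {} \<and> B \<subseteq> tuples n"

text \<open>Uncrossedness is stated as a single implication because the two points of the cell are
  interchangeable.\<close>

definition decomposes ::
  "nat \<Rightarrow> nat \<Rightarrow> ('a list \<Rightarrow> bool) set \<Rightarrow> nat \<Rightarrow> (('a list \<Rightarrow> bool) \<times> ('a list \<Rightarrow> bool)) set \<Rightarrow> nat \<Rightarrow> bool" where
  "decomposes m n Ps k T r \<longleftrightarrow> finite T \<and> (\<forall>F E. (F, E) \<in> T \<longrightarrow> dfn (m + k * n) F \<and> dfn (n + k * n) E) \<and>
     (\<forall>B x. params n B \<longrightarrow> x \<in> tuples m \<longrightarrow> (\<exists>D\<in>scells m k T B. x \<in> D)) \<and>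
     (\<forall>B D P b x y. params n B \<longrightarrow> D \<in> scells m k T B \<longrightarrow> P \<in> Ps \<longrightarrow> b \<in> B \<longrightarrow> x \<in> D \<longrightarrow> y \<in> D \<longrightarrow> P (x @ b) \<longrightarrow> P (y @ b)) \<and>
     (\<exists>C. \<forall>B. params n B \<longrightarrow> card (scells m k T B) \<le> C * card B ^ r)"

text \<open>A new cell lies over a base cell, with fibres given by \<open>F\<close> and three
  parameters b1, b2, b3. With these fixed, the base is decomposed for the parameters (b, b1, b2, b3)
  of length 4 n, of which there are at most |B|. Uniformity of the predicates \<open>GE\<close> on a
  base cell makes the fibre condition hold over all its points once it holds over one; uniformity of
  \<open>GP\<close> carries a point satisfying P from one fibre to another.\<close>

lemma decomposes_step:
  assumes one: "decomposes 1 (d + n) Ps 3 T1 1"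
    and Ps: "finite Ps" "\<forall>P\<in>Ps. dfn (Suc d + n) P"
    and rest: "\<And>Gs. finite Gs \<Longrightarrow> \<forall>G\<in>Gs. dfn (d + 4 * n) G \<Longrightarrow> \<exists>k T. decomposes d (4 * n) Gs k T r"
  shows "\<exists>k T. decomposes (Suc d) n Ps k T (r + 3)"
proof -
  have T1: "finite T1" "\<And>F E. (F, E) \<in> T1 \<Longrightarrow> dfn (1 + 3 * (d + n)) F" "\<And>F E. (F, E) \<in> T1 \<Longrightarrow> dfn (d + n + 3 * (d + n)) E"
    and cov1: "\<And>B x. params (d + n) B \<Longrightarrow> x \<in> tuples 1 \<Longrightarrow> \<exists>D\<in>scells 1 3 T1 B. x \<in> D"
    and unc1: "\<And>B D P b x y. params (d + n) B \<Longrightarrow> D \<in> scells 1 3 T1 B \<Longrightarrow> P \<in> Ps \<Longrightarrow> b \<in> B \<Longrightarrow> x \<in> D \<Longrightarrow> y \<in> D \<Longrightarrow> P (x @ b) \<Longrightarrow> P (y @ b)"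
    using one unfolding decomposes_def by meson+
  \<comment> \<open>For u = (x, b, b1, b2, b3) these are the parameters of the one-dimensional
    decomposition in the fibre over x: index 0 gives (x, b), the indices 1 to 3 give the parameters
    of the fibre cell.\<close>
  define w where "w j u = take d u @ block n d j u" for j and u :: "'a list"
  have sw: "sel (d + 4 * n) (d + n) (w j)" if "j < 4" for j
  proof -
    have "d + Suc j * n \<le> d + 4 * n" using that mult_le_mono1[of "Suc j" 4 n] by simp
    then show ?thesis unfolding w_def by (intro sel_append sel_take[OF sel_id] sel_block) simp_all
  qed
  define GE where "GE E u \<longleftrightarrow> E (w 0 u @ concat [w 1 u, w 2 u, w 3 u])" for E :: "'a list \<Rightarrow> bool" and u
  define GP where "GP F P u \<longleftrightarrow> (\<exists>z. F ([z] @ concat [w 1 u, w 2 u, w 3 u]) \<and> P ([z] @ w 0 u))" for F P :: "'a list \<Rightarrow> bool" and u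
  have s3: "sel (d + 4 * n) (3 * (d + n)) (\<lambda>u. concat [w 1 u, w 2 u, w 3 u])"
  proof -
    have "sel (d + 4 * n) ((d + n) + ((d + n) + (d + n))) (\<lambda>u. w 1 u @ (w 2 u @ w 3 u))"
      by (intro sel_append sw) simp_all
    moreover have "(d + n) + ((d + n) + (d + n)) = 3 * (d + n)" by simp
    ultimately show ?thesis by simp
  qed
  have dGE: "dfn (d + 4 * n) (GE E)" if "(F, E) \<in> T1" for F E
    unfolding GE_def by (rule dfn_sel[OF T1(3)[OF that]], rule sel_append[OF sw s3]) simp
  have dGP: "dfn (d + 4 * n) (GP F P)" if FE: "(F, E) \<in> T1" and P: "P \<in> Ps" for F E P
  proof -
    have "sel (Suc (d + 4 * n)) (1 + 3 * (d + n)) (\<lambda>v. [v ! 0] @ concat [w 1 (tl v), w 2 (tl v), w 3 (tl v)])"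
      by (intro sel_append sel_nth sel_comp[OF sel_tl s3]) simp
    from dfn_sel[OF T1(2)[OF FE] this]
    have 1: "dfn (Suc (d + 4 * n)) (\<lambda>v. F ([v ! 0] @ concat [w 1 (tl v), w 2 (tl v), w 3 (tl v)]))" .
    have "sel (Suc (d + 4 * n)) (1 + (d + n)) (\<lambda>v. [v ! 0] @ w 0 (tl v))"
      by (intro sel_append sel_nth sel_comp[OF sel_tl sw]) simp_all
    moreover have "dfn (1 + (d + n)) P" using Ps(2) P by simp
    ultimately have 2: "dfn (Suc (d + 4 * n)) (\<lambda>v. P ([v ! 0] @ w 0 (tl v)))" by (rule dfn_sel[rotated])
    have "dfn (Suc (d + 4 * n)) (\<lambda>v. F ([hd v] @ concat [w 1 (tl v), w 2 (tl v), w 3 (tl v)]) \<and> P ([hd v] @ w 0 (tl v)))"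
      by (rule iffD1[OF dfn_cong dfn_conj[OF 1 2]]) (auto simp: length_Suc_conv)
    then show ?thesis unfolding GP_def by (rule dfn_ex)
  qed
  define Gs where "Gs = (\<lambda>(F, E). GE E) ` T1 \<union> (\<lambda>((F, E), P). GP F P) ` (T1 \<times> Ps)"
  have "finite Gs" unfolding Gs_def using T1(1) Ps(1) by simp
  moreover have "\<forall>G\<in>Gs. dfn (d + 4 * n) G" unfolding Gs_def using dGE dGP by auto
  ultimately obtain k T' where dec: "decomposes d (4 * n) Gs k T' r" using rest by meson
  have T': "finite T'" "\<And>F E. (F, E) \<in> T' \<Longrightarrow> dfn (d + k * (4 * n)) F" "\<And>F E. (F, E) \<in> T' \<Longrightarrow> dfn (4 * n + k * (4 * n)) E"
    and cov': "\<And>B x. params (4 * n) B \<Longrightarrow> x \<in> tuples d \<Longrightarrow> \<exists>D\<in>scells d k T' B. x \<in> D"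
    and unc': "\<And>B D P b x y. params (4 * n) B \<Longrightarrow> D \<in> scells d k T' B \<Longrightarrow> P \<in> Gs \<Longrightarrow> b \<in> B \<Longrightarrow> x \<in> D \<Longrightarrow> y \<in> D \<Longrightarrow> P (x @ b) \<Longrightarrow> P (y @ b)"
    using dec unfolding decomposes_def by meson+
  obtain C where C: "\<And>B. params (4 * n) B \<Longrightarrow> card (scells d k T' B) \<le> C * card B ^ r"
    using dec unfolding decomposes_def by meson
  \<comment> \<open>A new cell has the parameters b1, b2, b3 and k further ones; its base cell needs
    each of the latter extended by b1, b2, b3, which is rebuilt here from the flat list.\<close>
  define args where "args c u = concat (map (\<lambda>i. concat [block n c (3 + i) u, block n c 0 u, block n c 1 u, block n c 2 u]) [0..<k])"
    for c and u :: "'a list"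
  have le: "c + Suc j * n \<le> c + (3 + k) * n" if "j < 3 + k" for c j
    using that mult_le_mono1[of "Suc j" "3 + k" n] by simp
  have sb: "sel (c + (3 + k) * n) n (block n c j)" if "j < 3 + k" for c j by (rule sel_block[OF le[OF that]])
  have sargs: "sel (c + (3 + k) * n) (k * (4 * n)) (args c)" for c
    unfolding args_def
  proof (rule sel_concat)
    fix i assume i: "i < k"
    have "sel (c + (3 + k) * n) (n + (n + (n + n))) (\<lambda>u. block n c (3 + i) u @ (block n c 0 u @ (block n c 1 u @ block n c 2 u)))"
      by (intro sel_append sb) (use i in simp_all)
    moreover have "n + (n + (n + n)) = 4 * n" by simp
    ultimately show "sel (c + (3 + k) * n) (4 * n) (\<lambda>u. concat [block n c (3 + i) u, block n c 0 u, block n c 1 u, block n c 2 u])"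
      by simp
  qed
  define ext where "ext b1 b2 b3 b = concat [b, b1, b2, b3]" for b b1 b2 b3 :: "'a list"
  have args: "args c (a @ concat (b1 # b2 # b3 # as)) = concat (map (ext b1 b2 b3) as)"
    if "length a = c" "length as = k" "\<forall>b\<in>set (b1 # b2 # b3 # as). length b = n" for a as b1 b2 b3 c
  proof -
    have "map (\<lambda>i. concat [block n c (3 + i) (a @ concat (b1 # b2 # b3 # as)), block n c 0 (a @ concat (b1 # b2 # b3 # as)),
      block n c 1 (a @ concat (b1 # b2 # b3 # as)), block n c 2 (a @ concat (b1 # b2 # b3 # as))]) [0..<k] = map (ext b1 b2 b3) as"
    proof (rule nth_equalityI)
      fix i assume "i < length (map (\<lambda>i. concat [block n c (3 + i) (a @ concat (b1 # b2 # b3 # as)), block n c 0 (a @ concat (b1 # b2 # b3 # as)),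
      block n c 1 (a @ concat (b1 # b2 # b3 # as)), block n c 2 (a @ concat (b1 # b2 # b3 # as))]) [0..<k])"
      then have i: "i < k" by simp
      have "block n c j (a @ concat (b1 # b2 # b3 # as)) = (b1 # b2 # b3 # as) ! j" if "j < 3 + k" for j
        by (rule block_append) (use that \<open>length a = c\<close> \<open>length as = k\<close> \<open>\<forall>b\<in>set (b1 # b2 # b3 # as). length b = n\<close> in simp_all)
      from this[of "3 + i"] this[of 0] this[of 1] this[of 2]
      show "map (\<lambda>i. concat [block n c (3 + i) (a @ concat (b1 # b2 # b3 # as)), block n c 0 (a @ concat (b1 # b2 # b3 # as)),
      block n c 1 (a @ concat (b1 # b2 # b3 # as)), block n c 2 (a @ concat (b1 # b2 # b3 # as))]) [0..<k] ! i = map (ext b1 b2 b3) as ! i"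
        using i that(2) by (simp add: ext_def del: concat.simps(2)) 
    qed (use that in simp)
    then show ?thesis by (simp only: args_def)
  qed
  define x' where "x' u = take d (drop 1 u)" for u :: "'a list"
  define NF where "NF F F' u \<longleftrightarrow> F' (x' u @ args (Suc d) u) \<and>
    F ([u ! 0] @ concat [x' u @ block n (Suc d) 0 u, x' u @ block n (Suc d) 1 u, x' u @ block n (Suc d) 2 u])"
    for F F' :: "'a list \<Rightarrow> bool" and u
  \<comment> \<open>An element excludes the new cell if it excludes the base cell, or the fibre cell
    over some point of the base cell.\<close>
  define NE where "NE E F' E' u \<longleftrightarrow> E' (concat [take n u, block n n 0 u, block n n 1 u, block n n 2 u] @ args n u) \<or>
    (\<exists>x\<in>tuples d. F' (x @ args n u) \<and>
      E ((x @ take n u) @ concat [x @ block n n 0 u, x @ block n n 1 u, x @ block n n 2 u]))"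
    for E F' E' :: "'a list \<Rightarrow> bool" and u
  define T where "T = (\<lambda>((F, E), (F', E')). (NF F F', NE E F' E')) ` (T1 \<times> T')"
  have NF: "NF F F' ((z # x) @ concat (b1 # b2 # b3 # as)) \<longleftrightarrow> F' (x @ concat (map (ext b1 b2 b3) as)) \<and>
      F ([z] @ concat [x @ b1, x @ b2, x @ b3])"
    if "length x = d" "length as = k" "\<forall>b\<in>set (b1 # b2 # b3 # as). length b = n" for F F' z x b1 b2 b3 as
  proof -
    have "block n (Suc d) j ((z # x) @ concat (b1 # b2 # b3 # as)) = (b1 # b2 # b3 # as) ! j" if "j < 3 + k" for j
      by (rule block_append) (use that \<open>length x = d\<close> \<open>length as = k\<close> \<open>\<forall>b\<in>set (b1 # b2 # b3 # as). length b = n\<close> in simp_all)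
    from this[of 0] this[of 1] this[of 2] args[of "z # x" "Suc d" as b1 b2 b3]
    have eqs: "block n (Suc d) 0 ((z # x) @ concat (b1 # b2 # b3 # as)) = b1" "block n (Suc d) 1 ((z # x) @ concat (b1 # b2 # b3 # as)) = b2"
      "block n (Suc d) 2 ((z # x) @ concat (b1 # b2 # b3 # as)) = b3"
      "args (Suc d) ((z # x) @ concat (b1 # b2 # b3 # as)) = concat (map (ext b1 b2 b3) as)" using that by simp_all
    have "x' ((z # x) @ concat (b1 # b2 # b3 # as)) = x" using that by (simp add: x'_def)
    then show ?thesis unfolding NF_def eqs by simp
  qed
  have NE: "NE E F' E' (b @ concat (b1 # b2 # b3 # as)) \<longleftrightarrow> E' (ext b1 b2 b3 b @ concat (map (ext b1 b2 b3) as)) \<or>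
      (\<exists>x\<in>tuples d. F' (x @ concat (map (ext b1 b2 b3) as)) \<and> E ((x @ b) @ concat [x @ b1, x @ b2, x @ b3]))"
    if "length b = n" "length as = k" "\<forall>b\<in>set (b1 # b2 # b3 # as). length b = n" for E F' E' b b1 b2 b3 as
  proof -
    have "block n n j (b @ concat (b1 # b2 # b3 # as)) = (b1 # b2 # b3 # as) ! j" if "j < 3 + k" for j
      by (rule block_append) (use that \<open>length b = n\<close> \<open>length as = k\<close> \<open>\<forall>b\<in>set (b1 # b2 # b3 # as). length b = n\<close> in simp_all)
    from this[of 0] this[of 1] this[of 2] args[of b n as b1 b2 b3]
    have eqs: "block n n 0 (b @ concat (b1 # b2 # b3 # as)) = b1" "block n n 1 (b @ concat (b1 # b2 # b3 # as)) = b2"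
      "block n n 2 (b @ concat (b1 # b2 # b3 # as)) = b3"
      "args n (b @ concat (b1 # b2 # b3 # as)) = concat (map (ext b1 b2 b3) as)" using that by simp_all
    have "take n (b @ concat (b1 # b2 # b3 # as)) = b" using that by simp
    then show ?thesis unfolding NE_def eqs ext_def by (simp only:)
  qed
  have dNF: "dfn (Suc d + (3 + k) * n) (NF F F')" if "(F, E) \<in> T1" "(F', E') \<in> T'" for F E F' E'
  proof -
    have l: "1 + (d + (3 + k) * n) = Suc d + (3 + k) * n" by simp
    have sx: "sel (Suc d + (3 + k) * n) d x'" unfolding x'_def
      by (rule sel_take[OF sel_drop[OF sel_id l]]) simp
    have "sel (Suc d + (3 + k) * n) (1 + ((d + n) + ((d + n) + (d + n)))) (\<lambda>u. [u ! 0] @ ((x' u @ block n (Suc d) 0 u) @ ((x' u @ block n (Suc d) 1 u) @ (x' u @ block n (Suc d) 2 u))))"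
      by (intro sel_append sel_nth sx sb) simp_all
    moreover have "1 + ((d + n) + ((d + n) + (d + n))) = 1 + 3 * (d + n)" by simp
    ultimately have s: "sel (Suc d + (3 + k) * n) (1 + 3 * (d + n)) (\<lambda>u. [u ! 0] @ concat [x' u @ block n (Suc d) 0 u, x' u @ block n (Suc d) 1 u, x' u @ block n (Suc d) 2 u])"
      by (simp only: concat.simps append_Nil2)
    show ?thesis unfolding NF_def
      by (rule dfn_conj[OF dfn_sel[OF T'(2)[OF that(2)] sel_append[OF sx sargs]] dfn_sel[OF T1(2)[OF that(1)] s]])
  qed
  have dNE: "dfn (n + (3 + k) * n) (NE E F' E')" if "(F, E) \<in> T1" "(F', E') \<in> T'" for F E F' E'
  proof -
    let ?l = "n + (3 + k) * n"
    have "sel ?l (n + (n + (n + n))) (\<lambda>u. take n u @ (block n n 0 u @ (block n n 1 u @ block n n 2 u)))"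
      by (intro sel_append sel_take[OF sel_id] sb) simp_all
    moreover have "n + (n + (n + n)) = 4 * n" by simp
    ultimately have "sel ?l (4 * n) (\<lambda>u. concat [take n u, block n n 0 u, block n n 1 u, block n n 2 u])" by simp
    from dfn_sel[OF T'(3)[OF that(2)] sel_append[OF this sargs]]
    have 1: "dfn ?l (\<lambda>u. E' (concat [take n u, block n n 0 u, block n n 1 u, block n n 2 u] @ args n u))" .
    have d: "sel (d + ?l) ?l (drop d)" by (rule sel_drop[OF sel_id]) simp
    have t: "sel (d + ?l) d (take d)" by (rule sel_take[OF sel_id]) simp
    have b: "sel (d + ?l) (d + n) (\<lambda>u. take d u @ block n n j (drop d u))" if "j < 3 + k" for j
      by (rule sel_append[OF t sel_comp[OF d sb[OF that]]])
    have c: "sel (d + ?l) (d + n) (\<lambda>u. take d u @ take n (drop d u))"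
      by (rule sel_append[OF t sel_take[OF d]]) simp
    have "sel (d + ?l) ((d + n) + ((d + n) + ((d + n) + (d + n)))) (\<lambda>u. (take d u @ take n (drop d u)) @ ((take d u @ block n n 0 (drop d u)) @ ((take d u @ block n n 1 (drop d u)) @ (take d u @ block n n 2 (drop d u)))))"
      by (rule sel_append[OF c sel_append[OF b sel_append[OF b b]]]) simp_all
    moreover have "(d + n) + ((d + n) + ((d + n) + (d + n))) = d + n + 3 * (d + n)" by simp
    ultimately have "sel (d + ?l) (d + n + 3 * (d + n)) (\<lambda>u. (take d u @ take n (drop d u)) @ concat [take d u @ block n n 0 (drop d u), take d u @ block n n 1 (drop d u), take d u @ block n n 2 (drop d u)])"
      by simp
    note 3 = dfn_sel[OF T1(3)[OF that(1)] this]
    have 2: "dfn ?l (\<lambda>u. \<exists>x\<in>tuples d. F' (x @ args n u) \<and> E ((x @ take n u) @ concat [x @ block n n 0 u, x @ block n n 1 u, x @ block n n 2 u]))"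
      by (rule dfn_ex_tuple, rule dfn_conj[OF dfn_sel[OF T'(2)[OF that(2)] sel_append[OF t sel_comp[OF d sargs]]] 3])
    show ?thesis unfolding NE_def by (rule dfn_disj[OF 1 2])
  qed
  have len: "length b = n" if "params n B" "b \<in> B" for b B using that by (auto simp: params_def tuples_def)
  have pext: "params (4 * n) (ext b1 b2 b3 ` B)" if "params n B" "b1 \<in> B" "b2 \<in> B" "b3 \<in> B" for b1 b2 b3 B
    using that len[OF that(1)] by (auto simp: params_def tuples_def ext_def)
  have pfib: "params (d + n) ((\<lambda>b. x @ b) ` B)" if "params n B" "x \<in> tuples d" for x B
    using that len[OF that(1)] by (auto simp: params_def tuples_def)
  have wext: "w 0 (x @ ext b1 b2 b3 b) = x @ b" "concat [w 1 (x @ ext b1 b2 b3 b), w 2 (x @ ext b1 b2 b3 b), w 3 (x @ ext b1 b2 b3 b)] = concat [x @ b1, x @ b2, x @ b3]"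
    if "x \<in> tuples d" "length b = n" "length b1 = n" "length b2 = n" "length b3 = n" for x b b1 b2 b3
  proof -
    have l: "length x = d" using that by (simp add: tuples_def)
    have "block n d j (x @ ext b1 b2 b3 b) = [b, b1, b2, b3] ! j" if "j < 4" for j
      unfolding ext_def by (rule block_append) (use l that \<open>length b = n\<close> \<open>length b1 = n\<close> \<open>length b2 = n\<close> \<open>length b3 = n\<close> in simp_all)
    from this[of 0] this[of 1] this[of 2] this[of 3]
    have eqs: "block n d 0 (x @ ext b1 b2 b3 b) = b" "block n d 1 (x @ ext b1 b2 b3 b) = b1" "block n d 2 (x @ ext b1 b2 b3 b) = b2"
      "block n d 3 (x @ ext b1 b2 b3 b) = b3" by simp_all
    show "w 0 (x @ ext b1 b2 b3 b) = x @ b" "concat [w 1 (x @ ext b1 b2 b3 b), w 2 (x @ ext b1 b2 b3 b), w 3 (x @ ext b1 b2 b3 b)] = concat [x @ b1, x @ b2, x @ b3]"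
      unfolding w_def eqs using l by simp_all
  qed
  have fibre: thesis
    if D: "D \<in> scells (Suc d) (3 + k) T B"
      and that: "\<And>F E F' E' b1 b2 b3 as. (F, E) \<in> T1 \<Longrightarrow> (F', E') \<in> T' \<Longrightarrow> b1 \<in> B \<Longrightarrow> b2 \<in> B \<Longrightarrow> b3 \<in> B \<Longrightarrow> length as = k \<Longrightarrow> set as \<subseteq> B \<Longrightarrow>
      \<forall>b\<in>B. \<not> NE E F' E' (b @ concat (b1 # b2 # b3 # as)) \<Longrightarrow>
      D = {u \<in> tuples (Suc d). NF F F' (u @ concat (b1 # b2 # b3 # as))} \<Longrightarrow> thesis" for D B thesis
  proof -
    obtain G G' bs where *: "(G, G') \<in> T" "length bs = 3 + k" "set bs \<subseteq> B" "\<forall>b\<in>B. \<not> G' (b @ concat bs)"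
      "D = {x \<in> tuples (Suc d). G (x @ concat bs)}" using D by (rule scellsE)
    obtain F E F' E' where FE: "(F, E) \<in> T1" "(F', E') \<in> T'" "G = NF F F'" "G' = NE E F' E'"
      using *(1) unfolding T_def by auto
    have "\<exists>b1 b2 b3 as. bs = b1 # b2 # b3 # as" using *(2) by (cases bs; cases "tl bs"; cases "tl (tl bs)") auto
    then obtain b1 b2 b3 as where bs: "bs = b1 # b2 # b3 # as" by (elim exE)
    have "b1 \<in> B" "b2 \<in> B" "b3 \<in> B" "length as = k" "set as \<subseteq> B" using *(2,3) unfolding bs by auto
    from that[OF FE(1,2) this *(4,5)[unfolded bs FE(3,4)]] show thesis .
  qed
  have base_cell: "{x \<in> tuples d. F' (x @ concat (map (ext b1 b2 b3) as))} \<in> scells d k T' (ext b1 b2 b3 ` B)"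
    if B: "params n B" "b1 \<in> B" "b2 \<in> B" "b3 \<in> B" "length as = k" "set as \<subseteq> B" and F': "(F', E') \<in> T'"
      and NE0: "\<forall>b\<in>B. \<not> NE E F' E' (b @ concat (b1 # b2 # b3 # as))" for B b1 b2 b3 as F' E' E
  proof (rule scellsI[OF F'])
    show "length (map (ext b1 b2 b3) as) = k" using B by simp
    show "set (map (ext b1 b2 b3) as) \<subseteq> ext b1 b2 b3 ` B" using B by auto
    fix c assume "c \<in> ext b1 b2 b3 ` B"
    then obtain b where b: "b \<in> B" "c = ext b1 b2 b3 b" by auto
    have "\<forall>b\<in>set (b1 # b2 # b3 # as). length b = n" using B len[OF B(1)] by auto
    from NE[OF len[OF B(1) b(1)] B(5) this] NE0 b
    show "\<not> E' (c @ concat (map (ext b1 b2 b3) as))" by blast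
  qed
  have fib_cell: "{z \<in> tuples 1. F (z @ concat [x @ b1, x @ b2, x @ b3])} \<in> scells 1 3 T1 ((\<lambda>b. x @ b) ` B)"
    if B: "params n B" "b1 \<in> B" "b2 \<in> B" "b3 \<in> B" "length as = k" "set as \<subseteq> B" and F: "(F, E) \<in> T1"
      and NE0: "\<forall>b\<in>B. \<not> NE E F' E' (b @ concat (b1 # b2 # b3 # as))"
      and x: "x \<in> tuples d" "F' (x @ concat (map (ext b1 b2 b3) as))" for B b1 b2 b3 as F' E' E F x
  proof (rule scellsI[OF F])
    show "set [x @ b1, x @ b2, x @ b3] \<subseteq> (\<lambda>b. x @ b) ` B" using B by auto
    fix c assume "c \<in> (\<lambda>b. x @ b) ` B"
    then obtain b where b: "b \<in> B" "c = x @ b" by auto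
    have "\<forall>b\<in>set (b1 # b2 # b3 # as). length b = n" using B len[OF B(1)] by auto
    from NE[OF len[OF B(1) b(1)] B(5) this] NE0 b x
    show "\<not> E (c @ concat [x @ b1, x @ b2, x @ b3])" by blast
  qed simp
  show ?thesis
  proof (intro exI[of _ "3 + k"] exI[of _ T], unfold decomposes_def, intro conjI allI impI)
    show "finite T" unfolding T_def using T1(1) T'(1) by simp
  next
    fix F E assume "(F, E) \<in> T"
    then show "dfn (Suc d + (3 + k) * n) F" unfolding T_def using dNF by auto
  next
    fix F E assume "(F, E) \<in> T"
    then show "dfn (n + (3 + k) * n) E" unfolding T_def using dNE by auto
  next
    fix B and u :: "'a list" assume B: "params n B" and u: "u \<in> tuples (Suc d)"
    obtain z x where zx: "u = z # x" "length x = d" using u by (auto simp: tuples_def length_Suc_conv)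
    then have xd: "x \<in> tuples d" and z1: "[z] \<in> tuples 1" by (simp_all add: tuples_def)
    obtain D1 where D1: "D1 \<in> scells 1 3 T1 ((\<lambda>b. x @ b) ` B)" "[z] \<in> D1"
      using cov1[OF pfib[OF B xd] z1] by blast
    obtain F E cs where FE: "(F, E) \<in> T1" "length cs = 3" "set cs \<subseteq> (\<lambda>b. x @ b) ` B"
      "\<forall>c\<in>(\<lambda>b. x @ b) ` B. \<not> E (c @ concat cs)" "D1 = {x \<in> tuples 1. F (x @ concat cs)}" using D1(1) by (rule scellsE)
    obtain bs where bs: "set bs \<subseteq> B" "cs = map (\<lambda>b. x @ b) bs" using map_image_list[OF FE(3)] by blast
    obtain b1 b2 b3 where b: "bs = [b1, b2, b3]"
      using FE(2) bs(2) by (auto simp: numeral_3_eq_3 length_Suc_conv)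
    have bB: "b1 \<in> B" "b2 \<in> B" "b3 \<in> B" using bs b by auto
    have cs: "concat cs = concat [x @ b1, x @ b2, x @ b3]" using bs b by simp
    obtain D' where D': "D' \<in> scells d k T' (ext b1 b2 b3 ` B)" "x \<in> D'"
      using cov'[OF pext[OF B bB] xd] by blast
    obtain F' E' ds where FE': "(F', E') \<in> T'" "length ds = k" "set ds \<subseteq> ext b1 b2 b3 ` B"
      "\<forall>c\<in>ext b1 b2 b3 ` B. \<not> E' (c @ concat ds)" "D' = {x \<in> tuples d. F' (x @ concat ds)}" using D'(1) by (rule scellsE)
    obtain as where as: "set as \<subseteq> B" "ds = map (ext b1 b2 b3) as" using map_image_list[OF FE'(3)] by blast
    have lk: "length as = k" using as FE'(2) by simp
    have ll: "\<forall>b\<in>set (b1 # b2 # b3 # as). length b = n" using bB as len[OF B] by auto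
    have mem: "{u \<in> tuples (Suc d). NF F F' (u @ concat (b1 # b2 # b3 # as))} \<in> scells (Suc d) (3 + k) T B"
    proof (rule scellsI[where E = "NE E F' E'"])
      show "(NF F F', NE E F' E') \<in> T" unfolding T_def using FE(1) FE'(1) by force
      show "length (b1 # b2 # b3 # as) = 3 + k" using lk by simp
      show "set (b1 # b2 # b3 # as) \<subseteq> B" using bB as by simp
      fix b assume b: "b \<in> B"
      \<comment> \<open>If the fibre over some \<open>y\<close> in the base cell were obstructed, so
        would be the fibre over \<open>x\<close>, by uniformity, against the choice of the fibre
        cell.\<close>
      have no: "\<not> E ((y @ b) @ concat [y @ b1, y @ b2, y @ b3])" if y: "y \<in> tuples d" "F' (y @ concat (map (ext b1 b2 b3) as))" for y
      proof
        assume "E ((y @ b) @ concat [y @ b1, y @ b2, y @ b3])"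
        then have "GE E (y @ ext b1 b2 b3 b)" unfolding GE_def using wext[OF y(1)] ll len[OF B b] by simp
        moreover have "GE E \<in> Gs" unfolding Gs_def using FE(1) by force
        moreover have "y \<in> D'" using FE'(5) y as by simp
        ultimately have "GE E (x @ ext b1 b2 b3 b)" using unc'[OF pext[OF B bB] D'(1)] D'(2) b by blast
        then have "E ((x @ b) @ concat cs)" unfolding GE_def cs using wext[OF xd] ll len[OF B b] by simp
        then show False using FE(4) b by blast
      qed
      have "\<not> E' (ext b1 b2 b3 b @ concat (map (ext b1 b2 b3) as))" using FE'(4) b as by blast
      then show "\<not> NE E F' E' (b @ concat (b1 # b2 # b3 # as))"
        unfolding NE[OF len[OF B b] lk ll] using no by blast
    qed
    have "NF F F' (u @ concat (b1 # b2 # b3 # as))"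
      unfolding zx(1) NF[OF zx(2) lk ll] using D'(2) FE'(5) as D1(2) FE(5) cs by simp
    then have "u \<in> {u \<in> tuples (Suc d). NF F F' (u @ concat (b1 # b2 # b3 # as))}" using u by (intro CollectI conjI)
    then show "\<exists>D\<in>scells (Suc d) (3 + k) T B. u \<in> D" using mem by (rule bexI)
  next
    fix B D P b u v assume B: "params n B" and D: "D \<in> scells (Suc d) (3 + k) T B" and P: "P \<in> Ps" and b: "b \<in> B"
      and uD: "u \<in> D" and vD: "v \<in> D" and Pu: "P (u @ b)"
    obtain F E F' E' b1 b2 b3 as where *: "(F, E) \<in> T1" "(F', E') \<in> T'" "b1 \<in> B" "b2 \<in> B" "b3 \<in> B" "length as = k" "set as \<subseteq> B"
      and NE0: "\<forall>b\<in>B. \<not> NE E F' E' (b @ concat (b1 # b2 # b3 # as))"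
      and Deq: "D = {u \<in> tuples (Suc d). NF F F' (u @ concat (b1 # b2 # b3 # as))}" by (rule fibre[OF D])
    have ll: "\<forall>b\<in>set (b1 # b2 # b3 # as). length b = n" using * len[OF B] by auto
    obtain z x where u: "u = z # x" "length x = d" using uD Deq by (auto simp: tuples_def length_Suc_conv)
    obtain z2 y where v: "v = z2 # y" "length y = d" using vD Deq by (auto simp: tuples_def length_Suc_conv)
    have xd: "x \<in> tuples d" and yd: "y \<in> tuples d" using u v by (simp_all add: tuples_def)
    have Fx: "F' (x @ concat (map (ext b1 b2 b3) as))" "F ([z] @ concat [x @ b1, x @ b2, x @ b3])"
      using uD unfolding Deq u(1) using NF[OF u(2) *(6) ll] by blast+
    have Fy: "F' (y @ concat (map (ext b1 b2 b3) as))" "F ([z2] @ concat [y @ b1, y @ b2, y @ b3])"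
      using vD unfolding Deq v(1) using NF[OF v(2) *(6) ll] by blast+
    \<comment> \<open>Transport in two moves: from the fibre over \<open>x\<close> to some point
      \<open>t\<close> of the fibre over \<open>y\<close>, then within that fibre from
      \<open>t\<close> to \<open>z2\<close>.\<close>
    have "GP F P (x @ ext b1 b2 b3 b)" unfolding GP_def using wext[OF xd] ll len[OF B b] Fx(2) Pu u(1) by auto
    moreover have "GP F P \<in> Gs" unfolding Gs_def using *(1) P by force
    ultimately have "GP F P (y @ ext b1 b2 b3 b)"
      using unc'[OF pext[OF B *(3-5)] base_cell[OF B *(3-7) *(2) NE0], of "GP F P" "ext b1 b2 b3 b" x y] xd yd Fx(1) Fy(1) b by blast
    then obtain t where t: "F ([t] @ concat [y @ b1, y @ b2, y @ b3])" "P ([t] @ (y @ b))"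
      unfolding GP_def using wext[OF yd] ll len[OF B b] by auto
    have "[t] \<in> tuples 1" "[z2] \<in> tuples 1" by (simp_all add: tuples_def)
    then have "P ([z2] @ (y @ b))"
      using unc1[OF pfib[OF B yd] fib_cell[OF B *(3-7) *(1) NE0 yd Fy(1)] P, of "y @ b" "[t]" "[z2]"] t Fy(2) b by blast
    then show "P (v @ b)" using v(1) by simp
  next
    show "\<exists>C. \<forall>B. params n B \<longrightarrow> card (scells (Suc d) (3 + k) T B) \<le> C * card B ^ (r + 3)"
    proof (intro exI allI impI)
      fix B assume B: "params n B"
      \<comment> \<open>The choice of the fibre type and of b1, b2, b3 contributes the factor |B|^3
        up to a constant; what remains to be counted is the base cells.\<close>
      define I where "I = T1 \<times> B \<times> B \<times> B"
      define S where "S = (\<lambda>((F, E :: 'a list \<Rightarrow> bool), b1, b2, b3). (\<lambda>D'. {u \<in> tuples (Suc d). tl u \<in> D' \<and> F ([hd u] @ concat [tl u @ b1, tl u @ b2, tl u @ b3])}) ` scells d k T' (ext b1 b2 b3 ` B))"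
      have fB: "finite B" using B by (simp add: params_def)
      have fI: "finite I" unfolding I_def using fB T1(1) by simp
      have fS: "finite (S i)" for i unfolding S_def by (cases i) (auto simp: fB T'(1) intro!: finite_imageI finite_scells split: prod.splits)
      have cS: "card (S i) \<le> C * card B ^ r" if "i \<in> I" for i
      proof -
        obtain FE b1 b2 b3 where i0: "i = (FE, b1, b2, b3)" by (cases i)
        obtain F E where "FE = (F, E)" by (cases FE)
        with i0 that have i: "i = ((F, E), b1, b2, b3)" "b1 \<in> B" "b2 \<in> B" "b3 \<in> B" by (simp_all add: I_def)
        have "card (S i) \<le> card (scells d k T' (ext b1 b2 b3 ` B))" unfolding S_def i prod.case
          by (intro card_image_le finite_scells T'(1) finite_imageI fB)
        also have "\<dots> \<le> C * card (ext b1 b2 b3 ` B) ^ r" by (rule C[OF pext[OF B i(2-4)]])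
        also have "\<dots> \<le> C * card B ^ r" by (intro mult_le_mono2 power_mono card_image_le fB) simp
        finally show ?thesis .
      qed
      have sub: "scells (Suc d) (3 + k) T B \<subseteq> (\<Union>i\<in>I. S i)"
      proof
        fix D assume D: "D \<in> scells (Suc d) (3 + k) T B"
        obtain F E F' E' b1 b2 b3 as where *: "(F, E) \<in> T1" "(F', E') \<in> T'" "b1 \<in> B" "b2 \<in> B" "b3 \<in> B" "length as = k" "set as \<subseteq> B"
          and NE0: "\<forall>b\<in>B. \<not> NE E F' E' (b @ concat (b1 # b2 # b3 # as))"
          and Deq: "D = {u \<in> tuples (Suc d). NF F F' (u @ concat (b1 # b2 # b3 # as))}" by (rule fibre[OF D])
        have ll: "\<forall>b\<in>set (b1 # b2 # b3 # as). length b = n" using * len[OF B] by auto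
        let ?D = "{x \<in> tuples d. F' (x @ concat (map (ext b1 b2 b3) as))}"
        have "NF F F' (u @ concat (b1 # b2 # b3 # as)) \<longleftrightarrow> tl u \<in> ?D \<and> F ([hd u] @ concat [tl u @ b1, tl u @ b2, tl u @ b3])"
          if uT: "u \<in> tuples (Suc d)" for u
        proof -
          obtain z x where u: "u = z # x" "length x = d" using uT by (auto simp: tuples_def length_Suc_conv)
          show ?thesis unfolding u(1) NF[OF u(2) *(6) ll] using u(2) by (simp add: tuples_def)
        qed
        then have "D = {u \<in> tuples (Suc d). tl u \<in> ?D \<and> F ([hd u] @ concat [tl u @ b1, tl u @ b2, tl u @ b3])}"
          unfolding Deq by blast
        then have "D \<in> S ((F, E), b1, b2, b3)" unfolding S_def prod.case
          using base_cell[OF B *(3-7) *(2) NE0] by (rule image_eqI)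
        moreover have "((F, E), b1, b2, b3) \<in> I" unfolding I_def using * by simp
        ultimately show "D \<in> (\<Union>i\<in>I. S i)" by (rule UN_I[rotated])
      qed
      have "card (scells (Suc d) (3 + k) T B) \<le> card (\<Union>i\<in>I. S i)"
        by (rule card_mono[OF _ sub]) (use fI fS in blast)
      also have "\<dots> \<le> (\<Sum>i\<in>I. card (S i))" by (rule card_UN_le[OF fI])
      also have "\<dots> \<le> card I * (C * card B ^ r)" using sum_bounded_above[OF cS, of I] by simp
      also have "\<dots> = (card T1 * C) * card B ^ (r + 3)" unfolding I_def
        by (simp add: card_cartesian_product power_add power3_eq_cube)
      finally show "card (scells (Suc d) (3 + k) T B) \<le> (card T1 * C) * card B ^ (r + 3)" .
    qed
  qed
qed

text \<open>The one-dimensional case is required for all \<open>n\<close>, since the other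
  coordinates of x act as parameters in the fibres, and for all finite families, since the step
  creates new predicates.\<close>

lemma decomposes_all:
  assumes one: "\<And>Ps n. finite Ps \<Longrightarrow> \<forall>P\<in>Ps. dfn (Suc n) P \<Longrightarrow> \<exists>T. decomposes 1 n Ps 3 T 1"
    and "finite Ps" "\<forall>P\<in>Ps. dfn (Suc m + n) P"
  shows "\<exists>k T. decomposes (Suc m) n Ps k T (3 * m + 1)"
  using assms(2,3)
proof (induction m arbitrary: n Ps)
  case 0
  then show ?case using one[of Ps n] by auto
next
  case (Suc m)
  obtain T1 where "decomposes 1 (Suc m + n) Ps 3 T1 1" using one[of Ps "Suc m + n"] Suc.prems by auto
  from decomposes_step[OF this Suc.prems Suc.IH] show ?case by (simp add: add.commute)
qed

lemma dcd_of_decomposes: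
  assumes dec: "decomposes m n ((\<lambda>\<phi> a. holds K a \<phi>) ` \<Phi>) k T r"
  shows "\<exists>\<Psi> \<theta>. distal_cell_decomposition L K m n \<Phi> k \<Psi> \<theta> \<and> has_exponent K m n k \<Psi> \<theta> (real r)"
proof -
  have T: "finite T" "\<And>F E. (F, E) \<in> T \<Longrightarrow> dfn (m + k * n) F" "\<And>F E. (F, E) \<in> T \<Longrightarrow> dfn (n + k * n) E"
    and cov: "\<And>B x. params n B \<Longrightarrow> x \<in> tuples m \<Longrightarrow> \<exists>D\<in>scells m k T B. x \<in> D"
    and unc: "\<And>B D P b x y. params n B \<Longrightarrow> D \<in> scells m k T B \<Longrightarrow> P \<in> (\<lambda>\<phi> a. holds K a \<phi>) ` \<Phi> \<Longrightarrow> b \<in> B \<Longrightarrow> x \<in> D \<Longrightarrow> y \<in> D \<Longrightarrow> P (x @ b) \<Longrightarrow> P (y @ b)"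
    using dec unfolding decomposes_def by meson+
  obtain C where C: "\<And>B. params n B \<Longrightarrow> card (scells m k T B) \<le> C * card B ^ r"
    using dec unfolding decomposes_def by meson
  obtain ts where ts: "set ts = T" using finite_list[OF T(1)] by blast
  define l where "l = length ts"
  have tsT: "(fst (ts ! i), snd (ts ! i)) \<in> T" if "i < l" for i using that ts nth_mem[of i ts] by (simp add: l_def)
  have "\<forall>i. \<exists>\<phi>. i < l \<longrightarrow> \<phi> \<in> fm_in L (m + k * n) \<and> (\<forall>a\<in>tuples (m + k * n). holds K a \<phi> \<longleftrightarrow> fst (ts ! i) a)"
    using T(2)[OF tsT] unfolding dfn_def by blast
  from choice[OF this] obtain f where f: "\<And>i. i < l \<Longrightarrow> f i \<in> fm_in L (m + k * n)"
    "\<And>i a. i < l \<Longrightarrow> a \<in> tuples (m + k * n) \<Longrightarrow> holds K a (f i) \<longleftrightarrow> fst (ts ! i) a" by blast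
  have "\<forall>i. \<exists>\<phi>. i < l \<longrightarrow> \<phi> \<in> fm_in L (n + k * n) \<and> (\<forall>a\<in>tuples (n + k * n). holds K a \<phi> \<longleftrightarrow> snd (ts ! i) a)"
    using T(3)[OF tsT] unfolding dfn_def by blast
  from choice[OF this] obtain h where h: "\<And>i. i < l \<Longrightarrow> h i \<in> fm_in L (n + k * n)"
    "\<And>i a. i < l \<Longrightarrow> a \<in> tuples (n + k * n) \<Longrightarrow> holds K a (h i) \<longleftrightarrow> snd (ts ! i) a" by blast
  define \<psi> where "\<psi> i = Conj (f i) (tower i)" for i
  have inj: "inj_on \<psi> {..<l}" by (rule inj_onI) (auto simp: \<psi>_def dest: tower_inj)
  \<comment> \<open>This inverts \<psi>, which is injective thanks to the conjoined
    sentences.\<close>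
  define \<theta> where "\<theta> \<chi> = h (inv_into {..<l} \<psi> \<chi>)" for \<chi>
  have \<theta>: "\<theta> (\<psi> i) = h i" if "i < l" for i unfolding \<theta>_def using inv_into_f_f[OF inj] that by simp
  have \<psi>: "holds K a (\<psi> i) \<longleftrightarrow> holds K a (f i)" for a i unfolding \<psi>_def holds_def by (simp add: tower)
  define \<Psi> where "\<Psi> = \<psi> ` {..<l}"
  have cells: "cells K m k \<Psi> \<theta> B = scells m k T B" if B: "params n B" for B
  proof -
    have lb: "concat bs \<in> tuples (k * n)" if "length bs = k" "set bs \<subseteq> B" for bs
      using that B length_concat_blocks[of bs n] by (auto simp: params_def tuples_def)
    have ds: "def_set K m (\<psi> i) (concat bs) = {x \<in> tuples m. fst (ts ! i) (x @ concat bs)}" if "i < l" "length bs = k" "set bs \<subseteq> B" for i bs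
      unfolding def_set_def \<psi> using f(2)[OF that(1)] lb[OF that(2,3)] by (auto simp: tuples_def)
    have es: "holds K (b @ concat bs) (\<theta> (\<psi> i)) \<longleftrightarrow> snd (ts ! i) (b @ concat bs)" if "i < l" "length bs = k" "set bs \<subseteq> B" "b \<in> B" for i bs b
      unfolding \<theta>[OF that(1)] by (rule h(2)[OF that(1)]) (use lb[OF that(2,3)] B that(4) in \<open>auto simp: tuples_def params_def\<close>)
    show ?thesis
    proof (intro equalityI subsetI)
      fix D assume "D \<in> cells K m k \<Psi> \<theta> B"
      then obtain i bs where *: "i < l" "length bs = k" "set bs \<subseteq> B" "D = def_set K m (\<psi> i) (concat bs)"
        "\<not> (\<exists>b\<in>B. holds K (b @ concat bs) (\<theta> (\<psi> i)))" unfolding cells_def \<Psi>_def by auto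
      show "D \<in> scells m k T B" unfolding *(4) ds[OF *(1-3)]
        by (rule scellsI[OF tsT[OF *(1)] *(2,3)]) (use *(5) es[OF *(1-3)] in blast)
    next
      fix D assume "D \<in> scells m k T B"
      then obtain F E bs where *: "(F, E) \<in> T" "length bs = k" "set bs \<subseteq> B" "\<forall>b\<in>B. \<not> E (b @ concat bs)"
        "D = {x \<in> tuples m. F (x @ concat bs)}" by (rule scellsE)
      obtain i where i: "i < l" "ts ! i = (F, E)" using *(1) ts by (auto simp: in_set_conv_nth l_def)
      have "D = def_set K m (\<psi> i) (concat bs)" unfolding ds[OF i(1) *(2,3)] *(5) i(2) by simp
      moreover have "\<not> (\<exists>b\<in>B. holds K (b @ concat bs) (\<theta> (\<psi> i)))" using es[OF i(1) *(2,3)] *(4) i(2) by auto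
      moreover have "\<psi> i \<in> \<Psi>" using i(1) by (simp add: \<Psi>_def)
      ultimately show "D \<in> cells K m k \<Psi> \<theta> B" unfolding cells_def using *(2,3) by blast
    qed
  qed
  have "\<Psi> \<subseteq> fm_in L (m + k * n)"
  proof
    fix \<chi> assume "\<chi> \<in> \<Psi>"
    then obtain i where "i < l" "\<chi> = \<psi> i" by (auto simp: \<Psi>_def)
    then show "\<chi> \<in> fm_in L (m + k * n)" using f(1)[of i] by (simp add: fm_in_def \<psi>_def tower)
  qed
  moreover have "\<forall>\<psi>\<in>\<Psi>. \<theta> \<psi> \<in> fm_in L (n + k * n)" using h(1) \<theta> by (auto simp: \<Psi>_def)
  moreover have "\<Union> (cells K m k \<Psi> \<theta> B) = tuples m \<and> (\<forall>\<Delta>\<in>cells K m k \<Psi> \<theta> B. \<not> crossed K m \<Phi> B \<Delta>)"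
    if "finite B \<and> B \<noteq> {} \<and> B \<subseteq> tuples n" for B
  proof -
    have B: "params n B" using that by (simp add: params_def)
    have "\<Union> (scells m k T B) \<subseteq> tuples m" unfolding scells_def by auto
    then have "\<Union> (scells m k T B) = tuples m" using cov[OF B] by blast
    moreover have "\<not> crossed K m \<Phi> B D" if D: "D \<in> scells m k T B" for D
    proof
      assume "crossed K m \<Phi> B D"
      then obtain \<phi> b x y where c: "\<phi> \<in> \<Phi>" "b \<in> B" "x \<in> D" "y \<in> D" "x \<in> def_set K m \<phi> b" "y \<notin> def_set K m \<phi> b"
        unfolding crossed_def by auto
      have "y \<in> tuples m" using D c(4) unfolding scells_def by auto
      then show False using unc[OF B D imageI[OF c(1)] c(2-4)] c(5,6) unfolding def_set_def by simp
    qed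
    ultimately show ?thesis unfolding cells[OF B] by blast
  qed
  moreover have "finite \<Psi>" by (simp add: \<Psi>_def)
  ultimately have 1: "distal_cell_decomposition L K m n \<Phi> k \<Psi> \<theta>"
    unfolding distal_cell_decomposition_def by (intro conjI allI impI) blast+
  have 2: "has_exponent K m n k \<Psi> \<theta> (real r)" unfolding has_exponent_def
  proof (intro exI[of _ "real C"] allI impI)
    fix B :: "'a list set" assume "finite B \<and> B \<noteq> {} \<and> B \<subseteq> tuples n"
    then have B: "params n B" and pos: "card B > 0" by (auto simp: params_def card_gt_0_iff)
    have "real (card (scells m k T B)) \<le> real (C * card B ^ r)" using C[OF B] by (simp only: of_nat_le_iff)
    then show "real (card (cells K m k \<Psi> \<theta> B)) \<le> real C * real (card B) powr real r"
      unfolding cells[OF B] using pos by (simp add: powr_realpow)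
  qed
  from 1 2 show ?thesis by blast
qed

end

section \<open>Terms as polynomials\<close>

locale mac_field = p_field R A p + fo macintyre K
  for R :: "'a ring" (structure) and A p and K :: "'a mac_struct" +
  assumes ops: "fun_of K Times [x, y] = x \<otimes> y" "fun_of K Plus [x, y] = x \<oplus> y" "fun_of K Uminus [x] = \<ominus> x"
      "fun_of K Zero [] = \<zero>" "fun_of K One [] = \<one>"
    and div_iff: "rel_of K Div [x, y] \<longleftrightarrow> x \<preceq> y"
    and pow_iff: "k \<ge> 2 \<Longrightarrow> rel_of K (Pow k) [x] \<longleftrightarrow> (\<exists>y. y [^] k = x)"
    and qe: "quantifier_elimination macintyre K"
    and sk: "definable_Skolem_functions macintyre K"
begin

section \<open>Definability of the field operations and of the valuation\<close>

lemma dfun_mult: assumes "dfun n f" "dfun n g" shows "dfun n (\<lambda>a. f a \<otimes> g a)"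
proof (rule dfun_op2[OF _ assms, where F = "\<lambda>x y. x \<otimes> y"], unfold dfun_def, rule dfnI[of "Eq (Var 0) (Fun Times [Var 1, Var 2])"])
  fix a :: "'a list" assume "length a = Suc 2"
  then show "sat K (\<lambda>i. a ! i) (Eq (Var 0) (Fun Times [Var 1, Var 2])) \<longleftrightarrow> hd a = tl a ! 0 \<otimes> tl a ! 1"
    by (auto simp: ops length_Suc_conv numeral_2_eq_2)
qed (simp_all add: macintyre_def)

lemma dfun_add: assumes "dfun n f" "dfun n g" shows "dfun n (\<lambda>a. f a \<oplus> g a)"
proof (rule dfun_op2[OF _ assms, where F = "\<lambda>x y. x \<oplus> y"], unfold dfun_def, rule dfnI[of "Eq (Var 0) (Fun Plus [Var 1, Var 2])"])
  fix a :: "'a list" assume "length a = Suc 2"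
  then show "sat K (\<lambda>i. a ! i) (Eq (Var 0) (Fun Plus [Var 1, Var 2])) \<longleftrightarrow> hd a = tl a ! 0 \<oplus> tl a ! 1"
    by (auto simp: ops length_Suc_conv numeral_2_eq_2)
qed (simp_all add: macintyre_def)

lemma dfun_neg: assumes "dfun n f" shows "dfun n (\<lambda>a. \<ominus> f a)"
proof (rule dfun_op1[OF _ assms, where F = "\<lambda>x. \<ominus> x"], unfold dfun_def, rule dfnI[of "Eq (Var 0) (Fun Uminus [Var 1])"])
  fix a :: "'a list" assume "length a = Suc 1"
  then show "sat K (\<lambda>i. a ! i) (Eq (Var 0) (Fun Uminus [Var 1])) \<longleftrightarrow> hd a = \<ominus> (tl a ! 0)"
    by (auto simp: ops length_Suc_conv)
qed (simp_all add: macintyre_def)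

lemma dfun_zero: "dfun n (\<lambda>a. \<zero>)"
  unfolding dfun_def
proof (rule dfnI[of "Eq (Var 0) (Fun Zero [])"])
  fix a :: "'a list" assume "length a = Suc n"
  then show "sat K (\<lambda>i. a ! i) (Eq (Var 0) (Fun Zero [])) \<longleftrightarrow> hd a = \<zero>" by (auto simp: ops length_Suc_conv)
qed (simp_all add: macintyre_def)

lemma dfun_one: "dfun n (\<lambda>a. \<one>)"
  unfolding dfun_def
proof (rule dfnI[of "Eq (Var 0) (Fun One [])"])
  fix a :: "'a list" assume "length a = Suc n"
  then show "sat K (\<lambda>i. a ! i) (Eq (Var 0) (Fun One [])) \<longleftrightarrow> hd a = \<one>" by (auto simp: ops length_Suc_conv)
qed (simp_all add: macintyre_def)

lemma dfun_diff: "dfun n f \<Longrightarrow> dfun n g \<Longrightarrow> dfun n (\<lambda>a. f a \<ominus> g a)"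
  unfolding F.diff_conv_add_uminus by (intro dfun_add dfun_neg)

lemma dfun_pow: "dfun n f \<Longrightarrow> dfun n (\<lambda>a. f a [^] (k::nat))"
proof (induction k)
  case (Suc k)
  then show ?case unfolding pow_Suc by (intro dfun_mult) simp_all
qed (simp add: dfun_one)

lemma dfn_le: assumes "dfun n f" "dfun n g" shows "dfn n (\<lambda>a. f a \<preceq> g a)"
proof (rule dfn_rel2[OF _ assms, where P = "\<lambda>x y. x \<preceq> y"], rule dfnI[of "Rel Div [Var 0, Var 1]"])
  fix a :: "'a list" assume "length a = 2"
  show "sat K (\<lambda>i. a ! i) (Rel Div [Var 0, Var 1]) \<longleftrightarrow> a ! 0 \<preceq> a ! 1"
    by (simp add: div_iff)
qed (simp_all add: macintyre_def)

lemma dfn_eqv: "dfun n f \<Longrightarrow> dfun n g \<Longrightarrow> dfn n (\<lambda>a. f a \<approx> g a)"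
  unfolding eqv_def by (intro dfn_conj dfn_le)

lemma dfn_lt: "dfun n f \<Longrightarrow> dfun n g \<Longrightarrow> dfn n (\<lambda>a. f a \<prec> g a)"
  unfolding lt_def by (intro dfn_not dfn_le)

lemma dfn_uniformizer: assumes "dfun n f" shows "dfn n (\<lambda>a. uniformizer (f a))"
proof -
  have "dfn n (\<lambda>a. \<forall>z. \<one> \<prec> z \<longrightarrow> f a \<preceq> z)"
    by (rule dfn_all) (intro dfn_imp dfn_lt dfn_le dfun_one dfun_hd dfun_lift[OF assms])
  then show ?thesis unfolding uniformizer_def
    by (intro dfn_conj dfn_lt dfn_not dfn_eq dfun_one dfun_zero assms)
qed

lemma dfun_taylor:
  assumes "\<forall>c\<in>set cs. dfun n (\<lambda>a. c (f a))" "dfun n x"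
  shows "dfun n (\<lambda>a. taylor (map (\<lambda>c. c (f a)) cs) (x a) i)"
  using assms(1)
proof (induction cs arbitrary: i)
  case Nil
  then show ?case by (simp add: dfun_zero)
next
  case (Cons c cs)
  have "dfun n (\<lambda>a. taylor (map (\<lambda>c. c (f a)) cs) (x a) j)" for j using Cons by simp
  then show ?case using Cons.prems by (cases i) (simp_all add: dfun_add dfun_mult assms(2))
qed

text \<open>Constants of the language are integers; this survives in the coefficients of a term in one
  variable and is what makes parameter-free definable points algebraic.\<close>

definition Zs :: "'a set" where
  "Zs = {c. \<exists>(i::nat) (j::nat). c = ([i] \<cdot> \<one>) \<ominus> ([j] \<cdot> \<one>)}"

lemma Zs_add: assumes "c \<in> Zs" "d \<in> Zs" shows "c \<oplus> d \<in> Zs"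
proof -
  obtain i j k l :: nat where "c = ([i] \<cdot> \<one>) \<ominus> ([j] \<cdot> \<one>)" "d = ([k] \<cdot> \<one>) \<ominus> ([l] \<cdot> \<one>)"
    using assms unfolding Zs_def by blast
  note e = this
  have "c \<oplus> d = ([(i + k)] \<cdot> \<one>) \<ominus> ([(j + l)] \<cdot> \<one>)" unfolding e nat_add by (simp add: algebra_simps)
  then show ?thesis unfolding Zs_def by blast
qed

lemma Zs_mult: assumes "c \<in> Zs" "d \<in> Zs" shows "c \<otimes> d \<in> Zs"
proof -
  obtain i j k l :: nat where "c = ([i] \<cdot> \<one>) \<ominus> ([j] \<cdot> \<one>)" "d = ([k] \<cdot> \<one>) \<ominus> ([l] \<cdot> \<one>)"
    using assms unfolding Zs_def by blast
  note e = this
  have "c \<otimes> d = ([(i * k + j * l)] \<cdot> \<one>) \<ominus> ([(i * l + j * k)] \<cdot> \<one>)"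
    unfolding e nat_add nat_mult by (simp add: algebra_simps)
  then show ?thesis unfolding Zs_def by blast
qed

lemma Zs_neg: assumes "c \<in> Zs" shows "\<ominus> c \<in> Zs"
proof -
  obtain i j :: nat where "c = ([i] \<cdot> \<one>) \<ominus> ([j] \<cdot> \<one>)" using assms unfolding Zs_def by blast
  then have "\<ominus> c = ([j] \<cdot> \<one>) \<ominus> ([i] \<cdot> \<one>)" by (simp add: algebra_simps)
  then show ?thesis unfolding Zs_def by blast
qed

lemma Zs_zero: "\<zero> \<in> Zs" unfolding Zs_def by (intro CollectI exI[of _ 0]) simp

lemma Zs_one: "\<one> \<in> Zs" unfolding Zs_def by (intro CollectI exI[of _ 1] exI[of _ 0]) simp

lemma Zs_val: assumes "c \<in> Zs" "c \<noteq> \<zero>" "uniformizer \<pi>" shows "\<exists>j. c \<approx> \<pi> [^] (j::nat)"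
proof -
  obtain i j :: nat where c: "c = ([i] \<cdot> \<one>) \<ominus> ([j] \<cdot> \<one>)" using assms unfolding Zs_def by blast
  consider "i = j" | "i < j" | "j < i" by linarith
  then show ?thesis
  proof cases
    case 1
    then show ?thesis using c assms(2) by simp
  next
    case 2
    then obtain k where k: "j = i + k" "k > 0" using less_imp_add_positive by blast
    have "c = \<ominus> ([k] \<cdot> \<one>)" unfolding c k(1) nat_add by (simp add: algebra_simps)
    then show ?thesis using nat_val[OF assms(3) k(2)] by simp
  next
    case 3
    then obtain k where k: "i = j + k" "k > 0" using less_imp_add_positive by blast
    have "c = [k] \<cdot> \<one>" unfolding c k(1) nat_add by (simp add: algebra_simps)
    then show ?thesis using nat_val[OF assms(3) k(2)] by simp
  qed
qed

text \<open>The clause for \<open>n = 0\<close> serves the computation of the value group, where a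
  point definable without parameters has to become a root of a polynomial with integer
  coefficients.\<close>

definition coef :: "nat \<Rightarrow> ('a list \<Rightarrow> 'a) \<Rightarrow> bool" where
  "coef n c \<longleftrightarrow> dfun n c \<and> (n = 0 \<longrightarrow> c [] \<in> Zs)"

lemma coef_zero: "coef n (\<lambda>a. \<zero>)" and coef_one: "coef n (\<lambda>a. \<one>)"
  and coef_add: "coef n c \<Longrightarrow> coef n d \<Longrightarrow> coef n (\<lambda>a. c a \<oplus> d a)"
  and coef_mult: "coef n c \<Longrightarrow> coef n d \<Longrightarrow> coef n (\<lambda>a. c a \<otimes> d a)"
  and coef_neg: "coef n c \<Longrightarrow> coef n (\<lambda>a. \<ominus> c a)"
  by (simp_all add: coef_def dfun_zero dfun_one dfun_add dfun_mult dfun_neg Zs_zero Zs_one Zs_add Zs_mult Zs_neg)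

lemma coef_nth: "i < n \<Longrightarrow> coef n (\<lambda>a. a ! i)"
  by (simp add: coef_def dfun_nth)

definition pv :: "('a list \<Rightarrow> 'a) list \<Rightarrow> 'a list \<Rightarrow> 'a \<Rightarrow> 'a" where
  "pv cs b x = ev (map (\<lambda>c. c b) cs) x"

lemma pv_Nil [simp]: "pv [] b x = \<zero>" and pv_Cons [simp]: "pv (c # cs) b x = x \<otimes> pv cs b x \<oplus> c b"
  by (simp_all add: pv_def)

section \<open>Polynomial functions of one variable with definable coefficients\<close>

definition polyf :: "nat \<Rightarrow> ('a \<Rightarrow> 'a list \<Rightarrow> 'a) \<Rightarrow> bool" where
  "polyf n h \<longleftrightarrow> (\<exists>cs. (\<forall>c\<in>set cs. coef n c) \<and> (\<forall>x b. length b = n \<longrightarrow> h x b = pv cs b x))"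

lemma polyf_const: "coef n c \<Longrightarrow> polyf n (\<lambda>x b. c b)"
  unfolding polyf_def by (rule exI[of _ "[c]"]) simp

lemma polyf_var: "polyf n (\<lambda>x b. x)"
  unfolding polyf_def by (rule exI[of _ "[\<lambda>a. \<zero>, \<lambda>a. \<one>]"]) (simp add: coef_zero coef_one)

lemma add_lists:
  "\<forall>c\<in>set cs. coef n c \<Longrightarrow> \<forall>c\<in>set ds. coef n c \<Longrightarrow>
    \<exists>es. (\<forall>c\<in>set es. coef n c) \<and> (\<forall>x b. pv es b x = pv cs b x \<oplus> pv ds b x)"
proof (induction cs arbitrary: ds)
  case Nil
  then show ?case by (intro exI[of _ ds]) simp
next
  case (Cons c cs)
  show ?case
  proof (cases ds)
    case Nil
    then show ?thesis using Cons.prems by (intro exI[of _ "c # cs"]) simp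
  next
    case (Cons d ds')
    obtain es where es: "\<forall>c\<in>set es. coef n c" "\<forall>x b. pv es b x = pv cs b x \<oplus> pv ds' b x"
      using Cons.IH[of ds'] Cons.prems Cons by auto
    have "coef n (\<lambda>a. c a \<oplus> d a)" using Cons.prems Cons by (intro coef_add) auto
    then show ?thesis using es Cons
      by (intro exI[of _ "(\<lambda>a. c a \<oplus> d a) # es"]) (simp add: algebra_simps)
  qed
qed

lemma mult_lists:
  "\<forall>c\<in>set cs. coef n c \<Longrightarrow> \<forall>c\<in>set ds. coef n c \<Longrightarrow>
    \<exists>es. (\<forall>c\<in>set es. coef n c) \<and> (\<forall>x b. pv es b x = pv cs b x \<otimes> pv ds b x)"
proof (induction cs)
  case Nil
  then show ?case by (intro exI[of _ "[]"]) simp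
next
  case (Cons c cs)
  obtain es where es: "\<forall>c\<in>set es. coef n c" "\<forall>x b. pv es b x = pv cs b x \<otimes> pv ds b x"
    using Cons.IH Cons.prems by auto
  let ?m = "map (\<lambda>d a. c a \<otimes> d a) ds"
  have m: "pv ?m b x = c b \<otimes> pv ds b x" for b x
    by (induction ds) (simp_all add: algebra_simps)
  have m': "\<forall>c\<in>set ?m. coef n c" using Cons.prems by (auto intro: coef_mult)
  have e': "\<forall>c\<in>set ((\<lambda>a. \<zero>) # es). coef n c" using es(1) coef_zero by simp
  obtain fs where fs: "\<forall>c\<in>set fs. coef n c" "\<forall>x b. pv fs b x = pv ?m b x \<oplus> pv ((\<lambda>a. \<zero>) # es) b x"
    using add_lists[OF m' e'] by blast
  have "pv fs b x = pv (c # cs) b x \<otimes> pv ds b x" for x b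
    unfolding fs(2)[rule_format] m by (simp add: es(2) algebra_simps)
  then show ?case using fs(1) by (intro exI[of _ fs]) simp
qed

lemma polyf_add: assumes "polyf n h" "polyf n k" shows "polyf n (\<lambda>x b. h x b \<oplus> k x b)"
proof -
  obtain cs ds where *: "\<forall>c\<in>set cs. coef n c" "\<forall>x b. length b = n \<longrightarrow> h x b = pv cs b x"
    "\<forall>c\<in>set ds. coef n c" "\<forall>x b. length b = n \<longrightarrow> k x b = pv ds b x" using assms unfolding polyf_def by blast
  obtain es where "\<forall>c\<in>set es. coef n c" "\<forall>x b. pv es b x = pv cs b x \<oplus> pv ds b x" using add_lists[OF *(1,3)] by blast
  then show ?thesis unfolding polyf_def using * by (intro exI[of _ es]) simp
qed

lemma polyf_mult: assumes "polyf n h" "polyf n k" shows "polyf n (\<lambda>x b. h x b \<otimes> k x b)"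
proof -
  obtain cs ds where *: "\<forall>c\<in>set cs. coef n c" "\<forall>x b. length b = n \<longrightarrow> h x b = pv cs b x"
    "\<forall>c\<in>set ds. coef n c" "\<forall>x b. length b = n \<longrightarrow> k x b = pv ds b x" using assms unfolding polyf_def by blast
  obtain es where "\<forall>c\<in>set es. coef n c" "\<forall>x b. pv es b x = pv cs b x \<otimes> pv ds b x" using mult_lists[OF *(1,3)] by blast
  then show ?thesis unfolding polyf_def using * by (intro exI[of _ es]) simp
qed

lemma polyf_neg: assumes "polyf n h" shows "polyf n (\<lambda>x b. \<ominus> h x b)"
  using polyf_mult[OF polyf_const[OF coef_neg[OF coef_one]] assms] by simp

lemma term_poly:
  "is_term macintyre t \<Longrightarrow> tm_vars t \<subseteq> {..<Suc n} \<Longrightarrow> polyf n (\<lambda>x b. eval_tm K (\<lambda>i. (x # b) ! i) t)"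
proof (induction t)
  case (Var i)
  then show ?case by (cases i) (simp_all add: polyf_var polyf_const coef_nth)
next
  case (Fun f ts)
  have IH: "polyf n (\<lambda>x b. eval_tm K (\<lambda>i. (x # b) ! i) t)" if "t \<in> set ts" for t
    by (rule Fun.IH[OF that]) (use Fun.prems that in auto)
  show ?case
  proof (cases f)
    case Zero
    then have "ts = []" using Fun.prems by (simp add: macintyre_def)
    then show ?thesis using Zero polyf_const[OF coef_zero] by (simp add: ops)
  next
    case One
    then have "ts = []" using Fun.prems by (simp add: macintyre_def)
    then show ?thesis using One polyf_const[OF coef_one] by (simp add: ops)
  next
    case Plus
    then have "length ts = 2" using Fun.prems by (simp add: macintyre_def)
    then obtain t u where "ts = [t, u]" by (auto simp: numeral_2_eq_2 length_Suc_conv)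
    then show ?thesis using Plus polyf_add[OF IH[of t] IH[of u]] by (simp add: ops)
  next
    case Uminus
    then have "length ts = 1" using Fun.prems by (simp add: macintyre_def)
    then obtain t where "ts = [t]" by (auto simp: length_Suc_conv)
    then show ?thesis using Uminus polyf_neg[OF IH[of t]] by (simp add: ops)
  next
    case Times
    then have "length ts = 2" using Fun.prems by (simp add: macintyre_def)
    then obtain t u where "ts = [t, u]" by (auto simp: numeral_2_eq_2 length_Suc_conv)
    then show ?thesis using Times polyf_mult[OF IH[of t] IH[of u]] by (simp add: ops)
  qed
qed

text \<open>The two points cannot be told apart by atomic conditions on the values of the listed
  polynomials.\<close>

definition agree :: "('a list \<Rightarrow> 'a) list set \<Rightarrow> nat set \<Rightarrow> 'a list \<Rightarrow> 'a \<Rightarrow> 'a \<Rightarrow> bool" where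
  "agree Ps Es b x x' \<longleftrightarrow>
     (\<forall>cs\<in>Ps. (pv cs b x = \<zero> \<longleftrightarrow> pv cs b x' = \<zero>) \<and>
       (\<forall>k\<in>Es. (\<exists>y. y [^] k = pv cs b x) \<longleftrightarrow> (\<exists>y. y [^] k = pv cs b x'))) \<and>
     (\<forall>cs\<in>Ps. \<forall>ds\<in>Ps. pv cs b x \<preceq> pv ds b x \<longleftrightarrow> pv cs b x' \<preceq> pv ds b x')"

lemma agree_mono: assumes "agree Ps Es b x x'" "Qs \<subseteq> Ps" "Fs \<subseteq> Es" shows "agree Qs Fs b x x'"
  unfolding agree_def
proof (intro conjI ballI)
  fix cs assume cs: "cs \<in> Qs"
  then have *: "cs \<in> Ps" using assms(2) by auto
  show "pv cs b x = \<zero> \<longleftrightarrow> pv cs b x' = \<zero>" using assms(1) * unfolding agree_def by simp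
  show "(\<exists>y. y [^] k = pv cs b x) \<longleftrightarrow> (\<exists>y. y [^] k = pv cs b x')" if "k \<in> Fs" for k
  proof -
    have "k \<in> Es" using that assms(3) by auto
    then show ?thesis using assms(1) * unfolding agree_def by simp
  qed
  show "pv cs b x \<preceq> pv ds b x \<longleftrightarrow> pv cs b x' \<preceq> pv ds b x'" if "ds \<in> Qs" for ds
  proof -
    have "ds \<in> Ps" using that assms(2) by auto
    then show ?thesis using assms(1) * unfolding agree_def by simp
  qed
qed

definition decides :: "nat \<Rightarrow> ('a list \<Rightarrow> 'a) list set \<Rightarrow> nat set \<Rightarrow> ('a list \<Rightarrow> bool) \<Rightarrow> bool" where
  "decides n Ps Es P \<longleftrightarrow> finite Ps \<and> finite Es \<and> 0 \<notin> Es \<and> (\<forall>cs\<in>Ps. \<forall>c\<in>set cs. coef n c) \<and>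
     (\<forall>b x x'. length b = n \<longrightarrow> agree Ps Es b x x' \<longrightarrow> P (x # b) = P (x' # b))"

lemma decidesD: "decides n Ps Es P \<Longrightarrow> length b = n \<Longrightarrow> agree Ps Es b x x' \<Longrightarrow> P (x # b) = P (x' # b)"
  unfolding decides_def by simp

lemma decides_union:
  assumes "decides n Ps Es P" "decides n Qs Fs Q"
  shows "decides n (Ps \<union> Qs) (Es \<union> Fs) P" "decides n (Ps \<union> Qs) (Es \<union> Fs) Q"
proof -
  have m: "agree Ps Es b x x' \<and> agree Qs Fs b x x'" if "agree (Ps \<union> Qs) (Es \<union> Fs) b x x'" for b x x'
    using agree_mono[OF that, of Ps Es] agree_mono[OF that, of Qs Fs] by simp
  have f: "finite (Ps \<union> Qs) \<and> finite (Es \<union> Fs) \<and> 0 \<notin> Es \<union> Fs \<and> (\<forall>cs\<in>Ps \<union> Qs. \<forall>c\<in>set cs. coef n c)"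
    using assms unfolding decides_def by auto
  show "decides n (Ps \<union> Qs) (Es \<union> Fs) P" unfolding decides_def using f decidesD[OF assms(1)] m by simp
  show "decides n (Ps \<union> Qs) (Es \<union> Fs) Q" unfolding decides_def using f decidesD[OF assms(2)] m by simp
qed

lemma decides_cong: "decides n Ps Es P \<Longrightarrow> (\<And>a. length a = Suc n \<Longrightarrow> P a = Q a) \<Longrightarrow> decides n Ps Es Q"
  unfolding decides_def by simp

lemma decides_qf:
  "quantifier_free \<phi> \<Longrightarrow> is_fm macintyre \<phi> \<Longrightarrow> free_vars \<phi> \<subseteq> {..<Suc n} \<Longrightarrow>
    \<exists>Ps Es. decides n Ps Es (\<lambda>a. sat K (\<lambda>i. a ! i) \<phi>)"
proof (induction \<phi>)
  case (Eq s t)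
  have "polyf n (\<lambda>x b. eval_tm K (\<lambda>i. (x # b) ! i) s)" "polyf n (\<lambda>x b. eval_tm K (\<lambda>i. (x # b) ! i) t)"
    by (rule term_poly; use Eq.prems in simp)+
  from polyf_add[OF this(1) polyf_neg[OF this(2)]] obtain cs where cs: "\<forall>c\<in>set cs. coef n c"
    "\<forall>x b. length b = n \<longrightarrow> eval_tm K (\<lambda>i. (x # b) ! i) s \<oplus> \<ominus> eval_tm K (\<lambda>i. (x # b) ! i) t = pv cs b x"
    unfolding polyf_def by blast
  have e: "eval_tm K (\<lambda>i. (x # b) ! i) s = eval_tm K (\<lambda>i. (x # b) ! i) t \<longleftrightarrow> pv cs b x = \<zero>" if "length b = n" for x b
    unfolding cs(2)[rule_format, OF that, symmetric] F.diff_conv_add_uminus[symmetric] by (simp only: F.right_minus_eq)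
  show ?case by (rule exI[of _ "{cs}"], rule exI[of _ "{}"]) (simp add: decides_def cs(1) e agree_def)
next
  case (Rel r ts)
  have tp: "polyf n (\<lambda>x b. eval_tm K (\<lambda>i. (x # b) ! i) t)" if "t \<in> set ts" for t
    by (rule term_poly) (use Rel.prems that in auto)
  show ?case
  proof (cases r)
    case Div
    then have "length ts = 2" using Rel.prems by (simp add: macintyre_def)
    then obtain s t where ts: "ts = [s, t]" by (auto simp: numeral_2_eq_2 length_Suc_conv)
    obtain cs where cs: "\<forall>c\<in>set cs. coef n c" "\<forall>x b. length b = n \<longrightarrow> eval_tm K (\<lambda>i. (x # b) ! i) s = pv cs b x"
      using tp[of s] ts unfolding polyf_def by auto
    obtain ds where ds: "\<forall>c\<in>set ds. coef n c" "\<forall>x b. length b = n \<longrightarrow> eval_tm K (\<lambda>i. (x # b) ! i) t = pv ds b x"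
      using tp[of t] ts unfolding polyf_def by auto
    show ?thesis by (rule exI[of _ "{cs, ds}"], rule exI[of _ "{}"])
      (simp add: decides_def cs ds Div ts div_iff agree_def)
  next
    case (Pow k)
    then have "length ts = 1" and k: "k \<ge> 2" using Rel.prems by (auto simp: macintyre_def)
    then obtain t where ts: "ts = [t]" by (auto simp: length_Suc_conv)
    obtain cs where cs: "\<forall>c\<in>set cs. coef n c" "\<forall>x b. length b = n \<longrightarrow> eval_tm K (\<lambda>i. (x # b) ! i) t = pv cs b x"
      using tp[of t] ts unfolding polyf_def by auto
    show ?thesis by (rule exI[of _ "{cs}"], rule exI[of _ "{k}"])
      (use k in \<open>simp add: decides_def cs Pow ts pow_iff agree_def\<close>)
  qed
next
  case (Neg \<phi>)
  then obtain Ps Es where "decides n Ps Es (\<lambda>a. sat K (\<lambda>i. a ! i) \<phi>)" by auto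
  then show ?case by (intro exI[of _ Ps] exI[of _ Es]) (simp add: decides_def)
next
  case (Conj \<phi> \<psi>)
  obtain Ps Es where 1: "decides n Ps Es (\<lambda>a. sat K (\<lambda>i. a ! i) \<phi>)" using Conj.IH(1) Conj.prems by auto
  obtain Qs Fs where 2: "decides n Qs Fs (\<lambda>a. sat K (\<lambda>i. a ! i) \<psi>)" using Conj.IH(2) Conj.prems by auto
  show ?case using decides_union[OF 1 2]
    by (intro exI[of _ "Ps \<union> Qs"] exI[of _ "Es \<union> Fs"]) (simp add: decides_def)
qed simp

text \<open>Quantifier elimination enters here: a quantifier-free formula sees \<open>x\<close> only
  through the atomic behaviour of finitely many polynomials.\<close>

lemma decides_dfn: assumes "dfn (Suc n) P" shows "\<exists>Ps Es. decides n Ps Es P"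
proof -
  obtain \<phi> where \<phi>: "\<phi> \<in> fm_in macintyre (Suc n)" "\<forall>a\<in>tuples (Suc n). holds K a \<phi> \<longleftrightarrow> P a"
    using assms unfolding dfn_def by blast
  obtain \<psi> where \<psi>: "\<psi> \<in> fm_in macintyre (Suc n)" "quantifier_free \<psi>" "\<forall>a\<in>tuples (Suc n). holds K a \<phi> \<longleftrightarrow> holds K a \<psi>"
    using qe \<phi>(1) unfolding quantifier_elimination_def by blast
  obtain Ps Es where *: "decides n Ps Es (\<lambda>a. sat K (\<lambda>i. a ! i) \<psi>)"
    using decides_qf[OF \<psi>(2), of n] \<psi>(1) unfolding fm_in_def by blast
  have "decides n Ps Es P" by (rule decides_cong[OF *]) (use \<phi>(2) \<psi>(3) in \<open>simp add: tuples_def holds_def\<close>)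
  then show ?thesis by blast
qed

lemma decides_family:
  assumes "finite Fs" "\<forall>P\<in>Fs. dfn (Suc n) P" shows "\<exists>Ps Es. finite Ps \<and> finite Es \<and> 0 \<notin> Es \<and> (\<forall>cs\<in>Ps. \<forall>c\<in>set cs. coef n c) \<and> (\<forall>P\<in>Fs. decides n Ps Es P)"
  using assms
proof (induction Fs rule: finite_induct)
  case empty
  show ?case by (rule exI[of _ "{}"], rule exI[of _ "{}"]) simp
next
  case (insert P Fs)
  obtain Ps Es where 1: "finite Ps" "finite Es" "0 \<notin> Es" "\<forall>cs\<in>Ps. \<forall>c\<in>set cs. coef n c" "\<forall>P\<in>Fs. decides n Ps Es P"
    using insert.IH insert.prems by auto
  obtain Qs Gs where 2: "decides n Qs Gs P" using decides_dfn[of n P] insert.prems by auto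
  have 3: "finite Qs" "finite Gs" "0 \<notin> Gs" "\<forall>cs\<in>Qs. \<forall>c\<in>set cs. coef n c" using 2 unfolding decides_def by simp_all
  have T: "decides n Ps Es (\<lambda>a. True)" using 1 unfolding decides_def by simp
  have "\<forall>P'\<in>insert P Fs. decides n (Ps \<union> Qs) (Es \<union> Gs) P'"
    using decides_union(1)[OF _ 2] decides_union(2)[OF T 2] 1(5) by auto
  moreover have "finite (Ps \<union> Qs)" "finite (Es \<union> Gs)" "0 \<notin> Es \<union> Gs" "\<forall>cs\<in>Ps \<union> Qs. \<forall>c\<in>set cs. coef n c"
    using 1 3 by auto
  ultimately show ?case by (intro exI[of _ "Ps \<union> Qs"] exI[of _ "Es \<union> Gs"] conjI)
qed

end

section \<open>The value group\<close>

context val_field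
begin

lemma upper2: "a \<noteq> \<zero> \<Longrightarrow> b \<noteq> \<zero> \<Longrightarrow> \<exists>w. w \<noteq> \<zero> \<and> a \<preceq> w \<and> b \<preceq> w"
  using le_total[of a b] by (cases "a \<preceq> b") auto

lemma lower2: assumes "a \<noteq> \<zero>" shows "\<exists>w. w \<noteq> \<zero> \<and> w \<preceq> a \<and> w \<preceq> b"
proof (cases "b \<preceq> a")
  case True
  then have "b \<noteq> \<zero>" using assms by auto
  then show ?thesis using True by (intro exI[of _ b]) simp
next
  case False
  then show ?thesis using le_total[of a b] assms by (intro exI[of _ a]) simp
qed

text \<open>Continuity in the valuation topology, for the perturbation argument that produces an
  algebraic equation for a definable point.\<close>

lemma ev_continuous: "z \<noteq> \<zero> \<Longrightarrow> \<exists>u. u \<noteq> \<zero> \<and> (\<forall>t. u \<preceq> t \<longrightarrow> z \<preceq> ev p (x \<oplus> t) \<ominus> ev p x)"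
proof (induction p arbitrary: z)
  case Nil
  show ?case by (rule exI[of _ \<one>]) simp
next
  case (Cons a p)
  define z1 where "z1 = (if x = \<zero> then \<one> else z \<oslash> x)"
  have "z1 \<noteq> \<zero>" using Cons.prems by (simp add: z1_def)
  from Cons.IH[OF this] obtain u1 where u1: "u1 \<noteq> \<zero>" "\<And>t. u1 \<preceq> t \<Longrightarrow> z1 \<preceq> ev p (x \<oplus> t) \<ominus> ev p x" by blast
  obtain u2 where u2: "u2 \<noteq> \<zero>" "\<And>t. u2 \<preceq> t \<Longrightarrow> \<one> \<preceq> ev p (x \<oplus> t) \<ominus> ev p x" using Cons.IH[of \<one>] by auto
  obtain c where c: "c \<noteq> \<zero>" "c \<preceq> \<one>" "c \<preceq> ev p x" using lower2[of \<one> "ev p x"] by auto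
  obtain u3 where u3: "u3 \<noteq> \<zero>" "u1 \<preceq> u3" "u2 \<preceq> u3" using upper2[OF u1(1) u2(1)] by blast
  have "z \<oslash> c \<noteq> \<zero>" using Cons.prems c by simp
  from upper2[OF u3(1) this] obtain u where u: "u \<noteq> \<zero>" "u3 \<preceq> u" "z \<oslash> c \<preceq> u" by blast
  have "z \<preceq> ev (a # p) (x \<oplus> t) \<ominus> ev (a # p) x" if t: "u \<preceq> t" for t
  proof -
    define e where "e = ev p (x \<oplus> t) \<ominus> ev p x"
    have E: "ev p (x \<oplus> t) = e \<oplus> ev p x" by (simp add: e_def)
    have e1: "z1 \<preceq> e" unfolding e_def by (rule u1(2)) (rule le_trans[OF u3(2) le_trans[OF u(2) t]])
    have e2: "\<one> \<preceq> e" unfolding e_def by (rule u2(2)) (rule le_trans[OF u3(3) le_trans[OF u(2) t]])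
    have "z \<preceq> x \<otimes> e"
    proof (cases "x = \<zero>")
      case False
      have "x \<otimes> z1 \<preceq> x \<otimes> e" using e1 by simp
      moreover have "x \<otimes> z1 = z" using False by (simp add: z1_def)
      ultimately show ?thesis by simp
    qed simp
    moreover have "z \<preceq> t \<otimes> ev p (x \<oplus> t)"
    proof -
      have "c \<preceq> ev p (x \<oplus> t)" unfolding E by (rule le_add[OF le_trans[OF c(2) e2] c(3)])
      then have "(z \<oslash> c) \<otimes> c \<preceq> t \<otimes> ev p (x \<oplus> t)" by (rule le_mult[OF le_trans[OF u(3) t]])
      then show ?thesis using c(1) by simp
    qed
    ultimately have "z \<preceq> x \<otimes> e \<oplus> t \<otimes> ev p (x \<oplus> t)" by (rule le_add)
    moreover have "ev (a # p) (x \<oplus> t) \<ominus> ev (a # p) x = x \<otimes> e \<oplus> t \<otimes> ev p (x \<oplus> t)"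
      unfolding e_def by (simp add: algebra_simps)
    ultimately show ?thesis by simp
  qed
  then show ?case using u(1) by blast
qed

lemma common_bound:
  assumes "finite I" "\<And>i. i \<in> I \<Longrightarrow> \<exists>u. u \<noteq> \<zero> \<and> (\<forall>t. u \<preceq> t \<longrightarrow> P i t)"
  shows "\<exists>u. u \<noteq> \<zero> \<and> (\<forall>t. u \<preceq> t \<longrightarrow> (\<forall>i\<in>I. P i t))"
  using assms
proof (induction I rule: finite_induct)
  case empty
  show ?case by (rule exI[of _ \<one>]) simp
next
  case (insert i I)
  obtain u where u: "u \<noteq> \<zero>" "\<forall>t. u \<preceq> t \<longrightarrow> (\<forall>i\<in>I. P i t)" using insert.IH insert.prems by auto
  obtain v where v: "v \<noteq> \<zero>" "\<forall>t. v \<preceq> t \<longrightarrow> P i t" using insert.prems[of i] by auto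
  obtain w where w: "w \<noteq> \<zero>" "u \<preceq> w" "v \<preceq> w" using upper2[OF u(1) v(1)] by blast
  have "\<forall>i\<in>insert i I. P i t" if "w \<preceq> t" for t
    using u(2) v(2) le_trans[OF w(2) that] le_trans[OF w(3) that] by simp
  then show ?case using w(1) by (intro exI[of _ w]) simp
qed

end

context p_field_unif
begin

text \<open>The principle of the Newton polygon: if a single term had smallest valuation, all others
  would exceed it by a factor \<pi>, and the sum could not vanish.\<close>

lemma root_terms:
  assumes "ev s x = \<zero>" "x \<noteq> \<zero>" "\<exists>c\<in>set s. c \<noteq> \<zero>"
  shows "\<exists>i j. i < j \<and> cf s i \<noteq> \<zero> \<and> cf s j \<noteq> \<zero> \<and> cf s i \<otimes> x [^] i \<approx> cf s j \<otimes> x [^] j"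
proof (rule ccontr)
  assume no: "\<not> ?thesis"
  have ne: "{..<length s} \<noteq> {}" using assms(3) by (cases s) auto
  obtain k where k: "k \<in> {..<length s}" "\<And>j. j \<in> {..<length s} \<Longrightarrow> cf s k \<otimes> x [^] k \<preceq> cf s j \<otimes> x [^] j"
    using finite_min[OF finite_lessThan ne, where f = "\<lambda>i. cf s i \<otimes> x [^] i"] by blast
  obtain j where j: "j < length s" "cf s j \<noteq> \<zero>" using assms(3) by (auto simp: in_set_conv_nth cf_def)
  have k0: "cf s k \<noteq> \<zero>" using k(2)[of j] j assms(2) by auto
  have "cf s k \<otimes> x [^] k \<otimes> \<pi> \<preceq> cf s i \<otimes> x [^] i" if i: "i \<noteq> k" for i
  proof (cases "i < length s \<and> cf s i \<noteq> \<zero>")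
    case True
    have "\<not> cf s i \<otimes> x [^] i \<approx> cf s k \<otimes> x [^] k"
    proof
      assume a: "cf s i \<otimes> x [^] i \<approx> cf s k \<otimes> x [^] k"
      show False
      proof (cases "i < k")
        case True2: True
        then show False using no a True k0 by blast
      next
        case False
        then have "k < i" using i by simp
        then show False using no eqv_sym[OF a] True k0 by blast
      qed
    qed
    then have "cf s k \<otimes> x [^] k \<prec> cf s i \<otimes> x [^] i" using k(2)[of i] True unfolding eqv_def lt_def by simp
    then show ?thesis unfolding lt_iff_\<pi> by simp
  next
    case False
    then have "cf s i = \<zero>" by (auto simp: cf_def)
    then show ?thesis by simp
  qed
  from ev_dominated[OF assms(2) this]
  have "cf s k \<otimes> x [^] k \<otimes> \<pi> \<preceq> cf s k \<otimes> x [^] k" using assms(1) by simp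
  moreover have "cf s k \<otimes> x [^] k \<noteq> \<zero>" using k0 assms(2) by simp
  then have "(cf s k \<otimes> x [^] k) \<otimes> \<one> \<prec> (cf s k \<otimes> x [^] k) \<otimes> \<pi>" using \<pi>1 by (simp only: lt_mult_cancel_left simp_thms)
  ultimately show False by (simp add: lt_def)
qed

text \<open>By the relation, a positive multiple of v(x) is an integral multiple of v(\<pi>). This
  confines v(x) between multiples of v(\<pi>), and discreteness makes it such a multiple itself;
  division with remainder by \<open>q\<close> does the rest.\<close>

lemma root_of_power:
  assumes x: "x \<noteq> \<zero>" and e: "\<pi> [^] (a::nat) \<otimes> x [^] i \<approx> \<pi> [^] (b::nat) \<otimes> x [^] j" and ij: "i < (j::nat)" and q: "q > (0::nat)"
  shows "\<exists>y k. y \<noteq> \<zero> \<and> k < q \<and> x \<approx> y [^] q \<otimes> \<pi> [^] (k::nat)"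
proof -
  define d where "d = j - i"
  have d: "j = d + i" "d > 0" using ij by (simp_all add: d_def)
  have "x [^] i \<otimes> \<pi> [^] a \<approx> x [^] i \<otimes> (\<pi> [^] b \<otimes> x [^] d)"
    using e unfolding d(1) pow_add by (simp add: ac_simps)
  then have e': "\<pi> [^] a \<approx> \<pi> [^] b \<otimes> x [^] d" using x by simp
  have bd: "\<one> \<preceq> \<pi> [^] (k::nat)" for k by (rule \<pi>_pow_A)
  have pd: "z \<preceq> z [^] d" if "\<one> \<preceq> z" for z
  proof -
    obtain d' where d': "d = Suc d'" using d(2) gr0_conv_Suc by auto
    have "\<one> \<preceq> z [^] d'" using pow_le_mono[OF that, of d'] by simp
    from le_mult[OF le_refl this] have "z \<otimes> \<one> \<preceq> z \<otimes> z [^] d'" .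
    then show ?thesis unfolding d' pow_Suc by (simp only: F.mult_1_right)
  qed
  have "(\<exists>m. x \<approx> \<pi> [^] (m::nat)) \<or> (\<exists>m. x \<otimes> \<pi> [^] (m::nat) \<approx> \<one>)"
  proof (cases "\<one> \<preceq> x")
    case True
    have "\<not> \<pi> [^] Suc a \<preceq> x"
    proof
      assume "\<pi> [^] Suc a \<preceq> x"
      then have "(\<pi> [^] Suc a) [^] d \<preceq> x [^] d" by (rule pow_le_mono)
      then have "\<pi> [^] Suc a \<preceq> x [^] d" by (rule le_trans[OF pd[OF bd]])
      moreover have "x [^] d \<preceq> \<pi> [^] a"
      proof -
        have "\<one> \<otimes> x [^] d \<preceq> \<pi> [^] b \<otimes> x [^] d" by (rule le_mult[OF bd le_refl])
        then have "x [^] d \<preceq> \<pi> [^] b \<otimes> x [^] d" by simp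
        then show ?thesis using eqv_sym[OF e'] by (rule le_eqv_trans)
      qed
      ultimately have "\<pi> [^] Suc a \<preceq> \<pi> [^] a" by (rule le_trans)
      then show False unfolding \<pi>_pow_le_iff by simp
    qed
    then have "x \<prec> \<one> \<otimes> \<pi> [^] Suc a" unfolding lt_def by simp
    from discrete[OF True this] show ?thesis by auto
  next
    case False
    then have x1: "x \<preceq> \<one>" using le_total by blast
    have "\<one> \<prec> x \<otimes> \<pi> [^] Suc b"
    proof (rule ccontr)
      assume "\<not> \<one> \<prec> x \<otimes> \<pi> [^] Suc b"
      then have "x \<otimes> \<pi> [^] Suc b \<preceq> \<one>" unfolding lt_def by simp
      then have "(x \<otimes> \<pi> [^] Suc b) [^] d \<preceq> \<one> [^] d" by (rule pow_le_mono)
      then have 1: "x [^] d \<otimes> (\<pi> [^] Suc b) [^] d \<preceq> \<one>" by (simp only: pow_distrib pow_one)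
      have "x [^] d \<otimes> \<pi> [^] Suc b \<preceq> x [^] d \<otimes> (\<pi> [^] Suc b) [^] d" by (rule le_mult[OF le_refl pd[OF bd]])
      then have "x [^] d \<otimes> \<pi> [^] Suc b \<preceq> \<one>" using 1 by (rule le_trans)
      moreover have "x [^] d \<otimes> \<pi> [^] b \<prec> x [^] d \<otimes> \<pi> [^] Suc b" using x \<pi>_pow_lt[of b "Suc b"] by (simp only: lt_mult_cancel_left pow_eq_0) simp
      ultimately have "x [^] d \<otimes> \<pi> [^] b \<prec> \<one>" by (rule lt_le_trans[rotated])
      moreover have "\<one> \<preceq> x [^] d \<otimes> \<pi> [^] b" using le_eqv_trans[OF bd e'] by (simp only: F.mult.commute)
      ultimately show False unfolding lt_def by simp
    qed
    from discrete[OF x1 this] obtain m where "\<one> \<approx> x \<otimes> \<pi> [^] (m::nat)" by blast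
    then show ?thesis using eqv_sym by blast
  qed
  then show ?thesis
  proof (elim disjE exE)
    fix m :: nat assume m: "x \<approx> \<pi> [^] m"
    have "\<pi> [^] m = \<pi> [^] ((m div q) * q + m mod q)" by simp
    also have "\<dots> = (\<pi> [^] (m div q)) [^] q \<otimes> \<pi> [^] (m mod q)" by (simp only: pow_add pow_mult)
    finally have "x \<approx> (\<pi> [^] (m div q)) [^] q \<otimes> \<pi> [^] (m mod q)" using m by simp
    then show ?thesis using q by (intro exI[of _ "\<pi> [^] (m div q)"] exI[of _ "m mod q"]) simp
  next
    fix m :: nat assume m: "x \<otimes> \<pi> [^] m \<approx> \<one>"
    \<comment> \<open>Here v(x) is -m times v(\<pi>), and -m = l - m q with l \<ge> 0, so the
      remainder can be taken of the natural number \<open>l\<close>.\<close>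
    define l where "l = m * q - m"
    have ml: "m * q = m + l" using q by (simp add: l_def)
    have pl: "\<pi> [^] l = (\<pi> [^] (l div q)) [^] q \<otimes> \<pi> [^] (l mod q)"
    proof -
      have "\<pi> [^] l = \<pi> [^] ((l div q) * q + l mod q)" by simp
      then show ?thesis by (simp only: pow_add pow_mult)
    qed
    have P0: "(\<pi> [^] m) [^] q \<noteq> \<zero>" by simp
    have "(\<pi> [^] m) [^] q \<otimes> x = (x \<otimes> \<pi> [^] m) \<otimes> \<pi> [^] l"
      unfolding pow_mult[symmetric] ml pow_add by (simp add: ac_simps)
    also have "\<dots> \<approx> \<one> \<otimes> \<pi> [^] l" by (rule eqv_mult[OF m eqv_refl])
    also have "\<one> \<otimes> \<pi> [^] l = (\<pi> [^] m) [^] q \<otimes> ((\<pi> [^] (l div q) \<oslash> \<pi> [^] m) [^] q \<otimes> \<pi> [^] (l mod q))"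
      unfolding pl pow_divide using P0 by simp
    finally have "x \<approx> (\<pi> [^] (l div q) \<oslash> \<pi> [^] m) [^] q \<otimes> \<pi> [^] (l mod q)"
      unfolding eqv_mult_cancel_left using P0 by blast
    then show ?thesis using q by (intro exI[of _ "\<pi> [^] (l div q) \<oslash> \<pi> [^] m"] exI[of _ "l mod q"]) simp
  qed
qed

text \<open>The choices are nested: the product of the exponents gives \<open>M\<close> by Hensel's
  lemma, and \<open>M\<close> gives the factor \<open>e\<close> that makes powers of units congruent
  to one modulo \<pi>^M. The final exponent is a multiple of each exponent in \<open>Es\<close>, so
  its powers are powers for these as well.\<close>

lemma h_field_exists:
  assumes "finite Es" "0 \<notin> Es"
  shows "\<exists>M q. h_field R A p \<pi> M q \<and> (\<forall>k\<in>Es. k dvd q) \<and>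
    (\<forall>k\<in>Es. \<forall>u. \<pi> [^] (M::nat) \<preceq> u \<ominus> \<one> \<longrightarrow> (\<exists>y. y [^] (k::nat) = u))"
proof -
  define n where "n = \<Prod>Es"
  have n: "n > 0" "\<And>k. k \<in> Es \<Longrightarrow> k dvd n" using assms by (auto simp: n_def intro: Nat.gr0I dvd_prodI)
  obtain M :: nat where M: "M > 0" "\<forall>u. \<pi> [^] M \<preceq> u \<ominus> \<one> \<longrightarrow> (\<exists>y. y [^] n = u)" using nth_roots[OF n(1)] by blast
  obtain e :: nat where e: "e > 0" "\<forall>y. y \<approx> \<one> \<longrightarrow> \<pi> [^] M \<preceq> y [^] e \<ominus> \<one>" using unit_power[of M] by blast
  have "h_field R A p \<pi> M (n * e)"
  proof (intro h_field.intro p_field_unif_axioms h_field_axioms.intro)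
    fix y assume "y \<approx> \<one>"
    then have "y [^] n \<approx> \<one> [^] n" by (rule pow_eqv_mono)
    then show "\<pi> [^] M \<preceq> y [^] (n * e) \<ominus> \<one>" unfolding pow_mult by (intro e(2)[rule_format]) simp
  qed (use M e n in simp_all)
  moreover have "\<forall>k\<in>Es. k dvd n * e" using n(2) by auto
  moreover have "\<exists>y. y [^] k = u" if ku: "k \<in> Es" "\<pi> [^] M \<preceq> u \<ominus> \<one>" for k u
  proof -
    obtain m where m: "n = m * k" using n(2)[OF ku(1)] by (metis dvd_def mult.commute)
    obtain y where "y [^] n = u" using M(2)[rule_format, OF ku(2)] by blast
    then show ?thesis unfolding m pow_mult by blast
  qed
  ultimately show ?thesis by blast
qed

end

context h_field
begin

text \<open>An element of the subgroup is an \<open>n\<close>-th power times an element close to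
  one, and both factors are \<open>k\<close>-th powers.\<close>

lemma sim_power:
  assumes "sim v v'" "k dvd n" and root: "\<And>u. \<pi> [^] M \<preceq> u \<ominus> \<one> \<Longrightarrow> \<exists>y. y [^] (k::nat) = u"
  shows "(\<exists>y. y [^] k = v) \<longleftrightarrow> (\<exists>y. y [^] k = v')"
proof -
  have *: "\<exists>y. y [^] k = v'" if vv: "sim v v'" and v: "\<exists>y. y [^] k = v" for v v'
  proof -
    obtain h where h: "H h" "v' = h \<otimes> v" using vv unfolding sim_def by blast
    obtain y where y: "y \<noteq> \<zero>" "near (y [^] n) h" using h(1) unfolding H_def by blast
    have y0: "y [^] n \<noteq> \<zero>" using y(1) by simp
    have "y [^] n \<otimes> (h \<oslash> y [^] n \<ominus> \<one>) = h \<ominus> y [^] n"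
      unfolding F.right_diff_distrib using y0 by simp
    then have "y [^] n \<otimes> Q \<preceq> y [^] n \<otimes> (h \<oslash> y [^] n \<ominus> \<one>)" using y(2) unfolding near_def by (simp add: ac_simps)
    then have "Q \<preceq> h \<oslash> y [^] n \<ominus> \<one>" unfolding le_mult_cancel_left using y0 by blast
    from root[OF this[unfolded Q_def]] obtain z where z: "z [^] k = h \<oslash> y [^] n" by blast
    obtain m where m: "n = m * k" using assms(2) by (metis dvd_def mult.commute)
    obtain w where w: "w [^] k = v" using v by blast
    have "h = z [^] k \<otimes> (y [^] m) [^] k" using z y0 unfolding m pow_mult by simp
    then have "(z \<otimes> y [^] m \<otimes> w) [^] k = v'" unfolding pow_distrib w h(2) by simp
    then show ?thesis by blast
  qed
  show ?thesis using *[OF assms(1)] *[OF sim_sym[OF assms(1)]] by blast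
qed

end

context mac_field
begin

lemma skolem_const:
  assumes "dfn m P" "u \<in> tuples m" "P u"
  shows "\<exists>v. v \<in> tuples m \<and> P v \<and> (\<forall>j<m. dfun 0 (\<lambda>_. v ! j))"
proof -
  have "dfn (m + 0) P" using assms(1) by simp
  from skolem[OF sk this] obtain f where f: "\<forall>b\<in>tuples 0. f b \<in> tuples m" "\<forall>j<m. dfun 0 (\<lambda>b. f b ! j)"
    "\<forall>b\<in>tuples 0. (\<exists>a\<in>tuples m. P (a @ b)) \<longrightarrow> P (f b @ b)" by (elim exE conjE) (rule that)
  have nil: "[] \<in> (tuples 0 :: 'a list set)" by (simp add: tuples_def)
  have "P (f [])" using f(3)[rule_format, OF nil] assms(2,3) by auto
  moreover have "dfun 0 (\<lambda>_. f [] ! j)" if "j < m" for j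
    by (rule iffD1[OF dfun_cong f(2)[rule_format, OF that]]) simp
  ultimately show ?thesis using f(1) nil by blast
qed

lemma agree_of_sim:
  assumes h: "h_field R A p \<pi> M q" and Es: "\<forall>k\<in>Es. k dvd q"
      "\<forall>k\<in>Es. \<forall>u. \<pi> [^] (M::nat) \<preceq> u \<ominus> \<one> \<longrightarrow> (\<exists>y. y [^] (k::nat) = u)"
    and s: "\<And>cs. cs \<in> Ps \<Longrightarrow> h_field.sim R A \<pi> M q (pv cs b x) (pv cs b x')"
    and l: "\<And>cs ds. cs \<in> Ps \<Longrightarrow> ds \<in> Ps \<Longrightarrow> pv cs b x \<preceq> pv ds b x \<longleftrightarrow> pv cs b x' \<preceq> pv ds b x'"
  shows "agree Ps Es b x x'"
proof -
  interpret h: h_field R A p \<pi> M q by (rule h)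
  show ?thesis unfolding agree_def
  proof (intro conjI ballI)
    fix cs k assume "cs \<in> Ps" "k \<in> Es"
    then show "(\<exists>y. y [^] k = pv cs b x) \<longleftrightarrow> (\<exists>y. y [^] k = pv cs b x')"
      by (intro h.sim_power[OF s]) (use Es in simp_all)
  qed (use h.sim_zero_iff[OF s] l in simp_all)
qed

text \<open>That the definable point is algebraic is seen by perturbation: if no deciding polynomial
  other than the zero polynomial vanished at it, all points near it would agree with it, and its
  definition could not single it out.\<close>

lemma z_group:
  assumes u: "uniformizer \<pi>" and q: "q > 0" and x: "x \<noteq> \<zero>"
  shows "\<exists>y k. y \<noteq> \<zero> \<and> k < q \<and> x \<approx> y [^] q \<otimes> \<pi> [^] (k::nat)"
proof (rule ccontr)
  assume no: "\<not> ?thesis"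
  \<comment> \<open>The uniformizer is quantified instead of fixed, so that the set of bad points is
    definable without parameters.\<close>
  define bad where "bad x \<longleftrightarrow> x \<noteq> \<zero> \<and> \<not> (\<exists>\<rho>. \<exists>y. uniformizer \<rho> \<and> y \<noteq> \<zero> \<and> (\<exists>k\<in>{..<q}. x \<approx> y [^] q \<otimes> \<rho> [^] k))" for x
  have "dfn 1 (\<lambda>a. \<exists>\<rho>. \<exists>y. uniformizer \<rho> \<and> y \<noteq> \<zero> \<and> (\<exists>k\<in>{..<q}. a ! 0 \<approx> y [^] q \<otimes> \<rho> [^] k))"
  proof (rule dfn_ex, rule dfn_ex)
    have 1: "dfun (Suc (Suc 1)) hd" "dfun (Suc (Suc 1)) (\<lambda>a. hd (tl a))" "dfun (Suc (Suc 1)) (\<lambda>a. tl (tl a) ! 0)"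
      by (rule dfun_hd, rule dfun_lift[OF dfun_hd], rule dfun_lift[OF dfun_lift[OF dfun_nth]]) simp
    show "dfn (Suc (Suc 1)) (\<lambda>a. uniformizer (hd (tl a)) \<and> hd a \<noteq> \<zero> \<and> (\<exists>k\<in>{..<q}. tl (tl a) ! 0 \<approx> hd a [^] q \<otimes> hd (tl a) [^] k))"
      by (intro dfn_conj dfn_uniformizer dfn_not dfn_eq dfn_bex_finite dfn_eqv dfun_mult dfun_pow dfun_zero 1 finite_lessThan)
  qed
  then have dbad: "dfn 1 (\<lambda>a. bad (a ! 0))"
    unfolding bad_def by (intro dfn_conj dfn_not dfn_eq dfun_nth dfun_zero) simp_all
  have "\<rho> \<approx> \<pi>" if "uniformizer \<rho>" for \<rho> by (rule uniformizer_eqv[OF that u])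
  then have "bad x" unfolding bad_def
  proof (intro conjI notI x, elim exE conjE bexE)
    fix \<rho> y k assume *: "\<And>\<rho>. uniformizer \<rho> \<Longrightarrow> \<rho> \<approx> \<pi>" "uniformizer \<rho>" "y \<noteq> \<zero>" "k \<in> {..<q}" "x \<approx> y [^] q \<otimes> \<rho> [^] k"
    have "y [^] q \<otimes> \<rho> [^] k \<approx> y [^] q \<otimes> \<pi> [^] k" by (rule eqv_mult[OF eqv_refl pow_eqv_mono[OF *(1)[OF *(2)]]])
    with *(5) have "x \<approx> y [^] q \<otimes> \<pi> [^] k" by (rule eqv_trans)
    then show False using no *(3,4) by blast
  qed
  then obtain v where v: "v \<in> tuples 1" "bad (v ! 0)" "dfun 0 (\<lambda>_. v ! 0)"
    using skolem_const[OF dbad, of "[x]"] by (auto simp: tuples_def)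
  define x0 where "x0 = v ! 0"
  have d0: "dfn (Suc 0) (\<lambda>a. hd a = x0)" using v(3) unfolding dfun_def x0_def .
  obtain Ps Es where dec: "decides 0 Ps Es (\<lambda>a. hd a = x0)" using decides_dfn[OF d0] by blast
  have fin: "finite Ps" "finite Es" "0 \<notin> Es" and co: "\<forall>cs\<in>Ps. \<forall>c\<in>set cs. coef 0 c" using dec unfolding decides_def by simp_all
  interpret p_field_unif R A p \<pi> by (intro p_field_unif.intro p_field_axioms p_field_unif_axioms.intro u)
  obtain M q' where h: "h_field R A p \<pi> M q'" "\<forall>k\<in>Es. k dvd q'"
      "\<forall>k\<in>Es. \<forall>u. \<pi> [^] (M::nat) \<preceq> u \<ominus> \<one> \<longrightarrow> (\<exists>y. y [^] (k::nat) = u)"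
    using h_field_exists[OF fin(2,3)] by blast
  interpret h: h_field R A p \<pi> M q' by (rule h(1))
  have "\<exists>cs\<in>Ps. pv cs [] x0 = \<zero> \<and> (\<exists>c\<in>set cs. c [] \<noteq> \<zero>)"
  proof (rule ccontr)
    assume nr: "\<not> (\<exists>cs\<in>Ps. pv cs [] x0 = \<zero> \<and> (\<exists>c\<in>set cs. c [] \<noteq> \<zero>))"
    have "\<exists>u. u \<noteq> \<zero> \<and> (\<forall>t. u \<preceq> t \<longrightarrow> h.near (pv cs [] x0) (pv cs [] (x0 \<oplus> t)))" if cs: "cs \<in> Ps" for cs
    proof (cases "pv cs [] x0 = \<zero>")
      case True
      then have "\<forall>c\<in>set (map (\<lambda>c. c []) cs). c = \<zero>" using nr cs by auto
      then have "pv cs [] y = \<zero>" for y unfolding pv_def by (rule taylor_zero_poly)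
      then show ?thesis by (intro exI[of _ \<one>]) simp
    next
      case False
      then have "h.Q \<otimes> pv cs [] x0 \<noteq> \<zero>" by simp
      from ev_continuous[OF this, of "map (\<lambda>c. c []) cs" x0] show ?thesis unfolding h.near_def pv_def .
    qed
    from common_bound[OF fin(1) this, of "\<lambda>cs. cs"] obtain t where
      t: "t \<noteq> \<zero>" "\<forall>s. t \<preceq> s \<longrightarrow> (\<forall>cs\<in>Ps. h.near (pv cs [] x0) (pv cs [] (x0 \<oplus> s)))" by blast
    have nr: "h.near (pv cs [] x0) (pv cs [] (x0 \<oplus> t))" if "cs \<in> Ps" for cs using t(2) that by simp
    have "agree Ps Es [] x0 (x0 \<oplus> t)"
      by (rule agree_of_sim[OF h h.near_sim[OF nr] h.near_le[OF nr nr]])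
    from decidesD[OF dec _ this] have "x0 \<oplus> t = x0" by simp
    then show False using t(1) by simp
  qed
  then obtain cs where cs: "cs \<in> Ps" "pv cs [] x0 = \<zero>" "\<exists>c\<in>set cs. c [] \<noteq> \<zero>" by blast
  define s where "s = map (\<lambda>c. c []) cs"
  have x00: "x0 \<noteq> \<zero>" using v(2) unfolding bad_def x0_def by simp
  have sz: "c \<in> Zs" if "c \<in> set s" for c using that co cs(1) unfolding s_def coef_def by auto
  have "ev s x0 = \<zero>" "\<exists>c\<in>set s. c \<noteq> \<zero>" using cs(2,3) unfolding s_def pv_def by simp_all
  from root_terms[OF this(1) x00 this(2)] obtain i j where
    ij: "i < j" "cf s i \<noteq> \<zero>" "cf s j \<noteq> \<zero>" "cf s i \<otimes> x0 [^] i \<approx> cf s j \<otimes> x0 [^] j" by blast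
  have cz: "\<exists>a. cf s i \<approx> \<pi> [^] (a::nat)" if "cf s i \<noteq> \<zero>" for i
  proof (rule Zs_val[OF sz that u])
    show "cf s i \<in> set s" using that unfolding cf_def by (auto split: if_splits)
  qed
  obtain a b :: nat where ab: "cf s i \<approx> \<pi> [^] a" "cf s j \<approx> \<pi> [^] b" using cz[OF ij(2)] cz[OF ij(3)] by blast
  have "\<pi> [^] a \<otimes> x0 [^] i \<approx> cf s i \<otimes> x0 [^] i" by (rule eqv_mult[OF eqv_sym[OF ab(1)] eqv_refl])
  also note ij(4)
  also have "cf s j \<otimes> x0 [^] j \<approx> \<pi> [^] b \<otimes> x0 [^] j" by (rule eqv_mult[OF ab(2) eqv_refl])
  finally obtain y k where "y \<noteq> \<zero>" "k < q" "x0 \<approx> y [^] q \<otimes> \<pi> [^] (k::nat)"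
    using root_of_power[OF x00 _ ij(1) q, of a b] by blast
  then show False using v(2) u unfolding bad_def x0_def by auto
qed

end

section \<open>Decomposition of the line\<close>

context fo
begin

definition dset :: "nat \<Rightarrow> ('a list \<Rightarrow> 'a set) \<Rightarrow> bool" where
  "dset n V \<longleftrightarrow> dfn (Suc n) (\<lambda>u. hd u \<in> V (tl u))"

lemma dset_mem: "dset n V \<Longrightarrow> dfun n f \<Longrightarrow> dfn n (\<lambda>a. f a \<in> V a)"
  unfolding dset_def by (rule dfn_subst[where P = "\<lambda>x a. x \<in> V a"])

lemma dfn_hd_sel: assumes "dfn (Suc n) P" "sel k n s" shows "dfn (Suc k) (\<lambda>u. P (hd u # s (tl u)))"
proof -
  have "sel (Suc k) (1 + n) (\<lambda>u. [u ! 0] @ s (tl u))"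
    by (intro sel_append sel_nth sel_comp[OF sel_tl assms(2)]) simp
  moreover have "dfn (1 + n) P" using assms(1) by simp
  ultimately have "dfn (Suc k) (\<lambda>u. P ([u ! 0] @ s (tl u)))" by (rule dfn_sel[rotated])
  then show ?thesis by (rule iffD1[OF dfn_cong, rotated]) (auto simp: length_Suc_conv)
qed

lemma dset_sel: assumes "dset n V" "sel k n s" shows "dset k (\<lambda>a. V (s a))"
  using dfn_hd_sel[OF assms(1)[unfolded dset_def] assms(2)] unfolding dset_def by simp

lemma dset_Collect: "dfn (Suc n) (\<lambda>u. P (hd u) (tl u)) \<Longrightarrow> dset n (\<lambda>a. {x. P x a})"
  unfolding dset_def by simp

lemma dset_fibre: assumes "dfn (Suc n) P" "sel k n s" shows "dset k (\<lambda>a. {x. P (x # s a)})"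
  using dfn_hd_sel[OF assms] by (rule dset_Collect)

lemma dfn_psubset: assumes "dset n V" "dset n W" shows "dfn n (\<lambda>a. V a \<subset> W a)"
proof -
  have "dfn n (\<lambda>a. (\<forall>x. x \<in> V a \<longrightarrow> x \<in> W a) \<and> \<not> (\<forall>x. x \<in> W a \<longrightarrow> x \<in> V a))"
    by (intro dfn_conj dfn_not dfn_all dfn_imp assms[unfolded dset_def])
  then show ?thesis by (simp only: less_le_not_le subset_iff)
qed

lemma dfn_meets: assumes "dset n V" "dset n W" shows "dfn n (\<lambda>a. \<exists>x. x \<in> V a \<and> x \<in> W a)" "dfn n (\<lambda>a. \<exists>x. x \<in> V a \<and> x \<notin> W a)"
  by (intro dfn_ex dfn_conj dfn_not assms[unfolded dset_def])+

end

context val_field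
begin

text \<open>The radius involves a d-th root and need not exist in the value group, so this is a ball
  in the sense of a cut. The larger of the distances of \<open>x\<close> and \<open>y\<close> from
  \<open>c\<close> bounds that of \<open>z\<close>.\<close>

lemma ball_cut: assumes "d > 0" shows "ball {x. a \<preceq> e \<otimes> (x \<ominus> c) [^] (d::nat)}"
  unfolding ball_def
proof (intro conjI ballI allI impI)
  have "c \<in> {x. a \<preceq> e \<otimes> (x \<ominus> c) [^] d}" using assms by (simp add: pow_zero)
  then show "{x. a \<preceq> e \<otimes> (x \<ominus> c) [^] d} \<noteq> {}" by blast
next
  fix x y z assume x: "x \<in> {x. a \<preceq> e \<otimes> (x \<ominus> c) [^] d}" and y: "y \<in> {x. a \<preceq> e \<otimes> (x \<ominus> c) [^] d}" and z: "y \<ominus> x \<preceq> z \<ominus> x"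
  have yx: "y \<ominus> x = (y \<ominus> c) \<ominus> (x \<ominus> c)" and zc: "z \<ominus> c = (z \<ominus> x) \<oplus> (x \<ominus> c)" by (simp_all add: algebra_simps)
  have "\<exists>w. w \<preceq> z \<ominus> c \<and> a \<preceq> e \<otimes> w [^] d"
  proof (cases "x \<ominus> c \<preceq> y \<ominus> c")
    case True
    then have "x \<ominus> c \<preceq> y \<ominus> x" unfolding yx by (rule le_diff) simp
    then have "x \<ominus> c \<preceq> z \<ominus> x" using z by (rule le_trans)
    then have "x \<ominus> c \<preceq> z \<ominus> c" unfolding zc by (rule le_add) simp
    then show ?thesis using x by blast
  next
    case False
    then have *: "y \<ominus> c \<preceq> x \<ominus> c" using le_total by blast
    have "y \<ominus> c \<preceq> y \<ominus> x" unfolding yx by (rule le_diff[OF le_refl *])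
    then have "y \<ominus> c \<preceq> z \<ominus> x" using z by (rule le_trans)
    then have "y \<ominus> c \<preceq> z \<ominus> c" unfolding zc using * by (rule le_add)
    then show ?thesis using y by blast
  qed
  then obtain w where w: "w \<preceq> z \<ominus> c" "a \<preceq> e \<otimes> w [^] d" by blast
  have "e \<otimes> w [^] d \<preceq> e \<otimes> (z \<ominus> c) [^] d" by (rule le_mult[OF le_refl pow_le_mono[OF w(1)]])
  then show "z \<in> {x. a \<preceq> e \<otimes> (x \<ominus> c) [^] d}" using le_trans[OF w(2)] by blast
qed

lemma ball_UNIV: "ball UNIV" unfolding ball_def by simp

lemma ball_singleton: "ball {c}" unfolding ball_def by simp

text \<open>With finitely many indices, membership in a root ball becomes expressible by a
  formula.\<close>

lemma root_ball_iff:
  assumes "length s \<le> Suc D"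
  shows "y \<in> root_ball s x \<longleftrightarrow> (\<forall>i\<in>{1..D}. ev s x \<preceq> taylor s x i \<otimes> (y \<ominus> x) [^] i)"
proof
  assume "y \<in> root_ball s x"
  then show "\<forall>i\<in>{1..D}. ev s x \<preceq> taylor s x i \<otimes> (y \<ominus> x) [^] i" by (simp add: root_ball_def)
next
  assume *: "\<forall>i\<in>{1..D}. ev s x \<preceq> taylor s x i \<otimes> (y \<ominus> x) [^] i"
  have "ev s x \<preceq> taylor s x i \<otimes> (y \<ominus> x) [^] i" if "i > 0" for i
  proof (cases "i \<le> D")
    case True
    then show ?thesis using * that by simp
  next
    case False
    then have "taylor s x i = \<zero>" using assms by (intro taylor_eq_0) simp
    then show ?thesis by simp
  qed
  then show "y \<in> root_ball s x" by (simp add: root_ball_def)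
qed

end

text \<open>The uniformizer is definable without parameters, so that the formulas for cells have no
  parameters besides those taken from B.\<close>

locale mac_h = mac_field R A p K + h_field R A p \<pi> M q
  for R :: "'a ring" (structure) and A p and K :: "'a mac_struct" and \<pi> M q +
  assumes dfun_\<pi>: "dfun 0 (\<lambda>_. \<pi>)"
begin

lemma dfun_\<pi>_pow: "dfun n (\<lambda>a. \<pi> [^] (k::nat))"
  by (rule dfun_pow[OF dfun_const[OF dfun_\<pi>]])

lemma dfun_Q: "dfun n (\<lambda>a. Q)"
  unfolding Q_def by (rule dfun_\<pi>_pow)

lemma dfn_H: assumes "dfun n f" shows "dfn n (\<lambda>a. H (f a))"
  unfolding H_def near_def
  by (rule dfn_ex) (intro dfn_conj dfn_not dfn_eq dfn_le dfun_mult dfun_diff dfun_pow dfun_Q dfun_zero dfun_hd dfun_lift[OF assms])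

lemma dfn_sim: assumes "dfun n f" "dfun n g" shows "dfn n (\<lambda>a. sim (f a) (g a))"
  unfolding sim_def
  by (rule dfn_ex) (intro dfn_conj dfn_eq dfn_H dfun_mult dfun_hd dfun_lift[OF assms(1)] dfun_lift[OF assms(2)])

end

locale mac_cells = mac_h R A p K \<pi> M q + cell_family R A p \<pi> M q cen N g L rep r
  for R :: "'a ring" (structure) and A p and K :: "'a mac_struct" and \<pi> M q
    and cen :: "nat \<Rightarrow> 'a list \<Rightarrow> 'a" and N and g :: "nat \<Rightarrow> 'a list \<Rightarrow> 'a set" and L rep r +
  fixes n :: nat and Fs :: "('a list \<Rightarrow> bool) set"
  assumes dfun_cen: "j < N \<Longrightarrow> dfun n (cen j)" and dset_g: "l < L \<Longrightarrow> dset n (g l)"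
    and dfun_rep: "i < r \<Longrightarrow> dfun 0 (\<lambda>_. rep i)"
    and finite_Fs: "finite Fs" and dfn_Fs: "P \<in> Fs \<Longrightarrow> dfn (Suc n) P"
    and same_Fs: "length b = n \<Longrightarrow> same b x y \<Longrightarrow> P \<in> Fs \<Longrightarrow> P (x # b) = P (y # b)"
begin

lemma dset_U:
  assumes "i \<in> Idx" "dfun k c" "sel k n s" shows "dset k (\<lambda>a. U (c a) i (s a))"
proof (cases i)
  case (Inl l)
  then have "l < L" using assms(1) by (auto simp: Idx_def)
  then show ?thesis unfolding Inl U.simps by (intro dset_sel[OF dset_g assms(3)])
next
  case (Inr mj)
  obtain m j where mj: "mj = (m, j)" by (cases mj)
  then have "j < N" using assms(1) Inr by (auto simp: Idx_def)
  from dfun_sel[OF dfun_cen[OF this] assms(3)] have d: "dfun k (\<lambda>a. cen j (s a))" .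
  show ?thesis unfolding Inr mj U.simps J_def
    by (rule dset_Collect) (intro dfn_le dfun_mult dfun_diff dfun_\<pi>_pow dfun_Q dfun_hd dfun_lift[OF assms(2)] dfun_lift[OF d])
qed

lemma dfn_consecutive:
  assumes "dfun k c" "dset k V" "dset k W" "sel k n s" shows "dfn k (\<lambda>a. consecutive (c a) (V a) (W a) (s a))"
  unfolding consecutive_def
  by (intro dfn_conj dfn_not dfn_ball_finite dfn_psubset dset_mem dset_U assms finite_Idx)

lemma dset_cell:
  assumes "dfun k c" "dset k V" "dset k W" "i < r" shows "dset k (\<lambda>a. cell (c a) (V a) (W a) i)"
  unfolding cell_def
  by (rule dset_Collect) (intro dfn_conj dfn_not dfn_sim dfun_diff dfun_hd dfun_lift[OF assms(1)] assms(2,3)[unfolded dset_def] dfun_const[OF dfun_rep[OF assms(4)]])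

definition cl :: "nat \<Rightarrow> nat + nat \<times> nat \<Rightarrow> nat + nat \<times> nat \<Rightarrow> nat \<Rightarrow> 'a list \<Rightarrow> 'a list \<Rightarrow> 'a list \<Rightarrow> 'a set" where
  "cl j u w i b1 b2 b3 = cell (cen j b1) (U (cen j b1) u b2) (U (cen j b1) w b3) i"

text \<open>Being crossed by a predicate at \<open>b\<close> is itself made a reason for exclusion.
  The surviving cells are therefore uncrossed by construction, and the work lies in showing that the
  cell found around a given point survives.\<close>

definition bad :: "nat \<Rightarrow> nat + nat \<times> nat \<Rightarrow> nat + nat \<times> nat \<Rightarrow> nat \<Rightarrow> 'a list \<Rightarrow> 'a list \<Rightarrow> 'a list \<Rightarrow> 'a list \<Rightarrow> bool" where
  "bad j u w i b b1 b2 b3 \<longleftrightarrow> \<not> consecutive (cen j b1) (U (cen j b1) u b2) (U (cen j b1) w b3) b \<or>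
     (\<exists>P\<in>Fs. (\<exists>x. x \<in> cl j u w i b1 b2 b3 \<and> x \<in> {x. P (x # b)}) \<and> (\<exists>x. x \<in> cl j u w i b1 b2 b3 \<and> x \<notin> {x. P (x # b)}))"

lemma dset_cl:
  assumes "j < N" "u \<in> Idx" "w \<in> Idx" "i < r" "sel k n s1" "sel k n s2" "sel k n s3"
  shows "dset k (\<lambda>a. cl j u w i (s1 a) (s2 a) (s3 a))"
  unfolding cl_def by (intro dset_cell dset_U dfun_sel[OF dfun_cen] assms)

lemma dfn_bad:
  assumes "j < N" "u \<in> Idx" "w \<in> Idx" "i < r" "sel k n s" "sel k n s1" "sel k n s2" "sel k n s3"
  shows "dfn k (\<lambda>a. bad j u w i (s a) (s1 a) (s2 a) (s3 a))"
  unfolding bad_def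
  by (intro dfn_disj dfn_not dfn_consecutive dfn_bex_finite finite_Fs dfn_conj dfn_meets dset_cl dset_fibre[OF dfn_Fs assms(5)] dset_U dfun_sel[OF dfun_cen] assms)

lemma decomposition: "\<exists>T. decomposes 1 n Fs 3 T 1"
proof -
  \<comment> \<open>The centers themselves are covered by singleton cells, which depend on one
    parameter only and are never excluded.\<close>
  define F1 where "F1 j a \<longleftrightarrow> a ! 0 = cen j (block n 1 0 a)" for j a
  define F2 where "F2 j u w i a \<longleftrightarrow> a ! 0 \<in> cl j u w i (block n 1 0 a) (block n 1 1 a) (block n 1 2 a)" for j u w i a
  define E2 where "E2 j u w i a \<longleftrightarrow> bad j u w i (take n a) (block n n 0 a) (block n n 1 a) (block n n 2 a)" for j u w i a
  define T where "T = (\<lambda>j. (F1 j, \<lambda>a. False)) ` {..<N} \<union> (\<lambda>(j, u, w, i). (F2 j u w i, E2 j u w i)) ` ({..<N} \<times> Idx \<times> Idx \<times> {..<r})"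
  have blk: "block n k 0 (a @ concat [b1, b2, b3]) = b1" "block n k 1 (a @ concat [b1, b2, b3]) = b2" "block n k 2 (a @ concat [b1, b2, b3]) = b3"
    if "length a = k" "length b1 = n" "length b2 = n" "length b3 = n" for a k b1 b2 b3
  proof -
    have "block n k j (a @ concat [b1, b2, b3]) = [b1, b2, b3] ! j" if "j < 3" for j
      by (rule block_append) (use that \<open>length a = k\<close> \<open>length b1 = n\<close> \<open>length b2 = n\<close> \<open>length b3 = n\<close> in simp_all)
    from this[of 0] this[of 1] this[of 2] show "block n k 0 (a @ concat [b1, b2, b3]) = b1" "block n k 1 (a @ concat [b1, b2, b3]) = b2" "block n k 2 (a @ concat [b1, b2, b3]) = b3"
      by simp_all
  qed
  have sb: "sel (k + 3 * n) n (block n k j)" if "j < 3" for k j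
    by (rule sel_block) (use that mult_le_mono1[of "Suc j" 3 n] in simp)
  have F1: "F1 j ([x] @ concat [b1, b2, b3]) \<longleftrightarrow> x = cen j b1" if "length b1 = n" "length b2 = n" "length b3 = n" for j x b1 b2 b3
  proof -
    have l: "length [x] = 1" by simp
    show ?thesis unfolding F1_def blk[OF l that] by simp
  qed
  have F2: "F2 j u w i ([x] @ concat [b1, b2, b3]) \<longleftrightarrow> x \<in> cl j u w i b1 b2 b3" if "length b1 = n" "length b2 = n" "length b3 = n" for j u w i x b1 b2 b3
  proof -
    have l: "length [x] = 1" by simp
    show ?thesis unfolding F2_def blk[OF l that] by simp
  qed
  have E2: "E2 j u w i (b @ concat [b1, b2, b3]) \<longleftrightarrow> bad j u w i b b1 b2 b3" if "length b = n" "length b1 = n" "length b2 = n" "length b3 = n" for j u w i b b1 b2 b3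
  proof -
    have t: "take n (b @ concat [b1, b2, b3]) = b" using that by simp
    show ?thesis unfolding E2_def blk[OF that] t ..
  qed
  define emb where "emb Z = {a \<in> tuples 1. a ! 0 \<in> Z}" for Z :: "'a set"
  have len: "length b = n" if "params n B" "b \<in> B" for b B using that by (auto simp: params_def tuples_def)
  have three: thesis if "length bs = 3" "set bs \<subseteq> B" "\<And>b1 b2 b3. bs = [b1, b2, b3] \<Longrightarrow> b1 \<in> B \<Longrightarrow> b2 \<in> B \<Longrightarrow> b3 \<in> B \<Longrightarrow> thesis"
    for bs :: "'a list list" and B thesis
  proof -
    have "\<exists>b1 b2 b3. bs = [b1, b2, b3]" using that(1) by (auto simp: numeral_3_eq_3 length_Suc_conv)
    then obtain b1 b2 b3 where b: "bs = [b1, b2, b3]" by (elim exE)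
    then show thesis using that(2) by (intro that(3)[OF b]) simp_all
  qed
  have e1: "{x \<in> tuples 1. F1 j (x @ concat [b1, b2, b3])} = emb {cen j b1}" if "length b1 = n" "length b2 = n" "length b3 = n" for j b1 b2 b3
    using F1[OF that] unfolding emb_def by (auto simp: tuples_def length_Suc_conv)
  have e2: "{x \<in> tuples 1. F2 j u w i (x @ concat [b1, b2, b3])} = emb (cl j u w i b1 b2 b3)" if "length b1 = n" "length b2 = n" "length b3 = n" for j u w i b1 b2 b3
    using F2[OF that] unfolding emb_def by (auto simp: tuples_def length_Suc_conv)
  have cases: "(\<exists>j b1. j < N \<and> b1 \<in> B \<and> D = emb {cen j b1}) \<or>
      (\<exists>j u w i b1 b2 b3. j < N \<and> u \<in> Idx \<and> w \<in> Idx \<and> i < r \<and> b1 \<in> B \<and> b2 \<in> B \<and> b3 \<in> B \<and>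
        (\<forall>b\<in>B. \<not> bad j u w i b b1 b2 b3) \<and> D = emb (cl j u w i b1 b2 b3))"
    if B: "params n B" and D: "D \<in> scells 1 3 T B" for B D
  proof -
    obtain F E bs where *: "(F, E) \<in> T" "length bs = 3" "set bs \<subseteq> B" "\<forall>b\<in>B. \<not> E (b @ concat bs)"
      "D = {x \<in> tuples 1. F (x @ concat bs)}" using D by (rule scellsE)
    obtain b1 b2 b3 where b: "bs = [b1, b2, b3]" "b1 \<in> B" "b2 \<in> B" "b3 \<in> B" by (rule three[OF *(2,3)])
    note l = len[OF B b(2)] len[OF B b(3)] len[OF B b(4)]
    consider j where "j < N" "F = F1 j" | j u w i where "j < N" "u \<in> Idx" "w \<in> Idx" "i < r" "F = F2 j u w i" "E = E2 j u w i"
      using *(1) unfolding T_def by auto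
    then show ?thesis
    proof cases
      case 1
      have "D = emb {cen j b1}" unfolding *(5) 1(2) b(1) by (rule e1[OF l])
      then show ?thesis using 1(1) b(2) by blast
    next
      case 2
      have "D = emb (cl j u w i b1 b2 b3)" unfolding *(5) 2(5) b(1) by (rule e2[OF l])
      moreover have "\<forall>b\<in>B. \<not> bad j u w i b b1 b2 b3" using *(4) E2[OF len[OF B] l] unfolding 2(6) b(1) by blast
      ultimately show ?thesis using 2(1-4) b(2-4) by blast
    qed
  qed
  show ?thesis
  proof (intro exI[of _ T], unfold decomposes_def, intro conjI allI impI)
    show "finite T" unfolding T_def using finite_Idx by simp
  next
    fix F E assume "(F, E) \<in> T"
    then consider j where "j < N" "F = F1 j" | j u w i where "j < N" "u \<in> Idx" "w \<in> Idx" "i < r" "F = F2 j u w i"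
      unfolding T_def by auto
    then show "dfn (1 + 3 * n) F"
    proof cases
      case 1
      show ?thesis unfolding 1(2) F1_def
        by (intro dfn_eq dfun_nth dfun_sel[OF dfun_cen[OF 1(1)] sb]) simp_all
    next
      case 2
      show ?thesis unfolding 2(5) F2_def
        by (intro dset_mem dset_cl 2 dfun_nth sb) simp_all
    qed
  next
    fix F E assume "(F, E) \<in> T"
    then consider "E = (\<lambda>a. False)" | j u w i where "j < N" "u \<in> Idx" "w \<in> Idx" "i < r" "E = E2 j u w i"
      unfolding T_def by auto
    then show "dfn (n + 3 * n) E"
    proof cases
      case 1
      show ?thesis unfolding 1 by (rule dfn_const)
    next
      case 2
      show ?thesis unfolding 2(5) E2_def
        by (intro dfn_bad 2 sb sel_take[OF sel_id]) simp_all
    qed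
  next
    fix B and a :: "'a list" assume B: "params n B" and a: "a \<in> tuples 1"
    obtain x where x: "a = [x]" using a by (auto simp: tuples_def length_Suc_conv)
    have Bf: "finite B" "B \<noteq> {}" using B by (simp_all add: params_def)
    show "\<exists>D\<in>scells 1 3 T B. a \<in> D"
    proof (cases "x \<in> centers_of B")
      case True
      then obtain j b where j: "j < N" "b \<in> B" "x = cen j b" unfolding centers_of_def by blast
      note l = len[OF B j(2)]
      have "{x \<in> tuples 1. F1 j (x @ concat [b, b, b])} \<in> scells 1 3 T B"
        by (rule scellsI[where E = "\<lambda>a. False"]) (use j in \<open>auto simp: T_def\<close>)
      then have "emb {cen j b} \<in> scells 1 3 T B" unfolding e1[OF l l l] .
      moreover have "a \<in> emb {cen j b}" unfolding emb_def x j(3) by (simp add: tuples_def)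
      ultimately show ?thesis by (rule bexI[rotated])
    next
      case False
      obtain j u w i b1 b2 b3 where *: "j < N" "u \<in> Idx" "w \<in> Idx" "i < r" "b1 \<in> B" "b2 \<in> B" "b3 \<in> B"
        "x \<in> cell (cen j b1) (U (cen j b1) u b2) (U (cen j b1) w b3) i"
        "\<forall>b\<in>B. consecutive (cen j b1) (U (cen j b1) u b2) (U (cen j b1) w b3) b"
        "\<forall>y\<in>cell (cen j b1) (U (cen j b1) u b2) (U (cen j b1) w b3) i. \<forall>b\<in>B. same b x y"
        by (rule cover[OF Bf False])
      note l = len[OF B *(5)] len[OF B *(6)] len[OF B *(7)]
      have nb: "\<not> bad j u w i b b1 b2 b3" if b: "b \<in> B" for b
      proof
        assume "bad j u w i b b1 b2 b3"
        then obtain P y z where P: "P \<in> Fs" "y \<in> cl j u w i b1 b2 b3" "P (y # b)" "z \<in> cl j u w i b1 b2 b3" "\<not> P (z # b)"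
          unfolding bad_def using *(9) b by auto
        have "same b x y" "same b x z" using *(10) P(2,4) b unfolding cl_def by auto
        then have "P (x # b) = P (y # b)" "P (x # b) = P (z # b)" using same_Fs[OF len[OF B b] _ P(1)] by auto
        then show False using P(3,5) by simp
      qed
      have "{x \<in> tuples 1. F2 j u w i (x @ concat [b1, b2, b3])} \<in> scells 1 3 T B"
      proof (rule scellsI[where E = "E2 j u w i"])
        show "(F2 j u w i, E2 j u w i) \<in> T" unfolding T_def using *(1-4) by force
        show "set [b1, b2, b3] \<subseteq> B" using *(5-7) by simp
        show "\<not> E2 j u w i (b @ concat [b1, b2, b3])" if "b \<in> B" for b unfolding E2[OF len[OF B that] l] by (rule nb[OF that])
      qed simp
      then have "emb (cl j u w i b1 b2 b3) \<in> scells 1 3 T B" unfolding e2[OF l] .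
      moreover have "a \<in> emb (cl j u w i b1 b2 b3)" unfolding emb_def x cl_def using *(8) by (simp add: tuples_def)
      ultimately show ?thesis by (rule bexI[rotated])
    qed
  next
    fix B D P b x y assume B: "params n B" and D: "D \<in> scells 1 3 T B" and P: "P \<in> Fs" and b: "b \<in> B"
      and x: "x \<in> D" and y: "y \<in> D" and Px: "P (x @ b)"
    from cases[OF B D] show "P (y @ b)"
    proof (elim disjE exE conjE)
      fix j b1 assume "D = emb {cen j b1}"
      then have "x = y" using x y unfolding emb_def by (auto simp: tuples_def length_Suc_conv)
      then show ?thesis using Px by simp
    next
      fix j u w i b1 b2 b3 assume *: "\<forall>b\<in>B. \<not> bad j u w i b b1 b2 b3" "D = emb (cl j u w i b1 b2 b3)"
      obtain x0 y0 where xy: "x = [x0]" "y = [y0]" "x0 \<in> cl j u w i b1 b2 b3" "y0 \<in> cl j u w i b1 b2 b3"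
        using x y unfolding *(2) emb_def by (auto simp: tuples_def length_Suc_conv)
      have "\<not> bad j u w i b b1 b2 b3" using * b by blast
      then have "\<not> ((\<exists>x. x \<in> cl j u w i b1 b2 b3 \<and> P (x # b)) \<and> (\<exists>x. x \<in> cl j u w i b1 b2 b3 \<and> \<not> P (x # b)))"
        using P unfolding bad_def by auto
      then show ?thesis using xy Px by auto
    qed
  next
    obtain C where C: "\<And>B. finite B \<and> B \<noteq> {} \<Longrightarrow> finite (cells1 B) \<and> card (cells1 B) \<le> C * card B"
      using card_cells1 by (elim exE) (rule that, blast)
    show "\<exists>C. \<forall>B. params n B \<longrightarrow> card (scells 1 3 T B) \<le> C * card B ^ 1"
    proof (intro exI allI impI)
      fix B assume B: "params n B"
      then have Bf: "finite B \<and> B \<noteq> {}" by (simp add: params_def)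
      let ?S = "cells1 B \<union> (\<lambda>c. {c}) ` centers_of B"
      have sub: "scells 1 3 T B \<subseteq> emb ` ?S"
      proof
        fix D assume "D \<in> scells 1 3 T B"
        from cases[OF B this] show "D \<in> emb ` ?S"
        proof (elim disjE exE conjE)
          fix j b1 assume *: "j < N" "b1 \<in> B" "D = emb {cen j b1}"
          then have "cen j b1 \<in> centers_of B" unfolding centers_of_def by blast
          then show ?thesis using *(3) by blast
        next
          fix j u w i b1 b2 b3 assume *: "j < N" "u \<in> Idx" "w \<in> Idx" "i < r" "b1 \<in> B" "b2 \<in> B" "b3 \<in> B"
            "\<forall>b\<in>B. \<not> bad j u w i b b1 b2 b3" "D = emb (cl j u w i b1 b2 b3)"
          have "\<forall>b\<in>B. consecutive (cen j b1) (U (cen j b1) u b2) (U (cen j b1) w b3) b" using *(8) unfolding bad_def by simp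
          then have "cl j u w i b1 b2 b3 \<in> cells1 B" unfolding cells1_def cl_def using *(1-7)
            by (intro CollectI exI[of _ j] exI[of _ u] exI[of _ w] exI[of _ i] exI[of _ b1] exI[of _ b2] exI[of _ b3]) simp
          then show ?thesis unfolding *(9) by (intro imageI UnI1)
        qed
      qed
      have fS: "finite ?S" using C[OF Bf] finite_centers_of[of B] Bf by simp
      have "card (scells 1 3 T B) \<le> card (emb ` ?S)" by (rule card_mono[OF finite_imageI[OF fS] sub])
      also have "\<dots> \<le> card ?S" by (rule card_image_le[OF fS])
      also have "\<dots> \<le> card (cells1 B) + card ((\<lambda>c. {c}) ` centers_of B)" by (rule card_Un_le)
      also have "\<dots> \<le> C * card B + N * card B"
        using C[OF Bf] finite_centers_of[of B] Bf card_image_le[of "centers_of B" "\<lambda>c. {c}"] by (intro add_mono) auto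
      also have "\<dots> = (C + N) * card B ^ 1" by (simp add: algebra_simps)
      finally show "card (scells 1 3 T B) \<le> (C + N) * card B ^ 1" .
    qed
  qed
qed

end

context mac_field
begin

text \<open>The polynomials and exponents come from quantifier elimination; they fix M and q for a
  definable \<pi>. Centers and class representatives are then chosen as definable solutions of
  first-order conditions, and the balls are the cuts that compare Taylor terms at the
  centers.\<close>

lemma one_dim:
  assumes Fs: "finite Fs" "\<forall>P\<in>Fs. dfn (Suc n) P" shows "\<exists>T. decomposes 1 n Fs 3 T 1"
proof -
  obtain Ps Es where Ps: "finite Ps" and Es: "finite Es" "0 \<notin> Es" and co: "\<forall>cs\<in>Ps. \<forall>c\<in>set cs. coef n c"
    and dec: "\<forall>P\<in>Fs. decides n Ps Es P" using decides_family[OF Fs] by blast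
  have dc: "dfun n c" if "cs \<in> Ps" "c \<in> set cs" for cs c using co that by (simp add: coef_def)
  obtain \<rho> where \<rho>: "uniformizer \<rho>" using unif_ex by blast
  have "dfn 1 (\<lambda>a. uniformizer (a ! 0))" by (rule dfn_uniformizer, rule dfun_nth) simp
  from skolem_const[OF this, of "[\<rho>]"] \<rho> obtain v1 where v1: "uniformizer (v1 ! 0)" "dfun 0 (\<lambda>_. v1 ! 0)"
    by (auto simp: tuples_def)
  define \<pi> where "\<pi> = v1 ! 0"
  have \<pi>: "uniformizer \<pi>" "dfun 0 (\<lambda>_. \<pi>)" using v1 by (simp_all add: \<pi>_def)
  interpret p_field_unif R A p \<pi> by (intro p_field_unif.intro p_field_axioms p_field_unif_axioms.intro \<pi>(1))
  obtain M q where hf: "h_field R A p \<pi> M q" and Eq: "\<forall>k\<in>Es. k dvd q"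
      "\<forall>k\<in>Es. \<forall>u. \<pi> [^] (M::nat) \<preceq> u \<ominus> \<one> \<longrightarrow> (\<exists>y. y [^] (k::nat) = u)"
    using h_field_exists[OF Es] by blast
  have mh: "mac_h R A p K \<pi> M q" by (intro mac_h.intro mac_field_axioms hf mac_h_axioms.intro \<pi>(2))
  interpret h: mac_h R A p K \<pi> M q by (rule mh)
  define pl where "pl b cs = map (\<lambda>c. c b) cs" for b and cs :: "('a list \<Rightarrow> 'a) list"
  define D where "D = (\<Sum>cs\<in>Ps. length cs)"
  have D: "length (pl b cs) \<le> Suc D" if "cs \<in> Ps" for b cs
    using member_le_sum[OF that, of length] Ps by (simp add: D_def pl_def)
  \<comment> \<open>One more than a bound for the number of centers of all the polynomials together;
    surplus places are filled with zero.\<close>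
  define N where "N = Suc (\<Sum>cs\<in>Ps. Suc (length cs))"
  \<comment> \<open>The list \<open>u\<close> holds N candidate centers followed by
    \<open>b\<close>, and the condition says that every root ball contains one of the candidates. It
    is first-order, so Skolem functions can choose the centers from \<open>b\<close>.\<close>
  define good where "good u \<longleftrightarrow> (\<forall>cs\<in>Ps. \<forall>x. \<exists>j\<in>{..<N}. \<forall>i\<in>{1..D}.
    ev (pl (drop N u) cs) x \<preceq> taylor (pl (drop N u) cs) x i \<otimes> (u ! j \<ominus> x) [^] i)" for u
  have dgood: "dfn (N + n) good"
    unfolding good_def
  proof (rule dfn_ball_finite[OF Ps], rule dfn_all, rule dfn_bex_finite[OF finite_lessThan], rule dfn_ball_finite[OF finite_atLeastAtMost])
    fix cs j i assume cs: "cs \<in> Ps" and j: "j \<in> {..<N}"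
    have "sel (Suc (N + n)) n (\<lambda>v. drop N (tl v))" by (rule sel_comp[OF sel_tl sel_drop[OF sel_id refl]])
    then have "\<forall>c\<in>set cs. dfun (Suc (N + n)) (\<lambda>v. c (drop N (tl v)))" using dfun_sel[OF dc[OF cs]] by blast
    from dfun_taylor[OF this dfun_hd] have t: "dfun (Suc (N + n)) (\<lambda>v. taylor (pl (drop N (tl v)) cs) (hd v) i)" for i
      unfolding pl_def .
    have "dfun (Suc (N + n)) (\<lambda>v. tl v ! j)" by (rule dfun_lift[OF dfun_nth]) (use j in simp)
    then show "dfn (Suc (N + n)) (\<lambda>v. ev (pl (drop N (tl v)) cs) (hd v) \<preceq> taylor (pl (drop N (tl v)) cs) (hd v) i \<otimes> (tl v ! j \<ominus> hd v) [^] i)"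
      by (intro dfn_le dfun_mult dfun_pow dfun_diff t dfun_hd)
  qed
  have ex_good: "\<exists>u\<in>tuples N. good (u @ b)" if b: "b \<in> tuples n" for b
  proof -
    have "\<forall>cs. \<exists>C. finite C \<and> card C \<le> Suc (length cs) \<and> (\<forall>x. \<exists>c\<in>C. c \<in> root_ball (pl b cs) x)"
    proof
      fix cs
      show "\<exists>C. finite C \<and> card C \<le> Suc (length cs) \<and> (\<forall>x. \<exists>c\<in>C. c \<in> root_ball (pl b cs) x)"
      proof (rule centers[OF alg_max, of "pl b cs"])
        fix C assume "finite C" "card C \<le> Suc (length (pl b cs))" "\<And>x. \<exists>c\<in>C. c \<in> root_ball (pl b cs) x"
        then show ?thesis by (intro exI[of _ C]) (simp add: pl_def)
      qed
    qed
    from choice[OF this] obtain Cf where Cf: "\<forall>cs. finite (Cf cs) \<and> card (Cf cs) \<le> Suc (length cs) \<and> (\<forall>x. \<exists>c\<in>Cf cs. c \<in> root_ball (pl b cs) x)"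
      by blast
    define V where "V = (\<Union>cs\<in>Ps. Cf cs)"
    have fV: "finite V" unfolding V_def using Ps Cf by blast
    have "card V \<le> (\<Sum>cs\<in>Ps. card (Cf cs))" unfolding V_def by (rule card_UN_le[OF Ps])
    also have "\<dots> \<le> (\<Sum>cs\<in>Ps. Suc (length cs))" by (rule sum_mono) (use Cf in blast)
    finally have cV: "card V < N" unfolding N_def by simp
    obtain xs where xs: "set xs = V" "distinct xs" using finite_distinct_list[OF fV] by blast
    have lx: "length xs < N" using distinct_card[OF xs(2)] xs(1) cV by simp
    define u where "u = xs @ replicate (N - length xs) \<zero>"
    have lu: "length u = N" using lx by (simp add: u_def)
    have "good (u @ b)" unfolding good_def
    proof (intro ballI allI)
      fix cs x assume cs: "cs \<in> Ps"
      obtain c where c: "c \<in> Cf cs" "c \<in> root_ball (pl b cs) x" using Cf by blast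
      have "c \<in> set xs" using c(1) cs xs(1) unfolding V_def by blast
      then obtain j where j: "j < length xs" "xs ! j = c" by (auto simp: in_set_conv_nth)
      have uj: "(u @ b) ! j = c" using j lx by (simp add: u_def nth_append)
      have db: "drop N (u @ b) = b" using lu by simp
      show "\<exists>j\<in>{..<N}. \<forall>i\<in>{1..D}. ev (pl (drop N (u @ b)) cs) x \<preceq> taylor (pl (drop N (u @ b)) cs) x i \<otimes> ((u @ b) ! j \<ominus> x) [^] i"
        by (rule bexI[of _ j]) (use uj db c(2) root_ball_iff[OF D[OF cs]] j lx in \<open>simp_all\<close>)
    qed
    then show ?thesis using lu by (intro bexI[of _ u]) (simp_all add: tuples_def)
  qed
  obtain f where f: "\<forall>b\<in>tuples n. f b \<in> tuples N" "\<forall>j<N. dfun n (\<lambda>b. f b ! j)"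
    "\<forall>b\<in>tuples n. (\<exists>a\<in>tuples N. good (a @ b)) \<longrightarrow> good (f b @ b)"
    using skolem[OF sk dgood] by (elim exE conjE) (rule that)
  define cen where "cen j b = f b ! j" for j b
  have dcen: "dfun n (cen j)" if "j < N" for j using f(2) that unfolding cen_def by simp
  have cent: "\<exists>j<N. cen j b \<in> root_ball (pl b cs) x" if b: "length b = n" and cs: "cs \<in> Ps" for b cs x
  proof -
    have bt: "b \<in> tuples n" using b by (simp add: tuples_def)
    have fl: "length (f b) = N" using f(1) bt by (simp add: tuples_def)
    have "good (f b @ b)" using f(3) bt ex_good[OF bt] by blast
    then obtain j where j: "j < N" "\<forall>i\<in>{1..D}. ev (pl (drop N (f b @ b)) cs) x \<preceq> taylor (pl (drop N (f b @ b)) cs) x i \<otimes> ((f b @ b) ! j \<ominus> x) [^] i"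
      unfolding good_def using cs by blast
    have "drop N (f b @ b) = b" "(f b @ b) ! j = cen j b" using fl j(1) by (simp_all add: nth_append cen_def)
    then have "cen j b \<in> root_ball (pl b cs) x" using j(2) unfolding root_ball_iff[OF D[OF cs]] by simp
    then show ?thesis using j(1) by blast
  qed
  \<comment> \<open>Comparisons of Taylor terms at a center, as sets in x. The exponent is positive
    for all indices in \<open>Ix\<close>, which makes each of them a ball containing its
    center.\<close>
  define cut where "cut = (\<lambda>(cs, ds, j, i, i', d, m1, m2) b.
    {x. taylor (pl b cs) (cen j b) i \<otimes> \<pi> [^] (m1::nat) \<preceq> taylor (pl b ds) (cen j b) i' \<otimes> \<pi> [^] (m2::nat) \<otimes> (x \<ominus> cen j b) [^] (d::nat)})"
  define Ix where "Ix = Ps \<times> Ps \<times> {..<N} \<times> {..D} \<times> {..D} \<times> {1..D} \<times> {..Suc M} \<times> {..Suc M}"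
  define GG where "GG = {\<lambda>b. UNIV} \<union> (\<lambda>j b. {cen j b}) ` {..<N} \<union> cut ` Ix"
  have "finite GG" unfolding GG_def Ix_def using Ps by simp
  then obtain gs where gs: "set gs = GG" using finite_list by blast
  have GG: thesis if "G \<in> GG" "G = (\<lambda>b. UNIV) \<Longrightarrow> thesis" "\<And>j. j < N \<Longrightarrow> G = (\<lambda>b. {cen j b}) \<Longrightarrow> thesis"
    "\<And>cs ds j i i' d m1 m2. cs \<in> Ps \<Longrightarrow> ds \<in> Ps \<Longrightarrow> j < N \<Longrightarrow> 0 < d \<Longrightarrow> G = cut (cs, ds, j, i, i', d, m1, m2) \<Longrightarrow> thesis"
    for G thesis
  proof -
    from that(1) consider "G = (\<lambda>b. UNIV)" | j where "j < N" "G = (\<lambda>b. {cen j b})" | z where "z \<in> Ix" "G = cut z"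
      unfolding GG_def by blast
    then show thesis
    proof cases
      case 3
      obtain cs ds j i i' d m where z0: "z = (cs, ds, j, i, i', d, m)" by (cases z)
      obtain m1 m2 where "m = (m1, m2)" by (cases m)
      with z0 have z: "z = (cs, ds, j, i, i', d, m1, m2)" by simp
      show thesis by (rule that(4)[of cs ds j d i i' m1 m2]) (use 3 in \<open>simp_all add: z Ix_def\<close>)
    qed (use that(2,3) in blast)+
  qed
  have N0: "0 < N" by (simp add: N_def)
  have ballG: "ball (G b)" if "G \<in> GG" for G b
    using that by (rule GG) (simp_all add: ball_UNIV ball_singleton cut_def ball_cut)
  have cenG: "\<exists>j<N. cen j b \<in> G b" if "G \<in> GG" for G b
    using that
  proof (rule GG)
    fix cs ds j i i' d m1 m2 assume "j < N" "(0::nat) < d" "G = cut (cs, ds, j, i, i', d, m1, m2)"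
    then show ?thesis by (intro exI[of _ j]) (simp add: cut_def pow_zero)
  qed (use N0 in auto)
  have dsetG: "dset n G" if "G \<in> GG" for G
    using that
  proof (rule GG)
    assume G: "G = (\<lambda>b. UNIV)"
    show ?thesis unfolding G dset_def by (simp add: dfn_True)
  next
    fix j assume j: "j < N" and G: "G = (\<lambda>b. {cen j b})"
    show ?thesis unfolding G dset_def singleton_iff by (intro dfn_eq dfun_hd dfun_lift[OF dcen[OF j]])
  next
    fix cs ds j i i' d m1 m2 assume cs: "cs \<in> Ps" and ds: "ds \<in> Ps" and j: "j < N" and G: "G = cut (cs, ds, j, i, i', d, m1, m2)"
    have t: "dfun n (\<lambda>b. taylor (pl b cs) (cen j b) i)" if "cs \<in> Ps" for cs i
      unfolding pl_def by (rule dfun_taylor[OF _ dcen[OF j], where f = "\<lambda>b. b"]) (use dc[OF that] in blast)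
    show ?thesis unfolding G cut_def prod.case
      by (rule dset_Collect) (intro dfn_le dfun_mult dfun_pow dfun_diff h.dfun_\<pi>_pow dfun_hd dfun_lift[OF t[OF cs]] dfun_lift[OF t[OF ds]] dfun_lift[OF dcen[OF j]])
  qed
  have q0: "q > 0" using h.n_pos .
  obtain \<Lambda> where \<Lambda>: "finite \<Lambda>" "\<forall>x. x \<noteq> \<zero> \<longrightarrow> (\<exists>l\<in>\<Lambda>. h.sim l x)"
    using h.finite_index[OF z_group[OF \<pi>(1) q0]] by blast
  obtain ls where ls: "set ls = \<Lambda>" using finite_list[OF \<Lambda>(1)] by blast
  define r where "r = length ls"
  \<comment> \<open>Some finite list of representatives exists; to occur in formulas it is replaced
    by one with the same property that is definable without parameters.\<close>
  define reps where "reps a \<longleftrightarrow> (\<forall>x. x \<noteq> \<zero> \<longrightarrow> (\<exists>i\<in>{..<r}. h.sim (a ! i) x))" for a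
  have "dfn r reps" unfolding reps_def
  proof (rule dfn_all, rule dfn_imp)
    show "dfn (Suc r) (\<lambda>u. hd u \<noteq> \<zero>)" by (intro dfn_not dfn_eq dfun_hd dfun_zero)
    show "dfn (Suc r) (\<lambda>u. \<exists>i\<in>{..<r}. h.sim (tl u ! i) (hd u))"
    proof (rule dfn_bex_finite[OF finite_lessThan])
      fix i assume "i \<in> {..<r}"
      then have "dfun (Suc r) (\<lambda>u. tl u ! i)" by (intro dfun_lift[OF dfun_nth]) simp
      then show "dfn (Suc r) (\<lambda>u. h.sim (tl u ! i) (hd u))" by (intro h.dfn_sim dfun_hd)
    qed
  qed
  moreover have "reps ls" unfolding reps_def
  proof (intro allI impI)
    fix x assume "x \<noteq> \<zero>"
    then obtain l where "l \<in> set ls" "h.sim l x" using \<Lambda>(2) ls by blast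
    then show "\<exists>i\<in>{..<r}. h.sim (ls ! i) x" unfolding r_def in_set_conv_nth by blast
  qed
  moreover have "ls \<in> tuples r" by (simp add: r_def tuples_def)
  ultimately obtain v where v: "reps v" "\<forall>i<r. dfun 0 (\<lambda>_. v ! i)" using skolem_const by meson
  define g where "g l = gs ! l" for l
  define L where "L = length gs"
  have gG: "g l \<in> GG" if "l < L" for l using that gs nth_mem[of l gs] by (simp add: g_def L_def)
  have Gg: "\<exists>l<L. g l = G" if "G \<in> GG" for G using that gs unfolding g_def L_def by (metis in_set_conv_nth)
  define rep where "rep i = v ! i" for i
  have cfam: "cell_family R A p \<pi> M q cen N g L rep r"
  proof (intro cell_family.intro hf cell_family_axioms.intro)
    show "ball (g l b)" if "l < L" for l b by (rule ballG[OF gG[OF that]])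
    show "\<exists>j<N. cen j b \<in> g l b" if "l < L" for l b by (rule cenG[OF gG[OF that]])
    show "\<exists>l<L. \<forall>b. g l b = {cen j b}" if "j < N" for j
    proof -
      have "(\<lambda>b. {cen j b}) \<in> GG" using that by (simp add: GG_def)
      from Gg[OF this] show ?thesis by auto
    qed
    show "\<exists>l<L. \<forall>b. g l b = UNIV"
    proof -
      have "(\<lambda>b. UNIV) \<in> GG" by (simp add: GG_def)
      from Gg[OF this] show ?thesis by auto
    qed
    show "\<exists>i<r. h.sim (rep i) x" if "x \<noteq> \<zero>" for x using v(1) that unfolding reps_def rep_def by blast
  qed
  interpret cf: cell_family R A p \<pi> M q cen N g L rep r by (rule cfam)
  have same: "P (x # b) = P (y # b)" if b: "length b = n" and s: "cf.same b x y" and P: "P \<in> Fs" for b x y P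
  proof -
    have sg: "x \<in> G b \<longleftrightarrow> y \<in> G b" if "G \<in> GG" for G using Gg[OF that] s unfolding cf.same_def by auto
    have sc: "h.sim (x \<ominus> cen j b) (y \<ominus> cen j b)" if "j < N" for j using s that unfolding cf.same_def by blast
    have pr: "(\<forall>s\<in>pl b ` Ps. h.sim (ev s x) (ev s y)) \<and> (\<forall>s\<in>pl b ` Ps. \<forall>t\<in>pl b ` Ps. ev s x \<preceq> ev t x \<longleftrightarrow> ev s y \<preceq> ev t y)"
    proof (rule h.prep[where D = D and C = "(\<lambda>j. cen j b) ` {..<N}"])
      show "length s \<le> Suc D" if "s \<in> pl b ` Ps" for s using that D by blast
      show "finite ((\<lambda>j. cen j b) ` {..<N})" "(\<lambda>j. cen j b) ` {..<N} \<noteq> {}" using N0 by auto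
      show "\<exists>c\<in>(\<lambda>j. cen j b) ` {..<N}. c \<in> root_ball s z" if "s \<in> pl b ` Ps" for s z
        using that cent[OF b] by blast
      show "h.sim (x \<ominus> c) (y \<ominus> c)" if "c \<in> (\<lambda>j. cen j b) ` {..<N}" for c using that sc by blast
    next
      fix c s t i i' and d m1 m2 :: nat
      assume *: "c \<in> (\<lambda>j. cen j b) ` {..<N}" "s \<in> pl b ` Ps" "t \<in> pl b ` Ps" "i \<le> D" "i' \<le> D" "0 < d" "d \<le> D" "m1 \<le> Suc M" "m2 \<le> Suc M"
      obtain j where j: "j < N" "c = cen j b" using *(1) by blast
      obtain cs ds where cd: "cs \<in> Ps" "s = pl b cs" "ds \<in> Ps" "t = pl b ds" using *(2,3) by blast
      have "(cs, ds, j, i, i', d, m1, m2) \<in> Ix" unfolding Ix_def using * j(1) cd(1,3) by simp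
      then have "cut (cs, ds, j, i, i', d, m1, m2) \<in> GG" unfolding GG_def by blast
      from sg[OF this] show "taylor s c i \<otimes> \<pi> [^] m1 \<preceq> taylor t c i' \<otimes> \<pi> [^] m2 \<otimes> (x \<ominus> c) [^] d \<longleftrightarrow>
          taylor s c i \<otimes> \<pi> [^] m1 \<preceq> taylor t c i' \<otimes> \<pi> [^] m2 \<otimes> (y \<ominus> c) [^] d"
        unfolding cut_def j(2) cd by simp
    qed
    have "agree Ps Es b x y"
    proof (rule agree_of_sim[OF hf Eq])
      show "h.sim (pv cs b x) (pv cs b y)" if "cs \<in> Ps" for cs using pr that unfolding pv_def pl_def by blast
      show "pv cs b x \<preceq> pv ds b x \<longleftrightarrow> pv cs b y \<preceq> pv ds b y" if "cs \<in> Ps" "ds \<in> Ps" for cs ds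
        using pr that unfolding pv_def pl_def by blast
    qed
    then show ?thesis using decidesD[OF _ b] dec P by blast
  qed
  have "mac_cells R A p K \<pi> M q cen N g L rep r n Fs"
  proof (intro mac_cells.intro mh cfam mac_cells_axioms.intro)
    show "dfun n (cen j)" if "j < N" for j by (rule dcen[OF that])
    show "dset n (g l)" if "l < L" for l by (rule dsetG[OF gG[OF that]])
    show "dfun 0 (\<lambda>_. rep i)" if "i < r" for i using v(2) that unfolding rep_def by blast
    show "finite Fs" by (rule Fs)
    show "dfn (Suc n) P" if "P \<in> Fs" for P using Fs(2) that by blast
    show "P (x # b) = P (y # b)" if "length b = n" "cf.same b x y" "P \<in> Fs" for b x y P by (rule same[OF that])
  qed
  then show ?thesis by (rule mac_cells.decomposition)
qed

end

lemma mac_field_of_P_minimal: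
  assumes "P_minimal K" "quantifier_elimination macintyre K" "definable_Skolem_functions macintyre K"
  shows "\<exists>p. mac_field (ring_of K) (integers_of K) p K"
proof -
  have st: "p_adically_closed_struct K" using assms(1) by (simp add: P_minimal_def)
  then have cl: "p_adically_closed (ring_of K) (integers_of K)" by (simp add: p_adically_closed_struct_def)
  then obtain p d where pv: "p_valued p d (ring_of K) (integers_of K)" unfolding p_adically_closed_def by blast
  have U: "carrier (ring_of K) = UNIV" by (simp add: ring_of_def)
  note V = p_valued_val_field[OF pv U]
  interpret val_field "ring_of K" "integers_of K" by (rule V(1))
  have "p_field (ring_of K) (integers_of K) p"
    by (intro p_field.intro p_field_axioms.intro V alg_maximal[OF cl])
  then have "mac_field (ring_of K) (integers_of K) p K"
  proof (intro mac_field.intro mac_field_axioms.intro assms(2,3))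
    show "fun_of K Times [x, y] = x \<otimes>\<^bsub>ring_of K\<^esub> y" "fun_of K Plus [x, y] = x \<oplus>\<^bsub>ring_of K\<^esub> y"
      "fun_of K Zero [] = \<zero>\<^bsub>ring_of K\<^esub>" "fun_of K One [] = \<one>\<^bsub>ring_of K\<^esub>" for x y
      by (simp_all add: ring_of_def)
    show "fun_of K Uminus [x] = \<ominus>\<^bsub>ring_of K\<^esub> x" for x using st by (simp add: p_adically_closed_struct_def)
    show "rel_of K Div [x, y] \<longleftrightarrow> le x y" for x y using st by (simp add: p_adically_closed_struct_def le_def)
    show "rel_of K (Pow k) [x] \<longleftrightarrow> (\<exists>y. y [^]\<^bsub>ring_of K\<^esub> k = x)" if "k \<ge> 2" for k x
      using st that by (simp add: p_adically_closed_struct_def)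
  qed
  then show ?thesis by blast
qed

theorem theorem7p1:
  fixes K :: "'a mac_struct"
    and \<Phi> :: "(mac_fun, mac_rel) fm set"
    and m n :: nat
  assumes "P_minimal K"
    and "quantifier_elimination macintyre K"
    and "definable_Skolem_functions macintyre K"
    and "m \<ge> 1"
    and "finite \<Phi>"
    and "\<Phi> \<subseteq> fm_in macintyre (m + n)"
  shows "\<exists>k \<Psi> \<theta>. distal_cell_decomposition macintyre K m n \<Phi> k \<Psi> \<theta> \<and>
                 has_exponent K m n k \<Psi> \<theta> (3 * real m - 2)"
proof -
  obtain p where mf: "mac_field (ring_of K) (integers_of K) p K"
    using mac_field_of_P_minimal[OF assms(1-3)] by blast
  interpret mf: mac_field "ring_of K" "integers_of K" p K by (rule mf)
  \<comment> \<open>With m = l + 1 the exponent 3 l + 1 becomes 3 m - 2.\<close>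
  obtain l where m: "m = Suc l" using assms(4) by (cases m) auto
  have "\<forall>P\<in>(\<lambda>\<phi> a. holds K a \<phi>) ` \<Phi>. mf.dfn (Suc l + n) P" using mf.dfn_holds assms(6) unfolding m by blast
  then obtain k T where "mf.decomposes m n ((\<lambda>\<phi> a. holds K a \<phi>) ` \<Phi>) k T (3 * l + 1)"
    using mf.decomposes_all[OF mf.one_dim finite_imageI[OF assms(5)]] unfolding m by blast
  from mf.dcd_of_decomposes[OF this] obtain \<Psi> \<theta> where
    "distal_cell_decomposition macintyre K m n \<Phi> k \<Psi> \<theta>" "has_exponent K m n k \<Psi> \<theta> (real (3 * l + 1))" by blast
  moreover have "real (3 * l + 1) = 3 * real m - 2" by (simp add: m)
  ultimately show ?thesis by metis
qed

end
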